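(* Let $K$ be a compact Hausdorff space and let $A\subset C(K)$ be a unital norm-closed subalgebra. Suppose there exists a family $\{F_\alpha\}_{\alpha\in\Gamma}$ of spherical multifunctions in $C(K)$, where each $F_\alpha$ is of the form $F_\alpha=\{\phi_{j,\alpha}\}_{j\in J_\alpha}$ with each $\phi_{j,\alpha}\in A$, such that for each pair of distinct points $x,y\in K$ there exist an index $\alpha\in\Gamma$ and an index $j\in J_\alpha$ such that $\phi_{j,\alpha}(x)\neq\phi_{j,\alpha}(y)$. Then for any Borel probability measure $m$ on $K$ the following assertions hold true. (1) A bounded operator $X\in B(H^2(m))$ is a Toeplitz operator (i.e. $X=T_\psi$ for some $\psi\in L^\infty(m)$) if and only if it satisfies the following equations: $$\sum_{j\in J_\alpha}T_{\phi_{j,\alpha}}^{*}XT_{\phi_{j,\alpha}}=X\quad\text{for all }\alpha\in\Gamma$$ (in the case when $A$ is the disc algebra and $m$ is the Lebesgue measure on the unit circle, one retrieves the classical result of Brown-Halmos by taking as spherical multifunction $\phi(z)=z$). (2) A bounded operator $X\in B(H^2(m))$ is of the form $X=T_\psi$ for some $\psi\in H^\infty(m)$ if and only if it commutes with $T_{\phi_{j,\alpha}}$ for all $\alpha\in\Gamma$ and all $j\in J_\alpha$, if and only if it commutes with all $T_\phi$ with $\phi\in A$. The map $\psi\mapsto T_\psi$ is a Banach algebra isometric isomorphism between $H^\infty(m)$ and the commutant of the family $\{T_\phi\colon\phi\in A\}$. Moreover, this commutant is a maximal abelian subalgebra of $B(H^2(m))$ and hence, for every $\phi\in H^\infty(m)$,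 $\sigma(T_\phi)=\sigma_{H^\infty(m)}(\phi)$. (3) There exists a short exact sequence of $C^*$-algebras $$0\to\mathcal{C}(L^\infty(m))\hookrightarrow\mathcal{T}(L^\infty(m))\xrightarrow{\ \pi\ }L^\infty(m)\to 0$$ such that $\pi(T_\phi)=\phi$ for all $\phi\in L^\infty(m)$. In particular, the spectral inclusion $\operatorname{essran}(\phi)\subset\sigma(T_\phi)$ holds true (in the case of the unit circle this is the classical theorem of Hartman and Wintner), and also $\sigma(T_\phi)\subset\operatorname{conv}(\operatorname{essran}(\phi))$. (4) There exists a short exact sequence $$0\to\mathcal{C}(C(K))\hookrightarrow\mathcal{T}(C(K))\xrightarrow{\ \pi\ }C(\operatorname{supp}(m))\to 0$$ such that $\pi(T_\phi)=\phi$ on $\operatorname{supp}(m)$ (for $\phi\in C(K)$). Moreover, in this case $\mathcal{C}(C(K))$ always coincides with the closed ideal in $\mathcal{T}(C(K))$ generated by all commutators $T_\phi T_\psi-T_\psi T_\phi$ with $\phi,\psi\in C(K)$.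
   Context: $C(K)$ is the Banach algebra of all complex-valued continuous functions on $K$; "unital" means that $A$ contains the constants. A spherical multifunction in $C(K)$ is a finite family $F=\{\phi_1,\dots,\phi_n\}\subset C(K)$ such that $\sum_{j=1}^n|\phi_j(x)|^2=1$ for every $x\in K$ (so each index set $J_\alpha$ is finite). For a Borel probability measure $m$ on $K$, $\operatorname{supp}(m)$ is its closed support. The generalized Hardy space $H^2(m)$ associated to $A$ is the closure of $A$ in $L^2(m)$, and $B(H^2(m))$ is the algebra of bounded operators on it. For $\phi\in L^\infty(m)$ the Toeplitz operator $T_\phi\in B(H^2(m))$ is defined by $T_\phi h=P_{H^2(m)}(\phi h)$ for $h\in H^2(m)$, where $P_{H^2(m)}$ is the orthogonal projection of $L^2(m)$ onto $H^2(m)$. $H^\infty(m)=H^2(m)\cap L^\infty(m)$, a weak*-closed subalgebra of $L^\infty(m)$. For a unital subalgebra $B\subset L^\infty(m)$ (or for $B=C(K)$, whose elements are viewed in $L^\infty(m)$), $\mathcal{T}(B)$ denotes the $C^*$-subalgebra of $B(H^2(m))$ generated by all $T_\phi$ with $\phi\in B$, and $\mathcal{C}(B)$ denotes the closed ideal of $\mathcal{T}(B)$ generated by all operators $T_\phi T_\psi-T_{\phi\psi}$ with $\phi,\psi\in B$. $\sigma(T)$ is the spectrum of the operator $T$, $\sigma_{H^\infty(m)}(\phi)$ is the spectrum of $\phi$ in the Banach algebra $H^\infty(m)$, $\operatorname{essran}(\phi)$ is the essential range of $\phi\in L^\infty(m)$ with respect to $m$, and $\operatorname{conv}$ denotes the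 convex hull.
   Formalization: The Borel probability measure m is assumed to be regular (automatic when K is metrizable); for non-regular m assertion (3) can fail, e.g. on [0,ω₁] with the average of the Dieudonné measure and the point mass at ω₁. *)

theory Defs
  imports
    "HOL-Probability.Probability"
    "HOL-Algebra.QuotRing"
    "HOL-Algebra.Module"
begin

section \<open>Normed complex algebras with involution\<close>

text \<open>
  The ring and module structure is that of \<open>HOL-Algebra\<close>; a record of this type carries in addition
  an involution and a norm. No axioms are imposed by the record type itself.
\<close>

record 'a star_alg = "(complex, 'a) module" +
  adj :: "'a \<Rightarrow> 'a"
  anorm :: "'a \<Rightarrow> real"

definition norm_closed :: "('a, 'z) star_alg_scheme \<Rightarrow> 'a set \<Rightarrow> bool" where
  "norm_closed R S \<longleftrightarrow>
     (\<forall>x\<in>carrier R. (\<forall>e>0. \<exists>y\<in>S. anorm R (x \<ominus>\<^bsub>R\<^esub> y) < e) \<longrightarrow> x \<in> S)"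

definition complex_subalgebra :: "('a, 'z) star_alg_scheme \<Rightarrow> 'a set \<Rightarrow> bool" where
  "complex_subalgebra R S \<longleftrightarrow>
     S \<subseteq> carrier R \<and> \<zero>\<^bsub>R\<^esub> \<in> S \<and>
     (\<forall>x\<in>S. \<forall>y\<in>S. x \<oplus>\<^bsub>R\<^esub> y \<in> S \<and> x \<otimes>\<^bsub>R\<^esub> y \<in> S) \<and>
     (\<forall>c. \<forall>x\<in>S. c \<odot>\<^bsub>R\<^esub> x \<in> S)"

definition cstar_subalgebra :: "('a, 'z) star_alg_scheme \<Rightarrow> 'a set \<Rightarrow> bool" where
  "cstar_subalgebra R S \<longleftrightarrow>
     complex_subalgebra R S \<and> (\<forall>x\<in>S. adj R x \<in> S) \<and> norm_closed R S"

definition cstar_generated :: "'a star_alg \<Rightarrow> 'a set \<Rightarrow> 'a star_alg" where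
  "cstar_generated R G = R\<lparr>carrier := \<Inter>{S. cstar_subalgebra R S \<and> G \<subseteq> S}\<rparr>"

text \<open>
  Ideals are two-sided. In a unital algebra a ring ideal is automatically a complex subspace.
\<close>

definition closed_ideal :: "('a, 'z) star_alg_scheme \<Rightarrow> 'a set \<Rightarrow> bool" where
  "closed_ideal R I \<longleftrightarrow> ideal I R \<and> norm_closed R I"

definition closed_ideal_generated :: "('a, 'z) star_alg_scheme \<Rightarrow> 'a set \<Rightarrow> 'a set" where
  "closed_ideal_generated R G = \<Inter>{I. closed_ideal R I \<and> G \<subseteq> I}"

definition commutant :: "('a, 'z) star_alg_scheme \<Rightarrow> 'a set \<Rightarrow> 'a set" where
  "commutant R G = {x \<in> carrier R. \<forall>y\<in>G. x \<otimes>\<^bsub>R\<^esub> y = y \<otimes>\<^bsub>R\<^esub> x}"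

definition abelian_subalgebra :: "('a, 'z) star_alg_scheme \<Rightarrow> 'a set \<Rightarrow> bool" where
  "abelian_subalgebra R S \<longleftrightarrow>
     complex_subalgebra R S \<and> (\<forall>x\<in>S. \<forall>y\<in>S. x \<otimes>\<^bsub>R\<^esub> y = y \<otimes>\<^bsub>R\<^esub> x)"

definition maximal_abelian_subalgebra :: "('a, 'z) star_alg_scheme \<Rightarrow> 'a set \<Rightarrow> bool" where
  "maximal_abelian_subalgebra R S \<longleftrightarrow>
     abelian_subalgebra R S \<and> (\<forall>S'. abelian_subalgebra R S' \<and> S \<subseteq> S' \<longrightarrow> S' = S)"

definition alg_spectrum :: "('a, 'z) star_alg_scheme \<Rightarrow> 'a \<Rightarrow> complex set" where
  "alg_spectrum R x = {c. (c \<odot>\<^bsub>R\<^esub> \<one>\<^bsub>R\<^esub>) \<ominus>\<^bsub>R\<^esub> x \<notin> Units R}"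

definition isometric_isomorphism :: "'a star_alg \<Rightarrow> 'b star_alg \<Rightarrow> ('a \<Rightarrow> 'b) \<Rightarrow> bool" where
  "isometric_isomorphism R S h \<longleftrightarrow>
     h \<in> ring_iso R S \<and>
     (\<forall>c. \<forall>x\<in>carrier R. h (c \<odot>\<^bsub>R\<^esub> x) = c \<odot>\<^bsub>S\<^esub> h x) \<and>
     (\<forall>x\<in>carrier R. anorm S (h x) = anorm R x)"

definition star_homomorphism :: "'a star_alg \<Rightarrow> 'b star_alg \<Rightarrow> ('a \<Rightarrow> 'b) \<Rightarrow> bool" where
  "star_homomorphism R S h \<longleftrightarrow>
     h \<in> ring_hom R S \<and>
     (\<forall>c. \<forall>x\<in>carrier R. h (c \<odot>\<^bsub>R\<^esub> x) = c \<odot>\<^bsub>S\<^esub> h x) \<and>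
     (\<forall>x\<in>carrier R. h (adj R x) = adj S (h x))"

text \<open>
  Exactness of \<open>0 \<rightarrow> I \<hookrightarrow> R \<rightarrow> S \<rightarrow> 0\<close>, where the first map is the inclusion of a closed ideal
  and the second map is the *-homomorphism \<open>h\<close>.
\<close>

definition short_exact :: "'a set \<Rightarrow> 'a star_alg \<Rightarrow> 'b star_alg \<Rightarrow> ('a \<Rightarrow> 'b) \<Rightarrow> bool" where
  "short_exact I R S h \<longleftrightarrow>
     closed_ideal R I \<and> star_homomorphism R S h \<and>
     a_kernel R S h = I \<and> h ` carrier R = carrier S"


section \<open>Continuous functions\<close>

text \<open>
  The algebra \<open>C(X)\<close> for a compact nonempty subset \<open>X\<close> of a topological space. Functions are
  \<^const>\<open>undefined\<close> outside \<open>X\<close>, so that equality in \<open>C(X)\<close> is equality of HOL functions.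
\<close>

definition Cont :: "'k::topological_space set \<Rightarrow> ('k \<Rightarrow> complex) star_alg" where
  "Cont X =
     \<lparr>carrier = {f \<in> extensional X. continuous_on X f},
      mult = (\<lambda>f g. \<lambda>x\<in>X. f x * g x),
      one = (\<lambda>x\<in>X. 1),
      zero = (\<lambda>x\<in>X. 0),
      add = (\<lambda>f g. \<lambda>x\<in>X. f x + g x),
      smult = (\<lambda>c f. \<lambda>x\<in>X. c * f x),
      adj = (\<lambda>f. \<lambda>x\<in>X. cnj (f x)),
      anorm = (\<lambda>f. SUP x\<in>X. cmod (f x))\<rparr>"

definition spherical_multifunction :: "'j set \<Rightarrow> ('j \<Rightarrow> 'k::topological_space \<Rightarrow> complex) \<Rightarrow> bool" where
  "spherical_multifunction J \<phi> \<longleftrightarrow>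
     finite J \<and> (\<forall>j\<in>J. \<phi> j \<in> carrier (Cont UNIV)) \<and> (\<forall>x. (\<Sum>j\<in>J. (cmod (\<phi> j x))\<^sup>2) = 1)"


section \<open>Measures\<close>

text \<open>
  Borel measures on a compact Hausdorff space are understood to be regular, as usual. (On a
  non-metrizable space a Borel probability measure need not be regular, and then \<open>C(K)\<close> need not be
  dense in \<open>L\<^sup>2(m)\<close>.)
\<close>

definition regular_borel_prob :: "'k::topological_space measure \<Rightarrow> bool" where
  "regular_borel_prob m \<longleftrightarrow>
     prob_space m \<and> sets m = sets borel \<and>
     (\<forall>B\<in>sets borel.
        emeasure m B = (SUP C\<in>{C. C \<subseteq> B \<and> compact C}. emeasure m C) \<and>
        emeasure m B = (INF U\<in>{U. B \<subseteq> U \<and> open U}. emeasure m U))"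

definition msupp :: "'k::topological_space measure \<Rightarrow> 'k set" where
  "msupp m = {x. \<forall>U. open U \<and> x \<in> U \<longrightarrow> emeasure m U > 0}"


section \<open>Classes of measurable functions modulo null sets\<close>

type_synonym 'k lclass = "('k \<Rightarrow> complex) set"

definition ae_class :: "'k measure \<Rightarrow> ('k \<Rightarrow> complex) \<Rightarrow> 'k lclass" where
  "ae_class m f = {g \<in> borel_measurable m. AE x in m. g x = f x}"

definition repr :: "'k lclass \<Rightarrow> 'k \<Rightarrow> complex" where
  "repr F = (SOME f. f \<in> F)"

definition lc_add :: "'k measure \<Rightarrow> 'k lclass \<Rightarrow> 'k lclass \<Rightarrow> 'k lclass" where
  "lc_add m F G = ae_class m (\<lambda>x. repr F x + repr G x)"

definition lc_diff :: "'k measure \<Rightarrow> 'k lclass \<Rightarrow> 'k lclass \<Rightarrow> 'k lclass" where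
  "lc_diff m F G = ae_class m (\<lambda>x. repr F x - repr G x)"

definition lc_mult :: "'k measure \<Rightarrow> 'k lclass \<Rightarrow> 'k lclass \<Rightarrow> 'k lclass" where
  "lc_mult m F G = ae_class m (\<lambda>x. repr F x * repr G x)"

definition lc_scale :: "'k measure \<Rightarrow> complex \<Rightarrow> 'k lclass \<Rightarrow> 'k lclass" where
  "lc_scale m c F = ae_class m (\<lambda>x. c * repr F x)"

definition lc_cnj :: "'k measure \<Rightarrow> 'k lclass \<Rightarrow> 'k lclass" where
  "lc_cnj m F = ae_class m (\<lambda>x. cnj (repr F x))"

definition Linf :: "'k measure \<Rightarrow> 'k lclass star_alg" where
  "Linf m =
     \<lparr>carrier = {ae_class m f | f. f \<in> borel_measurable m \<and> (\<exists>c. AE x in m. cmod (f x) \<le> c)},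
      mult = lc_mult m,
      one = ae_class m (\<lambda>_. 1),
      zero = ae_class m (\<lambda>_. 0),
      add = lc_add m,
      smult = lc_scale m,
      adj = lc_cnj m,
      anorm = (\<lambda>F. real_of_ereal (esssup m (\<lambda>x. ereal (cmod (repr F x)))))\<rparr>"

definition essran :: "'k measure \<Rightarrow> 'k lclass \<Rightarrow> complex set" where
  "essran m F = {c. \<forall>e>0. emeasure m {x \<in> space m. cmod (repr F x - c) < e} > 0}"

definition L2 :: "'k measure \<Rightarrow> 'k lclass set" where
  "L2 m = {ae_class m f | f. f \<in> borel_measurable m \<and> integrable m (\<lambda>x. (cmod (f x))\<^sup>2)}"

definition l2_inner :: "'k measure \<Rightarrow> 'k lclass \<Rightarrow> 'k lclass \<Rightarrow> complex" where
  "l2_inner m F G = (LINT x|m. repr F x * cnj (repr G x))"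

definition l2_norm :: "'k measure \<Rightarrow> 'k lclass \<Rightarrow> real" where
  "l2_norm m F = sqrt (LINT x|m. (cmod (repr F x))\<^sup>2)"


section \<open>Bounded operators on a closed subspace of \<open>L\<^sup>2(m)\<close>\<close>

text \<open>
  Operators on \<open>H\<close> are extensional functions, i.e. \<^const>\<open>undefined\<close> outside \<open>H\<close>, so that equality of
  operators is equality of HOL functions.
\<close>

definition bounded_ops :: "'k measure \<Rightarrow> 'k lclass set \<Rightarrow> ('k lclass \<Rightarrow> 'k lclass) set" where
  "bounded_ops m H =
     {T \<in> H \<rightarrow>\<^sub>E H.
        (\<forall>f\<in>H. \<forall>g\<in>H. T (lc_add m f g) = lc_add m (T f) (T g)) \<and>
        (\<forall>c. \<forall>f\<in>H. T (lc_scale m c f) = lc_scale m c (T f)) \<and>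
        (\<exists>C. \<forall>f\<in>H. l2_norm m (T f) \<le> C * l2_norm m f)}"

definition BH :: "'k measure \<Rightarrow> 'k lclass set \<Rightarrow> ('k lclass \<Rightarrow> 'k lclass) star_alg" where
  "BH m H =
     \<lparr>carrier = bounded_ops m H,
      mult = compose H,
      one = (\<lambda>f\<in>H. f),
      zero = (\<lambda>f\<in>H. ae_class m (\<lambda>_. 0)),
      add = (\<lambda>S T. \<lambda>f\<in>H. lc_add m (S f) (T f)),
      smult = (\<lambda>c T. \<lambda>f\<in>H. lc_scale m c (T f)),
      adj = (\<lambda>T. THE S. S \<in> bounded_ops m H \<and>
                    (\<forall>f\<in>H. \<forall>g\<in>H. l2_inner m (T f) g = l2_inner m f (S g))),
      anorm = (\<lambda>T. SUP f\<in>{f \<in> H. l2_norm m f \<le> 1}. l2_norm m (T f))\<rparr>"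


section \<open>Hardy spaces and Toeplitz operators\<close>

definition H2 :: "'k measure \<Rightarrow> ('k \<Rightarrow> complex) set \<Rightarrow> 'k lclass set" where
  "H2 m A = {F \<in> L2 m. \<forall>e>0. \<exists>a\<in>A. l2_norm m (lc_diff m F (ae_class m a)) < e}"

definition Hinf :: "'k measure \<Rightarrow> ('k \<Rightarrow> complex) set \<Rightarrow> 'k lclass star_alg" where
  "Hinf m A = (Linf m)\<lparr>carrier := H2 m A \<inter> carrier (Linf m)\<rparr>"

abbreviation BH2 :: "'k measure \<Rightarrow> ('k \<Rightarrow> complex) set \<Rightarrow> ('k lclass \<Rightarrow> 'k lclass) star_alg" where
  "BH2 m A \<equiv> BH m (H2 m A)"

definition H2_proj :: "'k measure \<Rightarrow> ('k \<Rightarrow> complex) set \<Rightarrow> 'k lclass \<Rightarrow> 'k lclass" where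
  "H2_proj m A F = (THE G. G \<in> H2 m A \<and> (\<forall>h\<in>H2 m A. l2_inner m (lc_diff m F G) h = 0))"

definition toeplitz :: "'k measure \<Rightarrow> ('k \<Rightarrow> complex) set \<Rightarrow> 'k lclass \<Rightarrow> 'k lclass \<Rightarrow> 'k lclass" where
  "toeplitz m A \<psi> = (\<lambda>h\<in>H2 m A. H2_proj m A (lc_mult m \<psi> h))"

definition toeplitz_algebra ::
  "'k measure \<Rightarrow> ('k \<Rightarrow> complex) set \<Rightarrow> 'k lclass set \<Rightarrow> ('k lclass \<Rightarrow> 'k lclass) star_alg" where
  "toeplitz_algebra m A B = cstar_generated (BH2 m A) (toeplitz m A ` B)"

definition semicommutator_ideal ::
  "'k measure \<Rightarrow> ('k \<Rightarrow> complex) set \<Rightarrow> 'k lclass set \<Rightarrow> ('k lclass \<Rightarrow> 'k lclass) set" where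
  "semicommutator_ideal m A B =
     closed_ideal_generated (toeplitz_algebra m A B)
       {(toeplitz m A \<phi> \<otimes>\<^bsub>BH2 m A\<^esub> toeplitz m A \<psi>) \<ominus>\<^bsub>BH2 m A\<^esub> toeplitz m A (lc_mult m \<phi> \<psi>) | \<phi> \<psi>.
          \<phi> \<in> B \<and> \<psi> \<in> B}"

definition commutator_ideal ::
  "'k measure \<Rightarrow> ('k \<Rightarrow> complex) set \<Rightarrow> 'k lclass set \<Rightarrow> ('k lclass \<Rightarrow> 'k lclass) set" where
  "commutator_ideal m A B =
     closed_ideal_generated (toeplitz_algebra m A B)
       {(toeplitz m A \<phi> \<otimes>\<^bsub>BH2 m A\<^esub> toeplitz m A \<psi>) \<ominus>\<^bsub>BH2 m A\<^esub>
        (toeplitz m A \<psi> \<otimes>\<^bsub>BH2 m A\<^esub> toeplitz m A \<phi>) | \<phi> \<psi>. \<phi> \<in> B \<and> \<psi> \<in> B}"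

definition CK_classes :: "'k::topological_space measure \<Rightarrow> 'k lclass set" where
  "CK_classes m = ae_class m ` carrier (Cont UNIV)"

end

theory Submission imports Defs "HOL-Real_Asymp.Real_Asymp" begin

text \<open>
Call a finite list \<open>u\<close> of elements of \<open>A\<close> spherical if \<open>\<Sum>|u|\<^sup>2 = 1\<close> pointwise. The products of two spherical lists
form a spherical list again, so the lists generated by the given multifunctions are directed by refinement.
Everything rests on \<open>symbol_P\<close>: for every \<open>f\<close> in \<open>L\<^sup>2\<close>, the sum over \<open>w\<close> in the list of
\<open>\<parallel>w f - P (w f)\<parallel>\<^sup>2\<close> tends to \<open>0\<close> along this net; multiplied by fine families, \<open>L\<^sup>2\<close> becomes almost
analytic. The \<open>f\<close> with this property form a closed subspace that contains \<open>1\<close> and is invariant under \<open>A\<close>. It is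
also invariant under \<open>cnj \<phi>\<^sub>j\<close>, by a law of large numbers: expanding \<open>(\<Sum>|\<phi>\<^sub>l|\<^sup>2)^n = 1\<close> makes the words of
length \<open>n\<close> a probability space at each point, in which the frequency of \<open>j\<close> divided by \<open>\<phi>\<^sub>j\<close> has mean
\<open>cnj \<phi>\<^sub>j\<close> and can be written as \<open>v/u\<close> with \<open>u\<close>, \<open>v\<close> in \<open>A\<close> (\<open>cps_variance\<close>). By Stone--Weierstrass and
density of the continuous functions the subspace is all of \<open>L\<^sup>2\<close>.

An operator \<open>X\<close> on \<open>H\<^sup>2\<close> has symbol \<open>\<psi>\<close> if \<open>\<Sum>\<parallel>X P (w f) - \<psi> w f\<parallel>\<^sup>2 \<rightarrow> 0\<close> for all \<open>f\<close>. Symbols add and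
multiply, are bounded by the norm of \<open>X\<close>, pass to norm limits, and \<open>T\<^sub>\<psi>\<close> has symbol \<open>\<psi>\<close>. As each \<open>X\<close> in the
Toeplitz algebra agrees with the Toeplitz operator of its symbol modulo the semicommutator ideal, the symbol map
yields the exact sequences. An invertible \<open>T\<^sub>\<psi>\<close> forces \<open>\<psi>\<close> to be bounded below, which gives the spectral
inclusion; the convex hull bound is Lax--Milgram applied with a separating half-plane.

For Brown--Halmos, the sums of \<open>\<langle>X P (w f), w g\<rangle>\<close> converge to a bounded form on \<open>L\<^sup>2\<close> that is invariant under all
spherical lists. The same words show that such a form satisfies \<open>y(c f, g) = y(f, cnj c g)\<close> for continuous
\<open>c\<close>, so it is given by a bounded \<open>\<psi>\<close>. If \<open>X\<close> commutes with all \<open>T\<^bsub>\<phi>\<^esub>\<close>, the equations hold, and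
\<open>k = \<psi> - P \<psi>\<close> satisfies \<open>P (u k) = 0\<close> for all \<open>u\<close> in a spherical list; so
\<open>\<parallel>k\<parallel>\<^sup>2 = \<Sum>\<parallel>u k - P (u k)\<parallel>\<^sup>2 \<rightarrow> 0\<close> and \<open>\<psi>\<close> is analytic.
\<close>

abbreviation ptimes (infixl "\<cdot>" 70) where "f \<cdot> g \<equiv> \<lambda>x. f x * g x"
abbreviation padd (infixl "+:" 65) where "f +: g \<equiv> \<lambda>x. f x + g x"
abbreviation pminus (infixl "-:" 65) where "f -: g \<equiv> \<lambda>x. f x - g x"
abbreviation cts where "cts f \<equiv> continuous_on UNIV f"

section \<open>Square-integrable functions\<close>

lemma almost_Cauchy_limit:
  fixes z :: "nat \<Rightarrow> complex"
  assumes d: "\<And>i j. cmod (z i - z j) \<le> e i + e j" and e: "e \<longlonglongrightarrow> (0::real)"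
  shows "z \<longlonglongrightarrow> lim z" and "cmod (z i - lim z) \<le> e i"
proof -
  have "Cauchy z"
  proof (rule metric_CauchyI)
    fix d' :: real assume "d' > 0"
    then have "eventually (\<lambda>n. e n < d'/2) sequentially" using e by (intro order_tendstoD(2)) auto
    then obtain N where N: "\<And>n. n \<ge> N \<Longrightarrow> e n < d'/2" by (auto simp: eventually_sequentially)
    have "dist (z i) (z j) < d'" if "i \<ge> N" "j \<ge> N" for i j
      using d[of i j] N[OF that(1)] N[OF that(2)] unfolding dist_norm by linarith
    then show "\<exists>N. \<forall>i\<ge>N. \<forall>j\<ge>N. dist (z i) (z j) < d'" by blast
  qed
  then show l: "z \<longlonglongrightarrow> lim z" by (simp add: Cauchy_convergent_iff convergent_LIMSEQ_iff)
  have "(\<lambda>j. cmod (z i - z j)) \<longlonglongrightarrow> cmod (z i - lim z)" by (intro tendsto_intros l)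
  moreover have "(\<lambda>j. e i + e j) \<longlonglongrightarrow> e i + 0" by (intro tendsto_intros e)
  ultimately show "cmod (z i - lim z) \<le> e i" using d by (intro LIMSEQ_le[of _ _ "\<lambda>j. e i + e j"]) auto
qed

text \<open>The work is done with functions rather than classes modulo null sets; \<open>n2\<close> is the square of the \<open>L\<^sup>2\<close>
seminorm, which is additive over spherical families.\<close>

definition sq :: "'a measure \<Rightarrow> ('a \<Rightarrow> complex) set" where
  "sq M = {f. f \<in> borel_measurable M \<and> integrable M (\<lambda>x. (cmod (f x))\<^sup>2)}"

definition ip :: "'a measure \<Rightarrow> ('a \<Rightarrow> complex) \<Rightarrow> ('a \<Rightarrow> complex) \<Rightarrow> complex" where
  "ip M f g = (LINT x|M. f x * cnj (g x))"

definition n2 :: "'a measure \<Rightarrow> ('a \<Rightarrow> complex) \<Rightarrow> real" where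
  "n2 M f = (LINT x|M. (cmod (f x))\<^sup>2)"

definition bm :: "'a measure \<Rightarrow> ('a \<Rightarrow> complex) set" where
  "bm M = {f \<in> borel_measurable M. \<exists>c. AE x in M. cmod (f x) \<le> c}"

lemma sq_measurable [measurable_dest]: "f \<in> sq M \<Longrightarrow> f \<in> borel_measurable M"
  by (simp add: sq_def)

lemma sq_integrable: "f \<in> sq M \<Longrightarrow> integrable M (\<lambda>x. (cmod (f x))\<^sup>2)"
  by (simp add: sq_def)

lemma bm_measurable [measurable_dest]: "f \<in> bm M \<Longrightarrow> f \<in> borel_measurable M"
  by (simp add: bm_def)

lemma borel_measurable_cnj [measurable (raw)]:
  "f \<in> borel_measurable M \<Longrightarrow> (\<lambda>x. cnj (f x)) \<in> borel_measurable M"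
  by (rule measurable_compose[where g=cnj and N=borel]) (auto intro!: borel_measurable_continuous_onI continuous_intros)

lemma n2_nonneg [simp]: "0 \<le> n2 M f"
  by (simp add: n2_def)

lemma cmod_add_sq_le: "(cmod (a + b))\<^sup>2 \<le> 2 * (cmod a)\<^sup>2 + 2 * (cmod b)\<^sup>2"
proof -
  have "(cmod (a + b))\<^sup>2 \<le> (cmod a + cmod b)\<^sup>2"
    by (intro power_mono norm_triangle_ineq norm_ge_zero)
  also have "\<dots> \<le> 2 * (cmod a)\<^sup>2 + 2 * (cmod b)\<^sup>2"
    using zero_le_power2[of "cmod a - cmod b"] by (simp add: power2_sum power2_diff)
  finally show ?thesis .
qed

lemma sq_add:
  assumes "f \<in> sq M" "g \<in> sq M"
  shows "(f +: g) \<in> sq M"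
proof -
  have [measurable]: "f \<in> borel_measurable M" "g \<in> borel_measurable M"
    using assms by (auto simp: sq_def)
  have "integrable M (\<lambda>x. 2 * (cmod (f x))\<^sup>2 + 2 * (cmod (g x))\<^sup>2)"
    using assms by (simp add: sq_def)
  then have "integrable M (\<lambda>x. (cmod (f x + g x))\<^sup>2)"
    by (rule Bochner_Integration.integrable_bound) (auto simp: cmod_add_sq_le)
  then show ?thesis by (simp add: sq_def)
qed

lemma sq_scale: "f \<in> sq M \<Longrightarrow> (\<lambda>x. c * f x) \<in> sq M"
  by (auto simp: sq_def norm_mult power_mult_distrib)

lemma sq_minus: "f \<in> sq M \<Longrightarrow> (\<lambda>x. - f x) \<in> sq M"
  using sq_scale[of f M "-1"] by simp

lemma sq_diff: "f \<in> sq M \<Longrightarrow> g \<in> sq M \<Longrightarrow> (f -: g) \<in> sq M"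
  using sq_add[OF _ sq_minus, of f M g] by simp

lemma sq_zero: "(\<lambda>x. 0) \<in> sq M"
  by (simp add: sq_def)

lemma AE_mult_sq_le:
  assumes "AE x in M. cmod (h x) \<le> c"
  shows "AE x in M. (cmod (h x * f x))\<^sup>2 \<le> c\<^sup>2 * (cmod (f x))\<^sup>2"
  using assms by eventually_elim (auto simp: norm_mult power_mult_distrib intro!: mult_right_mono power_mono)

lemma sq_mult:
  assumes "h \<in> bm M" "f \<in> sq M"
  shows "(h \<cdot> f) \<in> sq M"
proof -
  obtain c where c: "AE x in M. cmod (h x) \<le> c" using assms by (auto simp: bm_def)
  have [measurable]: "h \<in> borel_measurable M" "f \<in> borel_measurable M"
    using assms by (auto simp: bm_def sq_def)
  have "integrable M (\<lambda>x. c\<^sup>2 * (cmod (f x))\<^sup>2)"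
    using assms by (simp add: sq_def)
  then have "integrable M (\<lambda>x. (cmod (h x * f x))\<^sup>2)"
    by (rule Bochner_Integration.integrable_bound) (use AE_mult_sq_le[OF c, of f] in auto)
  then show ?thesis by (simp add: sq_def)
qed

lemma sq_mult_right: "h \<in> bm M \<Longrightarrow> f \<in> sq M \<Longrightarrow> (f \<cdot> h) \<in> sq M"
  using sq_mult[of h M f] by (simp add: mult.commute)

lemma n2_mult_le:
  assumes "h \<in> borel_measurable M" "AE x in M. cmod (h x) \<le> c" "f \<in> sq M"
  shows "n2 M (h \<cdot> f) \<le> c\<^sup>2 * n2 M f"
proof -
  have "h \<in> bm M" using assms by (auto simp: bm_def)
  then have "(h \<cdot> f) \<in> sq M" using assms sq_mult by blast
  then have "n2 M (h \<cdot> f) \<le> (LINT x|M. c\<^sup>2 * (cmod (f x))\<^sup>2)"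
    unfolding n2_def
    by (intro integral_mono_AE) (use assms AE_mult_sq_le[OF assms(2), of f] in \<open>auto simp: sq_def\<close>)
  then show ?thesis by (simp add: n2_def)
qed

lemma sq_cong_AE: "f \<in> sq M \<Longrightarrow> g \<in> borel_measurable M \<Longrightarrow> AE x in M. g x = f x \<Longrightarrow> g \<in> sq M"
  unfolding sq_def mem_Collect_eq
  by (subst integrable_cong_AE[where g="\<lambda>x. (cmod (f x))\<^sup>2"]) auto

lemma n2_cong_AE:
  "f \<in> borel_measurable M \<Longrightarrow> g \<in> borel_measurable M \<Longrightarrow> AE x in M. f x = g x \<Longrightarrow> n2 M f = n2 M g"
  unfolding n2_def by (intro integral_cong_AE) auto

lemma ip_cong_AE:
  "f \<in> borel_measurable M \<Longrightarrow> f' \<in> borel_measurable M \<Longrightarrow> g \<in> borel_measurable M \<Longrightarrow> g' \<in> borel_measurable M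
   \<Longrightarrow> AE x in M. f x = f' x \<Longrightarrow> AE x in M. g x = g' x \<Longrightarrow> ip M f g = ip M f' g'"
  unfolding ip_def by (intro integral_cong_AE) auto

lemma ip_integrable:
  assumes "f \<in> sq M" "g \<in> sq M"
  shows "integrable M (\<lambda>x. f x * cnj (g x))"
proof -
  have [measurable]: "f \<in> borel_measurable M" "g \<in> borel_measurable M"
    using assms by (auto simp: sq_def)
  have *: "cmod (f x * cnj (g x)) \<le> (cmod (f x))\<^sup>2 + (cmod (g x))\<^sup>2" for x
    using zero_le_power2[of "cmod (f x) - cmod (g x)"] zero_le_power2[of "cmod (f x)"] zero_le_power2[of "cmod (g x)"]
    unfolding power2_diff norm_mult complex_mod_cnj using mult_nonneg_nonneg[OF norm_ge_zero norm_ge_zero, of "f x" "g x"] by linarith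
  have "integrable M (\<lambda>x. (cmod (f x))\<^sup>2 + (cmod (g x))\<^sup>2)" using assms by (simp add: sq_def)
  then show ?thesis
    by (rule Bochner_Integration.integrable_bound) (use * in auto)
qed

lemma ip_add_left:
  "f \<in> sq M \<Longrightarrow> g \<in> sq M \<Longrightarrow> h \<in> sq M \<Longrightarrow> ip M (f +: g) h = ip M f h + ip M g h"
  unfolding ip_def
  by (simp add: distrib_right ip_integrable)

lemma ip_add_right:
  "f \<in> sq M \<Longrightarrow> g \<in> sq M \<Longrightarrow> h \<in> sq M \<Longrightarrow> ip M h (f +: g) = ip M h f + ip M h g"
  unfolding ip_def
  by (simp add: distrib_left ip_integrable)

lemma ip_diff_left:
  "f \<in> sq M \<Longrightarrow> g \<in> sq M \<Longrightarrow> h \<in> sq M \<Longrightarrow> ip M (f -: g) h = ip M f h - ip M g h"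
  unfolding ip_def
  by (simp add: left_diff_distrib ip_integrable)

lemma ip_diff_right:
  "f \<in> sq M \<Longrightarrow> g \<in> sq M \<Longrightarrow> h \<in> sq M \<Longrightarrow> ip M h (f -: g) = ip M h f - ip M h g"
  unfolding ip_def
  by (simp add: right_diff_distrib ip_integrable)

lemma ip_scale_left: "ip M (\<lambda>x. c * f x) h = c * ip M f h"
  unfolding ip_def by (simp add: mult.assoc)

lemma ip_scale_right: "ip M h (\<lambda>x. c * f x) = cnj c * ip M h f"
  unfolding ip_def by (simp add: mult.left_commute)

lemma ip_zero [simp]: "ip M (\<lambda>x. 0) g = 0" "ip M g (\<lambda>x. 0) = 0"
  by (simp_all add: ip_def)

lemma ip_cnj: "cnj (ip M f g) = ip M g f"
  using Bochner_Integration.integral_cnj[of M "\<lambda>x. f x * cnj (g x)"] by (simp add: ip_def mult.commute)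

lemma ip_self: "ip M f f = of_real (n2 M f)"
  unfolding ip_def n2_def by (simp add: complex_norm_square[symmetric] del: of_real_power)

lemma n2_zero [simp]: "n2 M (\<lambda>x. 0) = 0"
  by (simp add: n2_def)

lemma n2_scale: "n2 M (\<lambda>x. c * f x) = (cmod c)\<^sup>2 * n2 M f"
  unfolding n2_def by (simp add: norm_mult power_mult_distrib)

lemma n2_minus: "n2 M (\<lambda>x. - f x) = n2 M f"
  by (simp add: n2_def)

lemma n2_diff_commute: "n2 M (f -: g) = n2 M (g -: f)"
  by (simp add: n2_def norm_minus_commute)

lemma n2_add:
  assumes "f \<in> sq M" "g \<in> sq M"
  shows "n2 M (f +: g) = n2 M f + 2 * Re (ip M f g) + n2 M g"
proof -
  have "complex_of_real (n2 M (f +: g)) = ip M (f +: g) (f +: g)"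
    by (simp add: ip_self)
  also have "\<dots> = n2 M f + (ip M f g + cnj (ip M f g)) + n2 M g"
    using assms by (simp add: ip_add_left ip_add_right sq_add ip_self[of M f] ip_self[of M g] ip_cnj[of M f g])
  also have "\<dots> = complex_of_real (n2 M f + 2 * Re (ip M f g) + n2 M g)"
    by (simp add: complex_add_cnj)
  finally show ?thesis by (simp only: of_real_eq_iff)
qed

lemma n2_diff:
  assumes "f \<in> sq M" "g \<in> sq M"
  shows "n2 M (f -: g) = n2 M f - 2 * Re (ip M f g) + n2 M g"
  using n2_add[OF assms(1) sq_minus[OF assms(2)]] ip_scale_right[of M f "-1" g] by (simp add: n2_minus)

lemma ip_weighted_bound:
  assumes "f \<in> sq M" "g \<in> sq M" "t > 0"
  shows "cmod (ip M f g) \<le> (t * n2 M f + n2 M g / t) / 2"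
proof -
  have *: "cmod (f x * cnj (g x)) \<le> (t * (cmod (f x))\<^sup>2 + (cmod (g x))\<^sup>2 / t) / 2" for x
    using zero_le_power2[of "t * cmod (f x) - cmod (g x)"] \<open>t > 0\<close>
    by (simp add: norm_mult power2_diff field_simps power2_eq_square)
  have "cmod (ip M f g) \<le> (LINT x|M. cmod (f x * cnj (g x)))"
    unfolding ip_def by (rule integral_norm_bound)
  also have "\<dots> \<le> (LINT x|M. (t * (cmod (f x))\<^sup>2 + (cmod (g x))\<^sup>2 / t) / 2)"
    using assms by (intro integral_mono integrable_norm ip_integrable *) (auto simp: sq_def)
  also have "\<dots> = (t * n2 M f + n2 M g / t) / 2"
    using assms by (simp add: sq_def n2_def)
  finally show ?thesis .
qed

lemma le_of_le_sqrt_mult: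
  fixes a b :: real
  assumes "0 \<le> a" "0 \<le> b" "a \<le> sqrt b * sqrt a"
  shows "a \<le> b"
proof (cases "a = 0")
  case False
  then have p: "sqrt a > 0" using assms by simp
  have "sqrt a * sqrt a \<le> sqrt b * sqrt a" using assms by simp
  from mult_right_le_imp_le[OF this p] show ?thesis by simp
qed (use assms in simp)

text \<open>Estimates of the form \<open>|z| \<le> (t a + b/t)/2\<close> can be summed over a family before the best \<open>t\<close> is chosen;
this recovers the Cauchy--Schwarz bound afterwards.\<close>

lemma weighted_bounds_imp_sqrt:
  fixes a b z :: real
  assumes "a \<ge> 0" "b \<ge> 0" "\<And>t. t > 0 \<Longrightarrow> z \<le> (t * a + b / t) / 2"
  shows "z \<le> sqrt a * sqrt b"
proof (cases "a = 0 \<or> b = 0")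
  case True
  have "z \<le> e" if "e > 0" for e
  proof -
    consider "a = 0" | "b = 0" using True by blast
    then show ?thesis
    proof cases
      case 1
      have "z \<le> (((b+1)/e) * a + b / ((b+1)/e)) / 2"
        using assms that by (intro assms(3)) (auto intro: divide_pos_pos)
      also have "\<dots> \<le> e" using 1 assms that by (simp add: field_simps)
      finally show ?thesis .
    next
      case 2
      have "z \<le> ((e/(a+1)) * a + b / (e/(a+1))) / 2"
        using assms that by (intro assms(3)) (auto intro: divide_pos_pos)
      also have "\<dots> \<le> e" using 2 assms that by (simp add: field_simps)
      finally show ?thesis .
    qed
  qed
  then have "z \<le> 0" by (rule field_le_epsilon) auto
  then show ?thesis using True by auto
next
  case False
  then have "a > 0" "b > 0" using assms by auto
  then have "z \<le> ((sqrt b / sqrt a) * a + b / (sqrt b / sqrt a)) / 2"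
    by (intro assms(3)) auto
  also have "(sqrt b / sqrt a) * a = sqrt a * sqrt b"
    using \<open>a > 0\<close> by (simp add: field_simps)
  also have "b / (sqrt b / sqrt a) = sqrt a * sqrt b"
    using \<open>b > 0\<close> by (simp add: field_simps)
  finally show ?thesis by simp
qed

lemma ip_Cauchy_Schwarz:
  assumes "f \<in> sq M" "g \<in> sq M"
  shows "cmod (ip M f g) \<le> sqrt (n2 M f) * sqrt (n2 M g)"
  by (rule weighted_bounds_imp_sqrt) (use ip_weighted_bound[OF assms] in auto)

lemma n2_add_le:
  assumes "f \<in> sq M" "g \<in> sq M" "t > 0"
  shows "n2 M (f +: g) \<le> (1 + t) * n2 M f + (1 + 1 / t) * n2 M g"
proof -
  have "Re (ip M f g) \<le> (t * n2 M f + n2 M g / t) / 2"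
    using ip_weighted_bound[OF assms] complex_Re_le_cmod order_trans by blast
  then show ?thesis using n2_add[OF assms(1,2)] by (simp add: algebra_simps)
qed

lemma n2_add_le2:
  assumes "f \<in> sq M" "g \<in> sq M"
  shows "n2 M (f +: g) \<le> 2 * n2 M f + 2 * n2 M g"
  using n2_add_le[OF assms, of 1] by simp

lemma n2_triangle:
  assumes "f \<in> sq M" "g \<in> sq M"
  shows "sqrt (n2 M (f +: g)) \<le> sqrt (n2 M f) + sqrt (n2 M g)"
proof (rule real_le_lsqrt)
  have "Re (ip M f g) \<le> sqrt (n2 M f) * sqrt (n2 M g)"
    using ip_Cauchy_Schwarz[OF assms] complex_Re_le_cmod order_trans by blast
  then show "n2 M (f +: g) \<le> (sqrt (n2 M f) + sqrt (n2 M g))\<^sup>2"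
    using n2_add[OF assms] by (simp add: power2_sum algebra_simps)
qed auto

lemma n2_eq_0_iff:
  assumes "f \<in> sq M"
  shows "n2 M f = 0 \<longleftrightarrow> (AE x in M. f x = 0)"
  unfolding n2_def using assms by (subst integral_nonneg_eq_0_iff_AE) (auto simp: sq_def)

lemma n2_diff_eq_0_imp_AE:
  assumes "f \<in> sq M" "g \<in> sq M" "n2 M (f -: g) = 0"
  shows "AE x in M. f x = g x"
  using n2_eq_0_iff[OF sq_diff[OF assms(1,2)]] assms(3) by auto

lemma (in prob_space) bm_imp_sq: "f \<in> bm M \<Longrightarrow> f \<in> sq M"
proof -
  assume f: "f \<in> bm M"
  have "(\<lambda>x. 1::complex) \<in> sq M" by (simp add: sq_def)
  from sq_mult[OF f this] show "f \<in> sq M" by simp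
qed

lemma (in prob_space) sq_cint:
  assumes "f \<in> sq M"
  shows "integrable M f" and "(LINT x|M. cmod (f x)) \<le> sqrt (n2 M f)"
proof -
  have 1: "(\<lambda>x. 1::complex) \<in> sq M" by (simp add: sq_def)
  show i: "integrable M f" using ip_integrable[OF assms 1] by simp
  have a: "(\<lambda>x. complex_of_real (cmod (f x))) \<in> sq M" using assms by (auto simp: sq_def)
  have "ip M (\<lambda>x. complex_of_real (cmod (f x))) (\<lambda>x. 1) = complex_of_real (LINT x|M. cmod (f x))"
    by (simp add: ip_def)
  then show "(LINT x|M. cmod (f x)) \<le> sqrt (n2 M f)"
    using ip_Cauchy_Schwarz[OF a 1] by (simp add: n2_def prob_space)
qed


section \<open>Completeness, projections and the Riesz theorem\<close>

context prob_space begin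

lemma sq_complete:
  fixes f :: "nat \<Rightarrow> 'a \<Rightarrow> complex"
  assumes f: "\<And>n. f n \<in> sq M"
    and cauchy: "\<And>e. e > 0 \<Longrightarrow> \<exists>N. \<forall>i\<ge>N. \<forall>j\<ge>N. n2 M (\<lambda>x. f i x - f j x) \<le> e"
  shows "\<exists>g\<in>sq M. \<forall>e>0. \<exists>N. \<forall>i\<ge>N. n2 M (\<lambda>x. f i x - g x) \<le> e"
proof -
  have [measurable]: "f n \<in> borel_measurable M" for n using f by (auto simp: sq_def)
  have L1: "\<exists>N. \<forall>i\<ge>N. \<forall>j\<ge>N. (LINT x|M. cmod (f i x - f j x)) < e" if e0: "e > 0" for e
  proof -
    obtain N where N: "\<forall>i\<ge>N. \<forall>j\<ge>N. n2 M (\<lambda>x. f i x - f j x) \<le> (e/2)\<^sup>2"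
      using cauchy[of "(e/2)\<^sup>2"] zero_less_power[OF half_gt_zero[OF e0], of 2] by blast
    show ?thesis
    proof (intro exI[of _ N] allI impI)
      fix i j assume "i \<ge> N" "j \<ge> N"
      have "(LINT x|M. cmod (f i x - f j x)) \<le> sqrt (n2 M (\<lambda>x. f i x - f j x))"
        by (rule sq_cint) (intro sq_diff f)
      also have "\<dots> \<le> sqrt ((e/2)\<^sup>2)" using N \<open>i \<ge> N\<close> \<open>j \<ge> N\<close> by (intro real_sqrt_le_mono) auto
      also have "\<dots> < e" using that by simp
      finally show "(LINT x|M. cmod (f i x - f j x)) < e" .
    qed
  qed
  obtain r where r: "strict_mono r" and rc: "AE x in M. Cauchy (\<lambda>i. f (r i) x)"
    using cauchy_L1_AE_cauchy_subseq[of M f, OF sq_cint(1)[OF f] L1] by blast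
  define g where "g = (\<lambda>x. lim (\<lambda>i. f (r i) x))"
  have [measurable]: "g \<in> borel_measurable M" unfolding g_def by measurable
  have lim: "AE x in M. (\<lambda>i. f (r i) x) \<longlonglongrightarrow> g x"
    using rc by eventually_elim (simp add: g_def Cauchy_convergent_iff convergent_LIMSEQ_iff)
  have key: "\<exists>N. \<forall>i\<ge>N. (\<lambda>x. f i x - g x) \<in> sq M \<and> n2 M (\<lambda>x. f i x - g x) \<le> e" if e0: "e > 0" for e
  proof -
    obtain N where N: "\<And>i j. i \<ge> N \<Longrightarrow> j \<ge> N \<Longrightarrow> n2 M (\<lambda>x. f i x - f j x) \<le> e"
      using cauchy[OF e0] by blast
    have "(\<lambda>x. f i x - g x) \<in> sq M \<and> n2 M (\<lambda>x. f i x - g x) \<le> e" if "i \<ge> N" for i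
    proof -
      have "(\<integral>\<^sup>+x. ennreal ((cmod (f i x - g x))\<^sup>2) \<partial>M)
            = (\<integral>\<^sup>+x. liminf (\<lambda>k. ennreal ((cmod (f i x - f (r k) x))\<^sup>2)) \<partial>M)"
      proof (intro nn_integral_cong_AE, use lim in eventually_elim)
        fix x assume "(\<lambda>i. f (r i) x) \<longlonglongrightarrow> g x"
        then have "(\<lambda>k. ennreal ((cmod (f i x - f (r k) x))\<^sup>2)) \<longlonglongrightarrow> ennreal ((cmod (f i x - g x))\<^sup>2)"
          by (intro tendsto_intros tendsto_ennrealI)
        then show "ennreal ((cmod (f i x - g x))\<^sup>2) = liminf (\<lambda>k. ennreal ((cmod (f i x - f (r k) x))\<^sup>2))"
          by (rule lim_imp_Liminf[OF sequentially_bot, symmetric])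
      qed
      also have "\<dots> \<le> liminf (\<lambda>k. \<integral>\<^sup>+x. ennreal ((cmod (f i x - f (r k) x))\<^sup>2) \<partial>M)"
        by (rule nn_integral_liminf) measurable
      also have "\<dots> \<le> ennreal e"
      proof (rule order_trans[OF Liminf_mono[where g="\<lambda>_. ennreal e"]])
        show "eventually (\<lambda>k. (\<integral>\<^sup>+x. ennreal ((cmod (f i x - f (r k) x))\<^sup>2) \<partial>M) \<le> ennreal e) sequentially"
        proof (rule eventually_sequentiallyI[of N])
          fix k assume "k \<ge> N"
          then have "r k \<ge> N" using seq_suble[OF r, of k] by linarith
          have "(\<integral>\<^sup>+x. ennreal ((cmod (f i x - f (r k) x))\<^sup>2) \<partial>M) = ennreal (n2 M (\<lambda>x. f i x - f (r k) x))"
            unfolding n2_def by (rule nn_integral_eq_integral) (use sq_integrable[OF sq_diff[OF f f]] in auto)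
          then show "(\<integral>\<^sup>+x. ennreal ((cmod (f i x - f (r k) x))\<^sup>2) \<partial>M) \<le> ennreal e"
            using N[OF \<open>i \<ge> N\<close> \<open>r k \<ge> N\<close>] by (simp add: ennreal_leI)
        qed
      qed (simp add: Liminf_const)
      finally have le: "(\<integral>\<^sup>+x. ennreal ((cmod (f i x - g x))\<^sup>2) \<partial>M) \<le> ennreal e" .
      have int: "integrable M (\<lambda>x. (cmod (f i x - g x))\<^sup>2)"
        by (rule integrableI_bounded) (use le_less_trans[OF le ennreal_less_top] in auto)
      from this have "ennreal (n2 M (\<lambda>x. f i x - g x)) = (\<integral>\<^sup>+x. ennreal ((cmod (f i x - g x))\<^sup>2) \<partial>M)"
        unfolding n2_def by (intro nn_integral_eq_integral[symmetric]) auto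
      then have "ennreal (n2 M (\<lambda>x. f i x - g x)) \<le> ennreal e" using le by simp
      then have "n2 M (\<lambda>x. f i x - g x) \<le> e" using e0 by (subst (asm) ennreal_le_iff) auto
      then show ?thesis using int by (simp add: sq_def)
    qed
    then show ?thesis by blast
  qed
  obtain N where "(\<lambda>x. f N x - g x) \<in> sq M" using key[of 1] by auto
  from sq_diff[OF f[of N] this] have "g \<in> sq M" by simp
  then show ?thesis using key by meson
qed

definition lsub :: "('a \<Rightarrow> complex) set \<Rightarrow> bool" where
  "lsub S \<longleftrightarrow> S \<subseteq> sq M \<and> (\<lambda>x. 0) \<in> S \<and> (\<forall>f\<in>S. \<forall>g\<in>S. (f +: g) \<in> S)
     \<and> (\<forall>c. \<forall>f\<in>S. (\<lambda>x. c * f x) \<in> S)"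

definition csub :: "('a \<Rightarrow> complex) set \<Rightarrow> bool" where
  "csub S \<longleftrightarrow> lsub S \<and> (\<forall>f\<in>sq M. (\<forall>e>0. \<exists>h\<in>S. n2 M (f -: h) \<le> e) \<longrightarrow> f \<in> S)"

lemma lsub_diff: "lsub S \<Longrightarrow> f \<in> S \<Longrightarrow> g \<in> S \<Longrightarrow> (f -: g) \<in> S"
proof -
  assume S: "lsub S" "f \<in> S" "g \<in> S"
  then have sc: "\<forall>c. \<forall>f\<in>S. (\<lambda>x. c * f x) \<in> S" and ad: "\<forall>f\<in>S. \<forall>g\<in>S. (f +: g) \<in> S"
    by (simp_all add: lsub_def)
  from ad[rule_format, OF S(2) sc[rule_format, OF S(3), of "-1"]] show ?thesis by simp
qed

text \<open>Used for the closure of \<open>A\<close>, which is the Hardy space.\<close>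

definition l2_closure :: "('a \<Rightarrow> complex) set \<Rightarrow> ('a \<Rightarrow> complex) set" where
  "l2_closure S = {f \<in> sq M. \<forall>e>0. \<exists>g\<in>S. n2 M (f -: g) \<le> e}"

lemma csub_closure:
  assumes S: "lsub S"
  shows "csub (l2_closure S)"
proof -
  have Ss: "g \<in> sq M" if "g \<in> S" for g using S that by (auto simp: lsub_def)
  have sub: "f \<in> sq M" if "f \<in> l2_closure S" for f using that by (simp add: l2_closure_def)
  have ap: "\<exists>g\<in>S. n2 M (f -: g) \<le> e" if "f \<in> l2_closure S" "e > 0" for f e
    using that by (simp add: l2_closure_def)
  show ?thesis
    unfolding csub_def lsub_def
  proof (intro conjI ballI allI impI subsetI)
    show "f \<in> sq M" if "f \<in> l2_closure S" for f using that by (rule sub)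
    show "(\<lambda>x. 0) \<in> l2_closure S"
      using S by (auto simp: l2_closure_def lsub_def sq_zero intro!: bexI[of _ "\<lambda>x. 0"])
    fix f g assume f: "f \<in> l2_closure S" and g: "g \<in> l2_closure S"
    show "(f +: g) \<in> l2_closure S" unfolding l2_closure_def
    proof (intro CollectI conjI allI impI sq_add sub f g)
      fix e :: real assume "e > 0"
      then have e4: "e/4 > 0" by simp
      obtain a b where ab: "a \<in> S" "n2 M (f -: a) \<le> e/4" "b \<in> S" "n2 M (g -: b) \<le> e/4"
        using ap[OF f e4] ap[OF g e4] by blast
      have "n2 M (\<lambda>x. (f x - a x) + (g x - b x)) \<le> 2 * n2 M (f -: a) + 2 * n2 M (g -: b)"
        by (intro n2_add_le2 sq_diff Ss ab sub f g)
      then have "n2 M (\<lambda>x. (f x + g x) - (a x + b x)) \<le> e" using ab by (simp add: algebra_simps)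
      moreover have "(a +: b) \<in> S" using S ab by (simp add: lsub_def)
      ultimately show "\<exists>h\<in>S. n2 M (\<lambda>x. f x + g x - h x) \<le> e" by (intro bexI[of _ "\<lambda>x. a x + b x"]) auto
    qed
  next
    fix c f assume f: "f \<in> l2_closure S"
    show "(\<lambda>x. c * f x) \<in> l2_closure S" unfolding l2_closure_def
    proof (intro CollectI conjI allI impI sq_scale sub f)
      fix e :: real assume e: "e > 0"
      have p: "(cmod c)\<^sup>2 + 1 > 0" by (intro add_nonneg_pos) auto
      then have ep: "e / ((cmod c)\<^sup>2 + 1) > 0" using e by simp
      obtain h where h: "h \<in> S" "n2 M (f -: h) \<le> e / ((cmod c)\<^sup>2 + 1)" using ap[OF f ep] by blast
      have "n2 M (\<lambda>x. c * (f x - h x)) \<le> ((cmod c)\<^sup>2 + 1) * (e / ((cmod c)\<^sup>2 + 1))"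
        unfolding n2_scale using h by (intro mult_mono) auto
      also have "((cmod c)\<^sup>2 + 1) * (e / ((cmod c)\<^sup>2 + 1)) = e" using p by simp
      finally have "n2 M (\<lambda>x. c * f x - c * h x) \<le> e" by (simp add: algebra_simps)
      moreover have "(\<lambda>x. c * h x) \<in> S" using S h by (simp add: lsub_def)
      ultimately show "\<exists>h\<in>S. n2 M (\<lambda>x. c * f x - h x) \<le> e" by (intro bexI[of _ "\<lambda>x. c * h x"]) auto
    qed
  next
    fix f assume f: "f \<in> sq M" and ap': "\<forall>e>0. \<exists>h\<in>l2_closure S. n2 M (f -: h) \<le> e"
    show "f \<in> l2_closure S" unfolding l2_closure_def
    proof (intro CollectI conjI allI impI f)
      fix e :: real assume "e > 0"
      then have e4: "e/4 > 0" by simp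
      then obtain h where h: "h \<in> l2_closure S" "n2 M (f -: h) \<le> e/4" using ap' by blast
      obtain a where a: "a \<in> S" "n2 M (h -: a) \<le> e/4" using ap[OF h(1) e4] by blast
      have "n2 M (\<lambda>x. (f x - h x) + (h x - a x)) \<le> 2 * n2 M (f -: h) + 2 * n2 M (h -: a)"
        by (intro n2_add_le2 sq_diff Ss a sub h f)
      then show "\<exists>a\<in>S. n2 M (f -: a) \<le> e" using h a by (intro bexI[of _ a]) auto
    qed
  qed
qed

lemma parallelogram:
  assumes "f \<in> sq M" "g \<in> sq M"
  shows "n2 M (f -: g) + n2 M (f +: g) = 2 * n2 M f + 2 * n2 M g"
  using n2_add[OF assms] n2_diff[OF assms] by simp

theorem projection_exists:
  assumes S: "csub S" and f: "f \<in> sq M"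
  shows "\<exists>h\<in>S. \<forall>k\<in>S. ip M (f -: h) k = 0"
proof -
  have Ssq: "\<And>h. h \<in> S \<Longrightarrow> h \<in> sq M" and lS: "lsub S" using S by (auto simp: csub_def lsub_def)
  have Sadd: "\<And>h k. h \<in> S \<Longrightarrow> k \<in> S \<Longrightarrow> (h +: k) \<in> S"
    and Ssc: "\<And>h c. h \<in> S \<Longrightarrow> (\<lambda>x. c * h x) \<in> S" and S0: "(\<lambda>x. 0) \<in> S"
    using lS by (auto simp: lsub_def)
  define D where "D h = n2 M (f -: h)" for h
  define d where "d = Inf (D ` S)"
  have bdd: "bdd_below (D ` S)" unfolding D_def by (rule bdd_belowI[of _ 0]) auto
  have dle: "d \<le> D h" if "h \<in> S" for h
    unfolding d_def using that bdd by (auto intro: cInf_lower)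
  have "\<exists>h\<in>S. D h < d + 1 / Suc n" for n
  proof -
    have "\<exists>y\<in>D ` S. y < d + 1 / Suc n"
      unfolding d_def using S0 by (intro cInf_lessD) auto
    then show ?thesis by blast
  qed
  then obtain h where hS: "\<And>n. h n \<in> S" and hD: "\<And>n. D (h n) < d + 1 / Suc n" by metis
  have par: "n2 M (\<lambda>x. h i x - h j x) \<le> 2 / Suc i + 2 / Suc j" for i j
  proof -
    have "n2 M (\<lambda>x. (f x - h j x) - (f x - h i x)) + n2 M (\<lambda>x. (f x - h j x) + (f x - h i x)) = 2 * D (h j) + 2 * D (h i)"
      unfolding D_def by (intro parallelogram sq_diff f Ssq hS)
    moreover have "(\<lambda>x. (f x - h j x) - (f x - h i x)) = (\<lambda>x. h i x - h j x)" by (auto simp: algebra_simps)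
    moreover have "(\<lambda>x. (f x - h j x) + (f x - h i x)) = (\<lambda>x. 2 * (f x - (1/2) * (h i x + h j x)))"
      by (auto simp: algebra_simps)
    moreover have "n2 M (\<lambda>x. 2 * (f x - (1/2) * (h i x + h j x))) \<ge> 4 * d"
      using dle[OF Ssc[OF Sadd[OF hS[of i] hS[of j]], of "1/2"]] by (subst n2_scale) (simp add: D_def)
    ultimately have "n2 M (\<lambda>x. h i x - h j x) \<le> 2 * D (h j) + 2 * D (h i) - 4 * d" by simp
    also have "\<dots> \<le> 2 / Suc i + 2 / Suc j" using hD[of i] hD[of j] by simp
    finally show ?thesis .
  qed
  have "\<exists>N. \<forall>i\<ge>N. \<forall>j\<ge>N. n2 M (\<lambda>x. h i x - h j x) \<le> e" if "e > 0" for e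
  proof -
    obtain N where N: "4 / e < real N" using reals_Archimedean2 by blast
    have "2 / Suc i \<le> e / 2" if "i \<ge> N" for i
    proof -
      have "4 / e < Suc i" using N that by linarith
      then show ?thesis using \<open>e > 0\<close> by (simp add: field_simps)
    qed
    then have "n2 M (\<lambda>x. h i x - h j x) \<le> e" if "i \<ge> N" "j \<ge> N" for i j
      using par[of i j] that by (smt (verit) field_sum_of_halves)
    then show ?thesis by blast
  qed
  from sq_complete[OF Ssq[OF hS] this] obtain p where p: "p \<in> sq M"
    and pl: "\<And>e. e > 0 \<Longrightarrow> \<exists>N. \<forall>i\<ge>N. n2 M (\<lambda>x. h i x - p x) \<le> e" by blast
  have pS: "p \<in> S"
  proof -
    have "\<exists>k\<in>S. n2 M (p -: k) \<le> e" if "e > 0" for e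
      using pl[OF that] hS n2_diff_commute by (metis order_refl)
    then show ?thesis using S p unfolding csub_def by blast
  qed
  have sD: "sqrt (D p) \<le> sqrt d"
  proof (rule field_le_epsilon)
    fix e :: real assume "e > 0"
    obtain N where N: "\<And>i. i \<ge> N \<Longrightarrow> n2 M (\<lambda>x. h i x - p x) \<le> (e/2)\<^sup>2" using pl[of "(e/2)\<^sup>2"] zero_less_power[OF half_gt_zero[OF \<open>e > 0\<close>], of 2] by blast
    obtain N' where N': "4 / e\<^sup>2 < real N'" using reals_Archimedean2 by blast
    define i where "i = max N N'"
    have d0: "0 \<le> d" unfolding d_def D_def using S0 by (intro cINF_greatest) auto
    have "sqrt (D p) = sqrt (n2 M (\<lambda>x. (f x - h i x) + (h i x - p x)))" by (simp add: D_def)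
    also have "\<dots> \<le> sqrt (D (h i)) + sqrt (n2 M (\<lambda>x. h i x - p x))"
      unfolding D_def by (intro n2_triangle sq_diff f Ssq hS p)
    also have "sqrt (n2 M (\<lambda>x. h i x - p x)) \<le> sqrt ((e/2)\<^sup>2)" using N[of i] by (intro real_sqrt_le_mono) (simp add: i_def)
    also have "\<dots> = e/2" using \<open>e > 0\<close> by simp
    also have "sqrt (D (h i)) \<le> sqrt (d + (e/2)\<^sup>2)"
    proof (intro real_sqrt_le_mono)
      have "4 / e\<^sup>2 < Suc i" using N' by (simp add: i_def)
      then have "1 / Suc i \<le> (e/2)\<^sup>2" using \<open>e > 0\<close> by (simp add: field_simps)
      then show "D (h i) \<le> d + (e/2)\<^sup>2" using hD[of i] by linarith
    qed
    also have "\<dots> \<le> sqrt d + sqrt ((e/2)\<^sup>2)" by (rule sqrt_add_le_add_sqrt) (use d0 in auto)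
    finally show "sqrt (D p) \<le> sqrt d + e" using \<open>e > 0\<close> by simp
  qed
  then have Dp: "D p \<le> d" by simp
  have "ip M (f -: p) k = 0" if k: "k \<in> S" for k
  proof (rule ccontr)
    define z where "z = ip M (f -: p) k"
    assume "ip M (f -: p) k \<noteq> 0"
    then have z: "z \<noteq> 0" by (simp add: z_def)
    have ksq: "k \<in> sq M" using k Ssq by blast
    define t where "t = 1 / (n2 M k + 1)"
    have "0 < n2 M k + 1" using n2_nonneg[of M k] by linarith
    then have t: "t > 0" "t * n2 M k \<le> 1" by (simp_all add: t_def)
    define q where "q = (\<lambda>x. p x + (of_real t * z) * k x)"
    have "q \<in> S" unfolding q_def using Sadd[OF pS Ssc[OF k]] by blast
    then have "d \<le> D q" by (rule dle)
    also have "D q = n2 M (\<lambda>x. (f x - p x) - (of_real t * z) * k x)"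
      unfolding D_def q_def by (simp add: diff_diff_eq)
    also have "\<dots> = D p - 2 * Re (ip M (f -: p) (\<lambda>x. (of_real t * z) * k x)) + n2 M (\<lambda>x. (of_real t * z) * k x)"
      unfolding D_def by (intro n2_diff sq_diff f p sq_scale ksq)
    also have "ip M (f -: p) (\<lambda>x. (of_real t * z) * k x) = of_real (t * (cmod z)\<^sup>2)"
      unfolding ip_scale_right z_def[symmetric] by (simp add: complex_norm_square[symmetric] mult.commute)
    also have "n2 M (\<lambda>x. (of_real t * z) * k x) = t * (cmod z)\<^sup>2 * (t * n2 M k)"
      unfolding n2_scale using t by (simp add: norm_mult power2_eq_square)
    also have "D p - 2 * Re (complex_of_real (t * (cmod z)\<^sup>2)) + t * (cmod z)\<^sup>2 * (t * n2 M k) \<le> D p - 2 * (t * (cmod z)\<^sup>2) + t * (cmod z)\<^sup>2 * 1"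
      using t by (intro add_mono mult_left_mono) auto
    also have "\<dots> < D p" using t z by simp
    finally show False using Dp by simp
  qed
  then show ?thesis using pS by blast
qed

theorem riesz:
  assumes add: "\<And>f g. f \<in> sq M \<Longrightarrow> g \<in> sq M \<Longrightarrow> L (f +: g) = L f + L g"
    and sc: "\<And>c f. f \<in> sq M \<Longrightarrow> L (\<lambda>x. c * f x) = c * L f"
    and bd: "\<And>f. f \<in> sq M \<Longrightarrow> (cmod (L f))\<^sup>2 \<le> C * n2 M f"
  shows "\<exists>g\<in>sq M. \<forall>f\<in>sq M. L f = ip M f g"
proof (cases "\<forall>f\<in>sq M. L f = 0")
  case True
  then show ?thesis using sq_zero by (intro bexI[of _ "\<lambda>x. 0"]) auto
next
  case False
  then obtain u where u: "u \<in> sq M" "L u \<noteq> 0" by blast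
  have Ldiff: "L (f -: g) = L f - L g" if "f \<in> sq M" "g \<in> sq M" for f g
    using add[OF that(1) sq_scale[OF that(2)], of "-1"] sc[OF that(2), of "-1"] by simp
  define S where "S = {f \<in> sq M. L f = 0}"
  have "csub S" unfolding csub_def
  proof (intro conjI ballI impI)
    show "lsub S" using sc[OF sq_zero, of 0] by (auto simp: S_def lsub_def sq_add sq_scale sq_zero add sc)
    fix f assume f: "f \<in> sq M" and ap: "\<forall>e>0. \<exists>h\<in>S. n2 M (f -: h) \<le> e"
    have "(cmod (L f))\<^sup>2 \<le> 0 + e" if e0: "e > 0" for e
    proof -
      obtain h where h: "h \<in> S" "n2 M (f -: h) \<le> e / (\<bar>C\<bar> + 1)"
        using ap divide_pos_pos[OF e0, of "\<bar>C\<bar> + 1"] by force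
      then have hs: "h \<in> sq M" "L h = 0" by (auto simp: S_def)
      have "(cmod (L f))\<^sup>2 = (cmod (L (f -: h)))\<^sup>2" using Ldiff[OF f hs(1)] hs by simp
      also have "\<dots> \<le> C * n2 M (f -: h)" by (intro bd sq_diff f hs)
      also have "\<dots> \<le> (\<bar>C\<bar> + 1) * (e / (\<bar>C\<bar> + 1))" using h by (intro mult_mono) auto
      finally show ?thesis by simp
    qed
    then have "(cmod (L f))\<^sup>2 \<le> 0" by (rule field_le_epsilon)
    then show "f \<in> S" using f by (simp add: S_def)
  qed
  from projection_exists[OF this u(1)] obtain h where h: "h \<in> S" "\<And>k. k \<in> S \<Longrightarrow> ip M (u -: h) k = 0" by blast
  define w where "w = (u -: h)"
  have w: "w \<in> sq M" "L w = L u" using h u Ldiff[of u h] by (auto simp: w_def S_def sq_diff)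
  have nz: "n2 M w \<noteq> 0" using bd[OF w(1)] w u by auto
  define c where "c = cnj (L w) / of_real (n2 M w)"
  have "L f = ip M f (\<lambda>x. c * w x)" if f: "f \<in> sq M" for f
  proof -
    define a where "a = L f / L w"
    have "L f = a * L w" using w u by (simp add: a_def)
    then have "(\<lambda>x. f x - a * w x) \<in> S"
      using f w(1) by (simp add: S_def Ldiff sq_scale sc sq_diff)
    from h(2)[OF this] have "ip M w (\<lambda>x. f x - a * w x) = 0" by (simp add: w_def)
    then have "ip M (\<lambda>x. f x - a * w x) w = 0" using ip_cnj[of M w "\<lambda>x. f x - a * w x"] by simp
    then have "ip M f w = a * of_real (n2 M w)"
      using f w(1) by (simp add: ip_diff_left sq_scale ip_scale_left ip_self)
    then have "ip M f w = L f / L w * of_real (n2 M w)" by (simp add: a_def)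
    then have "cnj c * ip M f w = L f" using nz w u by (simp add: c_def)
    then show ?thesis by (simp only: ip_scale_right)
  qed
  then show ?thesis using sq_scale[OF w(1)] by blast
qed

end


section \<open>Complex Stone--Weierstrass and spherical families\<close>

lemma sum_list_swap':
  fixes f :: "'a \<Rightarrow> 'b \<Rightarrow> 'c::comm_monoid_add"
  shows "(\<Sum>x\<leftarrow>xs. \<Sum>y\<leftarrow>ys. f x y) = (\<Sum>y\<leftarrow>ys. \<Sum>x\<leftarrow>xs. f x y)"
  by (induction xs) (simp_all add: sum_list_addf)

text \<open>The real theorem applies to the real-valued members, since real and imaginary parts of members are members.\<close>

theorem Stone_Weierstrass_complex:
  fixes P :: "('k::t2_space \<Rightarrow> complex) \<Rightarrow> bool"
  assumes K: "compact (UNIV :: 'k set)"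
    and cont: "\<And>f. P f \<Longrightarrow> cts f"
    and const: "\<And>c. P (\<lambda>_. c)"
    and add: "\<And>f g. P f \<Longrightarrow> P g \<Longrightarrow> P (f +: g)"
    and mult: "\<And>f g. P f \<Longrightarrow> P g \<Longrightarrow> P (f \<cdot> g)"
    and closed: "\<And>f. cts f \<Longrightarrow>
                   (\<And>e. e > 0 \<Longrightarrow> \<exists>g. P g \<and> (\<forall>x. cmod (f x - g x) \<le> e)) \<Longrightarrow> P f"
    and sep: "\<And>x y. x \<noteq> y \<Longrightarrow> \<exists>f. P f \<and> P (\<lambda>x. cnj (f x)) \<and> f x \<noteq> f y"
    and f: "cts f"
  shows "P f"
proof -
  define Q where "Q r = P (\<lambda>x. complex_of_real (r x))" for r :: "'k \<Rightarrow> real"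
  have realP: "P (\<lambda>x. complex_of_real (r x))" if r: "cts r" for r :: "'k \<Rightarrow> real"
  proof (rule closed)
    show "cts (\<lambda>x. complex_of_real (r x))" by (intro continuous_intros r)
    fix e :: real assume "e > 0"
    have "\<exists>g. Q g \<and> (\<forall>x\<in>UNIV. \<bar>r x - g x\<bar> < e)"
    proof (rule Stone_Weierstrass_HOL[of UNIV Q])
      show "\<exists>f. Q f \<and> f x \<noteq> f y" if xy: "x \<in> UNIV \<and> y \<in> UNIV \<and> x \<noteq> y" for x y
      proof -
        obtain g where g: "P g" "P (\<lambda>x. cnj (g x))" "g x \<noteq> g y" using sep xy by blast
        have 1: "Q (\<lambda>x. Re (g x))"
        proof -
          have "P (\<lambda>x. (1/2) * (g x + cnj (g x)))" by (intro mult const add g)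
          then show ?thesis by (simp add: Q_def complex_add_cnj)
        qed
        have 2: "Q (\<lambda>x. Im (g x))"
        proof -
          have "P (\<lambda>x. (- \<i>/2) * (g x + (-1) * cnj (g x)))" by (intro mult const add g)
          moreover have "(- \<i>/2) * (g x + (-1) * cnj (g x)) = complex_of_real (Im (g x))" for x
            by (simp add: complex_eq_iff)
          ultimately show ?thesis by (simp only: Q_def)
        qed
        show ?thesis using 1 2 g(3) complex_eq_iff by metis
      qed
      show "cts h" if "Q h" for h
        using continuous_on_Re[OF cont[OF that[unfolded Q_def]]] by simp
      show "Q (f +: g)" if "Q f \<and> Q g" for f g
        using add that by (simp add: Q_def)
      show "Q (f \<cdot> g)" if "Q f \<and> Q g" for f g
        using mult that by (simp add: Q_def)
    qed (use K const r \<open>e > 0\<close> in \<open>auto simp: Q_def\<close>)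
    then obtain g where "Q g" "\<And>x. \<bar>r x - g x\<bar> < e" by auto
    then show "\<exists>g. P g \<and> (\<forall>x. cmod (complex_of_real (r x) - g x) \<le> e)"
      by (intro exI[of _ "\<lambda>x. complex_of_real (g x)"])
        (auto simp: Q_def norm_of_real less_imp_le simp flip: of_real_diff)
  qed
  have "P (\<lambda>x. complex_of_real (Re (f x)) + \<i> * complex_of_real (Im (f x)))"
    by (intro add mult const realP continuous_intros f)
  then show ?thesis by (simp add: complex_eq[symmetric])
qed

text \<open>Families are lists since distinct pairs of factors may have the same product.\<close>

definition prodl :: "('k \<Rightarrow> complex) list \<Rightarrow> ('k \<Rightarrow> complex) list \<Rightarrow> ('k \<Rightarrow> complex) list" where
  "prodl us vs = concat (map (\<lambda>u. map (\<lambda>v x. u x * v x) vs) us)"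

lemma sum_prodl: "(\<Sum>w\<leftarrow>prodl us vs. F w) = (\<Sum>u\<leftarrow>us. \<Sum>v\<leftarrow>vs. F (u \<cdot> v))"
  unfolding prodl_def by (induction us) (simp_all add: o_def)

lemma sum_prodl_commute:
  fixes F :: "_ \<Rightarrow> 'c::comm_monoid_add"
  shows "(\<Sum>w\<leftarrow>prodl us vs. F w) = (\<Sum>w\<leftarrow>prodl vs us. F w)"
  unfolding sum_prodl by (subst sum_list_swap') (simp add: mult.commute)

lemma sum_prodl_assoc:
  "(\<Sum>w\<leftarrow>prodl (prodl us vs) ws. F w) = (\<Sum>w\<leftarrow>prodl us (prodl vs ws). F w)"
  by (simp add: sum_prodl mult.assoc)

lemma sum_prodl3:
  fixes G :: "_ \<Rightarrow> 'c::comm_monoid_add"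
  shows "(\<Sum>w\<leftarrow>prodl ws (prodl us vs). G w) = (\<Sum>w\<leftarrow>prodl (prodl ws vs) us. G w)"
proof -
  have "(\<Sum>w\<leftarrow>prodl ws (prodl us vs). G w) = (\<Sum>w\<leftarrow>prodl ws (prodl vs us). G w)"
    using sum_prodl_commute[of "\<lambda>v. G (u \<cdot> v)" us vs for u] by (simp add: sum_prodl[of _ ws])
  then show ?thesis by (simp only: sum_prodl_assoc)
qed

lemma set_prodl: "set (prodl us vs) = {\<lambda>x. u x * v x | u v. u \<in> set us \<and> v \<in> set vs}"
  by (auto simp: prodl_def)

locale spherical_setting =
  fixes A :: "('k::t2_space \<Rightarrow> complex) set"
    and \<Gamma> :: "'i set" and J :: "'i \<Rightarrow> 'j set" and \<phi> :: "'i \<Rightarrow> 'j \<Rightarrow> 'k \<Rightarrow> complex"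
    and m :: "'k measure"
  assumes K: "compact (UNIV :: 'k set)"
    and A_sub: "complex_subalgebra (Cont UNIV) A"
    and A_const: "\<And>c. (\<lambda>_. c) \<in> A"
    and sphm: "\<And>\<alpha>. \<alpha> \<in> \<Gamma> \<Longrightarrow> spherical_multifunction (J \<alpha>) (\<phi> \<alpha>)"
    and phi_A: "\<And>\<alpha> j. \<alpha> \<in> \<Gamma> \<Longrightarrow> j \<in> J \<alpha> \<Longrightarrow> \<phi> \<alpha> j \<in> A"
    and sep: "\<And>x y. x \<noteq> y \<Longrightarrow> \<exists>\<alpha>\<in>\<Gamma>. \<exists>j\<in>J \<alpha>. \<phi> \<alpha> j x \<noteq> \<phi> \<alpha> j y"
    and regular: "regular_borel_prob m"
begin

lemma sets_m [measurable_cong, simp]: "sets m = sets borel"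
  using regular by (simp add: regular_borel_prob_def)

lemma space_m [simp]: "space m = UNIV"
  using sets_eq_imp_space_eq[OF sets_m] by simp

lemma A_cont: "a \<in> A \<Longrightarrow> cts a"
  using A_sub by (auto simp: complex_subalgebra_def Cont_def restrict_def)

lemma A_add: "a \<in> A \<Longrightarrow> b \<in> A \<Longrightarrow> (a +: b) \<in> A"
  using A_sub by (auto simp: complex_subalgebra_def Cont_def restrict_def)

lemma A_mult: "a \<in> A \<Longrightarrow> b \<in> A \<Longrightarrow> (a \<cdot> b) \<in> A"
  using A_sub by (auto simp: complex_subalgebra_def Cont_def restrict_def)

lemma A_scale: "a \<in> A \<Longrightarrow> (\<lambda>x. c * a x) \<in> A"
  by (rule A_mult[OF A_const])

lemma finite_J: "\<alpha> \<in> \<Gamma> \<Longrightarrow> finite (J \<alpha>)"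
  using sphm by (auto simp: spherical_multifunction_def)

lemma phi_sum: "\<alpha> \<in> \<Gamma> \<Longrightarrow> (\<Sum>j\<in>J \<alpha>. (cmod (\<phi> \<alpha> j x))\<^sup>2) = 1"
  using sphm by (auto simp: spherical_multifunction_def)

lemma SW:
  fixes P :: "('k \<Rightarrow> complex) \<Rightarrow> bool"
  assumes cont: "\<And>f. P f \<Longrightarrow> cts f"
    and const: "\<And>c. P (\<lambda>_. c)"
    and add: "\<And>f g. P f \<Longrightarrow> P g \<Longrightarrow> P (f +: g)"
    and mult: "\<And>f g. P f \<Longrightarrow> P g \<Longrightarrow> P (f \<cdot> g)"
    and closed: "\<And>f. cts f \<Longrightarrow>
                   (\<And>e. e > 0 \<Longrightarrow> \<exists>g. P g \<and> (\<forall>x. cmod (f x - g x) \<le> e)) \<Longrightarrow> P f"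
    and phi: "\<And>\<alpha> j. \<alpha> \<in> \<Gamma> \<Longrightarrow> j \<in> J \<alpha> \<Longrightarrow> P (\<phi> \<alpha> j)"
    and phic: "\<And>\<alpha> j. \<alpha> \<in> \<Gamma> \<Longrightarrow> j \<in> J \<alpha> \<Longrightarrow> P (\<lambda>x. cnj (\<phi> \<alpha> j x))"
    and f: "cts f"
  shows "P f"
proof (rule Stone_Weierstrass_complex[where P=P, OF K cont const add mult closed _ f])
  fix x y :: 'k assume "x \<noteq> y"
  then show "\<exists>f. P f \<and> P (\<lambda>x. cnj (f x)) \<and> f x \<noteq> f y" using sep phi phic by blast
qed

lemma cont_bounded:
  assumes "continuous_on (UNIV::'k set) (f :: 'k \<Rightarrow> complex)"
  obtains B where "B > 0" "\<And>x. cmod (f x) \<le> B"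
proof -
  have "bounded (range f)" using compact_continuous_image[OF assms K] by (rule compact_imp_bounded)
  then obtain B where "\<And>x. cmod (f x) \<le> B" by (auto simp: bounded_iff)
  then have "cmod (f x) \<le> \<bar>B\<bar> + 1" for x by (smt (verit))
  then show thesis by (intro that[of "\<bar>B\<bar> + 1"]) auto
qed

lemma cont_measurable: "cts f \<Longrightarrow> f \<in> borel_measurable m"
  for f :: "'k \<Rightarrow> complex"
  using borel_measurable_continuous_onI[of f] measurable_cong_sets[OF sets_m refl] by blast

lemma cont_bm: "cts f \<Longrightarrow> f \<in> bm m"
  for f :: "'k \<Rightarrow> complex"
  unfolding bm_def using cont_measurable[of f] by (auto elim!: cont_bounded)

text \<open>The families generated by the given multifunctions under products.\<close>

inductive_set sph :: "('k \<Rightarrow> complex) list set" where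
  one: "[\<lambda>_. 1] \<in> sph"
| fam: "\<alpha> \<in> \<Gamma> \<Longrightarrow> distinct js \<Longrightarrow> set js = J \<alpha> \<Longrightarrow> map (\<phi> \<alpha>) js \<in> sph"
| prod: "us \<in> sph \<Longrightarrow> vs \<in> sph \<Longrightarrow> prodl us vs \<in> sph"

lemma sph_A: "us \<in> sph \<Longrightarrow> u \<in> set us \<Longrightarrow> u \<in> A"
  by (induction us arbitrary: u rule: sph.induct) (auto simp: A_const phi_A set_prodl intro: A_mult)

lemma sph_sum: "us \<in> sph \<Longrightarrow> (\<Sum>u\<leftarrow>us. (cmod (u x))\<^sup>2) = 1"
proof (induction us rule: sph.induct)
  case (fam \<alpha> js)
  then show ?case using phi_sum[of \<alpha> x] by (simp add: o_def sum_list_distinct_conv_sum_set)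
next
  case (prod us vs)
  then show ?case by (simp add: sum_prodl norm_mult power_mult_distrib sum_list_const_mult)
qed simp

text \<open>For each word \<open>l\<^sub>1 \<dots> l\<^sub>n\<close> over \<open>js\<close> the list has a pair \<open>(u, v)\<close>: \<open>u\<close> is the product of the \<open>\<psi>\<^bsub>l\<^sub>i\<^esub>\<close>, and \<open>v\<close>
the sum, over the positions \<open>i\<close> with \<open>l\<^sub>i = j\<close>, of this product with its \<open>i\<close>-th factor omitted. So \<open>v/u\<close> is the
number of occurrences of \<open>j\<close> divided by \<open>\<psi>\<^sub>j\<close>; when the word has probability \<open>|u|\<^sup>2\<close>, its mean is
\<open>n cnj \<psi>\<^sub>j\<close>.\<close>

fun cps :: "('j \<Rightarrow> 'k \<Rightarrow> complex) \<Rightarrow> 'j list \<Rightarrow> 'j \<Rightarrow> nat \<Rightarrow> (('k \<Rightarrow> complex) \<times> ('k \<Rightarrow> complex)) list" where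
  "cps \<psi> js j 0 = [(\<lambda>_. 1, \<lambda>_. 0)]"
| "cps \<psi> js j (Suc n) = concat (map (\<lambda>l. map (\<lambda>p. (\<lambda>x. \<psi> l x * fst p x,
      \<lambda>x. \<psi> l x * snd p x + (if l = j then fst p x else 0))) (cps \<psi> js j n)) js)"

lemma sum_cps_Suc:
  "(\<Sum>p\<leftarrow>cps \<psi> js j (Suc n). F p) =
   (\<Sum>l\<leftarrow>js. \<Sum>p\<leftarrow>cps \<psi> js j n. F (\<lambda>x. \<psi> l x * fst p x, \<lambda>x. \<psi> l x * snd p x + (if l = j then fst p x else 0)))"
proof -
  have "(\<Sum>p\<leftarrow>concat (map (\<lambda>l. map (g l) ps) ls). F p) = (\<Sum>l\<leftarrow>ls. \<Sum>p\<leftarrow>ps. F (g l p))"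
    for g :: "'j \<Rightarrow> ('k \<Rightarrow> complex) \<times> ('k \<Rightarrow> complex) \<Rightarrow> ('k \<Rightarrow> complex) \<times> ('k \<Rightarrow> complex)" and ps ls
    by (induction ls) (simp_all add: o_def)
  then show ?thesis by simp
qed

lemma cps_fst:
  assumes "\<alpha> \<in> \<Gamma>" "distinct js" "set js = J \<alpha>"
  shows "map fst (cps (\<phi> \<alpha>) js j n) \<in> sph"
proof (induction n)
  case (Suc n)
  have "map fst (cps (\<phi> \<alpha>) js j (Suc n)) = prodl (map (\<phi> \<alpha>) js) (map fst (cps (\<phi> \<alpha>) js j n))"
    by (simp add: prodl_def map_concat o_def)
  then show ?case using Suc sph.prod sph.fam[OF assms] by simp
qed (simp add: sph.one)

lemma cps_snd:
  assumes "\<alpha> \<in> \<Gamma>" "set js = J \<alpha>"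
  shows "p \<in> set (cps (\<phi> \<alpha>) js j n) \<Longrightarrow> fst p \<in> A \<and> snd p \<in> A"
proof (induction n arbitrary: p)
  case 0 then show ?case by (simp add: A_const)
next
  case (Suc n)
  then obtain l q where q: "l \<in> set js" "q \<in> set (cps (\<phi> \<alpha>) js j n)"
    "p = (\<lambda>x. \<phi> \<alpha> l x * fst q x, \<lambda>x. \<phi> \<alpha> l x * snd q x + (if l = j then fst q x else 0))"
    by auto
  have "\<phi> \<alpha> l \<in> A" using q assms phi_A by blast
  moreover have "fst q \<in> A" "snd q \<in> A" using Suc.IH q by auto
  ultimately show ?case using q(3) A_mult A_add A_const[of 0] by (cases "l = j") auto
qed

text \<open>One more independent letter: the cross terms cancel since the new increment has mean zero.\<close>

lemma variance_step:
  fixes a :: "'j \<Rightarrow> complex"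
  assumes I: "finite I" "(\<Sum>l\<in>I. (cmod (a l))\<^sup>2) = 1" and j: "j \<in> I"
  shows "(\<Sum>l\<in>I. (cmod (a l * D + (cnj (a j) * a l - (if l = j then 1 else 0)) * u))\<^sup>2)
         = (cmod D)\<^sup>2 + (1 - (cmod (a j))\<^sup>2) * (cmod u)\<^sup>2"
proof -
  define c where "c l = cnj (a j) * a l - (if l = j then 1 else 0)" for l
  have 1: "(\<Sum>l\<in>I. a l * cnj (a l)) = 1"
    using arg_cong[OF I(2), of complex_of_real] by (simp add: complex_norm_square[symmetric])
  have 2: "(\<Sum>l\<in>I. a l * cnj (c l)) = 0"
  proof -
    have "(\<Sum>l\<in>I. a l * cnj (c l)) = (\<Sum>l\<in>I. a j * (a l * cnj (a l)) - (if l = j then a l else 0))"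
      by (intro sum.cong) (auto simp: c_def algebra_simps)
    also have "\<dots> = a j * 1 - a j"
      using I j by (simp add: sum_subtractf sum.delta 1 flip: sum_distrib_left)
    finally show ?thesis by simp
  qed
  have 3: "(\<Sum>l\<in>I. c l * cnj (a l)) = 0"
    using arg_cong[OF 2, of cnj] by (simp add: mult.commute)
  have 4: "(\<Sum>l\<in>I. c l * cnj (c l)) = 1 - a j * cnj (a j)"
  proof -
    have "(\<Sum>l\<in>I. c l * cnj (c l)) = (\<Sum>l\<in>I. a j * (c l * cnj (a l)) - (if l = j then c l else 0))"
      by (intro sum.cong) (auto simp: c_def algebra_simps)
    also have "\<dots> = a j * 0 - c j"
      using I j by (simp add: sum_subtractf sum.delta 3 flip: sum_distrib_left)
    finally show ?thesis by (simp add: c_def mult.commute)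
  qed
  have "complex_of_real (\<Sum>l\<in>I. (cmod (a l * D + c l * u))\<^sup>2)
      = (\<Sum>l\<in>I. (D * cnj D) * (a l * cnj (a l)) + (D * cnj u) * (a l * cnj (c l))
          + (u * cnj D) * (c l * cnj (a l)) + (u * cnj u) * (c l * cnj (c l)))"
    unfolding of_real_sum
    by (intro sum.cong refl) (simp only: complex_norm_square, simp add: algebra_simps)
  also have "\<dots> = D * cnj D + (u * cnj u) * (1 - a j * cnj (a j))"
    by (simp add: sum.distrib 1 2 3 4 flip: sum_distrib_left)
  also have "\<dots> = complex_of_real ((cmod D)\<^sup>2 + (1 - (cmod (a j))\<^sup>2) * (cmod u)\<^sup>2)"
    by (simp only: of_real_add of_real_mult of_real_diff of_real_1 complex_norm_square) (simp add: mult.commute)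
  finally have "(\<Sum>l\<in>I. (cmod (a l * D + c l * u))\<^sup>2)
      = (cmod D)\<^sup>2 + (1 - (cmod (a j))\<^sup>2) * (cmod u)\<^sup>2"
    by (simp only: of_real_eq_iff)
  then show ?thesis by (simp add: c_def)
qed

text \<open>Deviations from the mean \<open>n cnj \<psi>\<^sub>j\<close> grow only like \<open>\<surd>n\<close>.\<close>

lemma cps_variance:
  assumes \<alpha>: "\<alpha> \<in> \<Gamma>" and js: "distinct js" "set js = J \<alpha>" and j: "j \<in> J \<alpha>"
  shows "(\<Sum>p\<leftarrow>cps (\<phi> \<alpha>) js j n. (cmod (of_nat n * cnj (\<phi> \<alpha> j x) * fst p x - snd p x))\<^sup>2) \<le> real n"
proof (induction n)
  case (Suc n)
  define a where "a l = \<phi> \<alpha> l x" for l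
  define ps where "ps = cps (\<phi> \<alpha>) js j n"
  define D where "D p = of_nat n * cnj (a j) * fst p x - snd p x" for p :: "('k \<Rightarrow> complex) \<times> ('k \<Rightarrow> complex)"
  have s1: "(\<Sum>p\<leftarrow>ps. (cmod (fst p x))\<^sup>2) = 1"
    using sph_sum[OF cps_fst[OF \<alpha> js, of j n], of x] by (simp add: ps_def o_def)
  have aj: "(cmod (a j))\<^sup>2 \<ge> 0" by simp
  have "(\<Sum>p\<leftarrow>cps (\<phi> \<alpha>) js j (Suc n). (cmod (of_nat (Suc n) * cnj (\<phi> \<alpha> j x) * fst p x - snd p x))\<^sup>2)
     = (\<Sum>l\<leftarrow>js. \<Sum>p\<leftarrow>ps. (cmod (a l * D p + (cnj (a j) * a l - (if l = j then 1 else 0)) * fst p x))\<^sup>2)"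
    unfolding sum_cps_Suc ps_def[symmetric]
    by (intro arg_cong[of _ _ sum_list] map_cong refl arg_cong[of _ _ "\<lambda>z. (cmod z)\<^sup>2"])
      (auto simp: D_def a_def algebra_simps)
  also have "\<dots> = (\<Sum>p\<leftarrow>ps. \<Sum>l\<leftarrow>js. (cmod (a l * D p + (cnj (a j) * a l - (if l = j then 1 else 0)) * fst p x))\<^sup>2)"
    by (rule sum_list_swap')
  also have "\<dots> = (\<Sum>p\<leftarrow>ps. (cmod (D p))\<^sup>2 + (1 - (cmod (a j))\<^sup>2) * (cmod (fst p x))\<^sup>2)"
    using variance_step[OF finite_J[OF \<alpha>], of a j] phi_sum[OF \<alpha>, of x] j js
    by (simp add: sum_list_distinct_conv_sum_set a_def)
  also have "\<dots> = (\<Sum>p\<leftarrow>ps. (cmod (D p))\<^sup>2) + (1 - (cmod (a j))\<^sup>2)"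
    by (simp add: sum_list_addf sum_list_const_mult s1)
  also have "(\<Sum>p\<leftarrow>ps. (cmod (D p))\<^sup>2) \<le> real n" using Suc by (simp only: D_def ps_def a_def)
  also have "real n + (1 - (cmod (a j))\<^sup>2) \<le> real (Suc n)" using aj by simp
  finally show ?case by simp
qed simp

end


section \<open>Density of the continuous functions\<close>

context spherical_setting begin

sublocale prob_space m using regular by (simp add: regular_borel_prob_def)

lemma normal_K: "normal_space (euclidean :: 'k topology)"
proof (rule compact_Hausdorff_or_regular_imp_normal_space)
  have "\<exists>U V. open U \<and> open V \<and> x \<in> U \<and> y \<in> V \<and> disjnt U V" if "x \<noteq> y" for x y :: 'k
    using hausdorff[OF that] by (auto simp: disjnt_def)
  then show "Hausdorff_space (euclidean :: 'k topology) \<or> regular_space (euclidean :: 'k topology)"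
    by (auto simp: Hausdorff_space_def)
qed (simp add: K compact_space_def)

lemma urysohn_indicator:
  assumes "compact C" "open U" "C \<subseteq> U"
  obtains h :: "'k \<Rightarrow> real" where "cts h" "\<And>x. x \<in> C \<Longrightarrow> h x = 1" "\<And>x. x \<notin> U \<Longrightarrow> h x = 0"
    "\<And>x. 0 \<le> h x" "\<And>x. h x \<le> 1"
proof -
  have "closedin euclidean (- U)" "closedin euclidean C" "disjnt (- U) C"
    using assms by (auto simp: disjnt_def compact_imp_closed closed_closedin[symmetric])
  then obtain h :: "'k \<Rightarrow> real" where h: "continuous_map euclidean (top_of_set {0..1}) h" "h ` (- U) \<subseteq> {0}" "h ` C \<subseteq> {1}"
    using Urysohn_lemma[OF normal_K, of "-U" C 0 1] by auto
  have "cts h" using h(1) by (simp add: continuous_map_in_subtopology)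
  moreover have "h x \<in> {0..1}" for x using h(1) by (auto simp: continuous_map_in_subtopology)
  ultimately show thesis using h(2,3) by (intro that[of h]) auto
qed

definition cdense :: "('k \<Rightarrow> complex) set" where
  "cdense = {f \<in> sq m. \<forall>e>0. \<exists>g. cts g \<and> n2 m (f -: g) \<le> e}"

lemma cont_sq: "cts g \<Longrightarrow> g \<in> sq m"
  for g :: "'k \<Rightarrow> complex"
  by (rule bm_imp_sq[OF cont_bm])

lemma csub_cdense: "csub cdense"
proof -
  have "lsub {g. cts g}"
    by (auto simp: lsub_def cont_sq intro: continuous_on_add continuous_on_mult continuous_on_const)
  moreover have "cdense = l2_closure {g. cts g}" by (simp add: cdense_def l2_closure_def)
  ultimately show ?thesis by (simp add: csub_closure)
qed

lemma indicator_cdense: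
  assumes E: "E \<in> sets borel"
  shows "(indicator E :: 'k \<Rightarrow> complex) \<in> cdense"
  unfolding cdense_def
proof (intro CollectI conjI allI impI)
  have "indicator E \<in> bm m" using E by (auto simp: bm_def indicator_def intro!: exI[of _ 1] borel_measurable_indicator[of E m, unfolded indicator_def])
  then show "(indicator E :: 'k \<Rightarrow> complex) \<in> sq m" by (rule bm_imp_sq)
  fix e :: real assume e: "e > 0"
  have reg: "emeasure m E = (SUP C\<in>{C. C \<subseteq> E \<and> compact C}. emeasure m C)"
    "emeasure m E = (INF U\<in>{U. E \<subseteq> U \<and> open U}. emeasure m U)"
    using regular E unfolding regular_borel_prob_def by blast+
  have ne: "{C. C \<subseteq> E \<and> compact C} \<noteq> {}" using compact_empty by blast
  obtain C where C: "C \<subseteq> E" "compact C" "emeasure m E < emeasure m C + ennreal (e/2)"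
    using SUP_approx_ennreal[OF _ ne reg(1), of "e/2"] e by auto
  obtain U where U: "E \<subseteq> U" "open U" "emeasure m U < emeasure m E + ennreal (e/2)"
    using INF_approx_ennreal[OF _ reg(2), of "e/2"] e by auto
  have [measurable]: "C \<in> sets m" "U \<in> sets m" using C U by (auto simp: borel_compact)
  have mC: "measure m E < measure m C + e/2"
    using C e by (simp add: emeasure_eq_measure ennreal_plus[symmetric] ennreal_less_iff del: ennreal_plus)
  have mU: "measure m U < measure m E + e/2"
    using U e by (simp add: emeasure_eq_measure ennreal_plus[symmetric] ennreal_less_iff del: ennreal_plus)
  have CU: "C \<subseteq> U" using C U by blast
  obtain h :: "'k \<Rightarrow> real" where h: "cts h" "\<And>x. x \<in> C \<Longrightarrow> h x = 1" "\<And>x. x \<notin> U \<Longrightarrow> h x = 0"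
    "\<And>x. 0 \<le> h x" "\<And>x. h x \<le> 1"
    using urysohn_indicator[OF C(2) U(2) CU] by blast
  define g where "g = (\<lambda>x. complex_of_real (h x))"
  have g: "cts g" unfolding g_def by (intro continuous_intros h)
  have pt: "(cmod (indicator E x - g x))\<^sup>2 \<le> indicator (U - C) x" for x
  proof -
    have "indicator E x - g x = complex_of_real (indicator E x - h x)" by (simp add: g_def indicator_def)
    then have *: "cmod (indicator E x - g x) = \<bar>indicator E x - h x\<bar>" by (simp only: norm_of_real)
    have "\<bar>indicator E x - h x\<bar> \<le> 1" using h(4)[of x] h(5)[of x] by (auto simp: indicator_def)
    then have "(cmod (indicator E x - g x))\<^sup>2 \<le> 1" unfolding * by (rule power_le_one[OF abs_ge_zero])
    then show ?thesis using h(2,3)[of x] C U unfolding * by (cases "x \<in> C"; cases "x \<in> U") (auto simp: indicator_def)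
  qed
  have "n2 m (\<lambda>x. indicator E x - g x) \<le> (LINT x|m. indicator (U - C) x)"
    unfolding n2_def
    by (intro integral_mono pt sq_integrable sq_diff cont_sq[OF g] \<open>indicator E \<in> sq m\<close>
        integrable_real_indicator) (use C U in \<open>auto simp: emeasure_eq_measure borel_compact\<close>)
  also have "\<dots> = measure m U - measure m C" using CU finite_measure_Diff[OF \<open>U \<in> sets m\<close> \<open>C \<in> sets m\<close>] by simp
  also have "\<dots> \<le> e" using mU mC by simp
  finally show "\<exists>g. cts g \<and> n2 m (\<lambda>x. indicator E x - g x) \<le> e" using g by blast
qed

text \<open>By regularity and Urysohn, indicators of Borel sets are limits of continuous functions. So a function orthogonal
to the continuous ones has integral zero over every Borel set.\<close>

theorem cont_dense:
  assumes f: "f \<in> sq m" and e: "e > 0"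
  obtains g where "cts g" "n2 m (f -: g) \<le> e"
proof -
  obtain h where h: "h \<in> cdense" "\<And>k. k \<in> cdense \<Longrightarrow> ip m (f -: h) k = 0"
    using projection_exists[OF csub_cdense f] by blast
  have hs: "h \<in> sq m" using h by (simp add: cdense_def)
  define d where "d = (f -: h)"
  have d: "d \<in> sq m" unfolding d_def by (intro sq_diff f hs)
  have "AE x in m. d x = 0"
  proof (rule density_zero)
    show "integrable m d" by (rule sq_cint[OF d])
    fix E assume "E \<in> sets m"
    then have "ip m d (indicator E) = 0" unfolding d_def by (intro h indicator_cdense) simp
    then show "set_lebesgue_integral m E d = 0"
      unfolding ip_def set_lebesgue_integral_def
      by (subst (asm) Bochner_Integration.integral_cong[where g="\<lambda>x. indicator E x *\<^sub>R d x" and N=m])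
        (auto simp: indicator_def)
  qed
  then have "f \<in> cdense"
    using csub_cdense f h(1) n2_eq_0_iff[OF d] unfolding csub_def d_def by (metis less_imp_le)
  then show thesis using e that unfolding cdense_def by blast
qed

end


section \<open>Bounded operators and the Hardy projection\<close>

lemma (in prob_space) mult_le_AE:
  assumes psi: "\<psi> \<in> sq M" and eta: "\<eta> \<in> sq M"
    and le: "\<And>f. f \<in> bm M \<Longrightarrow> n2 M (\<psi> \<cdot> f) \<le> C * n2 M (\<eta> \<cdot> f)"
  shows "AE x in M. (cmod (\<psi> x))\<^sup>2 \<le> C * (cmod (\<eta> x))\<^sup>2"
proof -
  have "AE x in M. 0 \<le> C * (cmod (\<eta> x))\<^sup>2 - (cmod (\<psi> x))\<^sup>2"
  proof (rule density_nonneg)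
    show "integrable M (\<lambda>x. C * (cmod (\<eta> x))\<^sup>2 - (cmod (\<psi> x))\<^sup>2)" using psi eta by (simp add: sq_def)
    fix E assume E: "E \<in> sets M"
    have ib: "(indicator E :: 'a \<Rightarrow> complex) \<in> bm M"
      using E by (auto simp: bm_def indicator_def intro!: exI[of _ 1] borel_measurable_indicator[of E M, unfolded indicator_def])
    have "set_lebesgue_integral M E (\<lambda>x. C * (cmod (\<eta> x))\<^sup>2 - (cmod (\<psi> x))\<^sup>2)
      = (LINT x|M. C * (cmod (\<eta> x * indicator E x))\<^sup>2 - (cmod (\<psi> x * indicator E x))\<^sup>2)"
      unfolding set_lebesgue_integral_def
      by (intro Bochner_Integration.integral_cong refl) (auto simp: indicator_def)
    also have "\<dots> = C * n2 M (\<lambda>x. \<eta> x * indicator E x) - n2 M (\<lambda>x. \<psi> x * indicator E x)"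
      unfolding n2_def using sq_integrable[OF sq_mult_right[OF ib eta]] sq_integrable[OF sq_mult_right[OF ib psi]]
      by (subst Bochner_Integration.integral_diff) auto
    also have "\<dots> \<ge> 0" using le[OF ib] by simp
    finally show "set_lebesgue_integral M E (\<lambda>x. C * (cmod (\<eta> x))\<^sup>2 - (cmod (\<psi> x))\<^sup>2) \<ge> 0" .
  qed
  then show ?thesis by simp
qed

lemma (in prob_space) sq_one: "(\<lambda>_. 1) \<in> sq M"
  by (simp add: sq_def)

lemma (in prob_space) mult_upper_AE:
  assumes "\<psi> \<in> sq M" "\<And>f. f \<in> bm M \<Longrightarrow> n2 M (\<psi> \<cdot> f) \<le> C * n2 M f"
  shows "AE x in M. (cmod (\<psi> x))\<^sup>2 \<le> C"
  using mult_le_AE[OF assms(1) sq_one, of C] assms(2) by simp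

text \<open>Bounded operators on representatives: \<open>C\<close> bounds the square of the norm, and linearity holds up to null
sets.\<close>

definition bop :: "'a measure \<Rightarrow> (('a \<Rightarrow> complex) \<Rightarrow> ('a \<Rightarrow> complex)) \<Rightarrow> real \<Rightarrow> bool" where
  "bop M L C \<longleftrightarrow> 0 \<le> C \<and> (\<forall>f\<in>sq M. L f \<in> sq M) \<and>
     (\<forall>f\<in>sq M. \<forall>g\<in>sq M. AE x in M. L (f +: g) x = L f x + L g x) \<and>
     (\<forall>c. \<forall>f\<in>sq M. AE x in M. L (\<lambda>x. c * f x) x = c * L f x) \<and>
     (\<forall>f\<in>sq M. n2 M (L f) \<le> C * n2 M f)"

lemma bop_sq: "bop M L C \<Longrightarrow> f \<in> sq M \<Longrightarrow> L f \<in> sq M" by (simp add: bop_def)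
lemma bop_n2: "bop M L C \<Longrightarrow> f \<in> sq M \<Longrightarrow> n2 M (L f) \<le> C * n2 M f" by (simp add: bop_def)
lemma bop_nonneg: "bop M L C \<Longrightarrow> 0 \<le> C" by (simp add: bop_def)
lemma bop_add: "bop M L C \<Longrightarrow> f \<in> sq M \<Longrightarrow> g \<in> sq M \<Longrightarrow> AE x in M. L (f +: g) x = L f x + L g x"
  by (simp add: bop_def)
lemma bop_scale: "bop M L C \<Longrightarrow> f \<in> sq M \<Longrightarrow> AE x in M. L (\<lambda>x. c * f x) x = c * L f x"
  by (simp add: bop_def)

lemma bop_diff:
  assumes L: "bop M L C" and f: "f \<in> sq M" and g: "g \<in> sq M"
  shows "AE x in M. L (f -: g) x = L f x - L g x"
  using bop_add[OF L sq_diff[OF f g] g] by eventually_elim simp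

lemma bop_diff_n2:
  assumes L: "bop M L C" and f: "f \<in> sq M" and g: "g \<in> sq M"
  shows "n2 M (\<lambda>x. L f x - L g x) \<le> C * n2 M (f -: g)"
proof -
  have "n2 M (\<lambda>x. L f x - L g x) = n2 M (L (f -: g))"
    using bop_diff[OF L f g] by (intro n2_cong_AE sq_measurable sq_diff bop_sq[OF L] f g) (auto elim: AE_mp)
  then show ?thesis using bop_n2[OF L sq_diff[OF f g]] by simp
qed

lemma bop_cong:
  assumes L: "bop M L C" and "f \<in> sq M" "g \<in> sq M" "AE x in M. f x = g x"
  shows "AE x in M. L f x = L g x"
proof (rule n2_diff_eq_0_imp_AE)
  have "n2 M (f -: g) = 0" using assms by (subst n2_eq_0_iff) (auto intro: sq_diff)
  then show "n2 M (\<lambda>x. L f x - L g x) = 0" using bop_diff_n2[OF L assms(2,3)] n2_nonneg[of M "\<lambda>x. L f x - L g x"] by simp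
qed (use assms bop_sq[OF L] in auto)

lemma bop_ip_add:
  assumes L: "bop M L C" and f: "f \<in> sq M" and g: "g \<in> sq M" and k: "k \<in> sq M"
  shows "ip M (L (f +: g)) k = ip M (L f) k + ip M (L g) k"
proof -
  have "ip M (L (f +: g)) k = ip M (\<lambda>x. L f x + L g x) k"
    using bop_sq[OF L sq_add[OF f g]] sq_add[OF bop_sq[OF L f] bop_sq[OF L g]] k bop_add[OF L f g]
    by (intro ip_cong_AE) (auto dest: sq_measurable)
  then show ?thesis using ip_add_left[OF bop_sq[OF L f] bop_sq[OF L g] k] by simp
qed

lemma bop_ip_scale:
  assumes L: "bop M L C" and f: "f \<in> sq M" and k: "k \<in> sq M"
  shows "ip M (L (\<lambda>x. c * f x)) k = c * ip M (L f) k"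
proof -
  have "ip M (L (\<lambda>x. c * f x)) k = ip M (\<lambda>x. c * L f x) k"
    using bop_sq[OF L sq_scale[OF f]] sq_scale[OF bop_sq[OF L f]] k bop_scale[OF L f]
    by (intro ip_cong_AE) (auto dest: sq_measurable)
  then show ?thesis by (simp add: ip_scale_left)
qed

context spherical_setting begin

definition Hf :: "('k \<Rightarrow> complex) set" where
  "Hf = {f \<in> sq m. \<forall>e>0. \<exists>a\<in>A. n2 m (f -: a) \<le> e}"

lemma Hf_sq: "f \<in> Hf \<Longrightarrow> f \<in> sq m" by (simp add: Hf_def)

lemma A_sq: "a \<in> A \<Longrightarrow> a \<in> sq m" by (rule cont_sq[OF A_cont])

lemma A_bm: "a \<in> A \<Longrightarrow> a \<in> bm m" by (rule cont_bm[OF A_cont])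

lemma A_Hf: "a \<in> A \<Longrightarrow> a \<in> Hf" by (auto simp: Hf_def A_sq intro!: bexI[of _ a])

lemma Hf_approx: assumes "f \<in> Hf" "e > 0" obtains a where "a \<in> A" "n2 m (f -: a) \<le> e"
  using assms unfolding Hf_def by blast

lemma Hf_mult_n2:
  assumes "h \<in> bm m" "f \<in> sq m" obtains c where "c > 0" "\<And>g. g \<in> sq m \<Longrightarrow> n2 m (h \<cdot> g) \<le> c * n2 m g"
proof -
  obtain c where c: "AE x in m. cmod (h x) \<le> c" using assms by (auto simp: bm_def)
  have "n2 m (h \<cdot> g) \<le> (c\<^sup>2 + 1) * n2 m g" if "g \<in> sq m" for g
  proof -
    have "n2 m (h \<cdot> g) \<le> c\<^sup>2 * n2 m g" by (intro n2_mult_le c that bm_measurable assms)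
    also have "\<dots> \<le> (c\<^sup>2 + 1) * n2 m g" by (intro mult_right_mono) auto
    finally show ?thesis .
  qed
  moreover have "c\<^sup>2 + 1 > 0" by (intro add_nonneg_pos) auto
  ultimately show thesis using that by blast
qed

lemma csub_Hf: "csub Hf"
  unfolding Hf_def l2_closure_def[symmetric]
  by (rule csub_closure) (auto simp: lsub_def A_sq A_const A_add A_scale)

lemma Hf_add: "f \<in> Hf \<Longrightarrow> g \<in> Hf \<Longrightarrow> (f +: g) \<in> Hf"
  and Hf_scale: "f \<in> Hf \<Longrightarrow> (\<lambda>x. c * f x) \<in> Hf"
  using csub_Hf by (simp_all add: csub_def lsub_def)

lemma Hf_zero: "(\<lambda>x. 0) \<in> Hf" by (rule A_Hf[OF A_const])

lemma Hf_diff: "f \<in> Hf \<Longrightarrow> g \<in> Hf \<Longrightarrow> (f -: g) \<in> Hf"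
  by (rule lsub_diff) (use csub_Hf in \<open>simp add: csub_def\<close>)

lemma Hf_closed: "f \<in> sq m \<Longrightarrow> (\<And>e. e > 0 \<Longrightarrow> \<exists>h\<in>Hf. n2 m (f -: h) \<le> e) \<Longrightarrow> f \<in> Hf"
  using csub_Hf unfolding csub_def by blast

lemma Hf_cong_AE: 
  assumes "f \<in> Hf" "g \<in> borel_measurable m" "AE x in m. g x = f x"
  shows "g \<in> Hf"
proof (rule Hf_closed)
  show g: "g \<in> sq m" using sq_cong_AE[OF Hf_sq[OF assms(1)] assms(2,3)] .
  have "n2 m (g -: f) = 0"
    by (subst n2_eq_0_iff[OF sq_diff[OF g Hf_sq[OF assms(1)]]]) (use assms(3) in auto)
  then show "\<exists>h\<in>Hf. n2 m (g -: h) \<le> e" if "e > 0" for e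
    using assms(1) that by (intro bexI[of _ f]) auto
qed

text \<open>By density of \<open>A\<close> in the Hardy space it suffices to multiply members of \<open>A\<close>.\<close>

lemma mult_Hf_if_A:
  assumes h: "h \<in> bm m" and A: "\<And>a. a \<in> A \<Longrightarrow> (h \<cdot> a) \<in> Hf" and f: "f \<in> Hf"
  shows "(h \<cdot> f) \<in> Hf"
proof (rule Hf_closed)
  show "(h \<cdot> f) \<in> sq m" by (intro sq_mult h Hf_sq f)
  fix e :: real assume e: "e > 0"
  obtain c where c: "c > 0" "\<And>g. g \<in> sq m \<Longrightarrow> n2 m (h \<cdot> g) \<le> c * n2 m g"
    using Hf_mult_n2[OF h Hf_sq[OF f]] by blast
  obtain a where a: "a \<in> A" "n2 m (f -: a) \<le> e / c" by (rule Hf_approx[OF f, of "e/c"]) (use e c in auto)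
  have "n2 m (\<lambda>x. h x * (f x - a x)) \<le> c * n2 m (f -: a)" by (intro c(2) sq_diff Hf_sq f A_sq a)
  also have "\<dots> \<le> c * (e / c)" using a c by (intro mult_left_mono) auto
  finally have "n2 m (\<lambda>x. h x * f x - h x * a x) \<le> e" using c by (simp add: algebra_simps)
  then show "\<exists>k\<in>Hf. n2 m (\<lambda>x. h x * f x - k x) \<le> e" using A[OF a(1)] by (intro bexI[of _ "\<lambda>x. h x * a x"]) auto
qed

lemma A_mult_Hf: "a \<in> A \<Longrightarrow> f \<in> Hf \<Longrightarrow> (a \<cdot> f) \<in> Hf"
  by (rule mult_Hf_if_A) (auto intro: A_bm A_Hf A_mult)

definition P :: "('k \<Rightarrow> complex) \<Rightarrow> ('k \<Rightarrow> complex)" where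
  "P f = (SOME h. h \<in> Hf \<and> (\<forall>k\<in>Hf. ip m (f -: h) k = 0))"

lemma P_props: "f \<in> sq m \<Longrightarrow> P f \<in> Hf \<and> (\<forall>k\<in>Hf. ip m (\<lambda>x. f x - P f x) k = 0)"
  unfolding P_def
  by (rule someI_ex[where P="\<lambda>h. h \<in> Hf \<and> (\<forall>k\<in>Hf. ip m (f -: h) k = 0)"])
    (use projection_exists[OF csub_Hf] in blast)

lemma P_Hf: "f \<in> sq m \<Longrightarrow> P f \<in> Hf" using P_props by blast

lemma P_sq: "f \<in> sq m \<Longrightarrow> P f \<in> sq m" by (rule Hf_sq[OF P_Hf])

lemma P_orth: "f \<in> sq m \<Longrightarrow> k \<in> Hf \<Longrightarrow> ip m (\<lambda>x. f x - P f x) k = 0" using P_props by blast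

lemma P_ip: "f \<in> sq m \<Longrightarrow> k \<in> Hf \<Longrightarrow> ip m (P f) k = ip m f k"
  using P_orth[of f k] ip_diff_left[of f m "P f" k] by (simp add: P_sq Hf_sq)

lemma P_ip_right: "f \<in> sq m \<Longrightarrow> k \<in> Hf \<Longrightarrow> ip m k (P f) = ip m k f"
  using P_ip[of f k] ip_cnj by metis

lemma P_pythagoras:
  assumes "f \<in> sq m" "k \<in> Hf"
  shows "n2 m (f -: k) = n2 m (\<lambda>x. f x - P f x) + n2 m (\<lambda>x. P f x - k x)"
proof -
  have "n2 m (\<lambda>x. (f x - P f x) + (P f x - k x)) = n2 m (\<lambda>x. f x - P f x) + n2 m (\<lambda>x. P f x - k x)"
    using assms P_orth[OF assms(1) Hf_diff[OF P_Hf[OF assms(1)] assms(2)]]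
    by (subst n2_add) (auto intro: sq_diff P_sq Hf_sq)
  then show ?thesis by simp
qed

lemma P_best: "f \<in> sq m \<Longrightarrow> k \<in> Hf \<Longrightarrow> n2 m (\<lambda>x. f x - P f x) \<le> n2 m (f -: k)"
  using P_pythagoras by simp

lemma P_unique:
  assumes "f \<in> sq m" "h \<in> Hf" "\<And>k. k \<in> Hf \<Longrightarrow> ip m h k = ip m f k"
  shows "AE x in m. P f x = h x"
proof (rule n2_diff_eq_0_imp_AE)
  have d: "(\<lambda>x. P f x - h x) \<in> Hf" by (intro Hf_diff P_Hf assms)
  have "ip m (\<lambda>x. P f x - h x) (\<lambda>x. P f x - h x) = 0"
    using assms d P_ip[OF assms(1) d] by (simp add: ip_diff_left P_sq Hf_sq)
  then show "n2 m (\<lambda>x. P f x - h x) = 0" by (simp add: ip_self)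
qed (use assms in \<open>auto intro: P_sq Hf_sq\<close>)

lemma P_id: "h \<in> Hf \<Longrightarrow> AE x in m. P h x = h x"
  by (rule P_unique) (auto intro: Hf_sq)

lemma bop_P: "bop m P 1"
  unfolding bop_def
proof (intro conjI ballI allI)
  fix f g assume fg: "f \<in> sq m" "g \<in> sq m"
  show "AE x in m. P (f +: g) x = P f x + P g x"
    by (rule P_unique[OF sq_add[OF fg] Hf_add[OF P_Hf[OF fg(1)] P_Hf[OF fg(2)]]])
      (simp add: fg P_ip ip_add_left P_sq Hf_sq)
next
  fix f c assume f: "f \<in> sq m"
  show "AE x in m. P (\<lambda>x. c * f x) x = c * P f x"
    by (rule P_unique[OF sq_scale[OF f] Hf_scale[OF P_Hf[OF f]]])
      (simp add: f P_ip ip_scale_left)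
next
  fix f assume f: "f \<in> sq m"
  show "P f \<in> sq m" using f by (rule P_sq)
  show "n2 m (P f) \<le> 1 * n2 m f" using P_pythagoras[OF f Hf_zero] by simp
qed simp

lemma bop_mult:
  assumes "\<psi> \<in> bm m" obtains C where "bop m (\<lambda>f x. \<psi> x * f x) C"
proof -
  obtain c where c: "c > 0" "\<And>g. g \<in> sq m \<Longrightarrow> n2 m (\<psi> \<cdot> g) \<le> c * n2 m g"
    using Hf_mult_n2[OF assms sq_zero] by blast
  then have "bop m (\<lambda>f x. \<psi> x * f x) c"
    unfolding bop_def using sq_mult[OF assms] by (auto simp: distrib_left)
  then show thesis by (rule that)
qed

lemma bop_comp:
  assumes L: "bop m L C" and L': "bop m L' C'"
  shows "bop m (\<lambda>f. L (L' f)) (C * C')"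
  unfolding bop_def
proof (intro conjI ballI allI)
  fix f g assume fg: "f \<in> sq m" "g \<in> sq m"
  have "AE x in m. L (L' (f +: g)) x = L (\<lambda>x. L' f x + L' g x) x"
    by (intro bop_cong[OF L] bop_sq[OF L'] sq_add fg bop_add[OF L'])
  moreover have "AE x in m. L (\<lambda>x. L' f x + L' g x) x = L (L' f) x + L (L' g) x"
    by (intro bop_add[OF L] bop_sq[OF L'] fg)
  ultimately show "AE x in m. L (L' (f +: g)) x = L (L' f) x + L (L' g) x" by eventually_elim simp
next
  fix c f assume f: "f \<in> sq m"
  have "AE x in m. L (L' (\<lambda>x. c * f x)) x = L (\<lambda>x. c * L' f x) x"
    by (intro bop_cong[OF L] bop_sq[OF L'] sq_scale f bop_scale[OF L'])
  moreover have "AE x in m. L (\<lambda>x. c * L' f x) x = c * L (L' f) x"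
    by (intro bop_scale[OF L] bop_sq[OF L'] f)
  ultimately show "AE x in m. L (L' (\<lambda>x. c * f x)) x = c * L (L' f) x" by eventually_elim simp
next
  fix f assume f: "f \<in> sq m"
  show "L (L' f) \<in> sq m" by (intro bop_sq[OF L] bop_sq[OF L'] f)
  have "n2 m (L (L' f)) \<le> C * n2 m (L' f)" by (intro bop_n2[OF L] bop_sq[OF L'] f)
  also have "\<dots> \<le> C * (C' * n2 m f)" by (intro mult_left_mono bop_n2[OF L'] f bop_nonneg[OF L])
  finally show "n2 m (L (L' f)) \<le> C * C' * n2 m f" by simp
qed (use bop_nonneg[OF L] bop_nonneg[OF L'] in auto)

lemma sph_bm: "us \<in> sph \<Longrightarrow> u \<in> set us \<Longrightarrow> u \<in> bm m"
  by (intro A_bm sph_A)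

lemma sph_mult_sq: "us \<in> sph \<Longrightarrow> u \<in> set us \<Longrightarrow> f \<in> sq m \<Longrightarrow> (u \<cdot> f) \<in> sq m"
  by (intro sq_mult sph_bm)

lemma sum_n2:
  assumes "\<And>p. p \<in> set ps \<Longrightarrow> F p \<in> sq m"
  shows "(\<Sum>p\<leftarrow>ps. n2 m (F p)) = (LINT x|m. (\<Sum>p\<leftarrow>ps. (cmod (F p x))\<^sup>2))
    \<and> integrable m (\<lambda>x. \<Sum>p\<leftarrow>ps. (cmod (F p x))\<^sup>2)"
  using assms by (induction ps) (simp_all add: n2_def sq_integrable)

lemma sph_n2:
  assumes us: "us \<in> sph" and f: "f \<in> sq m"
  shows "(\<Sum>u\<leftarrow>us. n2 m (u \<cdot> f)) = n2 m f"
proof -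
  have "(\<Sum>u\<leftarrow>us. n2 m (u \<cdot> f)) = (LINT x|m. (\<Sum>u\<leftarrow>us. (cmod (u x * f x))\<^sup>2))"
    using sum_n2[of us "\<lambda>u x. u x * f x"] sph_mult_sq[OF us _ f] by blast
  also have "\<dots> = n2 m f"
    unfolding n2_def by (simp add: norm_mult power_mult_distrib sum_list_mult_const sph_sum[OF us])
  finally show ?thesis .
qed

section \<open>The net of spherical families\<close>

lemma mset_eq_sum: "mset us = (\<Sum>w\<leftarrow>us. {#w#})"
  by (induction us) auto

text \<open>\<open>zs\<close> refines \<open>us\<close> if it is a product of a spherical family with \<open>us\<close>. Multisets make this a directed
relation, since products of families commute only up to the order of the list.\<close>

definition refining :: "('k \<Rightarrow> complex) list filter" where
  "refining = (INF us\<in>sph. principal {zs. \<exists>ws\<in>sph. mset zs = mset (prodl ws us)})"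

lemma eventually_refining:
  assumes Q: "\<And>us vs. mset us = mset vs \<Longrightarrow> Q us = Q vs"
  shows "eventually Q refining \<longleftrightarrow> (\<exists>us\<in>sph. \<forall>ws\<in>sph. Q (prodl ws us))"
proof -
  have "eventually Q refining \<longleftrightarrow> (\<exists>us\<in>sph. eventually Q (principal {zs. \<exists>ws\<in>sph. mset zs = mset (prodl ws us)}))"
    unfolding refining_def
  proof (rule eventually_INF_base)
    show "sph \<noteq> {}" using sph.one by blast
    fix us vs assume us: "us \<in> sph" and vs: "vs \<in> sph"
    have 1: "mset (prodl ws (prodl us vs)) = mset (prodl (prodl ws vs) us)" for ws
      by (simp only: mset_eq_sum sum_prodl3)
    have 2: "mset (prodl ws (prodl us vs)) = mset (prodl (prodl ws us) vs)" for ws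
      by (simp only: mset_eq_sum sum_prodl_assoc)
    have "{zs. \<exists>ws\<in>sph. mset zs = mset (prodl ws (prodl us vs))}
      \<subseteq> {zs. \<exists>ws\<in>sph. mset zs = mset (prodl ws us)} \<inter> {zs. \<exists>ws\<in>sph. mset zs = mset (prodl ws vs)}"
    proof (intro subsetI IntI CollectI)
      fix zs assume "zs \<in> {zs. \<exists>ws\<in>sph. mset zs = mset (prodl ws (prodl us vs))}"
      then obtain ws where ws: "ws \<in> sph" "mset zs = mset (prodl ws (prodl us vs))" by blast
      show "\<exists>ws\<in>sph. mset zs = mset (prodl ws us)"
        using ws(2) 1[of ws] by (intro bexI[OF _ sph.prod[OF ws(1) vs]]) (simp only:)
      show "\<exists>ws\<in>sph. mset zs = mset (prodl ws vs)"
        using ws(2) 2[of ws] by (intro bexI[OF _ sph.prod[OF ws(1) us]]) (simp only:)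
    qed
    then show "\<exists>xs\<in>sph. principal {zs. \<exists>ws\<in>sph. mset zs = mset (prodl ws xs)}
      \<le> inf (principal {zs. \<exists>ws\<in>sph. mset zs = mset (prodl ws us)}) (principal {zs. \<exists>ws\<in>sph. mset zs = mset (prodl ws vs)})"
      by (intro bexI[of _ "prodl us vs"] sph.prod us vs) simp
  qed
  also have "\<dots> \<longleftrightarrow> (\<exists>us\<in>sph. \<forall>ws\<in>sph. Q (prodl ws us))"
    unfolding eventually_principal
  proof (intro bex_cong refl iffI ballI)
    fix us ws assume "\<forall>zs\<in>{zs. \<exists>ws\<in>sph. mset zs = mset (prodl ws us)}. Q zs" "ws \<in> sph"
    then show "Q (prodl ws us)" by blast
  next
    fix us zs assume *: "\<forall>ws\<in>sph. Q (prodl ws us)" "zs \<in> {zs. \<exists>ws\<in>sph. mset zs = mset (prodl ws us)}"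
    then obtain ws where "ws \<in> sph" "mset zs = mset (prodl ws us)" by blast
    then show "Q zs" using Q[of zs "prodl ws us"] * by blast
  qed
  finally show ?thesis .
qed

lemma eventually_refining_sum:
  fixes F :: "('k \<Rightarrow> complex) \<Rightarrow> 'c::comm_monoid_add"
  shows "eventually (\<lambda>us. Q (\<Sum>w\<leftarrow>us. F w)) refining \<longleftrightarrow> (\<exists>us\<in>sph. \<forall>ws\<in>sph. Q (\<Sum>w\<leftarrow>prodl ws us. F w))"
proof (rule eventually_refining)
  fix us vs :: "('k \<Rightarrow> complex) list" assume "mset us = mset vs"
  then have "sum_mset (image_mset F (mset us)) = sum_mset (image_mset F (mset vs))" by simp
  then have "(\<Sum>w\<leftarrow>us. F w) = (\<Sum>w\<leftarrow>vs. F w)" by (simp only: mset_map[symmetric] sum_mset_sum_list)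
  then show "Q (\<Sum>w\<leftarrow>us. F w) = Q (\<Sum>w\<leftarrow>vs. F w)" by simp
qed

lemma eventually_refining_A: "eventually (\<lambda>us. set us \<subseteq> A) refining"
proof (subst eventually_refining)
  show "\<exists>us\<in>sph. \<forall>ws\<in>sph. set (prodl ws us) \<subseteq> A"
    using sph_A[OF sph.prod] sph.one by (intro bexI[of _ "[\<lambda>_. 1]"] ballI subsetI) blast+
  show "set us \<subseteq> A \<longleftrightarrow> set vs \<subseteq> A" if "mset us = mset vs" for us vs
    using mset_eq_setD[OF that] by simp
qed

lemma refining_neq_bot: "refining \<noteq> bot"
  using eventually_refining[of "\<lambda>_. False"] sph.one by (auto simp: trivial_limit_def)

definition vanish :: "(('k \<Rightarrow> complex) \<Rightarrow> real) \<Rightarrow> bool" where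
  "vanish F \<longleftrightarrow> (\<forall>e>0. eventually (\<lambda>us. (\<Sum>w\<leftarrow>us. F w) \<le> e) refining)"

lemma vanish_iff: "vanish F \<longleftrightarrow> (\<forall>e>0. \<exists>us\<in>sph. \<forall>ws\<in>sph. (\<Sum>w\<leftarrow>prodl ws us. F w) \<le> e)"
  unfolding vanish_def using eventually_refining_sum[of "\<lambda>s. s \<le> e" F for e] by simp

lemma vanish_add:
  assumes F: "vanish F" and G: "vanish G"
  shows "vanish (\<lambda>w. F w + G w)"
  unfolding vanish_def
proof (intro allI impI)
  fix e :: real assume "e > 0"
  then have "eventually (\<lambda>us. (\<Sum>w\<leftarrow>us. F w) \<le> e/2) refining" "eventually (\<lambda>us. (\<Sum>w\<leftarrow>us. G w) \<le> e/2) refining"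
    using F G half_gt_zero unfolding vanish_def by blast+
  then show "eventually (\<lambda>us. (\<Sum>w\<leftarrow>us. F w + G w) \<le> e) refining"
    by eventually_elim (simp add: sum_list_addf)
qed

lemma vanish_le:
  assumes G: "vanish G" and c: "c > 0" and le: "\<And>w. w \<in> A \<Longrightarrow> F w \<le> c * G w"
  shows "vanish F"
  unfolding vanish_def
proof (intro allI impI)
  fix e :: real assume "e > 0"
  then have "eventually (\<lambda>us. (\<Sum>w\<leftarrow>us. G w) \<le> e/c) refining" using G c unfolding vanish_def by simp
  then show "eventually (\<lambda>us. (\<Sum>w\<leftarrow>us. F w) \<le> e) refining" using eventually_refining_A
  proof eventually_elim
    fix us assume us: "(\<Sum>w\<leftarrow>us. G w) \<le> e/c" "set us \<subseteq> A"
    have "(\<Sum>w\<leftarrow>us. F w) \<le> (\<Sum>w\<leftarrow>us. c * G w)" using us(2) by (intro sum_list_mono le) blast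
    also have "\<dots> = c * (\<Sum>w\<leftarrow>us. G w)" by (rule sum_list_const_mult)
    finally show "(\<Sum>w\<leftarrow>us. F w) \<le> e" using us(1) c by (simp add: field_simps)
  qed
qed

lemma vanish_zero: "(\<And>w. w \<in> A \<Longrightarrow> F w \<le> 0) \<Longrightarrow> vanish F"
  by (rule vanish_le[of "\<lambda>_. 0" 1]) (auto simp: vanish_def)

section \<open>Asymptotic symbols\<close>

abbreviation defect where
  "defect L \<psi> f w \<equiv> n2 m (\<lambda>x. L (\<lambda>x. w x * f x) x - \<psi> x * (w x * f x))"

text \<open>With \<open>L f = X (P f)\<close> this says that \<open>X\<close> acts like multiplication by \<open>\<psi>\<close> after multiplication by
spherical families. The same notion is applied to operators on \<open>L\<^sup>2\<close>, in particular to \<open>P\<close>.\<close>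

definition symbol :: "(('k \<Rightarrow> complex) \<Rightarrow> ('k \<Rightarrow> complex)) \<Rightarrow> ('k \<Rightarrow> complex) \<Rightarrow> bool" where
  "symbol L \<psi> \<longleftrightarrow> (\<forall>f\<in>sq m. vanish (\<lambda>w. defect L \<psi> f w))"

lemma A_mult_sq: "w \<in> A \<Longrightarrow> f \<in> sq m \<Longrightarrow> (w \<cdot> f) \<in> sq m"
  by (intro sq_mult A_bm)

lemma sum_mult_n2_le:
  assumes G: "\<And>p. p \<in> set ps \<Longrightarrow> G p \<in> bm m" and le: "\<And>x. (\<Sum>p\<leftarrow>ps. (cmod (G p x))\<^sup>2) \<le> c" and g: "g \<in> sq m"
  shows "(\<Sum>p\<leftarrow>ps. n2 m (\<lambda>x. G p x * g x)) \<le> c * n2 m g"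
proof -
  have s: "(\<Sum>p\<leftarrow>ps. n2 m (\<lambda>x. G p x * g x)) = (LINT x|m. (\<Sum>p\<leftarrow>ps. (cmod (G p x * g x))\<^sup>2))"
    "integrable m (\<lambda>x. \<Sum>p\<leftarrow>ps. (cmod (G p x * g x))\<^sup>2)"
    using sum_n2[of ps "\<lambda>p x. G p x * g x", OF sq_mult[OF G g]] by auto
  have "(LINT x|m. (\<Sum>p\<leftarrow>ps. (cmod (G p x * g x))\<^sup>2)) \<le> (LINT x|m. c * (cmod (g x))\<^sup>2)"
  proof (intro integral_mono s(2))
    show "integrable m (\<lambda>x. c * (cmod (g x))\<^sup>2)" using sq_integrable[OF g] by simp
    show "(\<Sum>p\<leftarrow>ps. (cmod (G p x * g x))\<^sup>2) \<le> c * (cmod (g x))\<^sup>2" for x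
      using mult_right_mono[OF le[of x], of "(cmod (g x))\<^sup>2"] by (simp add: norm_mult power_mult_distrib sum_list_mult_const)
  qed
  then show ?thesis using s(1) by (simp add: n2_def)
qed

text \<open>The squared distance of \<open>w f\<close> to the Hardy space.\<close>

abbreviation off_H where
  "off_H f w \<equiv> n2 m (\<lambda>x. w x * f x - P (w \<cdot> f) x)"

definition tame :: "('k \<Rightarrow> complex) set" where
  "tame = {f \<in> sq m. vanish (off_H f)}"

lemma tame_sq: "f \<in> tame \<Longrightarrow> f \<in> sq m" and tame_vanish: "f \<in> tame \<Longrightarrow> vanish (off_H f)"
  by (simp_all add: tame_def)

lemma off_H_le: "f \<in> sq m \<Longrightarrow> w \<in> A \<Longrightarrow> k \<in> Hf \<Longrightarrow> off_H f w \<le> n2 m (\<lambda>x. w x * f x - k x)"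
  by (rule P_best[OF A_mult_sq])

lemma off_H_sq: "f \<in> sq m \<Longrightarrow> w \<in> A \<Longrightarrow> (\<lambda>x. w x * f x - P (w \<cdot> f) x) \<in> sq m"
  by (intro sq_diff P_sq A_mult_sq)

lemma tame_one: "(\<lambda>_. 1) \<in> tame"
  unfolding tame_def
proof (intro CollectI conjI sq_one vanish_zero)
  show "off_H (\<lambda>_. 1) w \<le> 0" if "w \<in> A" for w using off_H_le[OF sq_one that A_Hf[OF that]] by simp
qed

lemma tame_add: assumes f: "f \<in> tame" and g: "g \<in> tame" shows "(f +: g) \<in> tame"
  unfolding tame_def
proof (intro CollectI conjI sq_add tame_sq f g)
  show "vanish (off_H (f +: g))"
  proof (rule vanish_le[OF vanish_add[OF tame_vanish[OF f] tame_vanish[OF g]], of 2])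
    fix w assume w: "w \<in> A"
    have "off_H (f +: g) w \<le> n2 m (\<lambda>x. w x * (f x + g x) - (P (w \<cdot> f) x + P (w \<cdot> g) x))"
      by (intro off_H_le sq_add tame_sq f g w Hf_add P_Hf A_mult_sq)
    also have "\<dots> = n2 m (\<lambda>x. (w x * f x - P (w \<cdot> f) x) + (w x * g x - P (w \<cdot> g) x))" by (simp add: algebra_simps)
    also have "\<dots> \<le> 2 * off_H f w + 2 * off_H g w" by (intro n2_add_le2 off_H_sq tame_sq f g w)
    finally show "off_H (f +: g) w \<le> 2 * (off_H f w + off_H g w)" by simp
  qed simp
qed

lemma tame_A_mult: assumes a: "a \<in> A" and f: "f \<in> tame" shows "(a \<cdot> f) \<in> tame"
  unfolding tame_def
proof (intro CollectI conjI A_mult_sq tame_sq a f)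
  note fs = tame_sq[OF f]
  obtain c where c: "c > 0" "\<And>g. g \<in> sq m \<Longrightarrow> n2 m (a \<cdot> g) \<le> c * n2 m g"
    by (rule Hf_mult_n2[OF A_bm[OF a] fs]) auto
  show "vanish (off_H (a \<cdot> f))"
  proof (rule vanish_le[OF tame_vanish[OF f] c(1)])
    fix w assume w: "w \<in> A"
    have "off_H (a \<cdot> f) w \<le> n2 m (\<lambda>x. w x * (a x * f x) - a x * P (w \<cdot> f) x)"
      by (intro off_H_le A_mult_sq A_mult_Hf P_Hf a fs w)
    also have "\<dots> = n2 m (\<lambda>x. a x * (w x * f x - P (w \<cdot> f) x))" by (simp add: algebra_simps)
    also have "\<dots> \<le> c * off_H f w" by (intro c(2) off_H_sq fs w)
    finally show "off_H (a \<cdot> f) w \<le> c * off_H f w" .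
  qed
qed

lemma tame_limit:
  assumes f: "f \<in> sq m" and ap: "\<And>e. e > 0 \<Longrightarrow> \<exists>g\<in>tame. n2 m (f -: g) \<le> e"
  shows "f \<in> tame"
  unfolding tame_def vanish_iff
proof (intro CollectI conjI allI impI f)
  fix e :: real assume "e > 0"
  then have e4: "e/4 > 0" by simp
  obtain g where g: "g \<in> tame" "n2 m (f -: g) \<le> e/4" using ap[OF e4] by blast
  note gs = tame_sq[OF g(1)]
  obtain us where us: "us \<in> sph" "\<And>ws. ws \<in> sph \<Longrightarrow> (\<Sum>w\<leftarrow>prodl ws us. off_H g w) \<le> e/4"
    using tame_vanish[OF g(1)] e4 unfolding vanish_iff by blast
  have fg: "(f -: g) \<in> sq m" by (intro sq_diff f gs)
  show "\<exists>us\<in>sph. \<forall>ws\<in>sph. (\<Sum>w\<leftarrow>prodl ws us. off_H f w) \<le> e"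
  proof (intro bexI[of _ us] ballI us(1))
    fix ws assume ws: "ws \<in> sph"
    have pu: "prodl ws us \<in> sph" by (intro sph.prod ws us)
    have "(\<Sum>w\<leftarrow>prodl ws us. off_H f w) \<le> (\<Sum>w\<leftarrow>prodl ws us. 2 * n2 m (\<lambda>x. w x * (f x - g x)) + 2 * off_H g w)"
    proof (intro sum_list_mono)
      fix w assume "w \<in> set (prodl ws us)"
      then have w: "w \<in> A" by (rule sph_A[OF pu])
      have "off_H f w \<le> n2 m (\<lambda>x. w x * f x - P (w \<cdot> g) x)" by (intro off_H_le f w P_Hf A_mult_sq gs)
      also have "\<dots> = n2 m (\<lambda>x. w x * (f x - g x) + (w x * g x - P (w \<cdot> g) x))" by (simp add: algebra_simps)
      also have "\<dots> \<le> 2 * n2 m (\<lambda>x. w x * (f x - g x)) + 2 * off_H g w"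
        by (intro n2_add_le2 A_mult_sq[OF w fg] off_H_sq gs w)
      finally show "off_H f w \<le> 2 * n2 m (\<lambda>x. w x * (f x - g x)) + 2 * off_H g w" .
    qed
    also have "\<dots> = 2 * n2 m (f -: g) + 2 * (\<Sum>w\<leftarrow>prodl ws us. off_H g w)"
      by (simp only: sum_list_addf sum_list_const_mult sph_n2[OF pu fg])
    also have "\<dots> \<le> e" using g(2) us(2)[OF ws] by linarith
    finally show "(\<Sum>w\<leftarrow>prodl ws us. off_H f w) \<le> e" .
  qed
qed

text \<open>The decisive step. With the words of \<open>cps\<close> write \<open>cnj \<phi> u = b + D\<close>, where \<open>b = v/n\<close> lies in \<open>A\<close> and
\<open>\<Sum>|D|\<^sup>2 \<le> 1/n\<close>. Then \<open>b P (w f)\<close> is analytic and close to \<open>u w cnj \<phi> f\<close>: the error consists of \<open>D w f\<close>, small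
for large \<open>n\<close>, and \<open>b (w f - P (w f))\<close>, small for fine \<open>w\<close> since \<open>\<Sum>|b|\<^sup>2 \<le> 4\<close>.\<close>

lemma tame_cnj_phi:
  assumes \<alpha>: "\<alpha> \<in> \<Gamma>" and j: "j \<in> J \<alpha>" and f: "f \<in> tame"
  shows "(\<lambda>x. cnj (\<phi> \<alpha> j x) * f x) \<in> tame" (is "?g \<in> tame")
proof -
  note fs = tame_sq[OF f]
  have cb: "(\<lambda>x. cnj (\<phi> \<alpha> j x)) \<in> bm m" by (intro cont_bm continuous_intros A_cont phi_A \<alpha> j)
  have gs: "?g \<in> sq m" by (rule sq_mult[OF cb fs])
  obtain js where js: "set js = J \<alpha>" "distinct js" using finite_distinct_list[OF finite_J[OF \<alpha>]] by blast
  have "\<exists>us\<in>sph. \<forall>ws\<in>sph. (\<Sum>w\<leftarrow>prodl ws us. off_H ?g w) \<le> e" if e: "e > 0" for e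
  proof -
    obtain n where n: "4 * n2 m f / e + 1 < real n" using reals_Archimedean2 by blast
    have q: "4 * n2 m f / e \<ge> 0" using e by simp
    then have n1: "real n > 1" using n by linarith
    have ne: "2 / real n * n2 m f \<le> e / 2"
    proof -
      have "4 * n2 m f / e \<le> real n" using n by simp
      then show ?thesis using e n1 by (simp add: field_simps)
    qed
    define ps where "ps = cps (\<phi> \<alpha>) js j n"
    define b where "b p x = (1 / of_nat n) * snd p x" for p :: "('k \<Rightarrow> complex) \<times> ('k \<Rightarrow> complex)" and x
    define D where "D p x = cnj (\<phi> \<alpha> j x) * fst p x - b p x" for p :: "('k \<Rightarrow> complex) \<times> ('k \<Rightarrow> complex)" and x
    have pA: "fst p \<in> A" "b p \<in> A" if "p \<in> set ps" for p
    proof -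
      have q: "fst p \<in> A" "snd p \<in> A" using cps_snd[OF \<alpha> js(1)] that unfolding ps_def by blast+
      show "fst p \<in> A" by (rule q(1))
      have "b p = (\<lambda>x. (1 / of_nat n) * snd p x)" by (rule ext) (rule b_def)
      then show "b p \<in> A" by (simp only: A_scale[OF q(2)])
    qed
    have fsph: "map fst ps \<in> sph" using cps_fst[OF \<alpha> js(2,1)] by (simp add: ps_def)
    have Db: "D p \<in> bm m" if p: "p \<in> set ps" for p
      unfolding D_def[abs_def] by (intro cont_bm continuous_intros A_cont phi_A \<alpha> j pA[OF p])
    have D2: "(\<Sum>p\<leftarrow>ps. (cmod (D p x))\<^sup>2) \<le> 1 / real n" for x
    proof -
      have D: "D p x = (1 / of_nat n) * (of_nat n * cnj (\<phi> \<alpha> j x) * fst p x - snd p x)" for p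
        using n1 by (simp add: D_def b_def field_simps)
      have "cmod (1 / of_nat n) = 1 / real n" by (simp add: norm_divide)
      then have "(\<Sum>p\<leftarrow>ps. (cmod (D p x))\<^sup>2) = (1 / real n)\<^sup>2 * (\<Sum>p\<leftarrow>ps. (cmod (of_nat n * cnj (\<phi> \<alpha> j x) * fst p x - snd p x))\<^sup>2)"
        by (simp only: D norm_mult power_mult_distrib sum_list_const_mult)
      also have "\<dots> \<le> (1 / real n)\<^sup>2 * real n"
        unfolding ps_def by (intro mult_left_mono cps_variance \<alpha> js j) auto
      finally show ?thesis using n1 by (simp add: power2_eq_square)
    qed
    have b2: "(\<Sum>p\<leftarrow>ps. (cmod (b p x))\<^sup>2) \<le> 4" for x
    proof -
      have le: "(cmod (b p x))\<^sup>2 \<le> 2 * (cmod (fst p x))\<^sup>2 + 2 * (cmod (D p x))\<^sup>2" for p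
      proof -
        have "(cmod (\<phi> \<alpha> j x))\<^sup>2 \<le> (\<Sum>l\<in>J \<alpha>. (cmod (\<phi> \<alpha> l x))\<^sup>2)"
          by (rule member_le_sum[OF j]) (use finite_J[OF \<alpha>] in auto)
        then have "(cmod (\<phi> \<alpha> j x))\<^sup>2 * (cmod (fst p x))\<^sup>2 \<le> 1 * (cmod (fst p x))\<^sup>2"
          unfolding phi_sum[OF \<alpha>] by (rule mult_right_mono) simp
        moreover have "(cmod (cnj (\<phi> \<alpha> j x) * fst p x + - D p x))\<^sup>2
          \<le> 2 * (cmod (cnj (\<phi> \<alpha> j x) * fst p x))\<^sup>2 + 2 * (cmod (- D p x))\<^sup>2" by (rule cmod_add_sq_le)
        ultimately show ?thesis by (simp add: D_def norm_mult power_mult_distrib norm_minus_commute)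
      qed
      have "(\<Sum>p\<leftarrow>ps. (cmod (b p x))\<^sup>2) \<le> (\<Sum>p\<leftarrow>ps. 2 * (cmod (fst p x))\<^sup>2 + 2 * (cmod (D p x))\<^sup>2)"
        by (intro sum_list_mono le)
      also have "\<dots> = 2 * (\<Sum>u\<leftarrow>map fst ps. (cmod (u x))\<^sup>2) + 2 * (\<Sum>p\<leftarrow>ps. (cmod (D p x))\<^sup>2)"
        by (simp add: sum_list_addf sum_list_const_mult o_def)
      also have "\<dots> \<le> 2 * 1 + 2 * (1 / real n)" unfolding sph_sum[OF fsph] using D2[of x] by simp
      also have "\<dots> \<le> 4" using n1 by (simp add: field_simps)
      finally show ?thesis .
    qed
    have "e/16 > 0" using e by simp
    then obtain vs where vs: "vs \<in> sph" "\<And>ws. ws \<in> sph \<Longrightarrow> (\<Sum>w\<leftarrow>prodl ws vs. off_H f w) \<le> e/16"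
      using tame_vanish[OF f] unfolding vanish_iff by blast
    show ?thesis
    proof (intro bexI[of _ "prodl (map fst ps) vs"] ballI sph.prod fsph vs(1))
      fix ws assume ws: "ws \<in> sph"
      have wv: "prodl ws vs \<in> sph" by (intro sph.prod ws vs)
      have "(\<Sum>w\<leftarrow>prodl ws (prodl (map fst ps) vs). off_H ?g w)
        = (\<Sum>w\<leftarrow>prodl ws vs. \<Sum>p\<leftarrow>ps. off_H ?g (w \<cdot> fst p))"
        unfolding sum_prodl3 by (simp add: sum_prodl[of _ "prodl ws vs"] o_def)
      also have "\<dots> \<le> (\<Sum>w\<leftarrow>prodl ws vs. 2 / real n * n2 m (w \<cdot> f) + 8 * off_H f w)"
      proof (intro sum_list_mono)
        fix w assume "w \<in> set (prodl ws vs)"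
        then have w: "w \<in> A" by (rule sph_A[OF wv])
        note wf = A_mult_sq[OF w fs] and os = off_H_sq[OF fs w]
        have "(\<Sum>p\<leftarrow>ps. off_H ?g (w \<cdot> fst p))
          \<le> (\<Sum>p\<leftarrow>ps. 2 * n2 m (\<lambda>x. D p x * (w x * f x)) + 2 * n2 m (\<lambda>x. b p x * (w x * f x - P (w \<cdot> f) x)))"
        proof (intro sum_list_mono)
          fix p assume p: "p \<in> set ps"
          have "off_H ?g (w \<cdot> fst p) \<le> n2 m (\<lambda>x. w x * fst p x * (cnj (\<phi> \<alpha> j x) * f x) - b p x * P (w \<cdot> f) x)"
            by (rule off_H_le[OF gs A_mult[OF w pA(1)[OF p]] A_mult_Hf[OF pA(2)[OF p] P_Hf[OF wf]]])
          also have "\<dots> = n2 m (\<lambda>x. D p x * (w x * f x) + b p x * (w x * f x - P (w \<cdot> f) x))"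
            by (simp add: D_def algebra_simps)
          also have "\<dots> \<le> 2 * n2 m (\<lambda>x. D p x * (w x * f x)) + 2 * n2 m (\<lambda>x. b p x * (w x * f x - P (w \<cdot> f) x))"
            by (rule n2_add_le2[OF sq_mult[OF Db[OF p] wf] A_mult_sq[OF pA(2)[OF p] os]])
          finally show "off_H ?g (w \<cdot> fst p) \<le> 2 * n2 m (\<lambda>x. D p x * (w x * f x)) + 2 * n2 m (\<lambda>x. b p x * (w x * f x - P (w \<cdot> f) x))" .
        qed
        also have "\<dots> = 2 * (\<Sum>p\<leftarrow>ps. n2 m (\<lambda>x. D p x * (w x * f x))) + 2 * (\<Sum>p\<leftarrow>ps. n2 m (\<lambda>x. b p x * (w x * f x - P (w \<cdot> f) x)))"
          by (simp add: sum_list_addf sum_list_const_mult)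
        also have "\<dots> \<le> 2 * (1 / real n * n2 m (w \<cdot> f)) + 2 * (4 * off_H f w)"
          using sum_mult_n2_le[of ps D, OF Db D2 wf] sum_mult_n2_le[of ps b, OF A_bm[OF pA(2)] b2 os] by linarith
        finally show "(\<Sum>p\<leftarrow>ps. off_H ?g (w \<cdot> fst p)) \<le> 2 / real n * n2 m (w \<cdot> f) + 8 * off_H f w" by simp
      qed
      also have "\<dots> = 2 / real n * n2 m f + 8 * (\<Sum>w\<leftarrow>prodl ws vs. off_H f w)"
        by (simp only: sum_list_addf sum_list_const_mult sph_n2[OF wv fs])
      also have "\<dots> \<le> e" using ne vs(2)[OF ws] by linarith
      finally show "(\<Sum>w\<leftarrow>prodl ws (prodl (map fst ps) vs). off_H ?g w) \<le> e" .
    qed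
  qed
  then show ?thesis using gs by (simp add: tame_def vanish_iff)
qed

lemma tame_cts_mult:
  assumes c: "cts c" and f: "f \<in> tame"
  shows "(c \<cdot> f) \<in> tame"
proof -
  define Q where "Q c \<longleftrightarrow> cts c \<and> (\<forall>f\<in>tame. (c \<cdot> f) \<in> tame)" for c
  have "Q c"
  proof (rule SW[where P=Q, OF _ _ _ _ _ _ _ c])
    show "cts f" if "Q f" for f using that by (simp add: Q_def)
    have QA: "Q a" if "a \<in> A" for a using that tame_A_mult by (simp add: Q_def A_cont)
    show "Q (\<lambda>_. c)" for c by (rule QA[OF A_const])
    fix a b assume ab: "Q a" "Q b"
    have ct: "cts (a +: b)" "cts (a \<cdot> b)" using ab by (auto simp: Q_def intro: continuous_on_add continuous_on_mult)
    show "Q (a +: b)" using ab ct tame_add unfolding Q_def distrib_right by blast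
    have "(\<lambda>x. a x * (b x * f x)) \<in> tame" if "f \<in> tame" for f
      using bspec[OF conjunct2[OF ab(1)[unfolded Q_def]] bspec[OF conjunct2[OF ab(2)[unfolded Q_def]] that]] by simp
    then show "Q (a \<cdot> b)" using ct(2) by (simp add: Q_def mult.assoc)
  next
    fix \<alpha> j assume *: "\<alpha> \<in> \<Gamma>" "j \<in> J \<alpha>"
    show "Q (\<phi> \<alpha> j)" using tame_A_mult[OF phi_A[OF *]] A_cont[OF phi_A[OF *]] by (simp add: Q_def)
    show "Q (\<lambda>x. cnj (\<phi> \<alpha> j x))"
      using tame_cnj_phi[OF *] continuous_on_cnj[OF A_cont[OF phi_A[OF *]]] by (simp add: Q_def)
  next
    fix a :: "'k \<Rightarrow> complex" assume a: "cts a" and ap: "\<And>e. e > 0 \<Longrightarrow> \<exists>b. Q b \<and> (\<forall>x. cmod (a x - b x) \<le> e)"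
    have "(a \<cdot> f) \<in> tame" if f: "f \<in> tame" for f
    proof (rule tame_limit)
      note fs = tame_sq[OF f]
      show "(a \<cdot> f) \<in> sq m" by (intro sq_mult cont_bm a fs)
      fix e :: real assume e: "e > 0"
      have p: "n2 m f + 1 > 0" using n2_nonneg[of m f] by linarith
      define d where "d = sqrt (e / (n2 m f + 1))"
      have d: "d > 0" "d\<^sup>2 = e / (n2 m f + 1)" using e p by (simp_all add: d_def)
      obtain b where b: "Q b" "\<And>x. cmod (a x - b x) \<le> d" using ap[OF d(1)] by blast
      have "cts (a -: b)" using a b(1) by (auto simp: Q_def intro: continuous_on_diff)
      then have "n2 m (\<lambda>x. (a x - b x) * f x) \<le> d\<^sup>2 * n2 m f"
        by (intro n2_mult_le cont_measurable fs) (use b in auto)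
      also have "\<dots> \<le> d\<^sup>2 * (n2 m f + 1)" by (intro mult_left_mono) auto
      also have "\<dots> = e" using p by (simp add: d(2))
      finally have le: "n2 m (\<lambda>x. a x * f x - b x * f x) \<le> e" by (simp add: left_diff_distrib)
      have "(\<lambda>x. b x * f x) \<in> tame" using bspec[OF conjunct2[OF b(1)[unfolded Q_def]] f] .
      then show "\<exists>g\<in>tame. n2 m (\<lambda>x. a x * f x - g x) \<le> e" using le by (intro bexI[of _ "\<lambda>x. b x * f x"])
    qed
    then show "Q a" using a by (simp add: Q_def)
  qed
  then show ?thesis using f by (simp add: Q_def)
qed

lemma tame_eq: "f \<in> sq m \<Longrightarrow> f \<in> tame"
proof (rule tame_limit)
  fix e :: real assume f: "f \<in> sq m" and e: "e > 0"
  obtain g where g: "cts g" "n2 m (f -: g) \<le> e" by (rule cont_dense[OF f e])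
  then show "\<exists>g\<in>tame. n2 m (f -: g) \<le> e" using tame_cts_mult[OF g(1) tame_one] by auto
qed

text \<open>Every square-integrable function becomes almost analytic: the projection has symbol \<open>1\<close>.\<close>

lemma symbol_P: "symbol P (\<lambda>_. 1)"
proof -
  have "off_H f = (\<lambda>w. n2 m (\<lambda>x. P (w \<cdot> f) x - 1 * (w x * f x)))" for f
    by (simp add: n2_diff_commute)
  then show ?thesis using tame_vanish[OF tame_eq] by (simp add: symbol_def)
qed

lemma symbol_mult: "symbol (\<lambda>f x. \<psi> x * f x) \<psi>"
  unfolding symbol_def by (auto intro!: vanish_zero)

lemma symbol_cong:
  assumes hs: "symbol L \<psi>" and L: "\<And>f. f \<in> sq m \<Longrightarrow> L f \<in> sq m" "\<And>f. f \<in> sq m \<Longrightarrow> L' f \<in> sq m"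
    and eq: "\<And>f. f \<in> sq m \<Longrightarrow> AE x in m. L' f x = L f x"
    and psi: "\<psi> \<in> bm m" "\<psi>' \<in> bm m" "AE x in m. \<psi>' x = \<psi> x"
  shows "symbol L' \<psi>'"
  unfolding symbol_def
proof
  fix f assume f: "f \<in> sq m"
  show "vanish (\<lambda>w. defect L' \<psi>' f w)"
  proof (rule vanish_le[of _ 1])
    show "vanish (\<lambda>w. defect L \<psi> f w)" using hs f by (simp add: symbol_def)
    fix w assume "w \<in> A"
    then have wf: "(w \<cdot> f) \<in> sq m" by (intro A_mult_sq f)
    have "defect L' \<psi>' f w = defect L \<psi> f w"
      using sq_diff[OF L(2)[OF wf] sq_mult[OF psi(2) wf]] sq_diff[OF L(1)[OF wf] sq_mult[OF psi(1) wf]] eq[OF wf] psi(3)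
      by (intro n2_cong_AE) (auto dest: sq_measurable)
    then show "defect L' \<psi>' f w \<le> 1 * defect L \<psi> f w"
      by simp
  qed simp
qed

lemma symbol_add:
  assumes hs: "symbol L \<psi>" "symbol L' \<psi>'" and L: "\<And>f. f \<in> sq m \<Longrightarrow> L f \<in> sq m" "\<And>f. f \<in> sq m \<Longrightarrow> L' f \<in> sq m"
    and psi: "\<psi> \<in> bm m" "\<psi>' \<in> bm m"
  shows "symbol (\<lambda>f x. L f x + L' f x) (\<lambda>x. \<psi> x + \<psi>' x)"
  unfolding symbol_def
proof
  fix f assume f: "f \<in> sq m"
  show "vanish (\<lambda>w. n2 m (\<lambda>x. L (w \<cdot> f) x + L' (w \<cdot> f) x - (\<psi> x + \<psi>' x) * (w x * f x)))"
  proof (rule vanish_le[of _ 2])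
    show "vanish (\<lambda>w. defect L \<psi> f w + defect L' \<psi>' f w)"
      by (intro vanish_add) (use hs f in \<open>auto simp: symbol_def\<close>)
    fix w assume "w \<in> A"
    then have wf: "(w \<cdot> f) \<in> sq m" by (intro A_mult_sq f)
    have "n2 m (\<lambda>x. (L (w \<cdot> f) x - \<psi> x * (w x * f x)) + (L' (w \<cdot> f) x - \<psi>' x * (w x * f x)))
      \<le> 2 * defect L \<psi> f w + 2 * defect L' \<psi>' f w"
      by (intro n2_add_le2 sq_diff L sq_mult psi wf)
    then show "n2 m (\<lambda>x. L (w \<cdot> f) x + L' (w \<cdot> f) x - (\<psi> x + \<psi>' x) * (w x * f x))
      \<le> 2 * (defect L \<psi> f w + defect L' \<psi>' f w)"
      by (simp add: algebra_simps)
  qed simp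
qed

lemma symbol_scale:
  assumes "symbol L \<psi>" shows "symbol (\<lambda>f x. c * L f x) (\<lambda>x. c * \<psi> x)"
  unfolding symbol_def
proof
  fix f assume f: "f \<in> sq m"
  have p: "(cmod c)\<^sup>2 + 1 > 0" by (intro add_nonneg_pos) auto
  show "vanish (\<lambda>w. n2 m (\<lambda>x. c * L (w \<cdot> f) x - c * \<psi> x * (w x * f x)))"
  proof (rule vanish_le[OF _ p])
    show "vanish (\<lambda>w. defect L \<psi> f w)" using assms f by (simp add: symbol_def)
    fix w
    have "n2 m (\<lambda>x. c * L (w \<cdot> f) x - c * \<psi> x * (w x * f x)) = (cmod c)\<^sup>2 * defect L \<psi> f w"
      by (subst n2_scale[symmetric]) (simp add: algebra_simps)
    also have "\<dots> \<le> ((cmod c)\<^sup>2 + 1) * defect L \<psi> f w"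
      by (intro mult_right_mono) auto
    finally show "n2 m (\<lambda>x. c * L (w \<cdot> f) x - c * \<psi> x * (w x * f x))
      \<le> ((cmod c)\<^sup>2 + 1) * defect L \<psi> f w" .
  qed
qed

lemma symbol_comp:
  assumes L: "bop m L C" and L': "bop m L' C'" and hs: "symbol L \<psi>" "symbol L' \<eta>" and b: "\<psi> \<in> bm m" "\<eta> \<in> bm m"
  shows "symbol (\<lambda>f. L (L' f)) (\<psi> \<cdot> \<eta>)"
  unfolding symbol_def
proof
  fix f assume f: "f \<in> sq m"
  have cf: "(\<eta> \<cdot> f) \<in> sq m" by (intro sq_mult b f)
  define c where "c = 2 * C + 2"
  show "vanish (\<lambda>w. n2 m (\<lambda>x. L (L' (w \<cdot> f)) x - \<psi> x * \<eta> x * (w x * f x)))"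
  proof (rule vanish_le[of _ c])
    show "c > 0" using bop_nonneg[OF L] by (simp add: c_def)
    show "vanish (\<lambda>w. defect L' \<eta> f w
        + n2 m (\<lambda>x. L (\<lambda>x. w x * (\<eta> x * f x)) x - \<psi> x * (w x * (\<eta> x * f x))))"
      using hs f cf by (intro vanish_add) (auto simp: symbol_def)
    fix w assume "w \<in> A"
    then have wf: "(w \<cdot> f) \<in> sq m" and wcf: "(\<lambda>x. w x * (\<eta> x * f x)) \<in> sq m"
      by (auto intro!: A_mult_sq f cf)
    have "n2 m (\<lambda>x. L (L' (w \<cdot> f)) x - \<psi> x * \<eta> x * (w x * f x))
      = n2 m (\<lambda>x. (L (L' (w \<cdot> f)) x - L (\<lambda>x. w x * (\<eta> x * f x)) x) + (L (\<lambda>x. w x * (\<eta> x * f x)) x - \<psi> x * (w x * (\<eta> x * f x))))"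
      by (simp add: algebra_simps)
    also have "\<dots> \<le> 2 * n2 m (\<lambda>x. L (L' (w \<cdot> f)) x - L (\<lambda>x. w x * (\<eta> x * f x)) x)
       + 2 * n2 m (\<lambda>x. L (\<lambda>x. w x * (\<eta> x * f x)) x - \<psi> x * (w x * (\<eta> x * f x)))"
      by (intro n2_add_le2 sq_diff bop_sq[OF L] bop_sq[OF L'] wf wcf sq_mult b)
    also have "n2 m (\<lambda>x. L (L' (w \<cdot> f)) x - L (\<lambda>x. w x * (\<eta> x * f x)) x)
      \<le> C * n2 m (\<lambda>x. L' (w \<cdot> f) x - w x * (\<eta> x * f x))"
      by (intro bop_diff_n2[OF L] bop_sq[OF L'] wf wcf)
    also have "(\<lambda>x. L' (w \<cdot> f) x - w x * (\<eta> x * f x)) = (\<lambda>x. L' (w \<cdot> f) x - \<eta> x * (w x * f x))"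
      by (simp add: algebra_simps)
    finally have "n2 m (\<lambda>x. L (L' (w \<cdot> f)) x - \<psi> x * \<eta> x * (w x * f x))
      \<le> 2 * (C * defect L' \<eta> f w) + 2 * n2 m (\<lambda>x. L (\<lambda>x. w x * (\<eta> x * f x)) x - \<psi> x * (w x * (\<eta> x * f x)))"
      by simp
    also have "\<dots> \<le> c * (defect L' \<eta> f w + n2 m (\<lambda>x. L (\<lambda>x. w x * (\<eta> x * f x)) x - \<psi> x * (w x * (\<eta> x * f x))))"
      using mult_nonneg_nonneg[OF bop_nonneg[OF L] n2_nonneg[of m "\<lambda>x. L (\<lambda>x. w x * (\<eta> x * f x)) x - \<psi> x * (w x * (\<eta> x * f x))"]]
      by (simp add: c_def algebra_simps)
    finally show "n2 m (\<lambda>x. L (L' (w \<cdot> f)) x - \<psi> x * \<eta> x * (w x * f x))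
      \<le> c * (defect L' \<eta> f w + n2 m (\<lambda>x. L (\<lambda>x. w x * (\<eta> x * f x)) x - \<psi> x * (w x * (\<eta> x * f x))))" .
  qed
qed

lemma symbolE:
  assumes "symbol L \<psi>" "f \<in> sq m" "e > 0"
  obtains us where "us \<in> sph" "(\<Sum>u\<leftarrow>us. defect L \<psi> f u) \<le> e"
proof -
  obtain us where us: "us \<in> sph" "\<forall>ws\<in>sph. (\<Sum>w\<leftarrow>prodl ws us. defect L \<psi> f w) \<le> e"
    using assms unfolding symbol_def vanish_iff by blast
  from us(2) sph.one have "(\<Sum>u\<leftarrow>us. defect L \<psi> f u) \<le> e"
    by (fastforce simp: prodl_def)
  then show thesis using us that by blast
qed

text \<open>Sum \<open>n2 (L (w f)) \<le> C n2 (w f)\<close> over a fine family; the left side tends to \<open>n2 (\<psi> f)\<close>.\<close>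

lemma symbol_bound:
  assumes L: "bop m L C" and hs: "symbol L \<psi>" and b: "\<psi> \<in> bm m" and f: "f \<in> sq m"
  shows "n2 m (\<psi> \<cdot> f) \<le> C * n2 m f"
proof -
  have key: "n2 m (\<psi> \<cdot> f) \<le> (1 + t) * (C * n2 m f)" if t: "t > 0" for t
  proof (rule field_le_epsilon)
    fix e :: real assume e: "e > 0"
    have p: "1 + 1/t > 0" using t by (simp add: add_pos_pos)
    then have "e / (1 + 1/t) > 0" using e by simp
    then obtain us where us: "us \<in> sph" "(\<Sum>u\<leftarrow>us. defect L \<psi> f u) \<le> e / (1 + 1/t)"
      using symbolE[OF hs f] by blast
    have "n2 m (\<psi> \<cdot> f) = (\<Sum>u\<leftarrow>us. n2 m (\<lambda>x. u x * (\<psi> x * f x)))"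
      by (intro sph_n2[symmetric] us sq_mult b f)
    also have "\<dots> \<le> (\<Sum>u\<leftarrow>us. (1 + t) * (C * n2 m (u \<cdot> f)) + (1 + 1/t) * defect L \<psi> f u)"
    proof (intro sum_list_mono)
      fix u assume u: "u \<in> set us"
      have uf: "(u \<cdot> f) \<in> sq m" by (rule sph_mult_sq[OF us(1) u f])
      have "n2 m (\<lambda>x. u x * (\<psi> x * f x)) = n2 m (\<lambda>x. L (u \<cdot> f) x + (\<psi> x * (u x * f x) - L (u \<cdot> f) x))"
        by (simp add: algebra_simps)
      also have "\<dots> \<le> (1 + t) * n2 m (L (u \<cdot> f)) + (1 + 1/t) * n2 m (\<lambda>x. \<psi> x * (u x * f x) - L (u \<cdot> f) x)"
        by (intro n2_add_le sq_diff sq_mult b uf bop_sq[OF L] t)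
      also have "n2 m (\<lambda>x. \<psi> x * (u x * f x) - L (u \<cdot> f) x) = defect L \<psi> f u"
        by (rule n2_diff_commute)
      finally show "n2 m (\<lambda>x. u x * (\<psi> x * f x)) \<le> (1 + t) * (C * n2 m (u \<cdot> f)) + (1 + 1/t) * defect L \<psi> f u"
        using mult_left_mono[OF bop_n2[OF L uf], of "1 + t"] t by linarith
    qed
    also have "\<dots> = (1 + t) * (C * n2 m f) + (1 + 1/t) * (\<Sum>u\<leftarrow>us. defect L \<psi> f u)"
      by (simp only: sum_list_addf sum_list_const_mult sph_n2[OF us(1) f])
    also have "\<dots> \<le> (1 + t) * (C * n2 m f) + (1 + 1/t) * (e / (1 + 1/t))"
      using p us by (intro add_left_mono mult_left_mono) auto
    also have "(1 + 1/t) * (e / (1 + 1/t)) = e" using p by simp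
    finally show "n2 m (\<psi> \<cdot> f) \<le> (1 + t) * (C * n2 m f) + e" .
  qed
  show ?thesis
  proof (rule field_le_epsilon)
    fix e :: real assume e: "e > 0"
    define z where "z = C * n2 m f"
    have z: "z \<ge> 0" unfolding z_def using bop_nonneg[OF L] by simp
    have "n2 m (\<psi> \<cdot> f) \<le> (1 + e / (z + 1)) * z"
      unfolding z_def[symmetric] using key[of "e / (z+1)"] e z by (simp add: z_def)
    also have "\<dots> \<le> z + e" using e z by (simp add: field_simps)
    finally show "n2 m (\<psi> \<cdot> f) \<le> C * n2 m f + e" by (simp add: z_def)
  qed
qed

lemma symbol_AE_bound:
  assumes "bop m L C" "symbol L \<psi>" "\<psi> \<in> bm m"
  shows "AE x in m. (cmod (\<psi> x))\<^sup>2 \<le> C"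
  by (rule mult_upper_AE[OF bm_imp_sq[OF assms(3)]]) (rule symbol_bound[OF assms bm_imp_sq])

text \<open>A lower bound for \<open>L\<close> on the Hardy space transfers to the symbol because \<open>w f\<close> is nearly analytic; the factor
\<open>4\<close> comes from two uses of \<open>|a + b|\<^sup>2 \<le> 2|a|\<^sup>2 + 2|b|\<^sup>2\<close>.\<close>

lemma symbol_lower:
  assumes L: "\<And>f. f \<in> sq m \<Longrightarrow> L f \<in> sq m" and hs: "symbol L \<psi>" and b: "\<psi> \<in> bm m" and f: "f \<in> sq m"
    and low: "\<And>f. f \<in> sq m \<Longrightarrow> n2 m (P f) \<le> C * n2 m (L f)" and C: "C \<ge> 0"
  shows "n2 m f \<le> 4 * C * n2 m (\<psi> \<cdot> f)"
proof (rule field_le_epsilon)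
  fix e :: real assume e: "e > 0"
  define d where "d = e / (2 + 4 * C)"
  have d: "d > 0" using e C by (simp add: d_def)
  have "vanish (\<lambda>w. n2 m (\<lambda>x. P (w \<cdot> f) x - 1 * (w x * f x)) + defect L \<psi> f w)"
    using symbol_P hs f by (intro vanish_add) (auto simp: symbol_def)
  then obtain us where us: "us \<in> sph" "\<forall>ws\<in>sph. (\<Sum>w\<leftarrow>prodl ws us. n2 m (\<lambda>x. P (w \<cdot> f) x - 1 * (w x * f x)) + defect L \<psi> f w) \<le> d"
    using d unfolding vanish_iff by blast
  define e1 where "e1 w = n2 m (\<lambda>x. P (w \<cdot> f) x - w x * f x)" for w
  define e2 where "e2 w = defect L \<psi> f w" for w
  have se: "(\<Sum>u\<leftarrow>us. e1 u + e2 u) \<le> d"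
    using us(2) sph.one unfolding e1_def e2_def by (fastforce simp: prodl_def)
  have "n2 m f = (\<Sum>u\<leftarrow>us. n2 m (u \<cdot> f))" by (rule sph_n2[OF us(1) f, symmetric])
  also have "\<dots> \<le> (\<Sum>u\<leftarrow>us. 4 * C * n2 m (\<lambda>x. u x * (\<psi> x * f x)) + (2 + 4 * C) * (e1 u + e2 u))"
  proof (intro sum_list_mono)
    fix u assume u: "u \<in> set us"
    have uf: "(u \<cdot> f) \<in> sq m" by (rule sph_mult_sq[OF us(1) u f])
    have "n2 m (\<lambda>x. P (u \<cdot> f) x + (u x * f x - P (u \<cdot> f) x)) \<le> 2 * n2 m (P (u \<cdot> f)) + 2 * n2 m (\<lambda>x. u x * f x - P (u \<cdot> f) x)"
      by (intro n2_add_le2 sq_diff P_sq uf)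
    then have 1: "n2 m (u \<cdot> f) \<le> 2 * n2 m (P (u \<cdot> f)) + 2 * e1 u"
      by (simp add: e1_def n2_diff_commute)
    have 2: "n2 m (P (u \<cdot> f)) \<le> C * n2 m (L (u \<cdot> f))" by (rule low[OF uf])
    have "n2 m (\<lambda>x. \<psi> x * (u x * f x) + (L (u \<cdot> f) x - \<psi> x * (u x * f x))) \<le> 2 * n2 m (\<lambda>x. \<psi> x * (u x * f x)) + 2 * e2 u"
      unfolding e2_def by (intro n2_add_le2 sq_diff sq_mult b uf L)
    then have 3: "n2 m (L (u \<cdot> f)) \<le> 2 * n2 m (\<lambda>x. u x * (\<psi> x * f x)) + 2 * e2 u"
      by (simp add: mult.left_commute)
    have "C * n2 m (L (u \<cdot> f)) \<le> C * (2 * n2 m (\<lambda>x. u x * (\<psi> x * f x)) + 2 * e2 u)"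
      by (rule mult_left_mono[OF 3 C])
    moreover have "0 \<le> C * e1 u" "0 \<le> e2 u" using C by (auto simp: e1_def e2_def)
    ultimately show "n2 m (u \<cdot> f) \<le> 4 * C * n2 m (\<lambda>x. u x * (\<psi> x * f x)) + (2 + 4 * C) * (e1 u + e2 u)"
      using 1 2 by (simp add: algebra_simps)
  qed
  also have "\<dots> = 4 * C * n2 m (\<psi> \<cdot> f) + (2 + 4 * C) * (\<Sum>u\<leftarrow>us. e1 u + e2 u)"
    using sph_n2[OF us(1) sq_mult[OF b f]]
    by (simp only: sum_list_addf[of "\<lambda>u. 4 * C * n2 m (\<lambda>x. u x * (\<psi> x * f x))" "\<lambda>u. (2 + 4 * C) * (e1 u + e2 u)"] sum_list_const_mult)
  also have "\<dots> \<le> 4 * C * n2 m (\<psi> \<cdot> f) + (2 + 4 * C) * d"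
    using C by (intro add_left_mono mult_left_mono se) auto
  also have "(2 + 4 * C) * d = e" using C by (simp add: d_def)
  finally show "n2 m f \<le> 4 * C * n2 m (\<psi> \<cdot> f) + e" .
qed

lemma symbol_limit:
  assumes L: "\<And>f. f \<in> sq m \<Longrightarrow> L f \<in> sq m" and b: "\<psi> \<in> bm m"
    and ap: "\<And>e. e > 0 \<Longrightarrow> \<exists>L' \<psi>'. symbol L' \<psi>' \<and> \<psi>' \<in> bm m \<and> (\<forall>f\<in>sq m. L' f \<in> sq m \<and> n2 m (\<lambda>x. L f x - L' f x) \<le> e\<^sup>2 * n2 m f)
         \<and> (AE x in m. cmod (\<psi>' x - \<psi> x) \<le> e)"
  shows "symbol L \<psi>"
  unfolding symbol_def vanish_iff
proof (intro ballI allI impI)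
  fix f and e0 :: real assume f: "f \<in> sq m" and e0: "e0 > 0"
  define N where "N = n2 m f + 1"
  define e where "e = sqrt (e0 / (16 * N))"
  have p: "N > 0" using n2_nonneg[of m f] unfolding N_def by linarith
  have e: "e > 0" using e0 p by (simp add: e_def)
  have e2: "e\<^sup>2 * n2 m f \<le> e0 / 16"
  proof -
    have "e\<^sup>2 = e0 / (16 * N)" using e0 p by (simp add: e_def)
    then have "e\<^sup>2 * N = e0 / 16" using p by simp
    moreover have "e\<^sup>2 * n2 m f \<le> e\<^sup>2 * N" unfolding N_def by (intro mult_left_mono) auto
    ultimately show ?thesis by simp
  qed
  obtain L' \<psi>' where L': "symbol L' \<psi>'" "\<psi>' \<in> bm m" "\<And>f. f \<in> sq m \<Longrightarrow> L' f \<in> sq m" "\<And>f. f \<in> sq m \<Longrightarrow> n2 m (\<lambda>x. L f x - L' f x) \<le> e\<^sup>2 * n2 m f"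
    "AE x in m. cmod (\<psi>' x - \<psi> x) \<le> e" using ap[OF e] by blast
  have e8: "e0/8 > 0" using e0 by simp
  obtain us where us: "us \<in> sph" "\<And>ws. ws \<in> sph \<Longrightarrow> (\<Sum>w\<leftarrow>prodl ws us. defect L' \<psi>' f w) \<le> e0/8"
    using L'(1) f e8 unfolding symbol_def vanish_iff by blast
  show "\<exists>us\<in>sph. \<forall>ws\<in>sph. (\<Sum>w\<leftarrow>prodl ws us. defect L \<psi> f w) \<le> e0"
  proof (intro bexI[of _ us] ballI us)
    fix ws assume ws: "ws \<in> sph"
    have pu: "prodl ws us \<in> sph" by (intro sph.prod ws us)
    have "(\<Sum>w\<leftarrow>prodl ws us. defect L \<psi> f w)
      \<le> (\<Sum>w\<leftarrow>prodl ws us. 8 * (e\<^sup>2 * n2 m (w \<cdot> f)) + 2 * defect L' \<psi>' f w)"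
    proof (intro sum_list_mono)
      fix w assume w: "w \<in> set (prodl ws us)"
      have wf: "(w \<cdot> f) \<in> sq m" by (rule sph_mult_sq[OF pu w f])
      define a where "a = (\<lambda>x. L (w \<cdot> f) x - L' (w \<cdot> f) x)"
      define a' where "a' = (\<lambda>x. (\<psi>' x - \<psi> x) * (w x * f x))"
      define a'' where "a'' = (\<lambda>x. L' (w \<cdot> f) x - \<psi>' x * (w x * f x))"
      have s: "a \<in> sq m" "a'' \<in> sq m" unfolding a_def a''_def by (intro sq_diff L L' wf sq_mult)+
      have "a' = (\<lambda>x. \<psi>' x * (w x * f x) - \<psi> x * (w x * f x))" by (auto simp: a'_def algebra_simps)
      then have s': "a' \<in> sq m" by (auto intro!: sq_diff sq_mult b L' wf)
      have "defect L \<psi> f w = n2 m (\<lambda>x. (a x + a' x) + a'' x)"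
        by (simp add: a_def a'_def a''_def algebra_simps)
      also have "\<dots> \<le> 2 * n2 m (a +: a') + 2 * n2 m a''" by (intro n2_add_le2 sq_add s s')
      also have "n2 m (a +: a') \<le> 2 * n2 m a + n2 m a' * 2"
        using n2_add_le2[OF s(1) s'] by simp
      also have "n2 m a \<le> e\<^sup>2 * n2 m (w \<cdot> f)" unfolding a_def by (rule L'(4)[OF wf])
      also have "n2 m a' \<le> e\<^sup>2 * n2 m (w \<cdot> f)"
        unfolding a'_def using L'(2) b by (intro n2_mult_le L'(5) wf) auto
      finally show "defect L \<psi> f w \<le> 8 * (e\<^sup>2 * n2 m (w \<cdot> f)) + 2 * defect L' \<psi>' f w"
        unfolding a''_def by simp
    qed
    also have "\<dots> = 8 * (e\<^sup>2 * n2 m f) + 2 * (\<Sum>w\<leftarrow>prodl ws us. defect L' \<psi>' f w)"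
      by (simp only: sum_list_addf sum_list_const_mult sph_n2[OF pu f])
    also have "\<dots> \<le> 8 * (e0/16) + 2 * (e0/8)" by (intro add_mono mult_left_mono e2 us ws) auto
    finally show "(\<Sum>w\<leftarrow>prodl ws us. defect L \<psi> f w) \<le> e0" using e0 by simp
  qed
qed

end


section \<open>Forms invariant under spherical families\<close>

lemma le_zero_if_sqrt:
  fixes z c :: real
  assumes "c \<ge> 0" "\<And>e. e > 0 \<Longrightarrow> z \<le> c * sqrt e"
  shows "z \<le> 0"
proof (rule ccontr)
  assume "\<not> z \<le> 0"
  then have z: "z > 0" by simp
  have "z \<le> c * sqrt ((z / (2 * (c + 1)))\<^sup>2)" using z assms(1) by (intro assms(2)) auto
  also have "\<dots> = c * (z / (2 * (c + 1)))" using z assms(1) by (simp add: real_sqrt_abs)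
  also have "\<dots> = z * (c / (2 * (c + 1)))" by simp
  also have "\<dots> \<le> z * (1/2)" using z assms(1) by (intro mult_left_mono) (auto simp: field_simps)
  finally show False using z by simp
qed

text \<open>A sesquilinear form with \<open>|y(f,g)|\<^sup>2 \<le> C \<parallel>f\<parallel>\<^sup>2 \<parallel>g\<parallel>\<^sup>2\<close>, stated in the weighted form that can be summed over
families.\<close>

definition bform :: "'a measure \<Rightarrow> (('a \<Rightarrow> complex) \<Rightarrow> ('a \<Rightarrow> complex) \<Rightarrow> complex) \<Rightarrow> real \<Rightarrow> bool" where
  "bform M y C \<longleftrightarrow> 0 \<le> C \<and>
     (\<forall>f\<in>sq M. \<forall>g\<in>sq M. \<forall>k\<in>sq M. y (f +: g) k = y f k + y g k) \<and>
     (\<forall>f\<in>sq M. \<forall>g\<in>sq M. \<forall>k\<in>sq M. y k (f +: g) = y k f + y k g) \<and>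
     (\<forall>c. \<forall>f\<in>sq M. \<forall>k\<in>sq M. y (\<lambda>x. c * f x) k = c * y f k) \<and>
     (\<forall>c. \<forall>f\<in>sq M. \<forall>k\<in>sq M. y k (\<lambda>x. c * f x) = cnj c * y k f) \<and>
     (\<forall>f\<in>sq M. \<forall>g\<in>sq M. \<forall>t>0. cmod (y f g) \<le> (t * (C * n2 M f) + n2 M g / t) / 2)"

context
  fixes M :: "'a measure" and y C
  assumes y: "bform M y C"
begin

lemma bform_C: "0 \<le> C" using y by (simp add: bform_def)
lemma bform_add_left: "f \<in> sq M \<Longrightarrow> g \<in> sq M \<Longrightarrow> k \<in> sq M \<Longrightarrow> y (f +: g) k = y f k + y g k"
  using y by (simp add: bform_def)
lemma bform_add_right: "f \<in> sq M \<Longrightarrow> g \<in> sq M \<Longrightarrow> k \<in> sq M \<Longrightarrow> y k (f +: g) = y k f + y k g"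
  using y by (simp add: bform_def)
lemma bform_scale_left: "f \<in> sq M \<Longrightarrow> k \<in> sq M \<Longrightarrow> y (\<lambda>x. c * f x) k = c * y f k"
  using y by (simp add: bform_def)
lemma bform_scale_right: "f \<in> sq M \<Longrightarrow> k \<in> sq M \<Longrightarrow> y k (\<lambda>x. c * f x) = cnj c * y k f"
  using y by (simp add: bform_def)
lemma bform_weighted: "f \<in> sq M \<Longrightarrow> g \<in> sq M \<Longrightarrow> t > 0 \<Longrightarrow> cmod (y f g) \<le> (t * (C * n2 M f) + n2 M g / t) / 2"
  using y by (simp add: bform_def)

lemma bform_diff_left: "f \<in> sq M \<Longrightarrow> g \<in> sq M \<Longrightarrow> k \<in> sq M \<Longrightarrow> y (f -: g) k = y f k - y g k"
  using bform_add_left[OF _ sq_scale[of g M "-1"], of f k] bform_scale_left[of g k "-1"] by simp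
lemma bform_diff_right: "f \<in> sq M \<Longrightarrow> g \<in> sq M \<Longrightarrow> k \<in> sq M \<Longrightarrow> y k (f -: g) = y k f - y k g"
  using bform_add_right[OF _ sq_scale[of g M "-1"], of f k] bform_scale_right[of g k "-1"] by simp
lemma bform_zero_right: "k \<in> sq M \<Longrightarrow> y k (\<lambda>x. 0) = 0"
  using bform_scale_right[OF sq_zero, of k 0] by simp

lemma bform_sqrt:
  assumes "f \<in> sq M" "g \<in> sq M"
  shows "cmod (y f g) \<le> sqrt (C * n2 M f) * sqrt (n2 M g)"
  by (rule weighted_bounds_imp_sqrt) (use bform_weighted[OF assms] bform_C in auto)

end

context spherical_setting begin

definition inv_form where
  "inv_form y \<longleftrightarrow> (\<forall>us\<in>sph. \<forall>f\<in>sq m. \<forall>g\<in>sq m. (\<Sum>u\<leftarrow>us. y (u \<cdot> f) (u \<cdot> g)) = y f g)"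

lemma inv_formD:
  "inv_form y \<Longrightarrow> us \<in> sph \<Longrightarrow> f \<in> sq m \<Longrightarrow> g \<in> sq m \<Longrightarrow> (\<Sum>u\<leftarrow>us. y (u \<cdot> f) (u \<cdot> g)) = y f g"
  by (simp add: inv_form_def)

lemma norm_sum_list_le: "cmod (\<Sum>x\<leftarrow>xs. F x) \<le> (\<Sum>x\<leftarrow>xs. cmod (F x))" for F :: "'z \<Rightarrow> complex"
  by (induction xs) (auto intro: norm_triangle_le)

lemma sum_list_swap_if:
  fixes F :: "'x \<Rightarrow> 'y \<Rightarrow> complex"
  shows "(\<Sum>l\<leftarrow>js. \<Sum>p\<leftarrow>ps. F l p + (if l = j then G p else 0))
    = (\<Sum>p\<leftarrow>ps. \<Sum>l\<leftarrow>js. F l p) + (\<Sum>l\<leftarrow>js. if l = j then (\<Sum>p\<leftarrow>ps. G p) else 0)"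
proof -
  have "(\<Sum>p\<leftarrow>ps. F l p + (if l = j then G p else 0)) = (\<Sum>p\<leftarrow>ps. F l p) + (if l = j then (\<Sum>p\<leftarrow>ps. G p) else 0)" for l
    by (cases "l = j") (simp_all add: sum_list_addf)
  then show ?thesis by (simp add: sum_list_addf sum_list_swap'[of F ps js])
qed

text \<open>In each word with an occurrence of \<open>j\<close> singled out, the remaining \<open>n - 1\<close> letters form a spherical family and
are removed by invariance; the singled out letter stays on the left.\<close>

lemma inv_form_cps:
  assumes y: "bform m y C" and inv: "inv_form y" and \<alpha>: "\<alpha> \<in> \<Gamma>" and j: "j \<in> J \<alpha>"
    and js: "distinct js" "set js = J \<alpha>" and f: "f \<in> sq m" and g: "g \<in> sq m"
  shows "(\<Sum>p\<leftarrow>cps (\<phi> \<alpha>) js j n. y (fst p \<cdot> f) (snd p \<cdot> g)) = of_nat n * y (\<phi> \<alpha> j \<cdot> f) g"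
proof (induction n)
  case 0 then show ?case using bform_zero_right[OF y f] by simp
next
  case (Suc n)
  let ?ps = "cps (\<phi> \<alpha>) js j n"
  have pf: "\<phi> \<alpha> l \<in> A" if "l \<in> J \<alpha>" for l using that phi_A \<alpha> by blast
  have "(\<Sum>p\<leftarrow>cps (\<phi> \<alpha>) js j (Suc n). y (fst p \<cdot> f) (snd p \<cdot> g))
    = (\<Sum>l\<leftarrow>js. \<Sum>p\<leftarrow>?ps. y (\<lambda>x. \<phi> \<alpha> l x * (fst p x * f x)) (\<lambda>x. \<phi> \<alpha> l x * (snd p x * g x))
        + (if l = j then y (\<lambda>x. fst p x * (\<phi> \<alpha> j x * f x)) (fst p \<cdot> g) else 0))"
    unfolding sum_cps_Suc
  proof (intro arg_cong[of _ _ sum_list] map_cong refl)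
    fix l p assume l: "l \<in> set js" and p: "p \<in> set ?ps"
    have pA: "fst p \<in> A" "snd p \<in> A" using cps_snd[OF \<alpha> js(2) p] by auto
    have lA: "\<phi> \<alpha> l \<in> A" using l js pf by simp
    have s: "(\<lambda>x. \<phi> \<alpha> l x * (fst p x * f x)) \<in> sq m" "(\<lambda>x. \<phi> \<alpha> l x * (snd p x * g x)) \<in> sq m" "(fst p \<cdot> g) \<in> sq m"
      by (intro A_mult_sq lA pA f g)+
    show "y (\<lambda>x. fst (\<lambda>x. \<phi> \<alpha> l x * fst p x, \<lambda>x. \<phi> \<alpha> l x * snd p x + (if l = j then fst p x else 0)) x * f x)
         (\<lambda>x. snd (\<lambda>x. \<phi> \<alpha> l x * fst p x, \<lambda>x. \<phi> \<alpha> l x * snd p x + (if l = j then fst p x else 0)) x * g x)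
      = y (\<lambda>x. \<phi> \<alpha> l x * (fst p x * f x)) (\<lambda>x. \<phi> \<alpha> l x * (snd p x * g x))
        + (if l = j then y (\<lambda>x. fst p x * (\<phi> \<alpha> j x * f x)) (fst p \<cdot> g) else 0)"
    proof (cases "l = j")
      case True
      have "(\<lambda>x. fst p x * (\<phi> \<alpha> j x * f x)) = (\<lambda>x. \<phi> \<alpha> l x * (fst p x * f x))"
        unfolding True by (simp add: mult.left_commute)
      then show ?thesis using bform_add_right[OF y s(2,3,1)] True by (simp add: distrib_right mult.assoc)
    qed (simp add: mult.assoc)
  qed
  also have "\<dots> = (\<Sum>p\<leftarrow>?ps. \<Sum>l\<leftarrow>js. y (\<lambda>x. \<phi> \<alpha> l x * (fst p x * f x)) (\<lambda>x. \<phi> \<alpha> l x * (snd p x * g x)))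
       + (\<Sum>l\<leftarrow>js. if l = j then (\<Sum>p\<leftarrow>?ps. y (\<lambda>x. fst p x * (\<phi> \<alpha> j x * f x)) (fst p \<cdot> g)) else 0)"
    by (rule sum_list_swap_if)
  also have "(\<Sum>p\<leftarrow>?ps. \<Sum>l\<leftarrow>js. y (\<lambda>x. \<phi> \<alpha> l x * (fst p x * f x)) (\<lambda>x. \<phi> \<alpha> l x * (snd p x * g x)))
      = (\<Sum>p\<leftarrow>?ps. y (fst p \<cdot> f) (snd p \<cdot> g))"
  proof (intro arg_cong[of _ _ sum_list] map_cong refl)
    fix p assume p: "p \<in> set ?ps"
    have pA: "fst p \<in> A" "snd p \<in> A" using cps_snd[OF \<alpha> js(2) p] by auto
    have "(\<Sum>u\<leftarrow>map (\<phi> \<alpha>) js. y (\<lambda>x. u x * (fst p x * f x)) (\<lambda>x. u x * (snd p x * g x))) = y (fst p \<cdot> f) (snd p \<cdot> g)"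
      by (rule inv_formD[OF inv sph.fam[OF \<alpha> js] A_mult_sq[OF pA(1) f] A_mult_sq[OF pA(2) g]])
    then show "(\<Sum>l\<leftarrow>js. y (\<lambda>x. \<phi> \<alpha> l x * (fst p x * f x)) (\<lambda>x. \<phi> \<alpha> l x * (snd p x * g x))) = y (fst p \<cdot> f) (snd p \<cdot> g)"
      by (simp add: o_def)
  qed
  also have "(\<Sum>p\<leftarrow>?ps. y (\<lambda>x. fst p x * (\<phi> \<alpha> j x * f x)) (fst p \<cdot> g)) = y (\<phi> \<alpha> j \<cdot> f) g"
  proof -
    have "(\<Sum>u\<leftarrow>map fst ?ps. y (\<lambda>x. u x * (\<phi> \<alpha> j x * f x)) (u \<cdot> g)) = y (\<phi> \<alpha> j \<cdot> f) g"
      by (rule inv_formD[OF inv cps_fst[OF \<alpha> js] A_mult_sq[OF pf[OF j] f] g])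
    then show ?thesis by (simp add: o_def)
  qed
  also have "(\<Sum>l\<leftarrow>js. if l = j then y (\<phi> \<alpha> j \<cdot> f) g else 0) = y (\<phi> \<alpha> j \<cdot> f) g"
    using js j finite_J[OF \<alpha>] by (simp add: sum_list_distinct_conv_sum_set)
  finally show ?case using Suc by (simp add: distrib_right)
qed

text \<open>Replace \<open>v\<close> by \<open>n cnj \<phi> u\<close> in the previous sum. By the variance bound the error is of order \<open>\<surd>n\<close>, while both
sides are \<open>n\<close> times the two values to be compared.\<close>

lemma inv_form_phi:
  assumes y: "bform m y C" and inv: "inv_form y" and \<alpha>: "\<alpha> \<in> \<Gamma>" and j: "j \<in> J \<alpha>"
    and f: "f \<in> sq m" and g: "g \<in> sq m"
  shows "y (\<phi> \<alpha> j \<cdot> f) g = y f (\<lambda>x. cnj (\<phi> \<alpha> j x) * g x)"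
proof -
  obtain js where js: "set js = J \<alpha>" "distinct js" using finite_distinct_list[OF finite_J[OF \<alpha>]] by blast
  define z where "z = y f (\<lambda>x. cnj (\<phi> \<alpha> j x) * g x) - y (\<phi> \<alpha> j \<cdot> f) g"
  define b where "b = (C * n2 m f + n2 m g) / 2"
  have cb: "(\<lambda>x. cnj (\<phi> \<alpha> j x)) \<in> bm m" by (intro cont_bm continuous_intros A_cont phi_A \<alpha> j)
  have "cmod z \<le> b / sqrt (real n)" if n: "n > 0" for n :: nat
  proof -
    define ps where "ps = cps (\<phi> \<alpha>) js j n"
    define D where "D p x = of_nat n * cnj (\<phi> \<alpha> j x) * fst p x - snd p x" for p :: "('k \<Rightarrow> complex) \<times> ('k \<Rightarrow> complex)" and x
    have pA: "fst p \<in> A" "snd p \<in> A" if "p \<in> set ps" for p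
      using cps_snd[OF \<alpha> js(1)] that by (auto simp: ps_def)
    have cg: "(\<lambda>x. cnj (\<phi> \<alpha> j x) * g x) \<in> sq m" by (intro sq_mult cb g)
    have fsph: "map fst ps \<in> sph" using cps_fst[OF \<alpha> js(2,1)] by (simp add: ps_def)
    have Dg: "(\<lambda>x. D p x * g x) \<in> sq m" if p: "p \<in> set ps" for p
    proof -
      have "(\<lambda>x. of_nat n * (fst p x * (cnj (\<phi> \<alpha> j x) * g x)) - snd p x * g x) \<in> sq m"
        by (intro sq_diff sq_scale A_mult_sq pA p cg g)
      then show ?thesis by (simp add: D_def algebra_simps)
    qed
    have "of_nat n * z = (\<Sum>p\<leftarrow>ps. y (fst p \<cdot> f) (\<lambda>x. D p x * g x))"
    proof -
      have "(\<Sum>p\<leftarrow>ps. y (fst p \<cdot> f) (\<lambda>x. D p x * g x)) = (\<Sum>p\<leftarrow>ps. of_nat n * y (fst p \<cdot> f) (\<lambda>x. fst p x * (cnj (\<phi> \<alpha> j x) * g x)) - y (fst p \<cdot> f) (snd p \<cdot> g))"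
      proof (intro arg_cong[of _ _ sum_list] map_cong refl)
        fix p assume p: "p \<in> set ps"
        have s: "(fst p \<cdot> f) \<in> sq m" "(\<lambda>x. fst p x * (cnj (\<phi> \<alpha> j x) * g x)) \<in> sq m" "(snd p \<cdot> g) \<in> sq m"
          by (intro A_mult_sq pA p f g cg)+
        have "y (fst p \<cdot> f) (\<lambda>x. D p x * g x) = y (fst p \<cdot> f) (\<lambda>x. of_nat n * (fst p x * (cnj (\<phi> \<alpha> j x) * g x)) - snd p x * g x)"
          by (simp add: D_def algebra_simps)
        then show "y (fst p \<cdot> f) (\<lambda>x. D p x * g x) = of_nat n * y (fst p \<cdot> f) (\<lambda>x. fst p x * (cnj (\<phi> \<alpha> j x) * g x)) - y (fst p \<cdot> f) (snd p \<cdot> g)"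
          using bform_diff_right[OF y sq_scale[OF s(2)] s(3,1)] bform_scale_right[OF y s(2,1)] by simp
      qed
      also have "\<dots> = of_nat n * (\<Sum>p\<leftarrow>ps. y (fst p \<cdot> f) (\<lambda>x. fst p x * (cnj (\<phi> \<alpha> j x) * g x))) - (\<Sum>p\<leftarrow>ps. y (fst p \<cdot> f) (snd p \<cdot> g))"
        by (simp add: sum_list_subtractf sum_list_const_mult)
      also have "(\<Sum>p\<leftarrow>ps. y (fst p \<cdot> f) (\<lambda>x. fst p x * (cnj (\<phi> \<alpha> j x) * g x))) = (\<Sum>u\<leftarrow>map fst ps. y (u \<cdot> f) (\<lambda>x. u x * (cnj (\<phi> \<alpha> j x) * g x)))"
        by (simp add: o_def)
      also have "\<dots> = y f (\<lambda>x. cnj (\<phi> \<alpha> j x) * g x)"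
        by (rule inv_formD[OF inv fsph f cg])
      also have "(\<Sum>p\<leftarrow>ps. y (fst p \<cdot> f) (snd p \<cdot> g)) = of_nat n * y (\<phi> \<alpha> j \<cdot> f) g"
        unfolding ps_def by (rule inv_form_cps[OF y inv \<alpha> j js(2,1) f g])
      finally show ?thesis by (simp add: z_def right_diff_distrib)
    qed
    then have "real n * cmod z = cmod (\<Sum>p\<leftarrow>ps. y (fst p \<cdot> f) (\<lambda>x. D p x * g x))"
      using arg_cong[of _ _ cmod] by (metis norm_mult norm_of_nat)
    also have "\<dots> \<le> (\<Sum>p\<leftarrow>ps. cmod (y (fst p \<cdot> f) (\<lambda>x. D p x * g x)))" by (rule norm_sum_list_le)
    also have "\<dots> \<le> (\<Sum>p\<leftarrow>ps. sqrt (real n) * C / 2 * n2 m (fst p \<cdot> f) + 1 / (2 * sqrt (real n)) * n2 m (\<lambda>x. D p x * g x))"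
    proof (intro sum_list_mono)
      fix p assume p: "p \<in> set ps"
      have "cmod (y (fst p \<cdot> f) (\<lambda>x. D p x * g x)) \<le> (sqrt (real n) * (C * n2 m (fst p \<cdot> f)) + n2 m (\<lambda>x. D p x * g x) / sqrt (real n)) / 2"
        using n by (intro bform_weighted[OF y] Dg p A_mult_sq pA f) auto
      then show "cmod (y (fst p \<cdot> f) (\<lambda>x. D p x * g x)) \<le> sqrt (real n) * C / 2 * n2 m (fst p \<cdot> f) + 1 / (2 * sqrt (real n)) * n2 m (\<lambda>x. D p x * g x)"
        by (simp add: add_divide_distrib)
    qed
    also have "\<dots> = sqrt (real n) * C / 2 * (\<Sum>p\<leftarrow>ps. n2 m (fst p \<cdot> f)) + 1 / (2 * sqrt (real n)) * (\<Sum>p\<leftarrow>ps. n2 m (\<lambda>x. D p x * g x))"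
      by (simp only: sum_list_addf sum_list_const_mult)
    also have "(\<Sum>p\<leftarrow>ps. n2 m (fst p \<cdot> f)) = n2 m f"
      using sph_n2[OF fsph f] by (simp add: o_def)
    also have "(\<Sum>p\<leftarrow>ps. n2 m (\<lambda>x. D p x * g x)) \<le> real n * n2 m g"
    proof (rule sum_mult_n2_le[OF _ _ g])
      show "D p \<in> bm m" if p: "p \<in> set ps" for p
        unfolding D_def[abs_def] by (intro cont_bm continuous_intros A_cont phi_A \<alpha> j pA[OF p])
      show "(\<Sum>p\<leftarrow>ps. (cmod (D p x))\<^sup>2) \<le> real n" for x
        unfolding D_def ps_def by (intro cps_variance \<alpha> js j)
    qed
    finally have "real n * cmod z \<le> sqrt (real n) * C / 2 * n2 m f + 1 / (2 * sqrt (real n)) * (real n * n2 m g)"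
      using n by (simp add: mult_left_mono divide_right_mono)
    also have "1 / (2 * sqrt (real n)) * (real n * n2 m g) = sqrt (real n) * n2 m g / 2"
      using n by (simp add: field_simps)
    finally have "real n * cmod z \<le> sqrt (real n) * b" by (simp add: b_def field_simps)
    then have "sqrt (real n) * (sqrt (real n) * cmod z) \<le> sqrt (real n) * b" by (simp flip: mult.assoc)
    then have "sqrt (real n) * cmod z \<le> b" using n by simp
    then show ?thesis using n by (simp add: field_simps)
  qed
  then have le: "cmod z \<le> b / sqrt (real (Suc n))" for n by blast
  have "(\<lambda>n. b / sqrt (real (Suc n))) \<longlonglongrightarrow> 0" by real_asymp
  then have "cmod z \<le> 0" by (rule LIMSEQ_le_const) (use le in auto)
  then show ?thesis by (simp add: z_def)
qed

lemma bform_conj: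
  assumes y: "bform m y C"
  shows "bform m (\<lambda>f g. cnj (y g f)) C"
proof (cases "C = 0")
  case True
  have "y f g = 0" if "f \<in> sq m" "g \<in> sq m" for f g
    using bform_sqrt[OF y that] True by simp
  then show ?thesis using True by (simp add: bform_def sq_add sq_scale)
next
  case False
  then have C: "C > 0" using bform_C[OF y] by simp
  have "cmod (y g f) \<le> (t * (C * n2 m f) + n2 m g / t) / 2" if "f \<in> sq m" "g \<in> sq m" "t > 0" for f g t
    using bform_weighted[OF y that(2,1), of "1 / (C * t)"] that C by (simp add: field_simps)
  then show ?thesis using C
    by (simp add: bform_def bform_add_left[OF y] bform_add_right[OF y] bform_scale_left[OF y] bform_scale_right[OF y])
qed

text \<open>The set of such \<open>c\<close> is a closed algebra containing the \<open>\<phi>\<^sub>j\<close> and, by symmetry of the form's two arguments, their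
conjugates.\<close>

lemma inv_form_cont:
  assumes y: "bform m y C" and inv: "inv_form y" and c: "cts c"
  shows "\<forall>f\<in>sq m. \<forall>g\<in>sq m. y (c \<cdot> f) g = y f (\<lambda>x. cnj (c x) * g x)"
proof -
  define Q where "Q c \<longleftrightarrow> cts c \<and> (\<forall>f\<in>sq m. \<forall>g\<in>sq m. y (c \<cdot> f) g = y f (\<lambda>x. cnj (c x) * g x))" for c
  have cc: "(\<lambda>x. cnj (c x)) \<in> bm m" "c \<in> bm m" if "cts c" for c :: "'k \<Rightarrow> complex"
    using that by (auto intro!: cont_bm continuous_intros)
  have "Q c"
  proof (rule SW[where P=Q, OF _ _ _ _ _ _ _ c])
    show "cts f" if "Q f" for f using that by (simp add: Q_def)
    show "Q (\<lambda>_. c)" for c by (simp add: Q_def bform_scale_left[OF y] bform_scale_right[OF y])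
    show "Q (a +: b)" if ab: "Q a" "Q b" for a b
    proof -
      have ct: "cts a" "cts b" using ab by (auto simp: Q_def)
      have "y (\<lambda>x. (a x + b x) * f x) g = y f (\<lambda>x. cnj (a x + b x) * g x)" if "f \<in> sq m" "g \<in> sq m" for f g
      proof -
        have s: "(a \<cdot> f) \<in> sq m" "(b \<cdot> f) \<in> sq m" "(\<lambda>x. cnj (a x) * g x) \<in> sq m" "(\<lambda>x. cnj (b x) * g x) \<in> sq m"
          by (intro sq_mult cc ct that)+
        show ?thesis using ab that bform_add_left[OF y s(1,2), of g] bform_add_right[OF y s(3,4), of f]
          by (simp add: Q_def distrib_right)
      qed
      then show ?thesis using ct by (auto simp: Q_def intro: continuous_intros)
    qed
    show "Q (a \<cdot> b)" if ab: "Q a" "Q b" for a b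
    proof -
      have ct: "cts a" "cts b" using ab by (auto simp: Q_def)
      have "y (\<lambda>x. (a x * b x) * f x) g = y f (\<lambda>x. cnj (a x * b x) * g x)" if "f \<in> sq m" "g \<in> sq m" for f g
      proof -
        have s: "(b \<cdot> f) \<in> sq m" "(\<lambda>x. cnj (a x) * g x) \<in> sq m"
          by (intro sq_mult cc ct that)+
        have "y (\<lambda>x. a x * (b x * f x)) g = y (b \<cdot> f) (\<lambda>x. cnj (a x) * g x)" using ab s that by (simp add: Q_def)
        also have "\<dots> = y f (\<lambda>x. cnj (b x) * (cnj (a x) * g x))" using ab s that by (simp add: Q_def)
        finally show ?thesis by (simp add: mult.assoc mult.left_commute)
      qed
      then show ?thesis using ct by (auto simp: Q_def intro: continuous_intros)
    qed
    show "Q (\<phi> \<alpha> j)" if "\<alpha> \<in> \<Gamma>" "j \<in> J \<alpha>" for \<alpha> j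
      using that inv_form_phi[OF y inv] by (auto simp: Q_def intro: A_cont phi_A)
    show "Q (\<lambda>x. cnj (\<phi> \<alpha> j x))" if \<alpha>: "\<alpha> \<in> \<Gamma>" "j \<in> J \<alpha>" for \<alpha> j
    proof -
      have inv': "inv_form (\<lambda>f g. cnj (y g f))"
        unfolding inv_form_def
      proof (intro ballI)
        fix us f g assume *: "us \<in> sph" "f \<in> sq m" "g \<in> sq m"
        have "(\<Sum>u\<leftarrow>us. cnj (y (u \<cdot> g) (u \<cdot> f))) = cnj (\<Sum>u\<leftarrow>us. y (u \<cdot> g) (u \<cdot> f))"
          by (induction us) simp_all
        then show "(\<Sum>u\<leftarrow>us. cnj (y (u \<cdot> g) (u \<cdot> f))) = cnj (y g f)"
          using inv * unfolding inv_form_def by simp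
      qed
      have "y (\<lambda>x. cnj (\<phi> \<alpha> j x) * f x) g = y f (\<phi> \<alpha> j \<cdot> g)" if "f \<in> sq m" "g \<in> sq m" for f g
        using inv_form_phi[OF bform_conj[OF y] inv' \<alpha> that(2,1)] by simp
      moreover have "cts (\<lambda>x. cnj (\<phi> \<alpha> j x))" by (intro continuous_on_cnj A_cont phi_A \<alpha>)
      ultimately show ?thesis by (simp add: Q_def)
    qed
    fix a assume a: "cts a" and ap: "\<And>e. e > 0 \<Longrightarrow> \<exists>b. Q b \<and> (\<forall>x. cmod (a x - b x) \<le> e)"
    have "y (a \<cdot> f) g = y f (\<lambda>x. cnj (a x) * g x)" if fg: "f \<in> sq m" "g \<in> sq m" for f g
    proof -
      define z where "z = y (a \<cdot> f) g - y f (\<lambda>x. cnj (a x) * g x)"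
      define c where "c = 2 * (sqrt (C * n2 m f) * sqrt (n2 m g))"
      have "cmod z \<le> c * sqrt e" if e: "e > 0" for e
      proof -
        obtain b where b: "Q b" "\<And>x. cmod (a x - b x) \<le> sqrt e" using ap[of "sqrt e"] e by auto
        have bc: "cts b" using b by (simp add: Q_def)
        have dc: "cts (a -: b)" by (intro continuous_intros a bc)
        have s: "(a \<cdot> f) \<in> sq m" "(b \<cdot> f) \<in> sq m" "(\<lambda>x. cnj (a x) * g x) \<in> sq m" "(\<lambda>x. cnj (b x) * g x) \<in> sq m"
          "(\<lambda>x. (a x - b x) * f x) \<in> sq m" "(\<lambda>x. cnj (a x - b x) * g x) \<in> sq m"
          by (intro sq_mult cc a bc dc fg)+
        have "z = y (\<lambda>x. (a x - b x) * f x) g - y f (\<lambda>x. cnj (a x - b x) * g x)"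
          using bform_diff_left[OF y s(1,2) fg(2)] bform_diff_right[OF y s(3,4) fg(1)] b(1) fg
          by (simp add: z_def Q_def left_diff_distrib)
        then have "cmod z \<le> cmod (y (\<lambda>x. (a x - b x) * f x) g) + cmod (y f (\<lambda>x. cnj (a x - b x) * g x))"
          by (simp add: norm_triangle_ineq4)
        also have "\<dots> \<le> sqrt (C * n2 m (\<lambda>x. (a x - b x) * f x)) * sqrt (n2 m g) + sqrt (C * n2 m f) * sqrt (n2 m (\<lambda>x. cnj (a x - b x) * g x))"
          by (intro add_mono bform_sqrt[OF y] s fg)
        also have "\<dots> \<le> sqrt (C * ((sqrt e)\<^sup>2 * n2 m f)) * sqrt (n2 m g) + sqrt (C * n2 m f) * sqrt ((sqrt e)\<^sup>2 * n2 m g)"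
        proof -
          have 1: "n2 m (\<lambda>x. (a x - b x) * f x) \<le> (sqrt e)\<^sup>2 * n2 m f"
            by (intro n2_mult_le fg cont_measurable dc) (use b in auto)
          have 2: "n2 m (\<lambda>x. cnj (a x - b x) * g x) \<le> (sqrt e)\<^sup>2 * n2 m g"
            by (intro n2_mult_le fg cont_measurable continuous_intros dc a bc) (use b(2) complex_mod_cnj[of "a x - b x" for x] in auto)
          show ?thesis using bform_C[OF y]
            by (intro add_mono mult_mono real_sqrt_le_mono mult_left_mono 1 2) auto
        qed
        also have "\<dots> = c * sqrt e" using e by (simp add: c_def real_sqrt_mult)
        finally show ?thesis .
      qed
      then have "cmod z \<le> 0" by (rule le_zero_if_sqrt[rotated]) (use bform_C[OF y] in \<open>auto simp: c_def\<close>)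
      then show ?thesis by (simp add: z_def)
    qed
    then show "Q a" using a by (simp add: Q_def)
  qed
  then show ?thesis by (simp add: Q_def)
qed

text \<open>By Riesz \<open>y(f, 1) = \<langle>\<psi> f, 1\<rangle>\<close>; for continuous \<open>h\<close>, \<open>y(f, h) = y(cnj h f, 1) = \<langle>\<psi> f, h\<rangle>\<close>, and such \<open>h\<close> are dense.\<close>

lemma inv_form_symbol:
  assumes y: "bform m y C" and inv: "inv_form y"
  obtains \<psi> where "\<psi> \<in> bm m" "AE x in m. (cmod (\<psi> x))\<^sup>2 \<le> C"
    "\<And>f g. f \<in> bm m \<Longrightarrow> g \<in> sq m \<Longrightarrow> y f g = ip m (\<psi> \<cdot> f) g"
proof -
  have one: "(\<lambda>x. 1) \<in> sq m" by (rule cont_sq) simp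
  have "\<exists>\<theta>\<in>sq m. \<forall>f\<in>sq m. y f (\<lambda>x. 1) = ip m f \<theta>"
  proof (rule riesz)
    show "(cmod (y f (\<lambda>x. 1)))\<^sup>2 \<le> C * n2 m f" if "f \<in> sq m" for f
    proof -
      have "cmod (y f (\<lambda>x. 1)) \<le> sqrt (C * n2 m f) * sqrt (n2 m (\<lambda>x. 1))" by (rule bform_sqrt[OF y that one])
      also have "n2 m (\<lambda>x. 1) = 1" using prob_space by (simp add: n2_def)
      finally have "(cmod (y f (\<lambda>x. 1)))\<^sup>2 \<le> (sqrt (C * n2 m f))\<^sup>2" by (intro power_mono) auto
      then show ?thesis using bform_C[OF y] by simp
    qed
  qed (use one in \<open>auto simp: bform_add_left[OF y] bform_scale_left[OF y]\<close>)
  then obtain \<theta> where \<theta>: "\<theta> \<in> sq m" "\<And>f. f \<in> sq m \<Longrightarrow> y f (\<lambda>x. 1) = ip m f \<theta>" by blast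
  define \<psi> where "\<psi> = (\<lambda>x. cnj (\<theta> x))"
  have psi: "\<psi> \<in> sq m" using \<theta> by (auto simp: sq_def \<psi>_def)
  have key: "y f g = ip m (\<psi> \<cdot> f) g" if f: "f \<in> bm m" and g: "g \<in> sq m" for f g
  proof -
    define z where "z = y f g - ip m (\<psi> \<cdot> f) g"
    have fs: "f \<in> sq m" and pf: "(\<psi> \<cdot> f) \<in> sq m" using bm_imp_sq[OF f] sq_mult_right[OF f psi] by auto
    define c where "c = sqrt (C * n2 m f) + sqrt (n2 m (\<psi> \<cdot> f))"
    have "cmod z \<le> c * sqrt e" if e: "e > 0" for e
    proof -
      obtain h where h: "cts h" "n2 m (g -: h) \<le> e" by (rule cont_dense[OF g e])
      have hs: "h \<in> sq m" by (rule cont_sq[OF h(1)])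
      have ch: "cts (\<lambda>x. cnj (h x))" by (intro continuous_intros h)
      have "y f h = y f (\<lambda>x. cnj (cnj (h x)) * 1)" by simp
      also have "\<dots> = y (\<lambda>x. cnj (h x) * f x) (\<lambda>x. 1)"
        using inv_form_cont[OF y inv ch] fs one by simp
      also have "\<dots> = ip m (\<lambda>x. cnj (h x) * f x) \<theta>" by (intro \<theta> sq_mult cont_bm ch fs)
      also have "\<dots> = ip m (\<psi> \<cdot> f) h" by (simp add: ip_def \<psi>_def mult_ac)
      finally have yh: "y f h = ip m (\<psi> \<cdot> f) h" .
      have "z = y f (g -: h) - ip m (\<psi> \<cdot> f) (g -: h)"
        by (simp add: z_def bform_diff_right[OF y g hs fs] ip_diff_right[OF g hs pf] yh)
      then have "cmod z \<le> cmod (y f (g -: h)) + cmod (ip m (\<psi> \<cdot> f) (g -: h))"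
        by (simp add: norm_triangle_ineq4)
      also have "\<dots> \<le> sqrt (C * n2 m f) * sqrt (n2 m (g -: h)) + sqrt (n2 m (\<psi> \<cdot> f)) * sqrt (n2 m (g -: h))"
        by (intro add_mono bform_sqrt[OF y] ip_Cauchy_Schwarz sq_diff fs g hs pf)
      also have "\<dots> = c * sqrt (n2 m (g -: h))" by (simp add: c_def distrib_right)
      also have "\<dots> \<le> c * sqrt e" using h bform_C[OF y] by (intro mult_left_mono) (auto simp: c_def)
      finally show ?thesis .
    qed
    then have "cmod z \<le> 0" by (rule le_zero_if_sqrt[rotated]) (use bform_C[OF y] in \<open>auto simp: c_def\<close>)
    then show ?thesis by (simp add: z_def)
  qed
  have AE: "AE x in m. (cmod (\<psi> x))\<^sup>2 \<le> C"
  proof (rule mult_upper_AE[OF psi])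
    fix f assume f: "f \<in> bm m"
    have fs: "f \<in> sq m" and pf: "(\<psi> \<cdot> f) \<in> sq m" using bm_imp_sq[OF f] sq_mult_right[OF f psi] by auto
    define a where "a = n2 m (\<psi> \<cdot> f)"
    have "complex_of_real a = y f (\<psi> \<cdot> f)" unfolding key[OF f pf] a_def by (simp add: ip_self)
    then have "cmod (complex_of_real a) = cmod (y f (\<psi> \<cdot> f))" by simp
    then have "a = cmod (y f (\<psi> \<cdot> f))" by (simp add: a_def)
    also have "\<dots> \<le> sqrt (C * n2 m f) * sqrt a" unfolding a_def by (rule bform_sqrt[OF y fs pf])
    finally have "a \<le> C * n2 m f"
      by (rule le_of_le_sqrt_mult[rotated 2]) (use bform_C[OF y] in \<open>auto simp: a_def\<close>)
    then show "n2 m (\<psi> \<cdot> f) \<le> C * n2 m f" by (simp add: a_def)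
  qed
  moreover have "\<psi> \<in> bm m"
  proof -
    have "AE x in m. cmod (\<psi> x) \<le> sqrt C" using AE by eventually_elim (rule real_le_rsqrt)
    then show ?thesis using psi by (auto simp: bm_def sq_def)
  qed
  ultimately show thesis using that key by blast
qed

end

context spherical_setting begin

section \<open>Averaging an operator into an invariant form\<close>

text \<open>Limits of sums over families along refinement.\<close>

definition netlim :: "(('k \<Rightarrow> complex) \<Rightarrow> complex) \<Rightarrow> complex \<Rightarrow> bool" where
  "netlim G z \<longleftrightarrow> ((\<lambda>us. \<Sum>w\<leftarrow>us. G w) \<longlongrightarrow> z) refining"

lemma netlim_iff:
  "netlim G z \<longleftrightarrow> (\<forall>e>0. \<exists>us\<in>sph. \<forall>ws\<in>sph. cmod ((\<Sum>w\<leftarrow>prodl ws us. G w) - z) \<le> e)"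
  unfolding netlim_def tendsto_iff dist_norm eventually_refining_sum[of "\<lambda>s. cmod (s - z) \<le> e" for e, symmetric]
proof (intro iffI allI impI)
  fix e :: real assume "\<forall>e>0. eventually (\<lambda>us. cmod ((\<Sum>w\<leftarrow>us. G w) - z) < e) refining" "e > 0"
  then have "eventually (\<lambda>us. cmod ((\<Sum>w\<leftarrow>us. G w) - z) < e) refining" by blast
  then show "eventually (\<lambda>us. cmod ((\<Sum>w\<leftarrow>us. G w) - z) \<le> e) refining" by eventually_elim simp
next
  fix e :: real assume "\<forall>e>0. eventually (\<lambda>us. cmod ((\<Sum>w\<leftarrow>us. G w) - z) \<le> e) refining" and e: "e > 0"
  then have "eventually (\<lambda>us. cmod ((\<Sum>w\<leftarrow>us. G w) - z) \<le> e/2) refining" using half_gt_zero[OF e] by blast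
  then show "eventually (\<lambda>us. cmod ((\<Sum>w\<leftarrow>us. G w) - z) < e) refining" by eventually_elim (use e in simp)
qed

lemma netlim_unique: "netlim G a \<Longrightarrow> netlim G b \<Longrightarrow> a = b"
  unfolding netlim_def by (rule tendsto_unique[OF refining_neq_bot])

lemma netlim_add: "netlim F a \<Longrightarrow> netlim G b \<Longrightarrow> netlim (\<lambda>w. F w + G w) (a + b)"
  unfolding netlim_def sum_list_addf by (rule tendsto_add)

lemma netlim_scale: "netlim F a \<Longrightarrow> netlim (\<lambda>w. c * F w) (c * a)"
  unfolding netlim_def sum_list_const_mult by (intro tendsto_mult tendsto_const)

lemma netlim_cong: assumes F: "netlim F a" and eq: "\<And>w. w \<in> A \<Longrightarrow> F w = G w" shows "netlim G a"
proof -
  have "eventually (\<lambda>us. (\<Sum>w\<leftarrow>us. F w) = (\<Sum>w\<leftarrow>us. G w)) refining" using eventually_refining_A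
    by eventually_elim (intro arg_cong[of _ _ sum_list] map_cong refl eq, blast)
  with F show ?thesis unfolding netlim_def by (rule Lim_transform_eventually)
qed

lemma netlim_exists:
  assumes cauchy: "\<And>e. e > 0 \<Longrightarrow> \<exists>us\<in>sph. \<exists>z. \<forall>ws\<in>sph. cmod ((\<Sum>w\<leftarrow>prodl ws us. G w) - z) \<le> e"
  shows "\<exists>z. netlim G z"
proof -
  have "\<forall>n. \<exists>us z. us \<in> sph \<and> (\<forall>ws\<in>sph. cmod ((\<Sum>w\<leftarrow>prodl ws us. G w) - z) \<le> inverse (Suc n))"
  proof
    fix n show "\<exists>us z. us \<in> sph \<and> (\<forall>ws\<in>sph. cmod ((\<Sum>w\<leftarrow>prodl ws us. G w) - z) \<le> inverse (Suc n))"
      using cauchy[of "inverse (Suc n)"] by auto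
  qed
  then obtain us z where us: "\<And>n. us n \<in> sph" "\<And>n ws. ws \<in> sph \<Longrightarrow> cmod ((\<Sum>w\<leftarrow>prodl ws (us n). G w) - z n) \<le> inverse (Suc n)"
    by metis
  have d: "cmod (z i - z j) \<le> inverse (Suc i) + inverse (Suc j)" for i j
  proof -
    define s where "s = (\<Sum>w\<leftarrow>prodl (us i) (us j). G w)"
    have "cmod (s - z j) \<le> inverse (Suc j)" unfolding s_def by (intro us)
    moreover have "cmod (s - z i) \<le> inverse (Suc i)" unfolding s_def sum_prodl_commute[of G "us i"] by (intro us)
    moreover have "cmod (z i - z j) \<le> cmod (s - z i) + cmod (s - z j)"
      using norm_triangle_ineq4[of "s - z j" "s - z i"] by simp
    ultimately show ?thesis by simp
  qed
  have e0: "(\<lambda>n. inverse (real (Suc n))) \<longlonglongrightarrow> 0" by (rule LIMSEQ_inverse_real_of_nat)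
  define a where "a = lim z"
  have za: "cmod (z n - a) \<le> inverse (Suc n)" for n unfolding a_def by (rule almost_Cauchy_limit(2)[OF d e0])
  have "netlim G a" unfolding netlim_iff
  proof (intro allI impI)
    fix e :: real assume e: "e > 0"
    obtain n where n: "inverse (real (Suc n)) < e/2" using reals_Archimedean[of "e/2"] e by auto
    show "\<exists>us\<in>sph. \<forall>ws\<in>sph. cmod ((\<Sum>w\<leftarrow>prodl ws us. G w) - a) \<le> e"
    proof (intro bexI[of _ "us n"] ballI us)
      fix ws assume ws: "ws \<in> sph"
      have "cmod (((\<Sum>w\<leftarrow>prodl ws (us n). G w) - z n) + (z n - a)) \<le> inverse (Suc n) + inverse (Suc n)"
        by (intro norm_triangle_mono us(2)[OF ws] za)
      then show "cmod ((\<Sum>w\<leftarrow>prodl ws (us n). G w) - a) \<le> e" using n by simp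
    qed
  qed
  then show ?thesis by blast
qed

lemma netlim_norm_le:
  assumes G: "netlim G z" and le: "\<And>us. us \<in> sph \<Longrightarrow> cmod (\<Sum>w\<leftarrow>us. G w) \<le> B"
  shows "cmod z \<le> B"
proof (rule tendsto_upperbound[OF tendsto_norm[OF G[unfolded netlim_def]] _ refining_neq_bot])
  show "eventually (\<lambda>us. cmod (\<Sum>w\<leftarrow>us. G w) \<le> B) refining"
    unfolding eventually_refining_sum[of "\<lambda>s. cmod s \<le> B"] using le[OF sph.prod] sph.one by blast
qed

lemma netlim_sum_list:
  assumes "\<And>v. v \<in> set vs \<Longrightarrow> netlim (G v) (z v)"
  shows "netlim (\<lambda>w. \<Sum>v\<leftarrow>vs. G v w) (\<Sum>v\<leftarrow>vs. z v)"
  using assms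
proof (induction vs)
  case Nil
  show ?case by (simp add: netlim_def)
next
  case (Cons v vs)
  then show ?case by (simp add: netlim_add)
qed

text \<open>If \<open>u\<close> is so fine that \<open>u f\<close> and \<open>u g\<close> are close to \<open>h = P (u f)\<close> and \<open>k = P (u g)\<close>, a further refinement changes
the sum only slightly, since the assumed equation applies to \<open>h\<close> and \<open>k\<close>. So the net of sums is Cauchy.\<close>

lemma averaged_form:
  assumes L: "bop m L C"
    and inv: "\<And>us h k. us \<in> sph \<Longrightarrow> h \<in> Hf \<Longrightarrow> k \<in> Hf \<Longrightarrow>
               (\<Sum>u\<leftarrow>us. ip m (L (u \<cdot> h)) (u \<cdot> k)) = ip m (L h) k"
  obtains y where "bform m y C" "inv_form y" "\<And>h k. h \<in> Hf \<Longrightarrow> k \<in> Hf \<Longrightarrow> y h k = ip m (L h) k"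
proof -
  define G where "G f g w = ip m (L (w \<cdot> f)) (w \<cdot> g)" for f g w
  have C: "C \<ge> 0" by (rule bop_nonneg[OF L])
  have Gb: "cmod (G f g w) \<le> (t * (C * n2 m (w \<cdot> f)) + n2 m (w \<cdot> g) / t) / 2"
    if "f \<in> sq m" "g \<in> sq m" "t > 0" "w \<in> A" for f g t w
  proof -
    have s: "(w \<cdot> f) \<in> sq m" "(w \<cdot> g) \<in> sq m" by (intro A_mult_sq that)+
    have "cmod (G f g w) \<le> (t * n2 m (L (w \<cdot> f)) + n2 m (w \<cdot> g) / t) / 2"
      unfolding G_def by (intro ip_weighted_bound bop_sq[OF L] s that)
    also have "\<dots> \<le> (t * (C * n2 m (w \<cdot> f)) + n2 m (w \<cdot> g) / t) / 2"
      using that by (intro divide_right_mono add_right_mono mult_left_mono bop_n2[OF L] s) auto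
    finally show ?thesis .
  qed
  have Gsum: "cmod (\<Sum>w\<leftarrow>ws. G f g w) \<le> (t * (C * n2 m f) + n2 m g / t) / 2"
    if "f \<in> sq m" "g \<in> sq m" "t > 0" "ws \<in> sph" for f g t ws
  proof -
    have "cmod (\<Sum>w\<leftarrow>ws. G f g w) \<le> (\<Sum>w\<leftarrow>ws. cmod (G f g w))" by (rule norm_sum_list_le)
    also have "\<dots> \<le> (\<Sum>w\<leftarrow>ws. t * C / 2 * n2 m (w \<cdot> f) + 1 / (2 * t) * n2 m (w \<cdot> g))"
    proof (intro sum_list_mono)
      fix w assume "w \<in> set ws"
      from Gb[OF that(1-3) sph_A[OF that(4) this]]
      show "cmod (G f g w) \<le> t * C / 2 * n2 m (w \<cdot> f) + 1 / (2 * t) * n2 m (w \<cdot> g)"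
        by (simp add: add_divide_distrib)
    qed
    also have "\<dots> = t * C / 2 * n2 m f + 1 / (2 * t) * n2 m g"
      by (simp only: sum_list_addf sum_list_const_mult sph_n2[OF that(4,1)] sph_n2[OF that(4,2)])
    finally show ?thesis by (simp add: add_divide_distrib)
  qed
  have Gadd_l: "G (f +: g) k w = G f k w + G g k w" if "w \<in> A" "f \<in> sq m" "g \<in> sq m" "k \<in> sq m" for f g k w
    unfolding G_def using bop_ip_add[OF L A_mult_sq[OF that(1,2)] A_mult_sq[OF that(1,3)] A_mult_sq[OF that(1,4)]]
    by (simp add: distrib_left)
  have Gadd_r: "G k (f +: g) w = G k f w + G k g w" if "w \<in> A" "f \<in> sq m" "g \<in> sq m" "k \<in> sq m" for f g k w
    unfolding G_def using ip_add_right[OF A_mult_sq[OF that(1,2)] A_mult_sq[OF that(1,3)] bop_sq[OF L A_mult_sq[OF that(1,4)]]]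
    by (simp add: distrib_left)
  have Gsc_l: "G (\<lambda>x. c * f x) k w = c * G f k w" if "w \<in> A" "f \<in> sq m" "k \<in> sq m" for f k w c
    unfolding G_def using bop_ip_scale[OF L A_mult_sq[OF that(1,2)] A_mult_sq[OF that(1,3)]]
    by (simp add: mult.left_commute)
  have Gsc_r: "G k (\<lambda>x. c * f x) w = cnj c * G k f w" for f k w c
    unfolding G_def ip_scale_right[symmetric] by (simp add: mult.left_commute)
  have Gdiff_l: "G (f -: g) k w = G f k w - G g k w" if "w \<in> A" "f \<in> sq m" "g \<in> sq m" "k \<in> sq m" for f g k w
    using Gadd_l[OF that(1,2) sq_scale[OF that(3), of "-1"] that(4)] Gsc_l[OF that(1,3,4), of "-1"] by simp
  have Gdiff_r: "G k (f -: g) w = G k f w - G k g w" if "w \<in> A" "f \<in> sq m" "g \<in> sq m" "k \<in> sq m" for f g k w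
    using Gadd_r[OF that(1,2) sq_scale[OF that(3), of "-1"] that(4)] Gsc_r[of k "-1" g w] by simp
  have GH: "(\<Sum>w\<leftarrow>ws. G h k w) = ip m (L h) k" if "ws \<in> sph" "h \<in> Hf" "k \<in> Hf" for ws h k
    unfolding G_def by (rule inv[OF that])
  have ex: "\<exists>z. netlim (G f g) z" if f: "f \<in> sq m" and g: "g \<in> sq m" for f g
  proof (rule netlim_exists)
    fix e :: real assume e: "e > 0"
    define B where "B = C + n2 m g + C * n2 m f + 1"
    have B: "B > 0" unfolding B_def using C by (intro add_nonneg_pos) auto
    define \<delta> where "\<delta> = e / B"
    have \<delta>: "\<delta> > 0" using e B by (simp add: \<delta>_def)
    have "vanish (\<lambda>w. n2 m (\<lambda>x. P (w \<cdot> f) x - 1 * (w x * f x)) + n2 m (\<lambda>x. P (w \<cdot> g) x - 1 * (w x * g x)))"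
      using symbol_P f g by (intro vanish_add) (auto simp: symbol_def)
    then obtain us where us: "us \<in> sph" "\<forall>ws\<in>sph. (\<Sum>w\<leftarrow>prodl ws us. n2 m (\<lambda>x. P (w \<cdot> f) x - 1 * (w x * f x)) + n2 m (\<lambda>x. P (w \<cdot> g) x - 1 * (w x * g x))) \<le> \<delta>\<^sup>2"
      using zero_less_power[OF \<delta>, of 2] unfolding vanish_iff by blast
    define h where "h u = P (u \<cdot> f)" for u
    define k where "k u = P (u \<cdot> g)" for u
    define E where "E u = n2 m (\<lambda>x. u x * f x - h u x)" for u
    define E' where "E' u = n2 m (\<lambda>x. u x * g x - k u x)" for u
    have se: "(\<Sum>u\<leftarrow>us. E u + E' u) \<le> \<delta>\<^sup>2"
    proof -
      have "prodl [\<lambda>_. 1] us = us" by (simp add: prodl_def)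
      then have "(\<Sum>w\<leftarrow>us. n2 m (\<lambda>x. P (w \<cdot> f) x - 1 * (w x * f x)) + n2 m (\<lambda>x. P (w \<cdot> g) x - 1 * (w x * g x))) \<le> \<delta>\<^sup>2"
        using bspec[OF us(2) sph.one] by (simp only:)
      then show ?thesis by (simp add: E_def E'_def h_def k_def n2_diff_commute)
    qed
    have uf: "(u \<cdot> f) \<in> sq m" "(u \<cdot> g) \<in> sq m" if "u \<in> set us" for u
      using that by (auto intro!: sph_mult_sq[OF us(1)] f g)
    have hH: "h u \<in> Hf" "k u \<in> Hf" if "u \<in> set us" for u
      unfolding h_def k_def using that by (auto intro!: P_Hf uf)
    define z where "z = (\<Sum>u\<leftarrow>us. ip m (L (h u)) (k u))"
    have "cmod ((\<Sum>w\<leftarrow>prodl ws us. G f g w) - z) \<le> e" if ws: "ws \<in> sph" for ws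
    proof -
      have eq: "(\<Sum>w\<leftarrow>prodl ws us. G f g w) - z = (\<Sum>u\<leftarrow>us. (\<Sum>w\<leftarrow>ws. G (\<lambda>x. u x * f x - h u x) (u \<cdot> g) w) + (\<Sum>w\<leftarrow>ws. G (h u) (\<lambda>x. u x * g x - k u x) w))"
      proof -
        have "(\<Sum>w\<leftarrow>prodl ws us. G f g w) = (\<Sum>u\<leftarrow>us. \<Sum>w\<leftarrow>ws. G (u \<cdot> f) (u \<cdot> g) w)"
          unfolding sum_prodl by (subst sum_list_swap') (simp add: G_def mult.assoc)
        moreover have "z = (\<Sum>u\<leftarrow>us. \<Sum>w\<leftarrow>ws. G (h u) (k u) w)"
          unfolding z_def by (intro arg_cong[of _ _ sum_list] map_cong refl GH[symmetric] ws hH)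
        ultimately have "(\<Sum>w\<leftarrow>prodl ws us. G f g w) - z = (\<Sum>u\<leftarrow>us. \<Sum>w\<leftarrow>ws. G (u \<cdot> f) (u \<cdot> g) w - G (h u) (k u) w)"
          by (simp add: sum_list_subtractf)
        also have "\<dots> = (\<Sum>u\<leftarrow>us. \<Sum>w\<leftarrow>ws. G (\<lambda>x. u x * f x - h u x) (u \<cdot> g) w + G (h u) (\<lambda>x. u x * g x - k u x) w)"
        proof (intro arg_cong[of _ _ sum_list] map_cong refl)
          fix u w assume u: "u \<in> set us" and w: "w \<in> set ws"
          note wA = sph_A[OF ws w]
          show "G (u \<cdot> f) (u \<cdot> g) w - G (h u) (k u) w = G (\<lambda>x. u x * f x - h u x) (u \<cdot> g) w + G (h u) (\<lambda>x. u x * g x - k u x) w"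
            using Gdiff_l[OF wA uf(1)[OF u] Hf_sq[OF hH(1)[OF u]] uf(2)[OF u]] Gdiff_r[OF wA uf(2)[OF u] Hf_sq[OF hH(2)[OF u]] Hf_sq[OF hH(1)[OF u]]] by simp
        qed
        finally show ?thesis by (simp only: sum_list_addf)
      qed
      have "cmod ((\<Sum>w\<leftarrow>prodl ws us. G f g w) - z) \<le> (\<Sum>u\<leftarrow>us. cmod ((\<Sum>w\<leftarrow>ws. G (\<lambda>x. u x * f x - h u x) (u \<cdot> g) w) + (\<Sum>w\<leftarrow>ws. G (h u) (\<lambda>x. u x * g x - k u x) w)))"
        unfolding eq by (rule norm_sum_list_le)
      also have "\<dots> \<le> (\<Sum>u\<leftarrow>us. (C + 1) / (2 * \<delta>) * (E u + E' u) + \<delta> / 2 * n2 m (u \<cdot> g) + \<delta> * C / 2 * n2 m (u \<cdot> f))"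
      proof (intro sum_list_mono)
        fix u assume u: "u \<in> set us"
        have s: "(\<lambda>x. u x * f x - h u x) \<in> sq m" "(\<lambda>x. u x * g x - k u x) \<in> sq m" "h u \<in> sq m"
          using uf[OF u] hH[OF u] by (auto intro: sq_diff Hf_sq)
        have 1: "cmod (\<Sum>w\<leftarrow>ws. G (\<lambda>x. u x * f x - h u x) (u \<cdot> g) w) \<le> (1/\<delta> * (C * E u) + n2 m (u \<cdot> g) / (1/\<delta>)) / 2"
          unfolding E_def using \<delta> by (intro Gsum s uf u ws) auto
        have 2: "cmod (\<Sum>w\<leftarrow>ws. G (h u) (\<lambda>x. u x * g x - k u x) w) \<le> (\<delta> * (C * n2 m (h u)) + E' u / \<delta>) / 2"
          unfolding E'_def using \<delta> by (intro Gsum s ws) auto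
        have hu: "n2 m (h u) \<le> n2 m (u \<cdot> f)" unfolding h_def using bop_n2[OF bop_P uf(1)[OF u]] by simp
        have "\<delta> * (C * n2 m (h u)) \<le> \<delta> * (C * n2 m (u \<cdot> f))"
          using hu \<delta> C by (intro mult_left_mono) auto
        then have "cmod ((\<Sum>w\<leftarrow>ws. G (\<lambda>x. u x * f x - h u x) (u \<cdot> g) w) + (\<Sum>w\<leftarrow>ws. G (h u) (\<lambda>x. u x * g x - k u x) w))
          \<le> (1/\<delta> * (C * E u) + n2 m (u \<cdot> g) / (1/\<delta>)) / 2 + (\<delta> * (C * n2 m (u \<cdot> f)) + E' u / \<delta>) / 2"
          using 1 2 by (intro norm_triangle_le) argo
        also have "\<dots> = (C * E u + E' u) / (2 * \<delta>) + \<delta> / 2 * n2 m (u \<cdot> g) + \<delta> * C / 2 * n2 m (u \<cdot> f)"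
          using \<delta> by (simp add: field_simps)
        also have "(C * E u + E' u) / (2 * \<delta>) \<le> (C + 1) * (E u + E' u) / (2 * \<delta>)"
        proof -
          have "0 \<le> C * E' u" "0 \<le> E u" using C by (auto simp: E_def E'_def)
          then have "C * E u + E' u \<le> (C + 1) * (E u + E' u)" by (simp add: algebra_simps)
          then show ?thesis using \<delta> by (intro divide_right_mono) auto
        qed
        finally show "cmod ((\<Sum>w\<leftarrow>ws. G (\<lambda>x. u x * f x - h u x) (u \<cdot> g) w) + (\<Sum>w\<leftarrow>ws. G (h u) (\<lambda>x. u x * g x - k u x) w))
          \<le> (C + 1) / (2 * \<delta>) * (E u + E' u) + \<delta> / 2 * n2 m (u \<cdot> g) + \<delta> * C / 2 * n2 m (u \<cdot> f)" by simp
      qed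
      also have "\<dots> = (C + 1) / (2 * \<delta>) * (\<Sum>u\<leftarrow>us. E u + E' u) + \<delta> / 2 * n2 m g + \<delta> * C / 2 * n2 m f"
        by (simp only: sum_list_addf[of "\<lambda>u. (C + 1) / (2 * \<delta>) * (E u + E' u) + \<delta> / 2 * n2 m (u \<cdot> g)"]
           sum_list_addf[of "\<lambda>u. (C + 1) / (2 * \<delta>) * (E u + E' u)"] sum_list_const_mult sph_n2[OF us(1) f] sph_n2[OF us(1) g])
      also have "\<dots> \<le> (C + 1) / (2 * \<delta>) * \<delta>\<^sup>2 + \<delta> / 2 * n2 m g + \<delta> * C / 2 * n2 m f"
        using C \<delta> by (intro add_right_mono mult_left_mono se) auto
      also have "\<dots> = \<delta> * B / 2" using \<delta> by (simp add: B_def field_simps power2_eq_square)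
      also have "\<dots> \<le> e" using B e by (simp add: \<delta>_def)
      finally show ?thesis .
    qed
    then show "\<exists>us\<in>sph. \<exists>z. \<forall>ws\<in>sph. cmod ((\<Sum>w\<leftarrow>prodl ws us. G f g w) - z) \<le> e" using us(1) by blast
  qed
  define y where "y f g = (SOME z. netlim (G f g) z)" for f g
  have yl: "netlim (G f g) (y f g)" if "f \<in> sq m" "g \<in> sq m" for f g
    unfolding y_def by (rule someI_ex[OF ex[OF that]])
  have yeq: "y f g = z" if "f \<in> sq m" "g \<in> sq m" "netlim (G f g) z" for f g z
    using netlim_unique[OF yl[OF that(1,2)] that(3)] .
  have bf: "bform m y C"
    unfolding bform_def
  proof (intro conjI ballI allI impI C)
    fix f g k assume *: "f \<in> sq m" "g \<in> sq m" "k \<in> sq m"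
    show "y (f +: g) k = y f k + y g k"
      by (intro yeq sq_add * netlim_cong[OF netlim_add[OF yl[OF *(1,3)] yl[OF *(2,3)]]] Gadd_l[symmetric])
    show "y k (f +: g) = y k f + y k g"
      by (intro yeq sq_add * netlim_cong[OF netlim_add[OF yl[OF *(3,1)] yl[OF *(3,2)]]] Gadd_r[symmetric])
  next
    fix c f k assume *: "f \<in> sq m" "k \<in> sq m"
    show "y (\<lambda>x. c * f x) k = c * y f k"
      by (intro yeq sq_scale * netlim_cong[OF netlim_scale[OF yl[OF *(1,2)]]] Gsc_l[symmetric])
    show "y k (\<lambda>x. c * f x) = cnj c * y k f"
      by (intro yeq sq_scale * netlim_cong[OF netlim_scale[OF yl[OF *(2,1)]]] Gsc_r[symmetric])
  next
    fix f g and t :: real assume *: "f \<in> sq m" "g \<in> sq m" "t > 0"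
    show "cmod (y f g) \<le> (t * (C * n2 m f) + n2 m g / t) / 2"
      by (rule netlim_norm_le[OF yl[OF *(1,2)] Gsum[OF *]])
  qed
  have iv: "inv_form y"
    unfolding inv_form_def
  proof (intro ballI)
    fix vs f g assume vs: "vs \<in> sph" and f: "f \<in> sq m" and g: "g \<in> sq m"
    have 1: "netlim (\<lambda>w. \<Sum>v\<leftarrow>vs. G (v \<cdot> f) (v \<cdot> g) w) (\<Sum>v\<leftarrow>vs. y (v \<cdot> f) (v \<cdot> g))"
      by (intro netlim_sum_list yl sph_mult_sq[OF vs] f g)
    have 2: "netlim (\<lambda>w. \<Sum>v\<leftarrow>vs. G (v \<cdot> f) (v \<cdot> g) w) (y f g)"
      unfolding netlim_iff
    proof (intro allI impI)
      fix e :: real assume "e > 0"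
      then obtain us where us: "us \<in> sph" "\<And>ws. ws \<in> sph \<Longrightarrow> cmod ((\<Sum>w\<leftarrow>prodl ws us. G f g w) - y f g) \<le> e"
        using yl[OF f g] unfolding netlim_iff by blast
      show "\<exists>us\<in>sph. \<forall>ws\<in>sph. cmod ((\<Sum>w\<leftarrow>prodl ws us. \<Sum>v\<leftarrow>vs. G (v \<cdot> f) (v \<cdot> g) w) - y f g) \<le> e"
      proof (intro bexI[of _ us] ballI us)
        fix ws assume ws: "ws \<in> sph"
        have "(\<Sum>w\<leftarrow>prodl ws us. \<Sum>v\<leftarrow>vs. G (v \<cdot> f) (v \<cdot> g) w) = (\<Sum>w\<leftarrow>prodl (prodl ws us) vs. G f g w)"
          by (simp add: sum_prodl[of _ _ vs] G_def mult.assoc)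
        also have "\<dots> = (\<Sum>w\<leftarrow>prodl ws (prodl us vs). G f g w)" by (rule sum_prodl_assoc)
        also have "\<dots> = (\<Sum>w\<leftarrow>prodl (prodl ws vs) us. G f g w)" by (rule sum_prodl3)
        finally show "cmod ((\<Sum>w\<leftarrow>prodl ws us. \<Sum>v\<leftarrow>vs. G (v \<cdot> f) (v \<cdot> g) w) - y f g) \<le> e"
          using us(2)[OF sph.prod[OF ws vs]] by simp
      qed
    qed
    show "(\<Sum>v\<leftarrow>vs. y (v \<cdot> f) (v \<cdot> g)) = y f g"
      by (rule netlim_unique[OF 1 2])
  qed
  have "y h k = ip m (L h) k" if "h \<in> Hf" "k \<in> Hf" for h k
  proof (intro yeq Hf_sq that)
    show "netlim (G h k) (ip m (L h) k)"
      unfolding netlim_iff using GH[OF sph.prod[OF _ sph.one] that] sph.one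
      by (auto intro!: bexI[of _ "[\<lambda>_. 1]"])
  qed
  then show thesis using that bf iv by blast
qed

theorem brown_halmos_function:
  assumes L: "bop m L C"
    and inv: "\<And>us h k. us \<in> sph \<Longrightarrow> h \<in> Hf \<Longrightarrow> k \<in> Hf \<Longrightarrow>
               (\<Sum>u\<leftarrow>us. ip m (L (u \<cdot> h)) (u \<cdot> k)) = ip m (L h) k"
  obtains \<psi> where "\<psi> \<in> bm m" "AE x in m. (cmod (\<psi> x))\<^sup>2 \<le> C"
    "\<And>h k. h \<in> Hf \<Longrightarrow> k \<in> Hf \<Longrightarrow> ip m (L h) k = ip m (\<psi> \<cdot> h) k"
proof -
  obtain y where y: "bform m y C" "inv_form y" "\<And>h k. h \<in> Hf \<Longrightarrow> k \<in> Hf \<Longrightarrow> y h k = ip m (L h) k"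
    by (rule averaged_form[OF L inv]) auto
  obtain \<psi> where psi: "\<psi> \<in> bm m" "AE x in m. (cmod (\<psi> x))\<^sup>2 \<le> C"
    "\<And>f g. f \<in> bm m \<Longrightarrow> g \<in> sq m \<Longrightarrow> y f g = ip m (\<psi> \<cdot> f) g" by (rule inv_form_symbol[OF y(1,2)]) auto
  obtain D where D: "bop m (\<lambda>f x. \<psi> x * f x) D" by (rule bop_mult[OF psi(1)])
  have "ip m (L h) k = ip m (\<psi> \<cdot> h) k" if h: "h \<in> Hf" and k: "k \<in> Hf" for h k
  proof -
    define z where "z = ip m (L h) k - ip m (\<psi> \<cdot> h) k"
    note sqs = Hf_sq[OF h] Hf_sq[OF k]
    define c where "c = (sqrt C + sqrt D) * sqrt (n2 m k)"
    have cd: "C \<ge> 0" "D \<ge> 0" using bop_nonneg L D by auto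
    have "cmod z \<le> c * sqrt e" if e: "e > 0" for e
    proof -
      obtain a where a: "a \<in> A" "n2 m (h -: a) \<le> e" by (rule Hf_approx[OF h e])
      note as = A_sq[OF a(1)]
      have d: "(h -: a) \<in> sq m" by (intro sq_diff sqs as)
      have "ip m (L a) k = ip m (\<psi> \<cdot> a) k"
        using y(3)[OF A_Hf[OF a(1)] k] psi(3)[OF A_bm[OF a(1)] sqs(2)] by simp
      moreover have "ip m (L h) k = ip m (L (h -: a)) k + ip m (L a) k"
        using bop_ip_add[OF L d as sqs(2)] by simp
      moreover have "ip m (\<psi> \<cdot> h) k = ip m (\<lambda>x. \<psi> x * (h x - a x)) k + ip m (\<psi> \<cdot> a) k"
        using bop_ip_add[OF D d as sqs(2)] by simp
      ultimately have "z = ip m (L (h -: a)) k - ip m (\<lambda>x. \<psi> x * (h x - a x)) k" by (simp add: z_def)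
      then have "cmod z \<le> cmod (ip m (L (h -: a)) k) + cmod (ip m (\<lambda>x. \<psi> x * (h x - a x)) k)"
        by (simp add: norm_triangle_ineq4)
      also have "\<dots> \<le> sqrt (n2 m (L (h -: a))) * sqrt (n2 m k) + sqrt (n2 m (\<lambda>x. \<psi> x * (h x - a x))) * sqrt (n2 m k)"
        by (intro add_mono ip_Cauchy_Schwarz bop_sq[OF L] d sq_mult psi sqs)
      also have "\<dots> \<le> sqrt (C * e) * sqrt (n2 m k) + sqrt (D * e) * sqrt (n2 m k)"
        using order_trans[OF bop_n2[OF L d] mult_left_mono[OF a(2) cd(1)]]
          order_trans[OF bop_n2[OF D d] mult_left_mono[OF a(2) cd(2)]]
        by (intro add_mono mult_right_mono real_sqrt_le_mono) auto
      also have "\<dots> = c * sqrt e" by (simp add: c_def real_sqrt_mult algebra_simps)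
      finally show ?thesis .
    qed
    then have "cmod z \<le> 0" by (rule le_zero_if_sqrt[rotated]) (use cd in \<open>auto simp: c_def\<close>)
    then show ?thesis by (simp add: z_def)
  qed
  then show thesis using that psi by blast
qed

end


section \<open>Normed star-algebras and closed ideals\<close>

text \<open>The common algebra of \<open>L\<^sup>\<infinity>\<close> and the operators on the Hardy space: a normed algebra with isometric
involution.\<close>

locale star_ring = ring R for R :: "'a star_alg" (structure) +
  assumes smult_closed: "x \<in> carrier R \<Longrightarrow> c \<odot> x \<in> carrier R"
    and smult_neg: "x \<in> carrier R \<Longrightarrow> (-1) \<odot> x = \<ominus> x"
    and smult_mult: "x \<in> carrier R \<Longrightarrow> y \<in> carrier R \<Longrightarrow> c \<odot> (x \<otimes> y) = (c \<odot> x) \<otimes> y"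
    and norm_ge0: "x \<in> carrier R \<Longrightarrow> 0 \<le> anorm R x"
    and norm_0: "x \<in> carrier R \<Longrightarrow> anorm R x = 0 \<Longrightarrow> x = \<zero>"
    and norm_zero: "anorm R \<zero> = 0"
    and norm_tri: "x \<in> carrier R \<Longrightarrow> y \<in> carrier R \<Longrightarrow> anorm R (x \<oplus> y) \<le> anorm R x + anorm R y"
    and norm_mult: "x \<in> carrier R \<Longrightarrow> y \<in> carrier R \<Longrightarrow> anorm R (x \<otimes> y) \<le> anorm R x * anorm R y"
    and norm_smult: "x \<in> carrier R \<Longrightarrow> anorm R (c \<odot> x) \<le> cmod c * anorm R x"
    and adj_closed: "x \<in> carrier R \<Longrightarrow> adj R x \<in> carrier R"
    and adj_add: "x \<in> carrier R \<Longrightarrow> y \<in> carrier R \<Longrightarrow> adj R (x \<oplus> y) = adj R x \<oplus> adj R y"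
    and adj_mult: "x \<in> carrier R \<Longrightarrow> y \<in> carrier R \<Longrightarrow> adj R (x \<otimes> y) = adj R y \<otimes> adj R x"
    and adj_smult: "x \<in> carrier R \<Longrightarrow> adj R (c \<odot> x) = cnj c \<odot> adj R x"
    and adj_adj: "x \<in> carrier R \<Longrightarrow> adj R (adj R x) = x"
    and norm_adj_le: "x \<in> carrier R \<Longrightarrow> anorm R (adj R x) \<le> anorm R x"
begin

lemma norm_adj: "x \<in> carrier R \<Longrightarrow> anorm R (adj R x) = anorm R x"
  using norm_adj_le[of x] norm_adj_le[of "adj R x"] adj_adj[of x] adj_closed[of x] by simp

lemma norm_neg: "x \<in> carrier R \<Longrightarrow> anorm R (\<ominus> x) = anorm R x"
  using norm_smult[of x "-1"] norm_smult[of "\<ominus> x" "-1"] smult_neg[of x] smult_neg[of "\<ominus> x"] by simp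

lemma adj_neg: "x \<in> carrier R \<Longrightarrow> adj R (\<ominus> x) = \<ominus> adj R x"
  using adj_smult[of x "-1"] smult_neg[of x] smult_neg[of "adj R x"] by (simp add: adj_closed)

lemma adj_minus: "x \<in> carrier R \<Longrightarrow> y \<in> carrier R \<Longrightarrow> adj R (x \<ominus> y) = adj R x \<ominus> adj R y"
  by (simp add: a_minus_def adj_add adj_neg)

lemma norm_minus_commute': "x \<in> carrier R \<Longrightarrow> y \<in> carrier R \<Longrightarrow> anorm R (x \<ominus> y) = anorm R (y \<ominus> x)"
proof -
  assume xy: "x \<in> carrier R" "y \<in> carrier R"
  then have "x \<ominus> y = \<ominus> (y \<ominus> x)" by (simp add: a_minus_def minus_add a_comm)
  then show ?thesis using xy by (simp add: norm_neg)
qed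

lemma norm_minus_tri: "x \<in> carrier R \<Longrightarrow> y \<in> carrier R \<Longrightarrow> z \<in> carrier R \<Longrightarrow>
    anorm R (x \<ominus> z) \<le> anorm R (x \<ominus> y) + anorm R (y \<ominus> z)"
proof -
  assume xy: "x \<in> carrier R" "y \<in> carrier R" "z \<in> carrier R"
  then have "x \<ominus> z = (x \<ominus> y) \<oplus> (y \<ominus> z)"
    by (simp add: a_minus_def a_assoc r_neg1)
  then show ?thesis using xy norm_tri[of "x \<ominus> y" "y \<ominus> z"] by simp
qed

lemma minus_self: "x \<in> carrier R \<Longrightarrow> x \<ominus> x = \<zero>" by (simp add: a_minus_def r_neg)

lemma eq_if_norm_le:
  assumes "x \<in> carrier R" "y \<in> carrier R" "\<And>e. e > 0 \<Longrightarrow> anorm R (x \<ominus> y) \<le> e"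
  shows "x = y"
proof -
  have "anorm R (x \<ominus> y) \<le> 0 + e" if "e > 0" for e using assms(3)[OF that] by simp
  then have "anorm R (x \<ominus> y) \<le> 0" by (rule field_le_epsilon)
  then have "x \<ominus> y = \<zero>" using norm_ge0[of "x \<ominus> y"] norm_0[of "x \<ominus> y"] assms by simp
  moreover have "x = (x \<ominus> y) \<oplus> y" using assms by (simp add: a_minus_def a_assoc l_neg)
  ultimately show ?thesis using assms by simp
qed

lemma cstar_subalgebra_carrier: "cstar_subalgebra R (carrier R)"
  by (auto simp: cstar_subalgebra_def complex_subalgebra_def norm_closed_def smult_closed adj_closed)

end

text \<open>The ideals of the exact sequences live in subalgebras; carrying the subalgebra as a set \<open>S\<close> keeps the operations
of the ambient algebra.\<close>

locale unital_subalgebra = star_ring +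
  fixes S
  assumes S: "complex_subalgebra R S" and one_S: "\<one> \<in> S"
begin

abbreviation "RS \<equiv> R\<lparr>carrier := S\<rparr>"

lemma S_sub: "x \<in> S \<Longrightarrow> x \<in> carrier R"
  and S_zero: "\<zero> \<in> S"
  and S_add: "x \<in> S \<Longrightarrow> y \<in> S \<Longrightarrow> x \<oplus> y \<in> S"
  and S_mult: "x \<in> S \<Longrightarrow> y \<in> S \<Longrightarrow> x \<otimes> y \<in> S"
  and S_smult: "x \<in> S \<Longrightarrow> c \<odot> x \<in> S"
  using S by (auto simp: complex_subalgebra_def)

lemma S_neg: "x \<in> S \<Longrightarrow> \<ominus> x \<in> S" using S_smult[of x "-1"] smult_neg[OF S_sub] by simp

lemma S_minus: "x \<in> S \<Longrightarrow> y \<in> S \<Longrightarrow> x \<ominus> y \<in> S" by (simp add: a_minus_def S_add S_neg)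

lemma ring_RS: "ring RS"
proof (rule ringI)
  show "abelian_group RS"
  proof (rule abelian_groupI)
    show "\<exists>y\<in>carrier RS. y \<oplus>\<^bsub>RS\<^esub> x = \<zero>\<^bsub>RS\<^esub>" if "x \<in> carrier RS" for x
      using that by (intro bexI[of _ "\<ominus> x"]) (auto simp: S_sub S_neg l_neg)
    show "x \<oplus>\<^bsub>RS\<^esub> y = y \<oplus>\<^bsub>RS\<^esub> x" if "x \<in> carrier RS" "y \<in> carrier RS" for x y
      using that by (simp add: S_sub a_comm)
  qed (auto simp: S_add S_zero S_sub a_assoc)
  show "monoid RS"
    by (rule monoidI) (auto simp: S_mult one_S S_sub m_assoc)
qed (auto simp: S_sub l_distr r_distr)

sublocale RS: ring RS by (rule ring_RS)

lemma RS_neg: "x \<in> S \<Longrightarrow> \<ominus>\<^bsub>RS\<^esub> x = \<ominus> x"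
proof -
  assume x: "x \<in> S"
  have "(\<ominus> x) \<oplus>\<^bsub>RS\<^esub> x = \<zero>\<^bsub>RS\<^esub>" using x by (simp add: S_sub l_neg)
  then show ?thesis using x by (intro RS.minus_equality) (auto simp: S_neg)
qed

lemma RS_minus: "x \<in> S \<Longrightarrow> y \<in> S \<Longrightarrow> x \<ominus>\<^bsub>RS\<^esub> y = x \<ominus> y"
  by (simp add: a_minus_def RS_neg)

end

locale star_subring = unital_subalgebra +
  assumes S_adj: "x \<in> S \<Longrightarrow> adj R x \<in> S"
    and S_closed: "norm_closed R S"
begin

lemma closed_ideal_RS_iff:
  "closed_ideal RS I \<longleftrightarrow> I \<subseteq> S \<and> \<zero> \<in> I \<and> (\<forall>x\<in>I. \<forall>y\<in>I. x \<oplus> y \<in> I)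
     \<and> (\<forall>x\<in>I. \<forall>y\<in>S. x \<otimes> y \<in> I \<and> y \<otimes> x \<in> I)
     \<and> (\<forall>x\<in>S. (\<forall>e>0. \<exists>y\<in>I. anorm R (x \<ominus> y) < e) \<longrightarrow> x \<in> I)" (is "?l \<longleftrightarrow> ?r")
proof
  assume l: ?l
  then have i: "ideal I RS" and n: "norm_closed RS I" by (auto simp: closed_ideal_def)
  have sub: "I \<subseteq> S" using ideal.axioms(1)[OF i] additive_subgroup.a_subset by fastforce
  have cl: "x \<in> I" if xS: "x \<in> S" and xap: "\<forall>e>0. \<exists>y\<in>I. anorm R (x \<ominus> y) < e" for x
  proof -
    have "\<forall>e>0. \<exists>y\<in>I. anorm RS (x \<ominus>\<^bsub>RS\<^esub> y) < e"
    proof (intro allI impI)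
      fix e :: real assume "e > 0"
      then obtain y where "y \<in> I" "anorm R (x \<ominus> y) < e" using xap by blast
      then show "\<exists>y\<in>I. anorm RS (x \<ominus>\<^bsub>RS\<^esub> y) < e" using sub xS RS_minus[of x y] by (intro bexI[of _ y]) auto
    qed
    then show ?thesis using n xS unfolding norm_closed_def by simp
  qed
  have z: "\<zero> \<in> I" using additive_subgroup.zero_closed[OF ideal.axioms(1)[OF i]] by simp
  have ad: "x \<oplus> y \<in> I" if "x \<in> I" "y \<in> I" for x y
    using additive_subgroup.a_closed[OF ideal.axioms(1)[OF i] that] by simp
  have m: "x \<otimes> y \<in> I" "y \<otimes> x \<in> I" if "x \<in> I" "y \<in> S" for x y
    using ideal.I_r_closed[OF i that(1), of y] ideal.I_l_closed[OF i that(1), of y] that(2) by simp_all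
  show ?r
  proof (intro conjI ballI impI)
    fix x assume "x \<in> S" "\<forall>e>0. \<exists>y\<in>I. anorm R (x \<ominus> y) < e"
    then show "x \<in> I" by (rule cl)
  qed (use sub in \<open>auto intro: z ad m\<close>)
next
  assume r: ?r
  then have sub: "I \<subseteq> S" and z: "\<zero> \<in> I" and ad: "\<And>x y. x \<in> I \<Longrightarrow> y \<in> I \<Longrightarrow> x \<oplus> y \<in> I"
    and m: "\<And>x y. x \<in> I \<Longrightarrow> y \<in> S \<Longrightarrow> x \<otimes> y \<in> I" "\<And>x y. x \<in> I \<Longrightarrow> y \<in> S \<Longrightarrow> y \<otimes> x \<in> I"
    and cl: "\<And>x. x \<in> S \<Longrightarrow> (\<forall>e>0. \<exists>y\<in>I. anorm R (x \<ominus> y) < e) \<Longrightarrow> x \<in> I" by blast+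
  have neg: "\<ominus> x \<in> I" if "x \<in> I" for x
  proof -
    have "x \<otimes> (\<ominus> \<one>) \<in> I" using m(1)[OF that S_neg[OF one_S]] .
    then show ?thesis using that sub by (auto simp: r_minus S_sub)
  qed
  have "subgroup I (add_monoid RS)"
  proof (rule group.subgroupI)
    show "group (add_monoid RS)" using RS.a_group .
    show "I \<noteq> {}" using z by blast
    fix a assume a: "a \<in> I"
    have "inv\<^bsub>add_monoid RS\<^esub> a = \<ominus>\<^bsub>RS\<^esub> a" by (simp add: a_inv_def)
    then show "inv\<^bsub>add_monoid RS\<^esub> a \<in> I" using a sub neg RS_neg by auto
  qed (use sub ad in auto)
  then have "ideal I RS"
    by (intro idealI ring_RS) (auto intro: m)
  moreover have "norm_closed RS I"
    unfolding norm_closed_def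
  proof (intro ballI impI)
    fix x assume x: "x \<in> carrier RS" and ap: "\<forall>e>0. \<exists>y\<in>I. anorm RS (x \<ominus>\<^bsub>RS\<^esub> y) < e"
    have "\<forall>e>0. \<exists>y\<in>I. anorm R (x \<ominus> y) < e"
    proof (intro allI impI)
      fix e :: real assume "e > 0"
      then obtain y where "y \<in> I" "anorm RS (x \<ominus>\<^bsub>RS\<^esub> y) < e" using ap by blast
      then show "\<exists>y\<in>I. anorm R (x \<ominus> y) < e" using sub x RS_minus[of x y] by (intro bexI[of _ y]) auto
    qed
    then show "x \<in> I" using cl x by simp
  qed
  ultimately show ?l by (simp add: closed_ideal_def)
qed

lemma closed_ideal_generated_closed:
  assumes "G \<subseteq> S"
  shows "closed_ideal RS (closed_ideal_generated RS G)" and "G \<subseteq> closed_ideal_generated RS G"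
proof -
  have c: "closed_ideal RS S"
    unfolding closed_ideal_RS_iff by (auto simp: S_zero S_add S_mult)
  show "closed_ideal RS (closed_ideal_generated RS G)"
    unfolding closed_ideal_RS_iff
  proof (intro conjI ballI impI)
    show "closed_ideal_generated RS G \<subseteq> S"
      unfolding closed_ideal_generated_def using c assms by blast
    fix x assume x: "x \<in> S" and ap: "\<forall>e>0. \<exists>y\<in>closed_ideal_generated RS G. anorm R (x \<ominus> y) < e"
    show "x \<in> closed_ideal_generated RS G"
      unfolding closed_ideal_generated_def
    proof (rule InterI)
      fix I assume "I \<in> {I. closed_ideal RS I \<and> G \<subseteq> I}"
      then have I: "closed_ideal RS I" "G \<subseteq> I" by auto
      have "\<forall>e>0. \<exists>y\<in>I. anorm R (x \<ominus> y) < e"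
        using ap I unfolding closed_ideal_generated_def by blast
      then show "x \<in> I" using I(1) x unfolding closed_ideal_RS_iff by blast
    qed
  qed (unfold closed_ideal_generated_def, auto simp: closed_ideal_RS_iff)
  show "G \<subseteq> closed_ideal_generated RS G" unfolding closed_ideal_generated_def by blast
qed

lemma closed_ideal_generated_least:
  "closed_ideal RS I \<Longrightarrow> G \<subseteq> I \<Longrightarrow> closed_ideal_generated RS G \<subseteq> I"
  unfolding closed_ideal_generated_def by blast

lemma closed_ideal_generated_adj:
  assumes G: "G \<subseteq> S" and adj: "\<And>x. x \<in> G \<Longrightarrow> adj R x \<in> G" and x: "x \<in> closed_ideal_generated RS G"
  shows "adj R x \<in> closed_ideal_generated RS G"
  unfolding closed_ideal_generated_def
proof (rule InterI)
  fix I assume "I \<in> {I. closed_ideal RS I \<and> G \<subseteq> I}"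
  then have I: "closed_ideal RS I" "G \<subseteq> I" by auto
  then have sub: "I \<subseteq> S" and z: "\<zero> \<in> I" and ad: "\<And>x y. x \<in> I \<Longrightarrow> y \<in> I \<Longrightarrow> x \<oplus> y \<in> I"
    and mm: "\<And>x y. x \<in> I \<Longrightarrow> y \<in> S \<Longrightarrow> x \<otimes> y \<in> I" "\<And>x y. x \<in> I \<Longrightarrow> y \<in> S \<Longrightarrow> y \<otimes> x \<in> I"
    and cl: "\<And>x. x \<in> S \<Longrightarrow> (\<forall>e>0. \<exists>y\<in>I. anorm R (x \<ominus> y) < e) \<Longrightarrow> x \<in> I"
    unfolding closed_ideal_RS_iff by blast+
  have az: "adj R \<zero> = \<zero>"
    using norm_0[of "adj R \<zero>"] norm_adj[of \<zero>] norm_zero adj_closed by simp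
  define I' where "I' = {x \<in> S. adj R x \<in> I}"
  have "closed_ideal RS I'"
    unfolding closed_ideal_RS_iff
  proof (intro conjI ballI impI)
    fix x assume x: "x \<in> S" and ap: "\<forall>e>0. \<exists>y\<in>I'. anorm R (x \<ominus> y) < e"
    have "\<forall>e>0. \<exists>y\<in>I. anorm R (adj R x \<ominus> y) < e"
    proof (intro allI impI)
      fix e :: real assume "e > 0"
      then obtain y where y: "y \<in> I'" "anorm R (x \<ominus> y) < e" using ap by blast
      then have "y \<in> S" "adj R y \<in> I" by (auto simp: I'_def)
      moreover have "anorm R (adj R x \<ominus> adj R y) = anorm R (x \<ominus> y)"
        using adj_minus[of x y] norm_adj[of "x \<ominus> y"] x \<open>y \<in> S\<close> S_sub by simp
      ultimately show "\<exists>y\<in>I. anorm R (adj R x \<ominus> y) < e" using y(2) by (intro bexI[of _ "adj R y"]) auto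
    qed
    then show "x \<in> I'" using cl[OF S_adj[OF x]] x by (simp add: I'_def)
  qed (auto simp: I'_def S_zero az z S_add S_mult S_sub adj_add adj_mult ad mm S_adj)
  moreover have "G \<subseteq> I'" using G adj I(2) by (auto simp: I'_def)
  ultimately have "closed_ideal_generated RS G \<subseteq> I'" by (rule closed_ideal_generated_least)
  then show "adj R x \<in> I" using x by (auto simp: I'_def)
qed

definition cong_mod :: "'a set \<Rightarrow> 'a \<Rightarrow> 'a \<Rightarrow> bool" where
  "cong_mod I x y \<longleftrightarrow> x \<in> S \<and> y \<in> S \<and> x \<ominus> y \<in> I"

context
  fixes I assumes I: "closed_ideal RS I"
begin

lemma ideal_facts:
  shows ideal_sub: "x \<in> I \<Longrightarrow> x \<in> S" and ideal_zero: "\<zero> \<in> I" and ideal_add: "x \<in> I \<Longrightarrow> y \<in> I \<Longrightarrow> x \<oplus> y \<in> I"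
    and ideal_mult_r: "x \<in> I \<Longrightarrow> y \<in> S \<Longrightarrow> x \<otimes> y \<in> I" and ideal_mult_l: "x \<in> I \<Longrightarrow> y \<in> S \<Longrightarrow> y \<otimes> x \<in> I"
    and ideal_closed: "x \<in> S \<Longrightarrow> (\<And>e. e > 0 \<Longrightarrow> \<exists>y\<in>I. anorm R (x \<ominus> y) < e) \<Longrightarrow> x \<in> I"
  using I unfolding closed_ideal_RS_iff by blast+

lemma ideal_neg: "x \<in> I \<Longrightarrow> \<ominus> x \<in> I"
  using ideal_mult_l[of x "\<ominus> \<one>"] S_neg[OF one_S] S_sub[OF ideal_sub[of x]] by (simp add: l_minus)

lemma cong_refl: "x \<in> S \<Longrightarrow> cong_mod I x x"
  by (simp add: cong_mod_def minus_self S_sub ideal_zero)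

lemma cong_sym: "cong_mod I x y \<Longrightarrow> cong_mod I y x"
proof -
  assume c: "cong_mod I x y"
  then have "y \<ominus> x = \<ominus> (x \<ominus> y)" by (simp add: cong_mod_def a_minus_def minus_add a_comm S_sub)
  then show ?thesis using c ideal_neg by (simp add: cong_mod_def)
qed

lemma cong_trans: "cong_mod I x y \<Longrightarrow> cong_mod I y z \<Longrightarrow> cong_mod I x z"
proof -
  assume c: "cong_mod I x y" "cong_mod I y z"
  then have "x \<ominus> z = (x \<ominus> y) \<oplus> (y \<ominus> z)" by (simp add: cong_mod_def a_minus_def a_assoc r_neg1 S_sub)
  then show ?thesis using c ideal_add by (simp add: cong_mod_def)
qed

lemma cong_add: "cong_mod I x y \<Longrightarrow> cong_mod I x' y' \<Longrightarrow> cong_mod I (x \<oplus> x') (y \<oplus> y')"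
proof -
  assume c: "cong_mod I x y" "cong_mod I x' y'"
  then have "(x \<oplus> x') \<ominus> (y \<oplus> y') = (x \<ominus> y) \<oplus> (x' \<ominus> y')"
    by (simp add: cong_mod_def a_minus_def minus_add a_ac S_sub)
  then show ?thesis using c ideal_add by (simp add: cong_mod_def S_add)
qed

lemma cong_mult_r: "cong_mod I x y \<Longrightarrow> z \<in> S \<Longrightarrow> cong_mod I (x \<otimes> z) (y \<otimes> z)"
proof -
  assume c: "cong_mod I x y" "z \<in> S"
  then have "(x \<otimes> z) \<ominus> (y \<otimes> z) = (x \<ominus> y) \<otimes> z" by (simp add: cong_mod_def a_minus_def l_distr l_minus S_sub)
  then show ?thesis using c ideal_mult_r by (simp add: cong_mod_def S_mult)
qed

lemma cong_mult_l: "cong_mod I x y \<Longrightarrow> z \<in> S \<Longrightarrow> cong_mod I (z \<otimes> x) (z \<otimes> y)"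
proof -
  assume c: "cong_mod I x y" "z \<in> S"
  then have "(z \<otimes> x) \<ominus> (z \<otimes> y) = z \<otimes> (x \<ominus> y)" by (simp add: cong_mod_def a_minus_def r_distr r_minus S_sub)
  then show ?thesis using c ideal_mult_l by (simp add: cong_mod_def S_mult)
qed

lemma cong_limit:
  assumes xy: "x \<in> S" "y \<in> S"
    and ap: "\<And>e. e > 0 \<Longrightarrow> \<exists>x' y'. cong_mod I x' y' \<and> anorm R (x \<ominus> x') < e \<and> anorm R (y \<ominus> y') < e"
  shows "cong_mod I x y"
  unfolding cong_mod_def
proof (intro conjI xy ideal_closed S_minus)
  fix e :: real assume "e > 0"
  then have "e / 2 > 0" by simp
  then obtain x' y' where c: "cong_mod I x' y'" "anorm R (x \<ominus> x') < e / 2" "anorm R (y \<ominus> y') < e / 2" using ap by blast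
  have S': "x \<in> carrier R" "y \<in> carrier R" "x' \<in> carrier R" "y' \<in> carrier R" using c xy by (auto simp: cong_mod_def S_sub)
  then have "(x \<ominus> y) \<ominus> (x' \<ominus> y') = (x \<ominus> x') \<oplus> (\<ominus> (y \<ominus> y'))" by (simp add: a_minus_def minus_add a_ac)
  then have "anorm R ((x \<ominus> y) \<ominus> (x' \<ominus> y')) \<le> anorm R (x \<ominus> x') + anorm R (y \<ominus> y')"
    using norm_tri[of "x \<ominus> x'" "\<ominus> (y \<ominus> y')"] norm_neg[of "y \<ominus> y'"] S' by simp
  then have "anorm R ((x \<ominus> y) \<ominus> (x' \<ominus> y')) < e" using c by simp
  then show "\<exists>z\<in>I. anorm R ((x \<ominus> y) \<ominus> z) < e" using c(1) by (auto simp: cong_mod_def)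
qed

end

end

context star_ring begin

lemma cstar_generated_props:
  assumes G: "G \<subseteq> carrier R"
  shows "cstar_subalgebra R (\<Inter>{S. cstar_subalgebra R S \<and> G \<subseteq> S})"
proof -
  have c: "carrier R \<in> {S. cstar_subalgebra R S \<and> G \<subseteq> S}" using cstar_subalgebra_carrier G by blast
  define X0 where "X0 = \<Inter>{S. cstar_subalgebra R S \<and> G \<subseteq> S}"
  have X0: "X0 \<subseteq> X" if "cstar_subalgebra R X" "G \<subseteq> X" for X using that by (auto simp: X0_def)
  have X0I: "x \<in> X0" if "\<And>X. cstar_subalgebra R X \<Longrightarrow> G \<subseteq> X \<Longrightarrow> x \<in> X" for x using that by (auto simp: X0_def)
  have "cstar_subalgebra R X0"
    unfolding cstar_subalgebra_def complex_subalgebra_def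
  proof (intro conjI ballI allI)
    show "X0 \<subseteq> carrier R" using c by (auto simp: X0_def)
    show "norm_closed R X0"
      unfolding norm_closed_def
    proof (intro ballI impI X0I)
      fix x X assume x: "x \<in> carrier R" and ap: "\<forall>e>0. \<exists>y\<in>X0. anorm R (x \<ominus> y) < e"
        and X: "cstar_subalgebra R X" "G \<subseteq> X"
      have "\<forall>e>0. \<exists>y\<in>X. anorm R (x \<ominus> y) < e" using ap X0[OF X] by blast
      then show "x \<in> X" using X(1) x unfolding cstar_subalgebra_def norm_closed_def by blast
    qed
    show "\<zero> \<in> X0" by (rule X0I) (auto simp: cstar_subalgebra_def complex_subalgebra_def)
    show "x \<oplus> y \<in> X0" if "x \<in> X0" "y \<in> X0" for x y
    proof (rule X0I)
      fix X assume X: "cstar_subalgebra R X" "G \<subseteq> X"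
      then have "x \<in> X" "y \<in> X" using that X0[OF X] by auto
      then show "x \<oplus> y \<in> X" using X(1) by (simp add: cstar_subalgebra_def complex_subalgebra_def)
    qed
    show "x \<otimes> y \<in> X0" if "x \<in> X0" "y \<in> X0" for x y
    proof (rule X0I)
      fix X assume X: "cstar_subalgebra R X" "G \<subseteq> X"
      then have "x \<in> X" "y \<in> X" using that X0[OF X] by auto
      then show "x \<otimes> y \<in> X" using X(1) by (simp add: cstar_subalgebra_def complex_subalgebra_def)
    qed
    show "k \<odot> x \<in> X0" if "x \<in> X0" for k x
    proof (rule X0I)
      fix X assume X: "cstar_subalgebra R X" "G \<subseteq> X"
      then show "k \<odot> x \<in> X" using that X0[OF X] by (auto simp: cstar_subalgebra_def complex_subalgebra_def)
    qed
    show "adj R x \<in> X0" if "x \<in> X0" for x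
    proof (rule X0I)
      fix X assume X: "cstar_subalgebra R X" "G \<subseteq> X"
      then show "adj R x \<in> X" using that X0[OF X] by (auto simp: cstar_subalgebra_def complex_subalgebra_def)
    qed
  qed
  then show ?thesis by (simp add: X0_def)
qed

end

section \<open>The abstract symbol sequence\<close>

text \<open>\<open>T\<close> is an isometric linear section of a symbol relation \<open>sym\<close> that is compatible with the algebra operations,
norm-decreasing and closed. These properties alone give the exact sequence.\<close>

locale symbol_calculus = R: star_ring R + Q: star_ring Q
  for R :: "'a star_alg" (structure) and Q :: "'b star_alg" +
  fixes T :: "'b \<Rightarrow> 'a" and sym :: "'a \<Rightarrow> 'b \<Rightarrow> bool" and B :: "'b set"
  assumes B: "cstar_subalgebra Q B" and one_B: "\<one>\<^bsub>Q\<^esub> \<in> B"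
    and T_closed: "f \<in> carrier Q \<Longrightarrow> T f \<in> carrier R"
    and T_add: "f \<in> carrier Q \<Longrightarrow> g \<in> carrier Q \<Longrightarrow> T (f \<oplus>\<^bsub>Q\<^esub> g) = T f \<oplus> T g"
    and T_smult: "f \<in> carrier Q \<Longrightarrow> T (c \<odot>\<^bsub>Q\<^esub> f) = c \<odot> T f"
    and T_one: "T \<one>\<^bsub>Q\<^esub> = \<one>"
    and T_adj: "f \<in> carrier Q \<Longrightarrow> adj R (T f) = T (adj Q f)"
    and T_norm: "f \<in> carrier Q \<Longrightarrow> anorm R (T f) \<le> anorm Q f"
    and sym_T: "f \<in> carrier Q \<Longrightarrow> sym (T f) f"
    and sym_add: "x \<in> carrier R \<Longrightarrow> y \<in> carrier R \<Longrightarrow> f \<in> carrier Q \<Longrightarrow> g \<in> carrier Q \<Longrightarrow> sym x f \<Longrightarrow> sym y g \<Longrightarrow>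
         sym (x \<oplus> y) (f \<oplus>\<^bsub>Q\<^esub> g)"
    and sym_mult: "x \<in> carrier R \<Longrightarrow> y \<in> carrier R \<Longrightarrow> f \<in> carrier Q \<Longrightarrow> g \<in> carrier Q \<Longrightarrow> sym x f \<Longrightarrow> sym y g \<Longrightarrow>
         sym (x \<otimes> y) (f \<otimes>\<^bsub>Q\<^esub> g)"
    and sym_smult: "x \<in> carrier R \<Longrightarrow> f \<in> carrier Q \<Longrightarrow> sym x f \<Longrightarrow> sym (c \<odot> x) (c \<odot>\<^bsub>Q\<^esub> f)"
    and sym_norm: "x \<in> carrier R \<Longrightarrow> f \<in> carrier Q \<Longrightarrow> sym x f \<Longrightarrow> anorm Q f \<le> anorm R x"
    and sym_lim: "x \<in> carrier R \<Longrightarrow> (\<And>e. e > 0 \<Longrightarrow> \<exists>y\<in>carrier R. \<exists>g\<in>B. sym y g \<and> anorm R (x \<ominus> y) < e) \<Longrightarrow> \<exists>f\<in>B. sym x f"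
begin

sublocale QB: star_subring Q B using B one_B by unfold_locales (auto simp: cstar_subalgebra_def)

lemma B_sub: "f \<in> B \<Longrightarrow> f \<in> carrier Q" by (rule QB.S_sub)

lemma sym_minus: 
  assumes "x \<in> carrier R" "y \<in> carrier R" "f \<in> carrier Q" "g \<in> carrier Q" "sym x f" "sym y g"
  shows "sym (x \<ominus> y) (f \<ominus>\<^bsub>Q\<^esub> g)"
proof -
  have "sym (x \<oplus> (-1) \<odot> y) (f \<oplus>\<^bsub>Q\<^esub> (-1) \<odot>\<^bsub>Q\<^esub> g)"
    using assms by (intro sym_add sym_smult) (auto simp: R.smult_closed Q.smult_closed)
  then show ?thesis using assms by (simp add: a_minus_def R.smult_neg Q.smult_neg)
qed

lemma sym_minus_norm:
  assumes "x \<in> carrier R" "y \<in> carrier R" "f \<in> carrier Q" "g \<in> carrier Q" "sym x f" "sym y g"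
  shows "anorm Q (f \<ominus>\<^bsub>Q\<^esub> g) \<le> anorm R (x \<ominus> y)"
  using assms by (intro sym_norm sym_minus) auto

lemma sym_unique:
  assumes "x \<in> carrier R" "f \<in> carrier Q" "g \<in> carrier Q" "sym x f" "sym x g"
  shows "f = g"
proof (rule Q.eq_if_norm_le[OF assms(2,3)])
  show "anorm Q (f \<ominus>\<^bsub>Q\<^esub> g) \<le> e" if "e > 0" for e
    using sym_minus_norm[OF assms(1,1,2,3,4,5)] that assms(1) by (simp add: R.minus_self R.norm_zero)
qed

text \<open>The elements having, with their adjoint, a symbol in \<open>B\<close>. They form a C*-algebra containing \<open>T f\<close>, hence the
algebra generated by these.\<close>

definition SB :: "'a set" where
  "SB = {x \<in> carrier R. \<exists>f\<in>B. sym x f \<and> sym (adj R x) (adj Q f)}"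

lemma SB_cstar: "cstar_subalgebra R SB"
  unfolding cstar_subalgebra_def complex_subalgebra_def
proof (intro conjI ballI allI)
  show "SB \<subseteq> carrier R" by (auto simp: SB_def)
  have T: "T f \<in> SB" if "f \<in> B" for f
    using that by (auto simp: SB_def T_closed B_sub sym_T T_adj Q.adj_closed intro!: bexI[of _ f])
  have ad: "x \<oplus> y \<in> SB" if xy: "x \<in> SB" "y \<in> SB" for x y
  proof -
    obtain f g where fg: "f \<in> B" "sym x f" "sym (adj R x) (adj Q f)" "g \<in> B" "sym y g" "sym (adj R y) (adj Q g)"
      and c: "x \<in> carrier R" "y \<in> carrier R"
      using xy by (auto simp: SB_def)
    have "sym (x \<oplus> y) (f \<oplus>\<^bsub>Q\<^esub> g)" by (intro sym_add fg c B_sub)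
    moreover have "sym (adj R (x \<oplus> y)) (adj Q (f \<oplus>\<^bsub>Q\<^esub> g))"
      using fg c by (auto simp: R.adj_add Q.adj_add B_sub intro!: sym_add R.adj_closed Q.adj_closed)
    ultimately show ?thesis using c fg QB.S_add by (auto simp: SB_def)
  qed
  then show "x \<oplus> y \<in> SB" if "x \<in> SB" "y \<in> SB" for x y using that .
  show "x \<otimes> y \<in> SB" if xy: "x \<in> SB" "y \<in> SB" for x y
  proof -
    obtain f g where fg: "f \<in> B" "sym x f" "sym (adj R x) (adj Q f)" "g \<in> B" "sym y g" "sym (adj R y) (adj Q g)"
      and c: "x \<in> carrier R" "y \<in> carrier R"
      using xy by (auto simp: SB_def)
    have "sym (x \<otimes> y) (f \<otimes>\<^bsub>Q\<^esub> g)" by (intro sym_mult fg c B_sub)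
    moreover have "sym (adj R (x \<otimes> y)) (adj Q (f \<otimes>\<^bsub>Q\<^esub> g))"
      using fg c by (auto simp: R.adj_mult Q.adj_mult B_sub intro!: sym_mult R.adj_closed Q.adj_closed)
    ultimately show ?thesis using c fg QB.S_mult by (auto simp: SB_def)
  qed
  show sm: "c \<odot> x \<in> SB" if x: "x \<in> SB" for c x
  proof -
    obtain f where fg: "f \<in> B" "sym x f" "sym (adj R x) (adj Q f)" and c: "x \<in> carrier R"
      using x by (auto simp: SB_def)
    have "sym (c \<odot> x) (c \<odot>\<^bsub>Q\<^esub> f)" by (intro sym_smult fg c B_sub)
    moreover have "sym (adj R (c \<odot> x)) (adj Q (c \<odot>\<^bsub>Q\<^esub> f))"
      using fg c by (auto simp: R.adj_smult Q.adj_smult B_sub intro!: sym_smult R.adj_closed Q.adj_closed)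
    ultimately show ?thesis using c fg QB.S_smult R.smult_closed by (auto simp: SB_def)
  qed
  show "adj R x \<in> SB" if x: "x \<in> SB" for x
  proof -
    obtain f where fg: "f \<in> B" "sym x f" "sym (adj R x) (adj Q f)" and c: "x \<in> carrier R"
      using x by (auto simp: SB_def)
    then show ?thesis using QB.S_adj[OF fg(1)] by (auto simp: SB_def R.adj_closed R.adj_adj Q.adj_adj B_sub)
  qed
  show "\<zero> \<in> SB"
  proof -
    have 1: "\<one> \<in> SB" using T[OF one_B] T_one by simp
    have "(-1) \<odot> \<one> \<in> SB" by (rule sm[OF 1])
    from ad[OF 1 this] show ?thesis by (simp add: R.smult_neg R.r_neg)
  qed
  show "norm_closed R SB"
    unfolding norm_closed_def
  proof (intro ballI impI)
    fix x assume x: "x \<in> carrier R" and ap: "\<forall>e>0. \<exists>y\<in>SB. anorm R (x \<ominus> y) < e"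
    have ax: "adj R x \<in> carrier R" using x by (rule R.adj_closed)
    have ap': "\<exists>y\<in>carrier R. \<exists>g\<in>B. sym y g \<and> sym (adj R y) (adj Q g) \<and> anorm R (x \<ominus> y) < e \<and> anorm R (adj R x \<ominus> adj R y) < e"
      if e: "e > 0" for e
    proof -
      obtain y where y: "y \<in> SB" "anorm R (x \<ominus> y) < e" using ap e by blast
      then obtain g where g: "y \<in> carrier R" "g \<in> B" "sym y g" "sym (adj R y) (adj Q g)" by (auto simp: SB_def)
      note yc = g(1)
      have "anorm R (adj R x \<ominus> adj R y) = anorm R (x \<ominus> y)"
        using R.adj_minus[OF x yc] R.norm_adj[of "x \<ominus> y"] x yc by simp
      then show ?thesis using y(2) g by (intro bexI[of _ y] bexI[of _ g] conjI) auto
    qed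
    have "\<exists>f\<in>B. sym x f" by (rule sym_lim[OF x]) (use ap' in blast)
    then obtain f where f: "f \<in> B" "sym x f" by blast
    have "\<exists>g\<in>B. sym (adj R x) g"
    proof (rule sym_lim[OF ax])
      fix e :: real assume "e > 0"
      then obtain y g where "y \<in> carrier R" "g \<in> B" "sym (adj R y) (adj Q g)" "anorm R (adj R x \<ominus> adj R y) < e"
        using ap' by blast
      then show "\<exists>y\<in>carrier R. \<exists>g\<in>B. sym y g \<and> anorm R (adj R x \<ominus> y) < e"
        using R.adj_closed QB.S_adj by blast
    qed
    then obtain h where h: "h \<in> B" "sym (adj R x) h" by blast
    have "h = adj Q f"
    proof (rule Q.eq_if_norm_le)
      show hc: "h \<in> carrier Q" "adj Q f \<in> carrier Q" using h f by (auto intro: B_sub Q.adj_closed)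
      fix e :: real assume "e > 0"
      then have "e/2 > 0" by simp
      then obtain y g where y: "y \<in> carrier R" "g \<in> B" "sym y g" "sym (adj R y) (adj Q g)"
        "anorm R (x \<ominus> y) < e/2" "anorm R (adj R x \<ominus> adj R y) < e/2" using ap' by blast
      have gc: "g \<in> carrier Q" "adj Q g \<in> carrier Q" using y by (auto intro: B_sub Q.adj_closed)
      have fc: "f \<in> carrier Q" using f by (auto intro: B_sub)
      have "anorm Q (h \<ominus>\<^bsub>Q\<^esub> adj Q f) \<le> anorm Q (h \<ominus>\<^bsub>Q\<^esub> adj Q g) + anorm Q (adj Q g \<ominus>\<^bsub>Q\<^esub> adj Q f)"
        by (intro Q.norm_minus_tri hc gc)
      also have "anorm Q (h \<ominus>\<^bsub>Q\<^esub> adj Q g) \<le> anorm R (adj R x \<ominus> adj R y)"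
        by (intro sym_minus_norm ax R.adj_closed y h hc gc)
      also have "anorm Q (adj Q g \<ominus>\<^bsub>Q\<^esub> adj Q f) = anorm Q (g \<ominus>\<^bsub>Q\<^esub> f)"
        using Q.adj_minus[OF gc(1) fc] Q.norm_adj[of "g \<ominus>\<^bsub>Q\<^esub> f"] gc fc by simp
      also have "anorm Q (g \<ominus>\<^bsub>Q\<^esub> f) = anorm Q (f \<ominus>\<^bsub>Q\<^esub> g)" by (rule Q.norm_minus_commute'[OF gc(1) fc])
      also have "anorm Q (f \<ominus>\<^bsub>Q\<^esub> g) \<le> anorm R (x \<ominus> y)" by (intro sym_minus_norm x y f fc gc)
      finally show "anorm Q (h \<ominus>\<^bsub>Q\<^esub> adj Q f) \<le> e" using y by simp
    qed
    then show "x \<in> SB" using x f h by (auto simp: SB_def)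
  qed
qed

definition TB :: "'a set" where "TB = \<Inter>{S. cstar_subalgebra R S \<and> T ` B \<subseteq> S}"

lemma cstar_generated_eq: "cstar_generated R (T ` B) = R\<lparr>carrier := TB\<rparr>"
  by (simp add: cstar_generated_def TB_def)

lemma TB_cstar: "cstar_subalgebra R TB"
  unfolding TB_def by (rule R.cstar_generated_props) (auto simp: T_closed B_sub)

lemma T_TB: "f \<in> B \<Longrightarrow> T f \<in> TB" by (auto simp: TB_def)

lemma one_TB: "\<one> \<in> TB" using T_TB[OF one_B] T_one by simp

sublocale TB: star_subring R TB using TB_cstar one_TB by unfold_locales (auto simp: cstar_subalgebra_def)

lemma TB_least: "cstar_subalgebra R S \<Longrightarrow> T ` B \<subseteq> S \<Longrightarrow> TB \<subseteq> S" by (auto simp: TB_def)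

lemma TB_SB: "TB \<subseteq> SB"
proof (rule TB_least[OF SB_cstar])
  show "T ` B \<subseteq> SB"
    by (auto simp: SB_def T_closed B_sub sym_T T_adj Q.adj_closed intro!: bexI)
qed

definition symb :: "'a \<Rightarrow> 'b" where "symb x = (THE f. f \<in> B \<and> sym x f)"

lemma symb_eq: "x \<in> carrier R \<Longrightarrow> f \<in> B \<Longrightarrow> sym x f \<Longrightarrow> symb x = f"
  unfolding symb_def by (rule the_equality) (auto intro: sym_unique B_sub)

lemma symb_props: "x \<in> TB \<Longrightarrow> symb x \<in> B \<and> sym x (symb x) \<and> sym (adj R x) (adj Q (symb x))"
proof -
  assume "x \<in> TB"
  then have "x \<in> SB" using TB_SB by blast
  then obtain f where "x \<in> carrier R" "f \<in> B" "sym x f" "sym (adj R x) (adj Q f)" by (auto simp: SB_def)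
  then show ?thesis using symb_eq by simp
qed

lemma symb_T: "f \<in> B \<Longrightarrow> symb (T f) = f"
  by (rule symb_eq) (auto simp: T_closed B_sub sym_T)

definition semi :: "'a set" where
  "semi = {(T f \<otimes> T g) \<ominus> T (f \<otimes>\<^bsub>Q\<^esub> g) | f g. f \<in> B \<and> g \<in> B}"

lemma semi_TB: "semi \<subseteq> TB"
  by (auto simp: semi_def intro!: TB.S_minus TB.S_mult T_TB QB.S_mult)

lemma semi_adj: "x \<in> semi \<Longrightarrow> adj R x \<in> semi"
proof -
  assume "x \<in> semi"
  then obtain f g where fg: "f \<in> B" "g \<in> B" "x = (T f \<otimes> T g) \<ominus> T (f \<otimes>\<^bsub>Q\<^esub> g)" by (auto simp: semi_def)
  have "adj R x = (T (adj Q g) \<otimes> T (adj Q f)) \<ominus> T (adj Q g \<otimes>\<^bsub>Q\<^esub> adj Q f)"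
    using fg by (simp add: R.adj_minus R.adj_mult T_closed B_sub T_adj Q.adj_mult)
  then show ?thesis using fg QB.S_adj unfolding semi_def by blast
qed

lemma T_minus: "f \<in> carrier Q \<Longrightarrow> g \<in> carrier Q \<Longrightarrow> T (f \<ominus>\<^bsub>Q\<^esub> g) = T f \<ominus> T g"
  using T_add[of f "(-1) \<odot>\<^bsub>Q\<^esub> g"] T_smult[of g "-1"]
  by (simp add: a_minus_def Q.smult_closed Q.smult_neg R.smult_neg T_closed)

abbreviation "CB \<equiv> closed_ideal_generated (R\<lparr>carrier := TB\<rparr>) semi"

lemma CB_closed_ideal: "closed_ideal (R\<lparr>carrier := TB\<rparr>) CB"
  by (rule TB.closed_ideal_generated_closed(1)[OF semi_TB])

lemma CB_semi: "semi \<subseteq> CB" by (rule TB.closed_ideal_generated_closed(2)[OF semi_TB])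

lemma CB_adj: "x \<in> CB \<Longrightarrow> adj R x \<in> CB"
  by (rule TB.closed_ideal_generated_adj[OF semi_TB semi_adj])

lemma symb_add: "x \<in> TB \<Longrightarrow> y \<in> TB \<Longrightarrow> symb (x \<oplus> y) = symb x \<oplus>\<^bsub>Q\<^esub> symb y"
  by (rule symb_eq) (auto simp: TB.S_sub symb_props B_sub intro!: sym_add QB.S_add)

lemma symb_mult: "x \<in> TB \<Longrightarrow> y \<in> TB \<Longrightarrow> symb (x \<otimes> y) = symb x \<otimes>\<^bsub>Q\<^esub> symb y"
  by (rule symb_eq) (auto simp: TB.S_sub symb_props B_sub intro!: sym_mult QB.S_mult)

lemma symb_smult: "x \<in> TB \<Longrightarrow> symb (c \<odot> x) = c \<odot>\<^bsub>Q\<^esub> symb x"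
  by (rule symb_eq) (auto simp: TB.S_sub symb_props B_sub R.smult_closed intro!: sym_smult QB.S_smult)

lemma symb_adj: "x \<in> TB \<Longrightarrow> symb (adj R x) = adj Q (symb x)"
  by (rule symb_eq) (auto simp: TB.S_sub symb_props B_sub R.adj_closed intro!: QB.S_adj)

lemma semi_cong: "f \<in> B \<Longrightarrow> g \<in> B \<Longrightarrow> TB.cong_mod CB (T f \<otimes> T g) (T (f \<otimes>\<^bsub>Q\<^esub> g))"
  using CB_semi TB.S_mult[OF T_TB T_TB] T_TB[OF QB.S_mult] unfolding TB.cong_mod_def semi_def by blast

text \<open>The elements congruent to \<open>T\<close> of their symbol form a C*-algebra that contains the generators: products are
covered since \<open>T f T g\<close> and \<open>T (f g)\<close> differ by a semicommutator.\<close>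

lemma cong_T_symb: "x \<in> TB \<Longrightarrow> TB.cong_mod CB x (T (symb x))"
proof -
  note I = CB_closed_ideal
  define D where "D = {x. TB.cong_mod CB x (T (symb x))}"
  have D_TB: "x \<in> TB" if "x \<in> D" for x using that by (simp add: D_def TB.cong_mod_def)
  have c: "symb x \<in> carrier Q" "T (symb x) \<in> TB" "symb x \<in> B" if "x \<in> TB" for x
    using that symb_props by (auto simp: B_sub T_TB)
  have T: "T f \<in> D" if "f \<in> B" for f
    using that by (simp add: D_def symb_T TB.cong_refl[OF I] T_TB)
  have "cstar_subalgebra R D"
    unfolding cstar_subalgebra_def complex_subalgebra_def
  proof (intro conjI ballI allI)
    show "D \<subseteq> carrier R" using D_TB TB.S_sub by blast
    show ad: "x \<oplus> y \<in> D" if xy: "x \<in> D" "y \<in> D" for x y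
    proof -
      have t: "x \<in> TB" "y \<in> TB" using xy D_TB by auto
      have "T (symb (x \<oplus> y)) = T (symb x) \<oplus> T (symb y)" using t c by (simp add: symb_add T_add)
      then show ?thesis using TB.cong_add[OF I] xy by (simp add: D_def)
    qed
    show "x \<otimes> y \<in> D" if xy: "x \<in> D" "y \<in> D" for x y
    proof -
      have t: "x \<in> TB" "y \<in> TB" using xy D_TB by auto
      have "TB.cong_mod CB (x \<otimes> y) (T (symb x) \<otimes> y)"
        using TB.cong_mult_r[OF I] xy(1) t(2) by (simp add: D_def)
      moreover have "TB.cong_mod CB (T (symb x) \<otimes> y) (T (symb x) \<otimes> T (symb y))"
        using TB.cong_mult_l[OF I] xy(2) c(2)[OF t(1)] by (simp add: D_def)
      moreover have "TB.cong_mod CB (T (symb x) \<otimes> T (symb y)) (T (symb (x \<otimes> y)))"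
        using semi_cong[OF c(3)[OF t(1)] c(3)[OF t(2)]] t by (simp add: symb_mult)
      ultimately show ?thesis unfolding D_def using TB.cong_trans[OF I] by blast
    qed
    have one: "(k \<odot> \<one>) \<otimes> z = k \<odot> z" if "z \<in> carrier R" for k z
      using R.smult_mult[OF R.one_closed that, of k] that by simp
    show sm: "k \<odot> x \<in> D" if x: "x \<in> D" for k x
    proof -
      have t: "x \<in> TB" using x D_TB by auto
      have "TB.cong_mod CB ((k \<odot> \<one>) \<otimes> x) ((k \<odot> \<one>) \<otimes> T (symb x))"
        using TB.cong_mult_l[OF I] x TB.S_smult[OF one_TB] by (simp add: D_def)
      then show ?thesis using t c by (simp add: D_def one TB.S_sub symb_smult T_smult)
    qed
    show "adj R x \<in> D" if x: "x \<in> D" for x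
    proof -
      have t: "x \<in> TB" using x D_TB by auto
      have "adj R x \<ominus> T (symb (adj R x)) = adj R (x \<ominus> T (symb x))"
        using t c by (simp add: symb_adj T_adj R.adj_minus TB.S_sub)
      moreover have "T (symb (adj R x)) \<in> TB" by (intro c TB.S_adj t)
      ultimately show ?thesis using x CB_adj TB.S_adj[OF t] by (simp add: D_def TB.cong_mod_def)
    qed
    show "\<zero> \<in> D"
    proof -
      have 1: "\<one> \<in> D" using T[OF one_B] T_one by simp
      from ad[OF 1 sm[OF 1, of "-1"]] show ?thesis by (simp add: R.smult_neg R.r_neg)
    qed
    show "norm_closed R D"
      unfolding norm_closed_def
    proof (intro ballI impI)
      fix x assume x: "x \<in> carrier R" and ap: "\<forall>e>0. \<exists>y\<in>D. anorm R (x \<ominus> y) < e"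
      have "\<forall>e>0. \<exists>y\<in>TB. anorm R (x \<ominus> y) < e" using ap D_TB by blast
      then have t: "x \<in> TB" using TB.S_closed x unfolding norm_closed_def by blast
      have "TB.cong_mod CB x (T (symb x))"
      proof (rule TB.cong_limit[OF I t c(2)[OF t]])
        fix e :: real assume "e > 0"
        then obtain y where y: "y \<in> D" "anorm R (x \<ominus> y) < e" using ap by blast
        note ty = D_TB[OF y(1)]
        have "anorm R (T (symb x) \<ominus> T (symb y)) \<le> anorm Q (symb x \<ominus>\<^bsub>Q\<^esub> symb y)"
          using c[OF t] c[OF ty] T_norm[of "symb x \<ominus>\<^bsub>Q\<^esub> symb y"] by (simp add: T_minus)
        also have "\<dots> \<le> anorm R (x \<ominus> y)"
          using symb_props[OF t] symb_props[OF ty] c[OF t] c[OF ty] by (intro sym_minus_norm) (auto simp: TB.S_sub t ty)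
        finally show "\<exists>x' y'. TB.cong_mod CB x' y' \<and> anorm R (x \<ominus> x') < e \<and> anorm R (T (symb x) \<ominus> y') < e"
          using y by (intro exI[of _ y] exI[of _ "T (symb y)"]) (simp add: D_def)
      qed
      then show "x \<in> D" by (simp add: D_def)
    qed
  qed
  moreover have "T ` B \<subseteq> D" using T by blast
  ultimately have "TB \<subseteq> D" by (rule TB_least)
  then show "TB.cong_mod CB x (T (symb x))" if "x \<in> TB" using that by (auto simp: D_def)
qed

lemma T_zero: "T \<zero>\<^bsub>Q\<^esub> = \<zero>"
  using T_minus[of "\<zero>\<^bsub>Q\<^esub>" "\<zero>\<^bsub>Q\<^esub>"] by (simp add: Q.minus_self R.minus_self T_closed)

text \<open>An element of symbol \<open>0\<close> is congruent to \<open>T 0 = 0\<close>; conversely the elements of symbol \<open>0\<close> form a closed ideal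
containing the semicommutators.\<close>

lemma symb_zero_iff: "x \<in> TB \<Longrightarrow> symb x = \<zero>\<^bsub>Q\<^esub> \<longleftrightarrow> x \<in> CB"
proof
  assume x: "x \<in> TB" and z: "symb x = \<zero>\<^bsub>Q\<^esub>"
  show "x \<in> CB" using cong_T_symb[OF x] z x by (simp add: TB.cong_mod_def T_zero a_minus_def TB.S_sub)
next
  assume x: "x \<in> CB"
  define I where "I = {x \<in> TB. symb x = \<zero>\<^bsub>Q\<^esub>}"
  have sz: "symb \<zero> = \<zero>\<^bsub>Q\<^esub>" using symb_T[OF QB.S_zero] T_zero by simp
  have c: "x \<in> carrier R" "symb x \<in> carrier Q" "symb x \<in> B" if "x \<in> TB" for x
    using that symb_props by (auto simp: TB.S_sub B_sub)
  have "closed_ideal (R\<lparr>carrier := TB\<rparr>) I"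
    unfolding TB.closed_ideal_RS_iff
  proof (intro conjI ballI impI)
    fix x assume x: "x \<in> TB" and ap: "\<forall>e>0. \<exists>y\<in>I. anorm R (x \<ominus> y) < e"
    have "symb x = \<zero>\<^bsub>Q\<^esub>"
    proof (rule Q.eq_if_norm_le)
      fix e :: real assume "e > 0"
      then obtain y where y: "y \<in> I" "anorm R (x \<ominus> y) < e" using ap by blast
      then have ty: "y \<in> TB" "symb y = \<zero>\<^bsub>Q\<^esub>" by (auto simp: I_def)
      have "anorm Q (symb x \<ominus>\<^bsub>Q\<^esub> symb y) \<le> anorm R (x \<ominus> y)"
        using symb_props[OF x] symb_props[OF ty(1)] c[OF x] c[OF ty(1)] by (intro sym_minus_norm) auto
      then show "anorm Q (symb x \<ominus>\<^bsub>Q\<^esub> \<zero>\<^bsub>Q\<^esub>) \<le> e" using y ty by simp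
    qed (use c[OF x] in auto)
    then show "x \<in> I" using x by (simp add: I_def)
  qed (auto simp: I_def TB.S_zero sz TB.S_add symb_add TB.S_mult symb_mult c)
  moreover have "semi \<subseteq> I"
  proof
    fix x assume "x \<in> semi"
    then obtain f g where fg: "f \<in> B" "g \<in> B" "x = (T f \<otimes> T g) \<ominus> T (f \<otimes>\<^bsub>Q\<^esub> g)" by (auto simp: semi_def)
    have "sym x ((f \<otimes>\<^bsub>Q\<^esub> g) \<ominus>\<^bsub>Q\<^esub> (f \<otimes>\<^bsub>Q\<^esub> g))"
      unfolding fg(3) using fg by (intro sym_minus sym_mult sym_T) (auto simp: T_closed B_sub)
    then have "sym x \<zero>\<^bsub>Q\<^esub>" using fg by (simp add: Q.minus_self B_sub)
    then have "symb x = \<zero>\<^bsub>Q\<^esub>" using fg by (intro symb_eq QB.S_zero) (auto simp: T_closed B_sub)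
    then show "x \<in> I" using \<open>x \<in> semi\<close> semi_TB by (auto simp: I_def)
  qed
  ultimately have "CB \<subseteq> I" by (rule TB.closed_ideal_generated_least)
  then show "symb x = \<zero>\<^bsub>Q\<^esub>" using x by (auto simp: I_def)
qed

theorem short_exact_symb: "short_exact CB (R\<lparr>carrier := TB\<rparr>) (Q\<lparr>carrier := B\<rparr>) symb"
  unfolding short_exact_def
proof (intro conjI)
  show "closed_ideal (R\<lparr>carrier := TB\<rparr>) CB" by (rule CB_closed_ideal)
  have "symb \<one> = \<one>\<^bsub>Q\<^esub>" using symb_T[OF one_B] T_one by simp
  then show "star_homomorphism (R\<lparr>carrier := TB\<rparr>) (Q\<lparr>carrier := B\<rparr>) symb"
    unfolding star_homomorphism_def ring_hom_def
    by (auto simp: symb_props symb_add symb_mult symb_smult symb_adj)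
  show "a_kernel (R\<lparr>carrier := TB\<rparr>) (Q\<lparr>carrier := B\<rparr>) symb = CB"
    unfolding a_kernel_def kernel_def using symb_zero_iff TB.ideal_sub[OF CB_closed_ideal] by auto
  show "symb ` carrier (R\<lparr>carrier := TB\<rparr>) = carrier (Q\<lparr>carrier := B\<rparr>)"
    using symb_props symb_T T_TB by (force simp: image_iff)
qed

end


section \<open>Classes of functions modulo null sets\<close>

lemma ae_class_cong:
  assumes "AE x in M. f x = g x"
  shows "ae_class M f = ae_class M g"
proof -
  have "(AE x in M. h x = f x) \<longleftrightarrow> (AE x in M. h x = g x)" for h
  proof
    assume "AE x in M. h x = f x"
    then show "AE x in M. h x = g x" using assms by eventually_elim simp
  next
    assume "AE x in M. h x = g x"
    then show "AE x in M. h x = f x" using assms by eventually_elim simp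
  qed
  then show ?thesis by (simp add: ae_class_def)
qed

lemma ae_class_eq_iff:
  assumes "f \<in> borel_measurable M" "g \<in> borel_measurable M"
  shows "ae_class M f = ae_class M g \<longleftrightarrow> (AE x in M. f x = g x)"
proof
  assume "ae_class M f = ae_class M g"
  moreover have "f \<in> ae_class M f" using assms by (simp add: ae_class_def)
  ultimately have "f \<in> ae_class M g" by simp
  then show "AE x in M. f x = g x" by (simp add: ae_class_def)
qed (rule ae_class_cong)

lemma repr_ae_class:
  assumes "f \<in> borel_measurable M"
  shows "repr (ae_class M f) \<in> borel_measurable M" "AE x in M. repr (ae_class M f) x = f x"
proof -
  have "f \<in> ae_class M f" using assms by (simp add: ae_class_def)
  then have "repr (ae_class M f) \<in> ae_class M f" unfolding repr_def
    by (rule someI[where P="\<lambda>g. g \<in> ae_class M f"])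
  then show "repr (ae_class M f) \<in> borel_measurable M" "AE x in M. repr (ae_class M f) x = f x"
    by (auto simp: ae_class_def)
qed

lemma ae_class_repr [simp]: "f \<in> borel_measurable M \<Longrightarrow> ae_class M (repr (ae_class M f)) = ae_class M f"
  by (rule ae_class_cong) (rule repr_ae_class)

lemma lc_add_cl: "f \<in> borel_measurable M \<Longrightarrow> g \<in> borel_measurable M \<Longrightarrow>
    lc_add M (ae_class M f) (ae_class M g) = ae_class M (f +: g)"
  unfolding lc_add_def by (rule ae_class_cong) (use repr_ae_class(2)[of f M] repr_ae_class(2)[of g M] in auto)

lemma lc_diff_cl: "f \<in> borel_measurable M \<Longrightarrow> g \<in> borel_measurable M \<Longrightarrow>
    lc_diff M (ae_class M f) (ae_class M g) = ae_class M (f -: g)"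
  unfolding lc_diff_def by (rule ae_class_cong) (use repr_ae_class(2)[of f M] repr_ae_class(2)[of g M] in auto)

lemma lc_mult_cl: "f \<in> borel_measurable M \<Longrightarrow> g \<in> borel_measurable M \<Longrightarrow>
    lc_mult M (ae_class M f) (ae_class M g) = ae_class M (f \<cdot> g)"
  unfolding lc_mult_def by (rule ae_class_cong) (use repr_ae_class(2)[of f M] repr_ae_class(2)[of g M] in auto)

lemma lc_scale_cl: "f \<in> borel_measurable M \<Longrightarrow> lc_scale M c (ae_class M f) = ae_class M (\<lambda>x. c * f x)"
  unfolding lc_scale_def by (rule ae_class_cong) (use repr_ae_class(2)[of f M] in auto)

lemma lc_cnj_cl: "f \<in> borel_measurable M \<Longrightarrow> lc_cnj M (ae_class M f) = ae_class M (\<lambda>x. cnj (f x))"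
  unfolding lc_cnj_def by (rule ae_class_cong) (use repr_ae_class(2)[of f M] in auto)

lemmas lc_cl = lc_add_cl lc_diff_cl lc_mult_cl lc_scale_cl lc_cnj_cl

lemma l2_inner_cl: "f \<in> borel_measurable M \<Longrightarrow> g \<in> borel_measurable M \<Longrightarrow>
    l2_inner M (ae_class M f) (ae_class M g) = ip M f g"
  unfolding l2_inner_def ip_def[symmetric]
  by (intro ip_cong_AE repr_ae_class)

lemma l2_norm_cl: "f \<in> borel_measurable M \<Longrightarrow> l2_norm M (ae_class M f) = sqrt (n2 M f)"
  unfolding l2_norm_def n2_def[symmetric]
  by (intro arg_cong[of _ _ sqrt] n2_cong_AE repr_ae_class)

lemma L2_eq: "L2 M = ae_class M ` sq M"
  by (auto simp: L2_def sq_def)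

lemma Linf_carrier: "carrier (Linf M) = ae_class M ` bm M"
  by (auto simp: Linf_def bm_def)

lemma bm_add:
  assumes "f \<in> bm M" "g \<in> bm M" shows "(f +: g) \<in> bm M"
proof -
  obtain c d where c: "AE x in M. cmod (f x) \<le> c" and d: "AE x in M. cmod (g x) \<le> d" using assms by (auto simp: bm_def)
  have "AE x in M. cmod (f x + g x) \<le> c + d"
    using c d by eventually_elim (rule norm_triangle_mono)
  then show ?thesis using assms by (auto simp: bm_def)
qed

lemma bm_mult:
  assumes "f \<in> bm M" "g \<in> bm M" shows "(f \<cdot> g) \<in> bm M"
proof -
  obtain c d where c: "AE x in M. cmod (f x) \<le> c" and d: "AE x in M. cmod (g x) \<le> d" using assms by (auto simp: bm_def)
  have "AE x in M. cmod (f x * g x) \<le> \<bar>c\<bar> * \<bar>d\<bar>"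
    using c d by eventually_elim (auto simp: norm_mult intro!: mult_mono)
  then show ?thesis using assms by (auto simp: bm_def)
qed

lemma bm_const: "(\<lambda>_. c) \<in> bm M" by (auto simp: bm_def)

lemma bm_scale: "f \<in> bm M \<Longrightarrow> (\<lambda>x. c * f x) \<in> bm M" by (rule bm_mult[OF bm_const])

lemma bm_diff: "f \<in> bm M \<Longrightarrow> g \<in> bm M \<Longrightarrow> (f -: g) \<in> bm M"
  using bm_add[OF _ bm_scale[of g M "-1"], of f] by simp

lemma bm_cnj: "f \<in> bm M \<Longrightarrow> (\<lambda>x. cnj (f x)) \<in> bm M" by (auto simp: bm_def)

lemma Linf_simps:
  "mult (Linf M) = lc_mult M" "one (Linf M) = ae_class M (\<lambda>_. 1)" "zero (Linf M) = ae_class M (\<lambda>_. 0)"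
  "add (Linf M) = lc_add M" "smult (Linf M) = lc_scale M" "adj (Linf M) = lc_cnj M"
  by (simp_all add: Linf_def)

lemma LinfE:
  assumes "F \<in> carrier (Linf M)" obtains f where "f \<in> bm M" "F = ae_class M f"
  using assms by (auto simp: Linf_carrier)

lemma cl_Linf: "f \<in> bm M \<Longrightarrow> ae_class M f \<in> carrier (Linf M)"
  by (simp add: Linf_carrier)

lemma Linf_cring: "cring (Linf M)"
proof (rule cringI)
  show "abelian_group (Linf M)"
  proof (rule abelian_groupI; unfold Linf_simps)
    show "lc_add M x y \<in> carrier (Linf M)" if "x \<in> carrier (Linf M)" "y \<in> carrier (Linf M)" for x y
      using that by (auto elim!: LinfE simp: lc_cl bm_measurable intro!: cl_Linf bm_add)
    show "ae_class M (\<lambda>_. 0) \<in> carrier (Linf M)" by (intro cl_Linf bm_const)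
    show "lc_add M (lc_add M x y) z = lc_add M x (lc_add M y z)"
      if "x \<in> carrier (Linf M)" "y \<in> carrier (Linf M)" "z \<in> carrier (Linf M)" for x y z
      using that by (auto elim!: LinfE simp: lc_cl bm_measurable add.assoc)
    show "lc_add M x y = lc_add M y x" if "x \<in> carrier (Linf M)" "y \<in> carrier (Linf M)" for x y
      using that by (auto elim!: LinfE simp: lc_cl bm_measurable add.commute)
    show "lc_add M (ae_class M (\<lambda>_. 0)) x = x" if "x \<in> carrier (Linf M)" for x
      using that by (auto elim!: LinfE simp: lc_cl bm_measurable)
    show "\<exists>y\<in>carrier (Linf M). lc_add M y x = ae_class M (\<lambda>_. 0)" if x: "x \<in> carrier (Linf M)" for x
    proof -
      obtain f where f: "f \<in> bm M" "x = ae_class M f" using x by (rule LinfE)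
      then show ?thesis
        by (intro bexI[of _ "ae_class M (\<lambda>x. (-1) * f x)"]) (auto simp: lc_cl bm_measurable intro!: cl_Linf bm_scale[of f M "-1", simplified])
    qed
  qed
  show "comm_monoid (Linf M)"
  proof (rule comm_monoidI; unfold Linf_simps)
    show "lc_mult M x y \<in> carrier (Linf M)" if "x \<in> carrier (Linf M)" "y \<in> carrier (Linf M)" for x y
      using that by (auto elim!: LinfE simp: lc_cl bm_measurable intro!: cl_Linf bm_mult)
    show "ae_class M (\<lambda>_. 1) \<in> carrier (Linf M)" by (intro cl_Linf bm_const)
    show "lc_mult M (lc_mult M x y) z = lc_mult M x (lc_mult M y z)"
      if "x \<in> carrier (Linf M)" "y \<in> carrier (Linf M)" "z \<in> carrier (Linf M)" for x y z
      using that by (auto elim!: LinfE simp: lc_cl bm_measurable mult.assoc)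
    show "lc_mult M x y = lc_mult M y x" if "x \<in> carrier (Linf M)" "y \<in> carrier (Linf M)" for x y
      using that by (auto elim!: LinfE simp: lc_cl bm_measurable mult.commute)
    show "lc_mult M (ae_class M (\<lambda>_. 1)) x = x" if "x \<in> carrier (Linf M)" for x
      using that by (auto elim!: LinfE simp: lc_cl bm_measurable)
  qed
  show "(x \<oplus>\<^bsub>Linf M\<^esub> y) \<otimes>\<^bsub>Linf M\<^esub> z = x \<otimes>\<^bsub>Linf M\<^esub> z \<oplus>\<^bsub>Linf M\<^esub> y \<otimes>\<^bsub>Linf M\<^esub> z"
    if "x \<in> carrier (Linf M)" "y \<in> carrier (Linf M)" "z \<in> carrier (Linf M)" for x y z
    using that unfolding Linf_simps by (auto elim!: LinfE simp: lc_cl bm_measurable distrib_right)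
qed

lemma Linf_neg: "f \<in> bm M \<Longrightarrow> \<ominus>\<^bsub>Linf M\<^esub> ae_class M f = ae_class M (\<lambda>x. - f x)"
proof -
  assume f: "f \<in> bm M"
  interpret cring "Linf M" by (rule Linf_cring)
  have n: "(\<lambda>x. - f x) \<in> bm M" using bm_scale[OF f, of "-1"] by simp
  show ?thesis
    by (rule minus_equality) (use f n in \<open>auto simp: Linf_simps lc_cl bm_measurable cl_Linf\<close>)
qed

lemma Linf_minus: "f \<in> bm M \<Longrightarrow> g \<in> bm M \<Longrightarrow>
    ae_class M f \<ominus>\<^bsub>Linf M\<^esub> ae_class M g = ae_class M (f -: g)"
  by (simp add: a_minus_def Linf_neg Linf_simps lc_cl bm_measurable)

context prob_space begin

lemma Linf_anorm:
  assumes f: "f \<in> bm M"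
  shows "0 \<le> anorm (Linf M) (ae_class M f)"
    and "AE x in M. cmod (f x) \<le> anorm (Linf M) (ae_class M f)"
    and "\<And>c. AE x in M. cmod (f x) \<le> c \<Longrightarrow> anorm (Linf M) (ae_class M f) \<le> c"
proof -
  define g where "g = repr (ae_class M f)"
  have fm: "f \<in> borel_measurable M" using f by (rule bm_measurable)
  have gm [measurable]: "g \<in> borel_measurable M" and gf: "AE x in M. g x = f x"
    using repr_ae_class[OF fm] by (auto simp: g_def)
  define E where "E = esssup M (\<lambda>x. ereal (cmod (g x)))"
  have N: "anorm (Linf M) (ae_class M f) = real_of_ereal E" by (simp add: Linf_def E_def g_def)
  have mm: "(\<lambda>x. ereal (cmod (g x))) \<in> borel_measurable M" by measurable
  have le: "E \<le> ereal c" if "AE x in M. cmod (f x) \<le> c" for c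
    unfolding E_def by (rule esssup_I[OF mm]) (use that gf in eventually_elim, simp)
  have E0: "0 \<le> E"
  proof -
    have "esssup M (\<lambda>x. 0::ereal) \<le> E" unfolding E_def by (rule esssup_mono) auto
    then show ?thesis using esssup_const[of M "0::ereal"] emeasure_space_1 by simp
  qed
  obtain c0 where "AE x in M. cmod (f x) \<le> c0" using f by (auto simp: bm_def)
  from le[OF this] E0 have E: "E = ereal (real_of_ereal E)" by (cases E) auto
  show "0 \<le> anorm (Linf M) (ae_class M f)" using E0 by (simp add: N real_of_ereal_pos)
  have "AE x in M. ereal (cmod (g x)) \<le> E" unfolding E_def by (rule esssup_AE)
  then have "AE x in M. ereal (cmod (g x)) \<le> ereal (real_of_ereal E)" using E by simp
  then show "AE x in M. cmod (f x) \<le> anorm (Linf M) (ae_class M f)"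
    unfolding N using gf by eventually_elim simp
  show "anorm (Linf M) (ae_class M f) \<le> c" if "AE x in M. cmod (f x) \<le> c" for c
    using le[OF that] E unfolding N by (metis ereal_less_eq(3))
qed

lemma essran_iff:
  assumes f: "f \<in> bm M"
  shows "c \<in> essran M (ae_class M f) \<longleftrightarrow> (\<forall>e>0. \<not> (AE x in M. e \<le> cmod (f x - c)))"
proof -
  define g where "g = repr (ae_class M f)"
  have fm: "f \<in> borel_measurable M" using f by (rule bm_measurable)
  have gm [measurable]: "g \<in> borel_measurable M" and gf: "AE x in M. g x = f x"
    using repr_ae_class[OF fm] by (auto simp: g_def)
  have "emeasure M {x \<in> space M. cmod (g x - c) < e} > 0 \<longleftrightarrow> \<not> (AE x in M. e \<le> cmod (f x - c))" for e
  proof -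
    have "(AE x in M. e \<le> cmod (f x - c)) \<longleftrightarrow> (AE x in M. \<not> (cmod (g x - c) < e))"
    proof
      assume "AE x in M. e \<le> cmod (f x - c)"
      then show "AE x in M. \<not> (cmod (g x - c) < e)" using gf by eventually_elim simp
    next
      assume "AE x in M. \<not> (cmod (g x - c) < e)"
      then show "AE x in M. e \<le> cmod (f x - c)" using gf by eventually_elim simp
    qed
    also have "\<dots> \<longleftrightarrow> emeasure M {x \<in> space M. cmod (g x - c) < e} = 0"
      by (subst AE_iff_measurable[OF _ refl]) auto
    finally show ?thesis by (simp add: zero_less_iff_neq_zero)
  qed
  then show ?thesis by (simp add: essran_def g_def)
qed

end


section \<open>Operators on the Hardy space\<close>

lemma bop_sum:
  assumes L: "bop M L C" and L': "bop M L' C'"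
  shows "bop M (\<lambda>f x. L f x + L' f x) (2 * C + 2 * C')"
  unfolding bop_def
proof (intro conjI ballI allI)
  show "0 \<le> 2 * C + 2 * C'" using bop_nonneg[OF L] bop_nonneg[OF L'] by simp
  fix f g assume f: "f \<in> sq M" and g: "g \<in> sq M"
  show "AE x in M. L (f +: g) x + L' (f +: g) x = L f x + L' f x + (L g x + L' g x)"
    using bop_add[OF L f g] bop_add[OF L' f g] by eventually_elim simp
next
  fix c f assume f: "f \<in> sq M"
  show "AE x in M. L (\<lambda>x. c * f x) x + L' (\<lambda>x. c * f x) x = c * (L f x + L' f x)"
    using bop_scale[OF L f, of c] bop_scale[OF L' f, of c] by eventually_elim (simp add: distrib_left)
next
  fix f assume f: "f \<in> sq M"
  show "(\<lambda>x. L f x + L' f x) \<in> sq M" by (intro sq_add bop_sq[OF L] bop_sq[OF L'] f)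
  have "n2 M (\<lambda>x. L f x + L' f x) \<le> 2 * n2 M (L f) + 2 * n2 M (L' f)"
    by (intro n2_add_le2 bop_sq[OF L] bop_sq[OF L'] f)
  also have "\<dots> \<le> 2 * (C * n2 M f) + 2 * (C' * n2 M f)"
    by (intro add_mono mult_left_mono bop_n2[OF L] bop_n2[OF L'] f) auto
  finally show "n2 M (\<lambda>x. L f x + L' f x) \<le> (2 * C + 2 * C') * n2 M f" by (simp add: algebra_simps)
qed

lemma bop_smult:
  assumes L: "bop M L C"
  shows "bop M (\<lambda>f x. c * L f x) ((cmod c)\<^sup>2 * C)"
  unfolding bop_def
proof (intro conjI ballI allI)
  show "0 \<le> (cmod c)\<^sup>2 * C" using bop_nonneg[OF L] by simp
  fix f g assume f: "f \<in> sq M" and g: "g \<in> sq M"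
  show "AE x in M. c * L (f +: g) x = c * L f x + c * L g x"
    using bop_add[OF L f g] by eventually_elim (simp add: distrib_left)
next
  fix d f assume f: "f \<in> sq M"
  show "AE x in M. c * L (\<lambda>x. d * f x) x = d * (c * L f x)"
    using bop_scale[OF L f, of d] by eventually_elim simp
next
  fix f assume f: "f \<in> sq M"
  show "(\<lambda>x. c * L f x) \<in> sq M" by (intro sq_scale bop_sq[OF L] f)
  show "n2 M (\<lambda>x. c * L f x) \<le> (cmod c)\<^sup>2 * C * n2 M f"
    unfolding n2_scale mult.assoc by (intro mult_left_mono bop_n2[OF L] f) auto
qed

lemma ip_ext_right:
  assumes "f \<in> sq M" "g \<in> sq M" "\<And>k. k \<in> sq M \<Longrightarrow> ip M k f = ip M k g"
  shows "AE x in M. f x = g x"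
proof (rule n2_diff_eq_0_imp_AE[OF assms(1,2)])
  have d: "(f -: g) \<in> sq M" by (intro sq_diff assms)
  have "ip M (f -: g) (f -: g) = 0"
    using ip_diff_right[OF assms(1,2) d] assms(3)[OF d] by simp
  then show "n2 M (f -: g) = 0" by (simp add: ip_self)
qed

lemma (in prob_space) bop_adjoint:
  assumes L: "bop M L C"
  obtains L' where "bop M L' C" "\<And>f g. f \<in> sq M \<Longrightarrow> g \<in> sq M \<Longrightarrow> ip M (L f) g = ip M f (L' g)"
proof -
  have "\<exists>h\<in>sq M. \<forall>f\<in>sq M. ip M (L f) g = ip M f h" if g: "g \<in> sq M" for g
  proof (rule riesz)
    fix f assume f: "f \<in> sq M"
    have "cmod (ip M (L f) g) \<le> sqrt (n2 M (L f)) * sqrt (n2 M g)"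
      by (intro ip_Cauchy_Schwarz bop_sq[OF L] f g)
    then have "(cmod (ip M (L f) g))\<^sup>2 \<le> (sqrt (n2 M (L f)) * sqrt (n2 M g))\<^sup>2" by (intro power_mono) auto
    also have "\<dots> = n2 M (L f) * n2 M g" by (simp add: power_mult_distrib)
    also have "\<dots> \<le> (C * n2 M f) * n2 M g" by (intro mult_right_mono bop_n2[OF L] f) auto
    finally show "(cmod (ip M (L f) g))\<^sup>2 \<le> (C * n2 M g) * n2 M f" by (simp add: mult_ac)
  qed (use g bop_ip_add[OF L] bop_ip_scale[OF L] in auto)
  then obtain L' where L': "\<And>g. g \<in> sq M \<Longrightarrow> L' g \<in> sq M"
    "\<And>f g. f \<in> sq M \<Longrightarrow> g \<in> sq M \<Longrightarrow> ip M (L f) g = ip M f (L' g)" by metis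
  have "bop M L' C"
    unfolding bop_def
  proof (intro conjI ballI allI bop_nonneg[OF L])
    fix f assume f: "f \<in> sq M"
    show "L' f \<in> sq M" by (rule L'(1)[OF f])
    have "ip M (L (L' f)) f = complex_of_real (n2 M (L' f))" using L' f by (simp add: ip_self)
    then have "n2 M (L' f) = cmod (ip M (L (L' f)) f)" by simp
    also have "\<dots> \<le> sqrt (n2 M (L (L' f))) * sqrt (n2 M f)"
      by (intro ip_Cauchy_Schwarz bop_sq[OF L] L' f)
    also have "\<dots> \<le> sqrt (C * n2 M (L' f)) * sqrt (n2 M f)"
      by (intro mult_right_mono real_sqrt_le_mono bop_n2[OF L] L' f) auto
    also have "\<dots> = sqrt (C * n2 M f) * sqrt (n2 M (L' f))" by (simp add: real_sqrt_mult)
    finally show "n2 M (L' f) \<le> C * n2 M f"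
      by (rule le_of_le_sqrt_mult[rotated 2]) (use bop_nonneg[OF L] in auto)
  next
    fix f g assume fg: "f \<in> sq M" "g \<in> sq M"
    show "AE x in M. L' (f +: g) x = L' f x + L' g x"
    proof (rule ip_ext_right)
      fix k assume k: "k \<in> sq M"
      show "ip M k (L' (f +: g)) = ip M k (\<lambda>x. L' f x + L' g x)"
        using fg k L' by (simp add: L'(2)[symmetric] ip_add_right sq_add bop_sq[OF L])
    qed (use fg L' in \<open>auto intro: sq_add\<close>)
  next
    fix c f assume f: "f \<in> sq M"
    show "AE x in M. L' (\<lambda>x. c * f x) x = c * L' f x"
    proof (rule ip_ext_right)
      fix k assume k: "k \<in> sq M"
      show "ip M k (L' (\<lambda>x. c * f x)) = ip M k (\<lambda>x. c * L' f x)"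
        using f k L' by (simp add: L'(2)[symmetric] ip_scale_right sq_scale)
    qed (use f L' in \<open>auto intro: sq_scale\<close>)
  qed
  then show thesis using that L' by blast
qed

context spherical_setting begin

abbreviation "cl \<equiv> ae_class m"
abbreviation "H \<equiv> H2 m A"
abbreviation "R \<equiv> BH m (H2 m A)"
abbreviation "Ops \<equiv> bounded_ops m (H2 m A)"

lemma sqm: "f \<in> sq m \<Longrightarrow> f \<in> borel_measurable m" by (rule sq_measurable)
lemma Hfm: "f \<in> Hf \<Longrightarrow> f \<in> borel_measurable m" by (rule sqm[OF Hf_sq])

lemma H_eq: "H = cl ` Hf"
proof (intro equalityI subsetI)
  fix F assume F: "F \<in> H"
  then obtain f where f: "f \<in> sq m" "F = cl f" by (auto simp: H2_def L2_eq)
  have "f \<in> Hf" unfolding Hf_def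
  proof (intro CollectI conjI allI impI f)
    fix e :: real assume "e > 0"
    then have "sqrt e > 0" by simp
    moreover have "\<forall>e>0. \<exists>a\<in>A. l2_norm m (lc_diff m F (cl a)) < e" using F by (simp add: H2_def)
    ultimately obtain a where a: "a \<in> A" "l2_norm m (lc_diff m F (cl a)) < sqrt e" by blast
    have am: "a \<in> borel_measurable m" by (rule sqm[OF A_sq[OF a(1)]])
    have "sqrt (n2 m (f -: a)) < sqrt e"
      using a f sqm am by (simp add: lc_cl l2_norm_cl)
    then show "\<exists>a\<in>A. n2 m (f -: a) \<le> e" using a(1) by (intro bexI[of _ a]) auto
  qed
  then show "F \<in> cl ` Hf" using f by blast
next
  fix F assume "F \<in> cl ` Hf"
  then obtain f where f: "f \<in> Hf" "F = cl f" by blast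
  show "F \<in> H" unfolding H2_def
  proof (intro CollectI conjI allI impI)
    show "F \<in> L2 m" using f by (auto simp: L2_eq Hf_sq)
    fix e :: real assume e: "e > 0"
    then have e2: "(e/2)\<^sup>2 > 0" by simp
    obtain a where a: "a \<in> A" "n2 m (f -: a) \<le> (e/2)\<^sup>2" by (rule Hf_approx[OF f(1) e2])
    have am: "a \<in> borel_measurable m" by (rule sqm[OF A_sq[OF a(1)]])
    have "l2_norm m (lc_diff m F (cl a)) = sqrt (n2 m (f -: a))"
      using f Hfm[OF f(1)] am by (simp add: lc_cl l2_norm_cl)
    also have "\<dots> \<le> sqrt ((e/2)\<^sup>2)" using a by (intro real_sqrt_le_mono) auto
    also have "\<dots> < e" using e by simp
    finally show "\<exists>a\<in>A. l2_norm m (lc_diff m F (cl a)) < e" using a by blast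
  qed
qed

lemma HE: assumes "F \<in> H" obtains f where "f \<in> Hf" "F = cl f"
  using assms by (auto simp: H_eq)

lemma cl_H: "f \<in> Hf \<Longrightarrow> cl f \<in> H" by (auto simp: H_eq)

lemma cl_H_iff: "f \<in> borel_measurable m \<Longrightarrow> cl f \<in> H \<longleftrightarrow> f \<in> Hf"
proof
  assume f: "f \<in> borel_measurable m" and "cl f \<in> H"
  then obtain g where g: "g \<in> Hf" "cl f = cl g" by (auto elim: HE)
  then have "AE x in m. f x = g x" using ae_class_eq_iff[OF f Hfm] by blast
  then show "f \<in> Hf" by (rule Hf_cong_AE[OF g(1) f])
qed (rule cl_H)

lemma repr_Hf: "f \<in> Hf \<Longrightarrow> repr (cl f) \<in> Hf"
  by (rule Hf_cong_AE[OF _ repr_ae_class(1)[OF Hfm] repr_ae_class(2)[OF Hfm]])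

lemma repr_H: "F \<in> H \<Longrightarrow> repr F \<in> Hf \<and> cl (repr F) = F"
  by (auto elim!: HE simp: repr_Hf Hfm)

lemma H2_proj_cl: "f \<in> sq m \<Longrightarrow> H2_proj m A (cl f) = cl (P f)"
  unfolding H2_proj_def
proof (rule the_equality)
  assume f: "f \<in> sq m"
  have inner: "l2_inner m (lc_diff m (cl f) (cl g)) (cl h) = ip m (f -: g) h" if "g \<in> sq m" "h \<in> sq m" for g h
    using f that sqm sqm[OF sq_diff[OF f that(1)]] by (simp add: lc_cl l2_inner_cl)
  show "cl (P f) \<in> H \<and> (\<forall>h\<in>H. l2_inner m (lc_diff m (cl f) (cl (P f))) h = 0)"
    using P_Hf[OF f] P_orth[OF f] by (auto simp: cl_H inner P_sq[OF f] Hf_sq elim!: HE)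
  fix G assume G: "G \<in> H \<and> (\<forall>h\<in>H. l2_inner m (lc_diff m (cl f) G) h = 0)"
  then obtain g where g: "g \<in> Hf" "G = cl g" by (auto elim: HE)
  have "ip m g k = ip m f k" if k: "k \<in> Hf" for k
    using G g k cl_H[OF k] inner[OF Hf_sq[OF g(1)] Hf_sq[OF k]] ip_diff_left[OF f Hf_sq[OF g(1)] Hf_sq[OF k]] by auto
  then have "AE x in m. P f x = g x" by (rule P_unique[OF f g(1)])
  then show "G = cl (P f)" unfolding g(2) by (rule ae_class_cong[symmetric])
qed

text \<open>The compression of an operator on functions to the Hardy space.\<close>

definition compress :: "(('k \<Rightarrow> complex) \<Rightarrow> ('k \<Rightarrow> complex)) \<Rightarrow> 'k lclass \<Rightarrow> 'k lclass" where
  "compress L = (\<lambda>F\<in>H. cl (P (L (repr F))))"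

text \<open>\<open>X P\<close> as an operator on functions.\<close>

definition L_of :: "('k lclass \<Rightarrow> 'k lclass) \<Rightarrow> ('k \<Rightarrow> complex) \<Rightarrow> ('k \<Rightarrow> complex)" where
  "L_of X f = repr (X (cl (P f)))"

lemma compress_cl: assumes L: "bop m L C" and h: "h \<in> Hf" shows "compress L (cl h) = cl (P (L h))"
proof -
  have r: "repr (cl h) \<in> Hf" "AE x in m. repr (cl h) x = h x" using repr_Hf[OF h] repr_ae_class(2)[OF Hfm[OF h]] by auto
  have "AE x in m. L (repr (cl h)) x = L h x" by (intro bop_cong[OF L] Hf_sq r h)
  then have "AE x in m. P (L (repr (cl h))) x = P (L h) x" by (intro bop_cong[OF bop_P] bop_sq[OF L] Hf_sq r h)
  then show ?thesis using cl_H[OF h] by (simp add: compress_def ae_class_cong)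
qed

lemma l2_norm_H: "h \<in> Hf \<Longrightarrow> l2_norm m (cl h) = sqrt (n2 m h)" by (rule l2_norm_cl[OF Hfm])

lemma compress_in:
  assumes L: "bop m L C"
  shows "compress L \<in> Ops"
proof -
  have LH: "P (L h) \<in> Hf" if "h \<in> Hf" for h by (intro P_Hf bop_sq[OF L] Hf_sq that)
  have PL: "bop m (\<lambda>f. P (L f)) (1 * C)" by (rule bop_comp[OF bop_P L])
  show ?thesis unfolding bounded_ops_def
  proof (intro CollectI conjI ballI allI)
    show "compress L \<in> H \<rightarrow>\<^sub>E H"
    proof (rule PiE_I)
      fix F assume "F \<in> H"
      then obtain f where "f \<in> Hf" "F = cl f" by (rule HE)
      then show "compress L F \<in> H" by (simp add: compress_cl[OF L] cl_H LH)
    qed (simp add: compress_def)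
    show "compress L (lc_add m F G) = lc_add m (compress L F) (compress L G)" if F: "F \<in> H" and G: "G \<in> H" for F G
    proof -
      obtain f g where fg: "f \<in> Hf" "F = cl f" "g \<in> Hf" "G = cl g" using F G by (auto elim!: HE)
      have "compress L (cl (f +: g)) = cl (\<lambda>x. P (L f) x + P (L g) x)"
        unfolding compress_cl[OF L Hf_add[OF fg(1,3)]]
        by (intro ae_class_cong bop_add[OF PL] Hf_sq fg)
      then show ?thesis using fg by (simp add: lc_cl Hfm compress_cl[OF L] LH)
    qed
    show "compress L (lc_scale m c F) = lc_scale m c (compress L F)" if F: "F \<in> H" for c F
    proof -
      obtain f where fg: "f \<in> Hf" "F = cl f" using F by (rule HE)
      have "compress L (cl (\<lambda>x. c * f x)) = cl (\<lambda>x. c * P (L f) x)"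
        unfolding compress_cl[OF L Hf_scale[OF fg(1)]]
        by (intro ae_class_cong bop_scale[OF PL] Hf_sq fg)
      then show ?thesis using fg by (simp add: lc_cl Hfm compress_cl[OF L] LH)
    qed
    have "l2_norm m (compress L F) \<le> sqrt C * l2_norm m F" if F: "F \<in> H" for F
    proof -
      obtain f where fg: "f \<in> Hf" "F = cl f" using F by (rule HE)
      have "sqrt (n2 m (P (L f))) \<le> sqrt (C * n2 m f)"
        using bop_n2[OF PL Hf_sq[OF fg(1)]] by (intro real_sqrt_le_mono) simp
      then show ?thesis using fg by (simp add: compress_cl[OF L] l2_norm_H LH real_sqrt_mult)
    qed
    then show "\<exists>C. \<forall>F\<in>H. l2_norm m (compress L F) \<le> C * l2_norm m F" by blast
  qed
qed

lemma ops_in: "X \<in> Ops \<Longrightarrow> F \<in> H \<Longrightarrow> X F \<in> H"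
  and ops_add: "X \<in> Ops \<Longrightarrow> F \<in> H \<Longrightarrow> G \<in> H \<Longrightarrow> X (lc_add m F G) = lc_add m (X F) (X G)"
  and ops_scale: "X \<in> Ops \<Longrightarrow> F \<in> H \<Longrightarrow> X (lc_scale m c F) = lc_scale m c (X F)"
  and ops_ext: "X \<in> Ops \<Longrightarrow> X \<in> extensional H"
  by (auto simp: bounded_ops_def PiE_def)

lemma ops_eqI: "X \<in> Ops \<Longrightarrow> Y \<in> Ops \<Longrightarrow> (\<And>h. h \<in> Hf \<Longrightarrow> X (cl h) = Y (cl h)) \<Longrightarrow> X = Y"
  by (rule extensionalityI[of _ H]) (auto intro: ops_ext elim!: HE)

lemma L_of_Hf: assumes X: "X \<in> Ops" and f: "f \<in> sq m"
  shows "L_of X f \<in> Hf" "cl (L_of X f) = X (cl (P f))"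
  using repr_H[OF ops_in[OF X cl_H[OF P_Hf[OF f]]]] by (auto simp: L_of_def)

lemma L_of_cl: assumes X: "X \<in> Ops" and h: "h \<in> Hf"
  shows "cl (L_of X h) = X (cl h)"
  using L_of_Hf(2)[OF X Hf_sq[OF h]] ae_class_cong[OF P_id[OF h]] by simp

lemma L_of_bop:
  assumes X: "X \<in> Ops" and c: "c \<ge> 0" and bd: "\<And>F. F \<in> H \<Longrightarrow> l2_norm m (X F) \<le> c * l2_norm m F"
  shows "bop m (L_of X) (c\<^sup>2)"
  unfolding bop_def
proof (intro conjI ballI allI)
  fix f g assume f: "f \<in> sq m" and g: "g \<in> sq m"
  have "cl (P (f +: g)) = cl (\<lambda>x. P f x + P g x)"
    by (rule ae_class_cong[OF bop_add[OF bop_P f g]])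
  then have "cl (L_of X (f +: g)) = X (lc_add m (cl (P f)) (cl (P g)))"
    using f g by (simp add: L_of_Hf[OF X] sq_add lc_cl Hfm P_Hf)
  also have "\<dots> = lc_add m (cl (L_of X f)) (cl (L_of X g))"
    using f g by (simp add: ops_add[OF X] cl_H P_Hf L_of_Hf[OF X])
  also have "\<dots> = cl (\<lambda>x. L_of X f x + L_of X g x)"
    by (rule lc_add_cl[OF Hfm[OF L_of_Hf(1)[OF X f]] Hfm[OF L_of_Hf(1)[OF X g]]])
  finally show "AE x in m. L_of X (f +: g) x = L_of X f x + L_of X g x"
    using f g by (subst (asm) ae_class_eq_iff) (auto intro!: Hfm Hf_add L_of_Hf[OF X] sq_add)
next
  fix d f assume f: "f \<in> sq m"
  have "cl (P (\<lambda>x. d * f x)) = cl (\<lambda>x. d * P f x)"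
    by (rule ae_class_cong[OF bop_scale[OF bop_P f]])
  then have "cl (L_of X (\<lambda>x. d * f x)) = X (lc_scale m d (cl (P f)))"
    using f by (simp add: L_of_Hf[OF X] sq_scale lc_cl Hfm P_Hf)
  also have "\<dots> = lc_scale m d (cl (L_of X f))"
    using f by (simp add: ops_scale[OF X] cl_H P_Hf L_of_Hf[OF X])
  also have "\<dots> = cl (\<lambda>x. d * L_of X f x)"
    by (rule lc_scale_cl[OF Hfm[OF L_of_Hf(1)[OF X f]]])
  finally show "AE x in m. L_of X (\<lambda>x. d * f x) x = d * L_of X f x"
    using f by (subst (asm) ae_class_eq_iff) (auto intro!: Hfm Hf_scale L_of_Hf[OF X] sq_scale)
next
  fix f assume f: "f \<in> sq m"
  show "L_of X f \<in> sq m" using L_of_Hf(1)[OF X f] by (rule Hf_sq)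
  have "sqrt (n2 m (L_of X f)) = l2_norm m (X (cl (P f)))"
    using l2_norm_H[OF L_of_Hf(1)[OF X f]] L_of_Hf(2)[OF X f] by simp
  also have "\<dots> \<le> c * l2_norm m (cl (P f))" by (intro bd cl_H P_Hf f)
  also have "\<dots> = c * sqrt (n2 m (P f))" by (simp add: l2_norm_H P_Hf f)
  also have "\<dots> \<le> c * sqrt (n2 m f)" using bop_n2[OF bop_P f] c by (intro mult_left_mono) auto
  finally have "(sqrt (n2 m (L_of X f)))\<^sup>2 \<le> (c * sqrt (n2 m f))\<^sup>2" by (intro power_mono) auto
  then show "n2 m (L_of X f) \<le> c\<^sup>2 * n2 m f" by (simp add: power_mult_distrib)
qed (use c in simp)

lemma l2_norm_nonneg: "0 \<le> l2_norm m F" by (simp add: l2_norm_def)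

lemma ops_bound:
  assumes X: "X \<in> Ops"
  obtains c where "c \<ge> 0" "\<And>F. F \<in> H \<Longrightarrow> l2_norm m (X F) \<le> c * l2_norm m F"
proof -
  have "\<exists>c. \<forall>F\<in>H. l2_norm m (X F) \<le> c * l2_norm m F" using X by (simp add: bounded_ops_def)
  then obtain c where c: "\<And>F. F \<in> H \<Longrightarrow> l2_norm m (X F) \<le> c * l2_norm m F" by blast
  have "l2_norm m (X F) \<le> \<bar>c\<bar> * l2_norm m F" if "F \<in> H" for F
    using c[OF that] mult_right_mono[OF abs_ge_self[of c] l2_norm_nonneg[of F]] by simp
  then show thesis by (intro that[of "\<bar>c\<bar>"]) auto
qed

lemma ops_bop: "X \<in> Ops \<Longrightarrow> \<exists>C. bop m (L_of X) C"
proof -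
  assume X: "X \<in> Ops"
  obtain c where c: "c \<ge> 0" "\<And>F. F \<in> H \<Longrightarrow> l2_norm m (X F) \<le> c * l2_norm m F" by (rule ops_bound[OF X]) auto
  show ?thesis using L_of_bop[OF X c] by blast
qed

lemma R_simps:
  "carrier R = Ops" "mult R = compose H" "one R = (\<lambda>f\<in>H. f)" "zero R = (\<lambda>f\<in>H. cl (\<lambda>_. 0))"
  "add R = (\<lambda>S T. \<lambda>f\<in>H. lc_add m (S f) (T f))" "smult R = (\<lambda>c T. \<lambda>f\<in>H. lc_scale m c (T f))"
  by (simp_all add: BH_def)

lemma R_app:
  assumes "F \<in> H"
  shows "(X \<otimes>\<^bsub>R\<^esub> Y) F = X (Y F)" "\<one>\<^bsub>R\<^esub> F = F" "\<zero>\<^bsub>R\<^esub> F = cl (\<lambda>_. 0)" "(X \<oplus>\<^bsub>R\<^esub> Y) F = lc_add m (X F) (Y F)"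
    "(c \<odot>\<^bsub>R\<^esub> X) F = lc_scale m c (X F)"
  using assms by (simp_all add: R_simps compose_def)

lemma H_add: "F \<in> H \<Longrightarrow> G \<in> H \<Longrightarrow> lc_add m F G \<in> H"
  and H_scale: "F \<in> H \<Longrightarrow> lc_scale m c F \<in> H"
  and H_zero: "cl (\<lambda>_. 0) \<in> H"
  by (auto elim!: HE simp: lc_cl Hfm intro!: cl_H Hf_add Hf_scale Hf_zero)

lemma H_assoc: "F \<in> H \<Longrightarrow> G \<in> H \<Longrightarrow> K \<in> H \<Longrightarrow> lc_add m (lc_add m F G) K = lc_add m F (lc_add m G K)"
  and H_comm: "F \<in> H \<Longrightarrow> G \<in> H \<Longrightarrow> lc_add m F G = lc_add m G F"
  and H_0: "F \<in> H \<Longrightarrow> lc_add m (cl (\<lambda>_. 0)) F = F"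
  and H_neg: "F \<in> H \<Longrightarrow> lc_add m (lc_scale m (-1) F) F = cl (\<lambda>_. 0)"
  by (auto elim!: HE simp: lc_cl Hfm Hf_add Hf_scale algebra_simps)

lemma opsI:
  assumes L: "bop m L C" and T: "T \<in> extensional H" and eq: "\<And>h. h \<in> Hf \<Longrightarrow> L h \<in> Hf \<and> T (cl h) = cl (L h)"
  shows "T \<in> Ops"
proof -
  have "T = compress L"
  proof (rule extensionalityI[OF T, of "compress L"])
    show "compress L \<in> extensional H" by (simp add: compress_def)
    fix F assume "F \<in> H"
    then obtain f where f: "f \<in> Hf" "F = cl f" by (rule HE)
    then show "T F = compress L F" using eq[OF f(1)] ae_class_cong[OF P_id[of "L f"]] by (simp add: compress_cl[OF L])
  qed
  then show ?thesis using compress_in[OF L] by simp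
qed

lemma R_add_closed: "X \<in> Ops \<Longrightarrow> Y \<in> Ops \<Longrightarrow> X \<oplus>\<^bsub>R\<^esub> Y \<in> Ops"
proof -
  assume X: "X \<in> Ops" and Y: "Y \<in> Ops"
  obtain C D where "bop m (L_of X) C" "bop m (L_of Y) D" using ops_bop X Y by blast
  from bop_sum[OF this] show ?thesis
  proof (rule opsI)
    show "X \<oplus>\<^bsub>R\<^esub> Y \<in> extensional H" by (simp add: R_simps)
    fix h assume h: "h \<in> Hf"
    have L: "L_of X h \<in> Hf" "L_of Y h \<in> Hf" using L_of_Hf(1)[OF X Hf_sq[OF h]] L_of_Hf(1)[OF Y Hf_sq[OF h]] by auto
    have "(X \<oplus>\<^bsub>R\<^esub> Y) (cl h) = lc_add m (cl (L_of X h)) (cl (L_of Y h))"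
      using cl_H[OF h] by (simp add: R_app L_of_cl[OF X h] L_of_cl[OF Y h])
    then show "(\<lambda>x. L_of X h x + L_of Y h x) \<in> Hf \<and> (X \<oplus>\<^bsub>R\<^esub> Y) (cl h) = cl (\<lambda>x. L_of X h x + L_of Y h x)"
      using L by (simp add: lc_add_cl Hfm Hf_add)
  qed
qed

lemma R_smult_closed: "X \<in> Ops \<Longrightarrow> c \<odot>\<^bsub>R\<^esub> X \<in> Ops"
proof -
  assume X: "X \<in> Ops"
  obtain C where "bop m (L_of X) C" using ops_bop X by blast
  from bop_smult[OF this, of c] show ?thesis
  proof (rule opsI)
    show "c \<odot>\<^bsub>R\<^esub> X \<in> extensional H" by (simp add: R_simps)
    fix h assume h: "h \<in> Hf"
    have L: "L_of X h \<in> Hf" by (rule L_of_Hf(1)[OF X Hf_sq[OF h]])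
    have "(c \<odot>\<^bsub>R\<^esub> X) (cl h) = lc_scale m c (cl (L_of X h))"
      using cl_H[OF h] by (simp add: R_app L_of_cl[OF X h])
    then show "(\<lambda>x. c * L_of X h x) \<in> Hf \<and> (c \<odot>\<^bsub>R\<^esub> X) (cl h) = cl (\<lambda>x. c * L_of X h x)"
      using L by (simp add: lc_scale_cl Hfm Hf_scale)
  qed
qed

lemma R_mult_closed: "X \<in> Ops \<Longrightarrow> Y \<in> Ops \<Longrightarrow> X \<otimes>\<^bsub>R\<^esub> Y \<in> Ops"
proof -
  assume X: "X \<in> Ops" and Y: "Y \<in> Ops"
  obtain C D where "bop m (L_of X) C" "bop m (L_of Y) D" using ops_bop X Y by blast
  from bop_comp[OF this] show ?thesis
    by (rule opsI) (auto simp: R_simps compose_def L_of_Hf(1)[OF X] L_of_Hf(1)[OF Y] Hf_sq cl_H L_of_cl[OF X] L_of_cl[OF Y])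
qed

lemma bop_id: "bop m (\<lambda>f. f) 1" by (simp add: bop_def)

lemma R_one_closed: "\<one>\<^bsub>R\<^esub> \<in> Ops"
  by (rule opsI[OF bop_id]) (auto simp: R_simps cl_H)

lemma R_zero_closed: "\<zero>\<^bsub>R\<^esub> \<in> Ops"
proof -
  have "bop m (\<lambda>f x. 0 * f x) ((cmod 0)\<^sup>2 * 1)" by (rule bop_smult[OF bop_id])
  then show ?thesis by (rule opsI) (auto simp: R_simps cl_H Hf_zero)
qed

lemma R_eqI: "X \<in> Ops \<Longrightarrow> Y \<in> Ops \<Longrightarrow> (\<And>F. F \<in> H \<Longrightarrow> X F = Y F) \<Longrightarrow> X = Y"
  by (rule extensionalityI[of _ H]) (auto intro: ops_ext)

lemma abelian_group_R: "abelian_group R"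
proof (rule abelian_groupI)
  fix x y z assume x: "x \<in> carrier R" and y: "y \<in> carrier R" and z: "z \<in> carrier R"
  then have xyz: "x \<in> Ops" "y \<in> Ops" "z \<in> Ops" by (auto simp: R_simps(1))
  show "x \<oplus>\<^bsub>R\<^esub> y \<oplus>\<^bsub>R\<^esub> z = x \<oplus>\<^bsub>R\<^esub> (y \<oplus>\<^bsub>R\<^esub> z)"
    by (rule R_eqI) (auto simp: R_add_closed xyz R_app H_assoc ops_in)
next
  fix x y assume x: "x \<in> carrier R" and y: "y \<in> carrier R"
  then have xyz: "x \<in> Ops" "y \<in> Ops" by (auto simp: R_simps(1))
  show "x \<oplus>\<^bsub>R\<^esub> y \<in> carrier R" using xyz by (simp add: R_simps(1) R_add_closed)
  show "x \<oplus>\<^bsub>R\<^esub> y = y \<oplus>\<^bsub>R\<^esub> x"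
    by (rule R_eqI) (auto simp: R_add_closed xyz R_app H_comm ops_in)
next
  fix x assume "x \<in> carrier R"
  then have x: "x \<in> Ops" by (auto simp: R_simps(1))
  show "\<zero>\<^bsub>R\<^esub> \<oplus>\<^bsub>R\<^esub> x = x"
    by (rule R_eqI) (auto simp: R_add_closed R_zero_closed x R_app H_0 ops_in)
  have "((-1) \<odot>\<^bsub>R\<^esub> x) \<oplus>\<^bsub>R\<^esub> x = \<zero>\<^bsub>R\<^esub>"
    by (rule R_eqI) (auto simp: R_add_closed R_zero_closed R_smult_closed x R_app H_neg ops_in)
  then show "\<exists>y\<in>carrier R. y \<oplus>\<^bsub>R\<^esub> x = \<zero>\<^bsub>R\<^esub>" using R_smult_closed[OF x] by (auto simp: R_simps(1))
qed (auto simp: R_simps(1) R_zero_closed)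

lemma monoid_R: "monoid R"
proof (rule monoidI)
  fix x y z assume x: "x \<in> carrier R" and y: "y \<in> carrier R" and z: "z \<in> carrier R"
  then have xyz: "x \<in> Ops" "y \<in> Ops" "z \<in> Ops" by (auto simp: R_simps(1))
  show "x \<otimes>\<^bsub>R\<^esub> y \<otimes>\<^bsub>R\<^esub> z = x \<otimes>\<^bsub>R\<^esub> (y \<otimes>\<^bsub>R\<^esub> z)"
    by (rule R_eqI) (auto simp: R_mult_closed xyz R_app ops_in)
next
  fix x assume "x \<in> carrier R"
  then have x: "x \<in> Ops" by (auto simp: R_simps(1))
  show "\<one>\<^bsub>R\<^esub> \<otimes>\<^bsub>R\<^esub> x = x" "x \<otimes>\<^bsub>R\<^esub> \<one>\<^bsub>R\<^esub> = x"
    by (rule R_eqI; auto simp: R_mult_closed R_one_closed x R_app ops_in)+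
qed (auto simp: R_simps(1) R_mult_closed R_one_closed)

lemma ring_R: "ring R"
proof (rule ringI[OF abelian_group_R monoid_R])
  fix x y z assume x: "x \<in> carrier R" and y: "y \<in> carrier R" and z: "z \<in> carrier R"
  then have xyz: "x \<in> Ops" "y \<in> Ops" "z \<in> Ops" by (auto simp: R_simps(1))
  show "(x \<oplus>\<^bsub>R\<^esub> y) \<otimes>\<^bsub>R\<^esub> z = x \<otimes>\<^bsub>R\<^esub> z \<oplus>\<^bsub>R\<^esub> y \<otimes>\<^bsub>R\<^esub> z"
    by (rule R_eqI) (auto simp: R_mult_closed R_add_closed xyz R_app ops_in)
  show "z \<otimes>\<^bsub>R\<^esub> (x \<oplus>\<^bsub>R\<^esub> y) = z \<otimes>\<^bsub>R\<^esub> x \<oplus>\<^bsub>R\<^esub> z \<otimes>\<^bsub>R\<^esub> y"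
    by (rule R_eqI) (auto simp: R_mult_closed R_add_closed xyz R_app ops_in ops_add[OF xyz(3)])
qed

lemma H_inner_add_l: "F \<in> H \<Longrightarrow> G \<in> H \<Longrightarrow> K \<in> H \<Longrightarrow> l2_inner m (lc_add m F G) K = l2_inner m F K + l2_inner m G K"
  and H_inner_add_r: "F \<in> H \<Longrightarrow> G \<in> H \<Longrightarrow> K \<in> H \<Longrightarrow> l2_inner m K (lc_add m F G) = l2_inner m K F + l2_inner m K G"
  and H_inner_scale_l: "F \<in> H \<Longrightarrow> K \<in> H \<Longrightarrow> l2_inner m (lc_scale m c F) K = c * l2_inner m F K"
  and H_inner_scale_r: "F \<in> H \<Longrightarrow> K \<in> H \<Longrightarrow> l2_inner m K (lc_scale m c F) = cnj c * l2_inner m K F"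
  and H_inner_cnj: "F \<in> H \<Longrightarrow> K \<in> H \<Longrightarrow> cnj (l2_inner m F K) = l2_inner m K F"
  by (auto elim!: HE simp: lc_cl l2_inner_cl Hfm ip_add_left ip_add_right ip_scale_left ip_scale_right Hf_sq ip_cnj Hf_add Hf_scale)

lemma H_inner_self: "F \<in> H \<Longrightarrow> l2_inner m F F = of_real ((l2_norm m F)\<^sup>2)"
  by (auto elim!: HE simp: l2_inner_cl l2_norm_cl Hfm ip_self simp del: of_real_power)

lemma H_inner_CS: "F \<in> H \<Longrightarrow> G \<in> H \<Longrightarrow> cmod (l2_inner m F G) \<le> l2_norm m F * l2_norm m G"
  by (auto elim!: HE simp: l2_inner_cl l2_norm_cl Hfm intro!: ip_Cauchy_Schwarz Hf_sq)

lemma H_norm_scale: "F \<in> H \<Longrightarrow> l2_norm m (lc_scale m c F) = cmod c * l2_norm m F"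
  by (auto elim!: HE simp: lc_cl l2_norm_cl Hfm Hf_scale n2_scale real_sqrt_mult)

lemma H_norm_tri: "F \<in> H \<Longrightarrow> G \<in> H \<Longrightarrow> l2_norm m (lc_add m F G) \<le> l2_norm m F + l2_norm m G"
  by (auto elim!: HE simp: lc_cl l2_norm_cl Hfm Hf_add intro!: n2_triangle Hf_sq)

lemma H_norm_0: "F \<in> H \<Longrightarrow> l2_norm m F = 0 \<Longrightarrow> F = cl (\<lambda>_. 0)"
proof -
  assume F: "F \<in> H" and 0: "l2_norm m F = 0"
  obtain f where f: "f \<in> Hf" "F = cl f" using F by (rule HE)
  then have "AE x in m. f x = 0" using 0 by (simp add: l2_norm_cl Hfm n2_eq_0_iff Hf_sq)
  then show "F = cl (\<lambda>_. 0)" unfolding f(2) by (rule ae_class_cong)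
qed

lemma H_norm_zero: "l2_norm m (cl (\<lambda>_. 0)) = 0"
  by (simp add: l2_norm_cl)

lemma H_inner_ext:
  assumes "F \<in> H" "G \<in> H" "\<And>K. K \<in> H \<Longrightarrow> l2_inner m K F = l2_inner m K G"
  shows "F = G"
proof -
  let ?D = "lc_add m F (lc_scale m (-1) G)"
  have D: "?D \<in> H" by (intro H_add H_scale assms)
  have "l2_inner m ?D ?D = l2_inner m ?D F - l2_inner m ?D G"
    using H_inner_add_r[OF assms(1) H_scale[OF assms(2)] D, of "-1"] H_inner_scale_r[OF assms(2) D, of "-1"] by simp
  then have "l2_inner m ?D ?D = 0" using assms(3)[OF D] by simp
  then have "l2_norm m ?D = 0" using H_inner_self[OF D] by simp
  then have "?D = cl (\<lambda>_. 0)" by (rule H_norm_0[OF D])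
  then have "lc_add m ?D G = G" using H_0[OF assms(2)] by simp
  moreover have "lc_add m ?D G = F"
  proof -
    obtain f g where fg: "f \<in> Hf" "F = cl f" "g \<in> Hf" "G = cl g" using assms by (auto elim!: HE)
    then show ?thesis by (simp add: lc_cl Hfm Hf_scale Hf_add Hf_diff)
  qed
  ultimately show ?thesis by simp
qed

lemma adj_ex:
  assumes X: "X \<in> Ops"
  shows "\<exists>Y. Y \<in> Ops \<and> (\<forall>F\<in>H. \<forall>G\<in>H. l2_inner m (X F) G = l2_inner m F (Y G))"
proof -
  obtain C where C: "bop m (L_of X) C" using ops_bop[OF X] by blast
  obtain L' where L': "bop m L' C" "\<And>f g. f \<in> sq m \<Longrightarrow> g \<in> sq m \<Longrightarrow> ip m (L_of X f) g = ip m f (L' g)"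
    by (rule bop_adjoint[OF C]) auto
  have "l2_inner m (X F) G = l2_inner m F (compress L' G)" if F: "F \<in> H" and G: "G \<in> H" for F G
  proof -
    obtain f g where fg: "f \<in> Hf" "F = cl f" "g \<in> Hf" "G = cl g" using F G by (auto elim!: HE)
    have "l2_inner m (X F) G = ip m (L_of X f) g"
      unfolding fg L_of_cl[OF X fg(1), symmetric] by (intro l2_inner_cl Hfm L_of_Hf[OF X] Hf_sq fg)
    also have "\<dots> = ip m f (L' g)" by (intro L' Hf_sq fg)
    also have "\<dots> = ip m f (P (L' g))" by (intro P_ip_right[symmetric] bop_sq[OF L'(1)] Hf_sq fg)
    also have "\<dots> = l2_inner m F (compress L' G)"
      unfolding fg compress_cl[OF L'(1) fg(3)] by (intro l2_inner_cl[symmetric] Hfm P_Hf bop_sq[OF L'(1)] Hf_sq fg)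
    finally show ?thesis .
  qed
  then show ?thesis using compress_in[OF L'(1)] by blast
qed

lemma adj_eqI:
  assumes X: "X \<in> Ops" and Y: "Y \<in> Ops"
    and eq: "\<And>F G. F \<in> H \<Longrightarrow> G \<in> H \<Longrightarrow> l2_inner m (X F) G = l2_inner m F (Y G)"
  shows "adj R X = Y"
proof -
  have "(THE S. S \<in> Ops \<and> (\<forall>f\<in>H. \<forall>g\<in>H. l2_inner m (X f) g = l2_inner m f (S g))) = Y"
  proof (rule the_equality)
    fix S assume S: "S \<in> Ops \<and> (\<forall>f\<in>H. \<forall>g\<in>H. l2_inner m (X f) g = l2_inner m f (S g))"
    show "S = Y"
    proof (rule R_eqI)
      fix F assume F: "F \<in> H"
      show "S F = Y F"
      proof (rule H_inner_ext)
        show "S F \<in> H" "Y F \<in> H" using S Y F by (auto intro: ops_in)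
        fix K assume K: "K \<in> H"
        show "l2_inner m K (S F) = l2_inner m K (Y F)" using S eq[OF K F] K F by simp
      qed
    qed (use S Y in auto)
  qed (use Y eq in auto)
  then show ?thesis by (simp add: BH_def)
qed

lemma adj_props:
  assumes X: "X \<in> Ops"
  shows "adj R X \<in> Ops" "\<And>F G. F \<in> H \<Longrightarrow> G \<in> H \<Longrightarrow> l2_inner m (X F) G = l2_inner m F (adj R X G)"
    "\<And>F G. F \<in> H \<Longrightarrow> G \<in> H \<Longrightarrow> l2_inner m F (X G) = l2_inner m (adj R X F) G"
proof -
  obtain Y where Y: "Y \<in> Ops" "\<And>F G. F \<in> H \<Longrightarrow> G \<in> H \<Longrightarrow> l2_inner m (X F) G = l2_inner m F (Y G)"
    using adj_ex[OF X] by blast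
  have eq: "adj R X = Y" by (rule adj_eqI[OF X Y])
  show "adj R X \<in> Ops" using Y eq by simp
  show "l2_inner m (X F) G = l2_inner m F (adj R X G)" if "F \<in> H" "G \<in> H" for F G
    using Y that eq by simp
  show "l2_inner m F (X G) = l2_inner m (adj R X F) G" if "F \<in> H" "G \<in> H" for F G
  proof -
    have "l2_inner m F (X G) = cnj (l2_inner m (X G) F)" by (rule H_inner_cnj[OF ops_in[OF X that(2)] that(1), symmetric])
    also have "\<dots> = cnj (l2_inner m G (Y F))" using Y(2)[OF that(2,1)] by simp
    also have "\<dots> = l2_inner m (Y F) G" by (rule H_inner_cnj[OF that(2) ops_in[OF Y(1) that(1)]])
    finally show ?thesis using eq by simp
  qed
qed

lemma R_anorm:
  assumes X: "X \<in> Ops"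
  shows R_anorm_bound: "\<And>F. F \<in> H \<Longrightarrow> l2_norm m (X F) \<le> anorm R X * l2_norm m F"
    and R_anorm_nonneg: "0 \<le> anorm R X"
    and R_anorm_le: "\<And>c. c \<ge> 0 \<Longrightarrow> (\<And>F. F \<in> H \<Longrightarrow> l2_norm m (X F) \<le> c * l2_norm m F) \<Longrightarrow> anorm R X \<le> c"
proof -
  obtain c where c: "c \<ge> 0" "\<And>F. F \<in> H \<Longrightarrow> l2_norm m (X F) \<le> c * l2_norm m F" by (rule ops_bound[OF X]) auto
  have N: "anorm R X = (SUP f\<in>{f \<in> H. l2_norm m f \<le> 1}. l2_norm m (X f))" by (simp add: BH_def)
  have bdd: "bdd_above ((\<lambda>f. l2_norm m (X f)) ` {f \<in> H. l2_norm m f \<le> 1})"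
  proof (rule bdd_aboveI2)
    fix F assume "F \<in> {f \<in> H. l2_norm m f \<le> 1}"
    then show "l2_norm m (X F) \<le> c" using c(2)[of F] mult_left_mono[of "l2_norm m F" 1 c] c(1) by auto
  qed
  have z: "cl (\<lambda>_. 0) \<in> {f \<in> H. l2_norm m f \<le> 1}" by (simp add: H_zero H_norm_zero)
  show nn: "0 \<le> anorm R X"
    unfolding N using cSUP_upper[OF z bdd] l2_norm_nonneg order_trans by blast
  show "l2_norm m (X F) \<le> anorm R X * l2_norm m F" if F: "F \<in> H" for F
  proof (cases "l2_norm m F = 0")
    case True then show ?thesis using c(2)[OF F] by simp
  next
    case False
    then have p: "l2_norm m F > 0" using l2_norm_nonneg[of F] by simp
    let ?c = "complex_of_real (1 / l2_norm m F)"
    have cc: "cmod ?c = 1 / l2_norm m F" using p by (simp only: norm_of_real) simp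
    have "lc_scale m ?c F \<in> {f \<in> H. l2_norm m f \<le> 1}" using F p cc by (simp add: H_scale H_norm_scale)
    from cSUP_upper[OF this bdd] have "l2_norm m (X (lc_scale m ?c F)) \<le> anorm R X" unfolding N .
    then have "1 / l2_norm m F * l2_norm m (X F) \<le> anorm R X"
      using F cc by (simp only: ops_scale[OF X F] H_norm_scale[OF ops_in[OF X F]])
    then show ?thesis using p by (simp add: field_simps)
  qed
  show "anorm R X \<le> d" if d: "d \<ge> 0" "\<And>F. F \<in> H \<Longrightarrow> l2_norm m (X F) \<le> d * l2_norm m F" for d
    unfolding N
  proof (rule cSUP_least)
    show "{f \<in> H. l2_norm m f \<le> 1} \<noteq> {}" using z by blast
    fix F assume "F \<in> {f \<in> H. l2_norm m f \<le> 1}"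
    then show "l2_norm m (X F) \<le> d" using d(2)[of F] mult_left_mono[of "l2_norm m F" 1 d] d(1) by auto
  qed
qed

end


lemma (in prob_space) Linf_star_ring: "star_ring (Linf M)"
proof -
  interpret cring "Linf M" by (rule Linf_cring)
  have ae: "ae_class M f = ae_class M g" if "AE x in M. f x = g x" for f g :: "'a \<Rightarrow> complex" using that by (rule ae_class_cong)
  have sc_le: "anorm (Linf M) (c \<odot>\<^bsub>Linf M\<^esub> x) \<le> cmod c * anorm (Linf M) x" if x: "x \<in> carrier (Linf M)" for c x
  proof -
    obtain f where f: "f \<in> bm M" "x = ae_class M f" using x by (rule LinfE)
    have "AE x in M. cmod (c * f x) \<le> cmod c * anorm (Linf M) (ae_class M f)"
      using Linf_anorm(2)[OF f(1)] by eventually_elim (auto simp: norm_mult intro!: mult_left_mono)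
    from Linf_anorm(3)[OF bm_scale[OF f(1)] this] show ?thesis
      using f by (simp add: Linf_simps lc_cl bm_measurable)
  qed
  have sc_cl: "c \<odot>\<^bsub>Linf M\<^esub> x \<in> carrier (Linf M)" if "x \<in> carrier (Linf M)" for c x
    using that by (auto elim!: LinfE simp: Linf_simps lc_cl bm_measurable intro!: cl_Linf bm_scale)
  have adj_le: "anorm (Linf M) (adj (Linf M) x) \<le> anorm (Linf M) x" if x: "x \<in> carrier (Linf M)" for x
  proof -
    obtain f where f: "f \<in> bm M" "x = ae_class M f" using x by (rule LinfE)
    have "AE x in M. cmod (cnj (f x)) \<le> anorm (Linf M) (ae_class M f)"
      using Linf_anorm(2)[OF f(1)] by simp
    from Linf_anorm(3)[OF bm_cnj[OF f(1)] this] show ?thesis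
      using f by (simp add: Linf_simps lc_cl bm_measurable)
  qed
  have adj_cl: "adj (Linf M) x \<in> carrier (Linf M)" if "x \<in> carrier (Linf M)" for x
    using that by (auto elim!: LinfE simp: Linf_simps lc_cl bm_measurable intro!: cl_Linf bm_cnj)
  have adj_adj: "adj (Linf M) (adj (Linf M) x) = x" if "x \<in> carrier (Linf M)" for x
    using that by (auto elim!: LinfE simp: Linf_simps lc_cl bm_measurable bm_cnj)
  have zero: "anorm (Linf M) \<zero>\<^bsub>Linf M\<^esub> = 0"
  proof -
    have "anorm (Linf M) (ae_class M (\<lambda>_. 0)) \<le> 0" by (rule Linf_anorm(3)[OF bm_const]) simp
    then show ?thesis using Linf_anorm(1)[OF bm_const[of 0]] by (simp add: Linf_simps)
  qed
  show ?thesis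
  proof (unfold_locales)
    fix x c assume x: "x \<in> carrier (Linf M)"
    show "c \<odot>\<^bsub>Linf M\<^esub> x \<in> carrier (Linf M)" by (rule sc_cl[OF x])
    show "(- 1) \<odot>\<^bsub>Linf M\<^esub> x = \<ominus>\<^bsub>Linf M\<^esub> x"
      using x by (auto elim!: LinfE simp: Linf_simps lc_cl bm_measurable Linf_neg)
    show "0 \<le> anorm (Linf M) x" using x by (auto elim!: LinfE intro: Linf_anorm)
    show "adj (Linf M) x \<in> carrier (Linf M)" by (rule adj_cl[OF x])
    show "adj (Linf M) (c \<odot>\<^bsub>Linf M\<^esub> x) = cnj c \<odot>\<^bsub>Linf M\<^esub> adj (Linf M) x"
      using x by (auto elim!: LinfE simp: Linf_simps lc_cl bm_measurable)
    show "adj (Linf M) (adj (Linf M) x) = x" by (rule adj_adj[OF x])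
    show "anorm (Linf M) (adj (Linf M) x) \<le> anorm (Linf M) x" by (rule adj_le[OF x])
    show "anorm (Linf M) (c \<odot>\<^bsub>Linf M\<^esub> x) \<le> cmod c * anorm (Linf M) x" by (rule sc_le[OF x])
  next
    fix x assume x: "x \<in> carrier (Linf M)" and 0: "anorm (Linf M) x = 0"
    obtain f where f: "f \<in> bm M" "x = ae_class M f" using x by (rule LinfE)
    have "AE x in M. f x = 0" using Linf_anorm(2)[OF f(1)] f(2) 0 by simp
    then show "x = \<zero>\<^bsub>Linf M\<^esub>" unfolding f(2) Linf_simps by (rule ae)
  next
    show "anorm (Linf M) \<zero>\<^bsub>Linf M\<^esub> = 0" by (rule zero)
  next
    fix x y c assume x: "x \<in> carrier (Linf M)" and y: "y \<in> carrier (Linf M)"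
    obtain f where f: "f \<in> bm M" "x = ae_class M f" using x by (rule LinfE)
    obtain g where g: "g \<in> bm M" "y = ae_class M g" using y by (rule LinfE)
    show "c \<odot>\<^bsub>Linf M\<^esub> (x \<otimes>\<^bsub>Linf M\<^esub> y) = (c \<odot>\<^bsub>Linf M\<^esub> x) \<otimes>\<^bsub>Linf M\<^esub> y"
      using f g by (simp add: Linf_simps lc_cl bm_measurable mult.assoc)
    show "adj (Linf M) (x \<oplus>\<^bsub>Linf M\<^esub> y) = adj (Linf M) x \<oplus>\<^bsub>Linf M\<^esub> adj (Linf M) y"
      using f g by (simp add: Linf_simps lc_cl bm_measurable)
    show "adj (Linf M) (x \<otimes>\<^bsub>Linf M\<^esub> y) = adj (Linf M) y \<otimes>\<^bsub>Linf M\<^esub> adj (Linf M) x"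
      using f g by (simp add: Linf_simps lc_cl bm_measurable mult.commute)
    have "AE z in M. cmod (f z + g z) \<le> anorm (Linf M) x + anorm (Linf M) y"
      using Linf_anorm(2)[OF f(1)] Linf_anorm(2)[OF g(1)] unfolding f(2) g(2) by eventually_elim (rule norm_triangle_mono)
    from Linf_anorm(3)[OF bm_add[OF f(1) g(1)] this]
    show "anorm (Linf M) (x \<oplus>\<^bsub>Linf M\<^esub> y) \<le> anorm (Linf M) x + anorm (Linf M) y"
      using f g by (simp add: Linf_simps lc_cl bm_measurable)
    have "AE z in M. cmod (f z * g z) \<le> anorm (Linf M) x * anorm (Linf M) y"
      using Linf_anorm(2)[OF f(1)] Linf_anorm(2)[OF g(1)] unfolding f(2) g(2)
      by eventually_elim (auto simp: norm_mult intro!: mult_mono Linf_anorm(1)[OF f(1)])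
    from Linf_anorm(3)[OF bm_mult[OF f(1) g(1)] this]
    show "anorm (Linf M) (x \<otimes>\<^bsub>Linf M\<^esub> y) \<le> anorm (Linf M) x * anorm (Linf M) y"
      using f g by (simp add: Linf_simps lc_cl bm_measurable)
  qed
qed

context spherical_setting begin

lemma R_smult_neg: "X \<in> Ops \<Longrightarrow> (-1) \<odot>\<^bsub>R\<^esub> X = \<ominus>\<^bsub>R\<^esub> X"
proof -
  assume x: "X \<in> Ops"
  interpret ring R by (rule ring_R)
  have "((-1) \<odot>\<^bsub>R\<^esub> X) \<oplus>\<^bsub>R\<^esub> X = \<zero>\<^bsub>R\<^esub>"
    by (rule R_eqI) (auto simp: R_add_closed R_zero_closed R_smult_closed x R_app H_neg ops_in)
  then show ?thesis using x by (intro minus_equality[symmetric]) (auto simp: R_simps(1) R_smult_closed)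
qed

lemma star_ring_R: "star_ring R"
proof -
  interpret ring R by (rule ring_R)
  have car: "carrier R = Ops" by (rule R_simps(1))
  have sc_le: "anorm R (c \<odot>\<^bsub>R\<^esub> X) \<le> cmod c * anorm R X" if X: "X \<in> Ops" for c X
  proof (rule R_anorm_le[OF R_smult_closed[OF X]])
    show "0 \<le> cmod c * anorm R X" using R_anorm_nonneg[OF X] by simp
    fix F assume F: "F \<in> H"
    show "l2_norm m ((c \<odot>\<^bsub>R\<^esub> X) F) \<le> cmod c * anorm R X * l2_norm m F"
      using R_anorm_bound[OF X F] F by (simp add: R_app H_norm_scale ops_in[OF X] mult.assoc mult_left_mono)
  qed
  have adj_adj: "adj R (adj R X) = X" if X: "X \<in> Ops" for X
    by (rule adj_eqI[OF adj_props(1)[OF X] X]) (simp add: adj_props(3)[OF X])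
  have adj_le: "anorm R (adj R X) \<le> anorm R X" if X: "X \<in> Ops" for X
  proof (rule R_anorm_le[OF adj_props(1)[OF X] R_anorm_nonneg[OF X]])
    fix F assume F: "F \<in> H"
    let ?G = "adj R X F"
    have G: "?G \<in> H" by (rule ops_in[OF adj_props(1)[OF X] F])
    have "l2_inner m (X ?G) F = of_real ((l2_norm m ?G)\<^sup>2)"
      using adj_props(2)[OF X G F] H_inner_self[OF G] by simp
    then have "(l2_norm m ?G)\<^sup>2 = cmod (l2_inner m (X ?G) F)" by (simp add: norm_power)
    also have "\<dots> \<le> l2_norm m (X ?G) * l2_norm m F" by (rule H_inner_CS[OF ops_in[OF X G] F])
    also have "\<dots> \<le> (anorm R X * l2_norm m ?G) * l2_norm m F"
      by (intro mult_right_mono R_anorm_bound[OF X G] l2_norm_nonneg)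
    finally have "l2_norm m ?G * l2_norm m ?G \<le> (anorm R X * l2_norm m F) * l2_norm m ?G"
      by (simp add: power2_eq_square mult_ac)
    then show "l2_norm m ?G \<le> anorm R X * l2_norm m F"
      using l2_norm_nonneg[of ?G] l2_norm_nonneg[of F] R_anorm_nonneg[OF X]
      by (cases "l2_norm m ?G = 0") (auto simp: mult_le_cancel_right)
  qed
  have zero: "anorm R \<zero>\<^bsub>R\<^esub> = 0"
  proof -
    have "anorm R \<zero>\<^bsub>R\<^esub> \<le> 0" by (rule R_anorm_le[OF R_zero_closed]) (auto simp: R_app H_norm_zero)
    then show ?thesis using R_anorm_nonneg[OF R_zero_closed] by simp
  qed
  show ?thesis
  proof (unfold_locales; (unfold car)?)
    fix X c assume X: "X \<in> Ops"
    show "c \<odot>\<^bsub>R\<^esub> X \<in> Ops" by (rule R_smult_closed[OF X])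
    show "(- 1) \<odot>\<^bsub>R\<^esub> X = \<ominus>\<^bsub>R\<^esub> X" by (rule R_smult_neg[OF X])
    show "0 \<le> anorm R X" by (rule R_anorm_nonneg[OF X])
    show "adj R X \<in> Ops" by (rule adj_props(1)[OF X])
    show "adj R (adj R X) = X" by (rule adj_adj[OF X])
    show "anorm R (adj R X) \<le> anorm R X" by (rule adj_le[OF X])
    show "adj R (c \<odot>\<^bsub>R\<^esub> X) = cnj c \<odot>\<^bsub>R\<^esub> adj R X"
      by (rule adj_eqI) (auto simp: R_smult_closed X adj_props(1)[OF X] R_app H_inner_scale_l H_inner_scale_r ops_in[OF X] ops_in[OF adj_props(1)[OF X]] adj_props(2)[OF X])
    show "anorm R (c \<odot>\<^bsub>R\<^esub> X) \<le> cmod c * anorm R X" by (rule sc_le[OF X])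
  next
    fix X assume X: "X \<in> Ops" and 0: "anorm R X = 0"
    show "X = \<zero>\<^bsub>R\<^esub>"
    proof (rule R_eqI[OF X R_zero_closed])
      fix F assume F: "F \<in> H"
      have "l2_norm m (X F) = 0" using R_anorm_bound[OF X F] 0 l2_norm_nonneg[of "X F"] by simp
      then show "X F = \<zero>\<^bsub>R\<^esub> F" using H_norm_0[OF ops_in[OF X F]] F by (simp add: R_app)
    qed
  next
    show "anorm R \<zero>\<^bsub>R\<^esub> = 0" by (rule zero)
  next
    fix X Y c assume X: "X \<in> Ops" and Y: "Y \<in> Ops"
    show "c \<odot>\<^bsub>R\<^esub> (X \<otimes>\<^bsub>R\<^esub> Y) = (c \<odot>\<^bsub>R\<^esub> X) \<otimes>\<^bsub>R\<^esub> Y"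
      by (rule R_eqI) (auto simp: R_smult_closed R_mult_closed X Y R_app ops_in[OF Y])
    show "adj R (X \<oplus>\<^bsub>R\<^esub> Y) = adj R X \<oplus>\<^bsub>R\<^esub> adj R Y"
      by (rule adj_eqI) (auto simp: R_add_closed X Y adj_props(1) R_app H_inner_add_l H_inner_add_r ops_in[OF X] ops_in[OF Y] ops_in[OF adj_props(1)[OF X]] ops_in[OF adj_props(1)[OF Y]] adj_props(2)[OF X] adj_props(2)[OF Y])
    show "adj R (X \<otimes>\<^bsub>R\<^esub> Y) = adj R Y \<otimes>\<^bsub>R\<^esub> adj R X"
      by (rule adj_eqI) (auto simp: R_mult_closed X Y adj_props(1) R_app ops_in[OF X] ops_in[OF Y] ops_in[OF adj_props(1)[OF X]] ops_in[OF adj_props(1)[OF Y]] adj_props(2)[OF X] adj_props(2)[OF Y])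
    show "anorm R (X \<oplus>\<^bsub>R\<^esub> Y) \<le> anorm R X + anorm R Y"
    proof (rule R_anorm_le[OF R_add_closed[OF X Y]])
      fix F assume F: "F \<in> H"
      have "l2_norm m ((X \<oplus>\<^bsub>R\<^esub> Y) F) \<le> l2_norm m (X F) + l2_norm m (Y F)"
        using F by (simp add: R_app H_norm_tri ops_in[OF X] ops_in[OF Y])
      then show "l2_norm m ((X \<oplus>\<^bsub>R\<^esub> Y) F) \<le> (anorm R X + anorm R Y) * l2_norm m F"
        using R_anorm_bound[OF X F] R_anorm_bound[OF Y F] by (simp add: distrib_right)
    qed (use R_anorm_nonneg X Y in auto)
    show "anorm R (X \<otimes>\<^bsub>R\<^esub> Y) \<le> anorm R X * anorm R Y"
    proof (rule R_anorm_le[OF R_mult_closed[OF X Y]])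
      fix F assume F: "F \<in> H"
      have "l2_norm m ((X \<otimes>\<^bsub>R\<^esub> Y) F) \<le> anorm R X * l2_norm m (Y F)"
        using F R_anorm_bound[OF X ops_in[OF Y F]] by (simp add: R_app)
      also have "\<dots> \<le> anorm R X * (anorm R Y * l2_norm m F)"
        by (intro mult_left_mono R_anorm_bound[OF Y F] R_anorm_nonneg[OF X])
      finally show "l2_norm m ((X \<otimes>\<^bsub>R\<^esub> Y) F) \<le> anorm R X * anorm R Y * l2_norm m F" by simp
    qed (use R_anorm_nonneg X Y in auto)
  qed
qed

section \<open>Toeplitz operators and their symbols\<close>

abbreviation "T \<equiv> toeplitz m A"

lemma toeplitz_compress:
  assumes psi: "\<psi> \<in> bm m" shows "T (cl \<psi>) = compress (\<lambda>f x. \<psi> x * f x)"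
proof (rule extensionalityI[of _ H])
  obtain C where C: "bop m (\<lambda>f x. \<psi> x * f x) C" by (rule bop_mult[OF psi])
  fix F assume F: "F \<in> H"
  then obtain f where f: "f \<in> Hf" "F = cl f" by (rule HE)
  have s: "(\<psi> \<cdot> f) \<in> sq m" by (intro sq_mult psi Hf_sq f)
  show "T (cl \<psi>) F = compress (\<lambda>f x. \<psi> x * f x) F"
    using F f s by (simp add: toeplitz_def compress_cl[OF C f(1)] lc_mult_cl bm_measurable[OF psi] Hfm H2_proj_cl)
qed (simp_all add: toeplitz_def compress_def)

lemma toeplitz_cl: "\<psi> \<in> bm m \<Longrightarrow> f \<in> Hf \<Longrightarrow> T (cl \<psi>) (cl f) = cl (P (\<psi> \<cdot> f))"
  using bop_mult[of \<psi>] toeplitz_compress[of \<psi>] compress_cl by metis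

lemma toeplitz_in: "\<psi> \<in> bm m \<Longrightarrow> T (cl \<psi>) \<in> Ops"
  using bop_mult[of \<psi>] toeplitz_compress[of \<psi>] compress_in by metis

definition sym :: "('k lclass \<Rightarrow> 'k lclass) \<Rightarrow> 'k lclass \<Rightarrow> bool" where
  "sym X F \<longleftrightarrow> (\<exists>\<psi>\<in>bm m. F = cl \<psi> \<and> symbol (L_of X) \<psi>)"

lemma L_of_sq: "X \<in> Ops \<Longrightarrow> f \<in> sq m \<Longrightarrow> L_of X f \<in> sq m"
  by (rule Hf_sq[OF L_of_Hf(1)])

lemma L_of_anorm: "X \<in> Ops \<Longrightarrow> bop m (L_of X) ((anorm R X)\<^sup>2)"
  by (rule L_of_bop) (auto intro: R_anorm_nonneg R_anorm_bound)

lemma symI: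
  assumes X: "X \<in> Ops" and hs: "symbol L \<psi>" and L: "\<And>f. f \<in> sq m \<Longrightarrow> L f \<in> Hf \<and> cl (L f) = X (cl (P f))"
    and psi: "\<psi> \<in> bm m"
  shows "sym X (cl \<psi>)"
proof -
  have "symbol (L_of X) \<psi>"
  proof (rule symbol_cong[OF hs])
    fix f assume f: "f \<in> sq m"
    show "L f \<in> sq m" using L[OF f] Hf_sq by blast
    show "L_of X f \<in> sq m" by (rule L_of_sq[OF X f])
    have "cl (L_of X f) = cl (L f)" using L[OF f] L_of_Hf(2)[OF X f] by simp
    then show "AE x in m. L_of X f x = L f x"
      using ae_class_eq_iff[OF Hfm[OF L_of_Hf(1)[OF X f]] Hfm] L[OF f] by blast
  qed (use psi in auto)
  then show ?thesis using psi by (auto simp: sym_def)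
qed

lemma sym_toeplitz:
  assumes psi: "\<psi> \<in> bm m" shows "sym (T (cl \<psi>)) (cl \<psi>)"
proof -
  obtain C where C: "bop m (\<lambda>f x. \<psi> x * f x) C" by (rule bop_mult[OF psi])
  have 1: "symbol (\<lambda>f x. \<psi> x * P f x) (\<lambda>x. \<psi> x * 1)"
    by (rule symbol_comp[OF C bop_P symbol_mult symbol_P psi bm_const])
  have 2: "symbol (\<lambda>f. P (\<lambda>x. \<psi> x * P f x)) (\<lambda>x. 1 * (\<psi> x * 1))"
    by (rule symbol_comp[OF bop_P bop_comp[OF C bop_P] symbol_P 1 bm_const]) (use psi in simp)
  show ?thesis
  proof (rule symI[OF toeplitz_in[OF psi] _ _ psi])
    show "symbol (\<lambda>f. P (\<lambda>x. \<psi> x * P f x)) \<psi>" using 2 by simp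
    show "P (\<lambda>x. \<psi> x * P f x) \<in> Hf \<and> cl (P (\<lambda>x. \<psi> x * P f x)) = T (cl \<psi>) (cl (P f))" if f: "f \<in> sq m" for f
      using toeplitz_cl[OF psi P_Hf[OF f]] P_Hf[OF sq_mult[OF psi P_sq[OF f]]] by simp
  qed
qed

lemma sym_add:
  assumes X: "X \<in> Ops" and Y: "Y \<in> Ops" and s: "sym X F" "sym Y G"
  shows "sym (X \<oplus>\<^bsub>R\<^esub> Y) (lc_add m F G)"
proof -
  obtain f g where fg: "f \<in> bm m" "F = cl f" "symbol (L_of X) f" "g \<in> bm m" "G = cl g" "symbol (L_of Y) g"
    using s by (auto simp: sym_def)
  have "sym (X \<oplus>\<^bsub>R\<^esub> Y) (cl (f +: g))"
  proof (rule symI[OF R_add_closed[OF X Y] _ _ bm_add[OF fg(1,4)]])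
    show "symbol (\<lambda>h x. L_of X h x + L_of Y h x) (f +: g)"
      by (rule symbol_add[OF fg(3,6) L_of_sq[OF X] L_of_sq[OF Y] fg(1,4)])
    fix h assume h: "h \<in> sq m"
    note LX = L_of_Hf[OF X h] and LY = L_of_Hf[OF Y h]
    have "cl (\<lambda>x. L_of X h x + L_of Y h x) = lc_add m (cl (L_of X h)) (cl (L_of Y h))"
      by (rule lc_add_cl[OF Hfm[OF LX(1)] Hfm[OF LY(1)], symmetric])
    then show "(\<lambda>x. L_of X h x + L_of Y h x) \<in> Hf \<and> cl (\<lambda>x. L_of X h x + L_of Y h x) = (X \<oplus>\<^bsub>R\<^esub> Y) (cl (P h))"
      using Hf_add[OF LX(1) LY(1)] LX(2) LY(2) cl_H[OF P_Hf[OF h]] by (simp add: R_app)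
  qed
  then show ?thesis using fg by (simp add: lc_add_cl bm_measurable)
qed

lemma sym_smult:
  assumes X: "X \<in> Ops" and s: "sym X F"
  shows "sym (c \<odot>\<^bsub>R\<^esub> X) (lc_scale m c F)"
proof -
  obtain f where fg: "f \<in> bm m" "F = cl f" "symbol (L_of X) f"
    using s by (auto simp: sym_def)
  have "sym (c \<odot>\<^bsub>R\<^esub> X) (cl (\<lambda>x. c * f x))"
  proof (rule symI[OF R_smult_closed[OF X] _ _ bm_scale[OF fg(1)]])
    show "symbol (\<lambda>h x. c * L_of X h x) (\<lambda>x. c * f x)"
      by (rule symbol_scale[OF fg(3)])
    fix h assume h: "h \<in> sq m"
    note LX = L_of_Hf[OF X h]
    have "cl (\<lambda>x. c * L_of X h x) = lc_scale m c (cl (L_of X h))"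
      by (rule lc_scale_cl[OF Hfm[OF LX(1)], symmetric])
    then show "(\<lambda>x. c * L_of X h x) \<in> Hf \<and> cl (\<lambda>x. c * L_of X h x) = (c \<odot>\<^bsub>R\<^esub> X) (cl (P h))"
      using Hf_scale[OF LX(1)] LX(2) cl_H[OF P_Hf[OF h]] by (simp add: R_app)
  qed
  then show ?thesis using fg by (simp add: lc_scale_cl bm_measurable)
qed

lemma sym_mult:
  assumes X: "X \<in> Ops" and Y: "Y \<in> Ops" and s: "sym X F" "sym Y G"
  shows "sym (X \<otimes>\<^bsub>R\<^esub> Y) (lc_mult m F G)"
proof -
  obtain f g where fg: "f \<in> bm m" "F = cl f" "symbol (L_of X) f" "g \<in> bm m" "G = cl g" "symbol (L_of Y) g"
    using s by (auto simp: sym_def)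
  have "sym (X \<otimes>\<^bsub>R\<^esub> Y) (cl (f \<cdot> g))"
  proof (rule symI[OF R_mult_closed[OF X Y] _ _ bm_mult[OF fg(1,4)]])
    show "symbol (\<lambda>h. L_of X (L_of Y h)) (f \<cdot> g)"
      by (rule symbol_comp[OF L_of_anorm[OF X] L_of_anorm[OF Y] fg(3,6) fg(1,4)])
    fix h assume h: "h \<in> sq m"
    note LY = L_of_Hf[OF Y h]
    have "cl (L_of X (L_of Y h)) = X (Y (cl (P h)))" using L_of_cl[OF X LY(1)] LY(2) by simp
    then show "L_of X (L_of Y h) \<in> Hf \<and> cl (L_of X (L_of Y h)) = (X \<otimes>\<^bsub>R\<^esub> Y) (cl (P h))"
      using L_of_Hf(1)[OF X Hf_sq[OF LY(1)]] cl_H[OF P_Hf[OF h]] by (simp add: R_app)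
  qed
  then show ?thesis using fg by (simp add: lc_mult_cl bm_measurable)
qed

lemma sym_norm:
  assumes X: "X \<in> Ops" and s: "sym X F"
  shows "anorm (Linf m) F \<le> anorm R X"
proof -
  obtain f where f: "f \<in> bm m" "F = cl f" "symbol (L_of X) f" using s by (auto simp: sym_def)
  have "AE x in m. (cmod (f x))\<^sup>2 \<le> (anorm R X)\<^sup>2" by (rule symbol_AE_bound[OF L_of_anorm[OF X] f(3,1)])
  then have "AE x in m. cmod (f x) \<le> anorm R X"
    by eventually_elim (use R_anorm_nonneg[OF X] power2_le_imp_le in blast)
  then show ?thesis unfolding f(2) by (rule Linf_anorm(3)[OF f(1)])
qed

end


lemma Linf_limit:
  fixes f :: "nat \<Rightarrow> 'a \<Rightarrow> complex"
  assumes f: "\<And>n. f n \<in> bm M"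
    and c: "\<And>i j. AE x in M. cmod (f i x - f j x) \<le> e i + e j" and e: "e \<longlonglongrightarrow> (0::real)"
  obtains g where "g \<in> bm M" "\<And>i. AE x in M. cmod (f i x - g x) \<le> e i"
proof -
  have [measurable]: "f n \<in> borel_measurable M" for n by (rule bm_measurable[OF f])
  define g where "g = (\<lambda>x. lim (\<lambda>n. f n x))"
  have [measurable]: "g \<in> borel_measurable M" unfolding g_def by measurable
  have all: "AE x in M. \<forall>i j. cmod (f i x - f j x) \<le> e i + e j" using c by (simp add: AE_all_countable)
  have lim: "AE x in M. \<forall>i. cmod (f i x - g x) \<le> e i" using all
    by eventually_elim (use almost_Cauchy_limit(2)[OF _ e, of "\<lambda>n. f n x" for x] in \<open>auto simp: g_def\<close>)
  obtain c0 where c0: "AE x in M. cmod (f 0 x) \<le> c0" using f[of 0] by (auto simp: bm_def)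
  have "AE x in M. cmod (g x) \<le> c0 + e 0" using lim c0
  proof eventually_elim
    fix x assume "\<forall>i. cmod (f i x - g x) \<le> e i" "cmod (f 0 x) \<le> c0"
    moreover have "cmod (g x) \<le> cmod (f 0 x) + cmod (f 0 x - g x)"
      using norm_triangle_ineq4[of "f 0 x" "f 0 x - g x"] by simp
    moreover have "cmod (f 0 x - g x) \<le> e 0" using calculation(1) by blast
    ultimately show "cmod (g x) \<le> c0 + e 0" by linarith
  qed
  then have "g \<in> bm M" by (auto simp: bm_def)
  moreover have "AE x in M. cmod (f i x - g x) \<le> e i" for i using lim by eventually_elim blast
  ultimately show thesis by (rule that)
qed

context spherical_setting begin

sublocale BH: star_ring R by (rule star_ring_R)
sublocale LI: star_ring "Linf m" by (rule Linf_star_ring)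

lemma R_minus_app: "X \<in> Ops \<Longrightarrow> Y \<in> Ops \<Longrightarrow> F \<in> H \<Longrightarrow>
    (X \<ominus>\<^bsub>R\<^esub> Y) F = lc_add m (X F) (lc_scale m (-1) (Y F))"
  by (simp add: a_minus_def R_smult_neg[symmetric] R_app)

lemma sym_sub:
  assumes X: "X \<in> Ops" and Y: "Y \<in> Ops" and s: "sym X (cl f)" "sym Y (cl g)" and fg: "f \<in> bm m" "g \<in> bm m"
  shows "sym (X \<ominus>\<^bsub>R\<^esub> Y) (cl (f -: g))"
proof -
  have "sym (X \<oplus>\<^bsub>R\<^esub> ((-1) \<odot>\<^bsub>R\<^esub> Y)) (lc_add m (cl f) (lc_scale m (-1) (cl g)))"
    by (intro sym_add sym_smult X Y R_smult_closed s)
  then show ?thesis using fg bm_scale[OF fg(2), of "-1"] by (simp add: a_minus_def R_smult_neg[OF Y] lc_cl bm_measurable)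
qed

text \<open>Symbols of approximating operators are Cauchy in \<open>L\<^sup>\<infinity>\<close> because symbols are bounded by the operator norm.\<close>

lemma sym_lim:
  assumes B: "cstar_subalgebra (Linf m) B" and X: "X \<in> Ops"
    and ap: "\<And>e. e > 0 \<Longrightarrow> \<exists>Y\<in>Ops. \<exists>G\<in>B. sym Y G \<and> anorm R (X \<ominus>\<^bsub>R\<^esub> Y) < e"
  shows "\<exists>F\<in>B. sym X F"
proof -
  have car: "carrier R = Ops" by (rule R_simps(1))
  define e where "e n = inverse (real (Suc n))" for n
  have e0: "e n > 0" for n by (simp add: e_def)
  have BL: "G \<in> carrier (Linf m)" if "G \<in> B" for G using B that by (auto simp: cstar_subalgebra_def complex_subalgebra_def)
  have "\<forall>n. \<exists>Y g. Y \<in> Ops \<and> g \<in> bm m \<and> cl g \<in> B \<and> sym Y (cl g) \<and> symbol (L_of Y) g \<and> anorm R (X \<ominus>\<^bsub>R\<^esub> Y) < e n"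
  proof
    fix n
    obtain Y G where "Y \<in> Ops" "G \<in> B" "sym Y G" "anorm R (X \<ominus>\<^bsub>R\<^esub> Y) < e n" using ap[OF e0] by blast
    then show "\<exists>Y g. Y \<in> Ops \<and> g \<in> bm m \<and> cl g \<in> B \<and> sym Y (cl g) \<and> symbol (L_of Y) g \<and> anorm R (X \<ominus>\<^bsub>R\<^esub> Y) < e n"
      by (auto simp: sym_def)
  qed
  then obtain Y g where Y: "\<And>n. Y n \<in> Ops" "\<And>n. g n \<in> bm m" "\<And>n. cl (g n) \<in> B" "\<And>n. sym (Y n) (cl (g n))"
    "\<And>n. symbol (L_of (Y n)) (g n)" "\<And>n. anorm R (X \<ominus>\<^bsub>R\<^esub> Y n) < e n" by metis
  have XY: "anorm R (X \<ominus>\<^bsub>R\<^esub> Y n) \<le> e n" for n using Y(6)[of n] by simp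
  have "AE x in m. cmod (g i x - g j x) \<le> e i + e j" for i j
  proof -
    have "anorm (Linf m) (cl (\<lambda>x. g i x - g j x)) \<le> anorm R (Y i \<ominus>\<^bsub>R\<^esub> Y j)"
      by (rule sym_norm[OF _ sym_sub]) (use Y BH.minus_closed car in auto)
    also have "\<dots> \<le> anorm R (Y i \<ominus>\<^bsub>R\<^esub> X) + anorm R (X \<ominus>\<^bsub>R\<^esub> Y j)"
      by (rule BH.norm_minus_tri) (use X Y car in auto)
    also have "anorm R (Y i \<ominus>\<^bsub>R\<^esub> X) = anorm R (X \<ominus>\<^bsub>R\<^esub> Y i)" by (rule BH.norm_minus_commute') (use X Y car in auto)
    finally have "anorm (Linf m) (cl (\<lambda>x. g i x - g j x)) \<le> e i + e j" using XY[of i] XY[of j] by simp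
    then show ?thesis using Linf_anorm(2)[OF bm_diff[OF Y(2)[of i] Y(2)[of j]]] by (auto elim: AE_mp)
  qed
  moreover have et: "e \<longlonglongrightarrow> 0" unfolding e_def by (rule LIMSEQ_inverse_real_of_nat)
  ultimately obtain f where f: "f \<in> bm m" "\<And>i. AE x in m. cmod (g i x - f x) \<le> e i"
    using Linf_limit[of g m e, OF Y(2)] by blast
  have small: "\<exists>n. e n < d" if "d > 0" for d
    using reals_Archimedean[OF that] by (auto simp: e_def)
  have "symbol (L_of X) f"
  proof (rule symbol_limit[OF L_of_sq[OF X] f(1)])
    fix d :: real assume "d > 0"
    then obtain n where n: "e n < d" using small by blast
    have "n2 m (\<lambda>x. L_of X h x - L_of (Y n) h x) \<le> d\<^sup>2 * n2 m h" if h: "h \<in> sq m" for h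
    proof -
      let ?Z = "X \<ominus>\<^bsub>R\<^esub> Y n"
      have Z: "?Z \<in> Ops" using BH.minus_closed X Y(1) car by auto
      note LX = L_of_Hf[OF X h] and LY = L_of_Hf[OF Y(1)[of n] h] and PH = cl_H[OF P_Hf[OF h]]
      have "cl (\<lambda>x. L_of X h x - L_of (Y n) h x) = ?Z (cl (P h))"
        unfolding R_minus_app[OF X Y(1) PH] LX(2)[symmetric] LY(2)[symmetric]
        using LX(1) LY(1) by (simp add: lc_cl Hfm Hf_scale)
      then have "sqrt (n2 m (\<lambda>x. L_of X h x - L_of (Y n) h x)) = l2_norm m (?Z (cl (P h)))"
        using l2_norm_H[OF Hf_diff[OF LX(1) LY(1)]] by simp
      also have "\<dots> \<le> anorm R ?Z * l2_norm m (cl (P h))" by (rule R_anorm_bound[OF Z PH])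
      also have "\<dots> \<le> d * sqrt (n2 m h)"
        using XY[of n] n bop_n2[OF bop_P h] R_anorm_nonneg[OF Z] by (intro mult_mono) (auto simp: l2_norm_H P_Hf h)
      finally have "(sqrt (n2 m (\<lambda>x. L_of X h x - L_of (Y n) h x)))\<^sup>2 \<le> (d * sqrt (n2 m h))\<^sup>2" by (intro power_mono) auto
      then show ?thesis by (simp add: power_mult_distrib)
    qed
    moreover have "AE x in m. cmod (g n x - f x) \<le> d" using f(2)[of n] by eventually_elim (use n in linarith)
    ultimately show "\<exists>L' \<psi>'. symbol L' \<psi>' \<and> \<psi>' \<in> bm m \<and> (\<forall>h\<in>sq m. L' h \<in> sq m \<and> n2 m (\<lambda>x. L_of X h x - L' h x) \<le> d\<^sup>2 * n2 m h)
         \<and> (AE x in m. cmod (\<psi>' x - f x) \<le> d)"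
      using Y(2,5) L_of_sq[OF Y(1)] by (intro exI[of _ "L_of (Y n)"] exI[of _ "g n"]) auto
  qed
  moreover have "cl f \<in> B"
  proof -
    have "\<forall>d>0. \<exists>G\<in>B. anorm (Linf m) (cl f \<ominus>\<^bsub>Linf m\<^esub> G) < d"
    proof (intro allI impI)
      fix d :: real assume "d > 0"
      then obtain n where n: "e n < d" using small by blast
      have "AE x in m. cmod (f x - g n x) \<le> e n" using f(2)[of n] by (simp add: norm_minus_commute)
      from Linf_anorm(3)[OF bm_diff[OF f(1) Y(2)] this] have "anorm (Linf m) (cl f \<ominus>\<^bsub>Linf m\<^esub> cl (g n)) \<le> e n"
        by (simp add: Linf_minus f Y)
      then show "\<exists>G\<in>B. anorm (Linf m) (cl f \<ominus>\<^bsub>Linf m\<^esub> G) < d" using n Y(3) by (intro bexI[of _ "cl (g n)"]) auto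
    qed
    then show ?thesis using B cl_Linf[OF f(1)] unfolding cstar_subalgebra_def norm_closed_def by blast
  qed
  ultimately show ?thesis using f(1) by (auto simp: sym_def)
qed

lemma T_bop:
  assumes psi: "\<psi> \<in> bm m" and c: "c \<ge> 0" "AE x in m. cmod (\<psi> x) \<le> c" and F: "F \<in> H"
  shows "l2_norm m (T (cl \<psi>) F) \<le> c * l2_norm m F"
proof -
  obtain f where f: "f \<in> Hf" "F = cl f" using F by (rule HE)
  have s: "(\<psi> \<cdot> f) \<in> sq m" by (intro sq_mult psi Hf_sq f)
  have "n2 m (P (\<psi> \<cdot> f)) \<le> n2 m (\<psi> \<cdot> f)" using bop_n2[OF bop_P s] by simp
  also have "\<dots> \<le> c\<^sup>2 * n2 m f" by (intro n2_mult_le bm_measurable psi c Hf_sq f)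
  finally have "sqrt (n2 m (P (\<psi> \<cdot> f))) \<le> sqrt (c\<^sup>2 * n2 m f)" by (rule real_sqrt_le_mono)
  then show ?thesis using c f by (simp add: toeplitz_cl[OF psi] l2_norm_H P_Hf[OF s] real_sqrt_mult)
qed

lemma T_adj: assumes psi: "\<psi> \<in> bm m" shows "adj R (T (cl \<psi>)) = T (cl (\<lambda>x. cnj (\<psi> x)))"
proof (rule adj_eqI[OF toeplitz_in[OF psi] toeplitz_in[OF bm_cnj[OF psi]]])
  fix F G assume "F \<in> H" "G \<in> H"
  then obtain f g where fg: "f \<in> Hf" "F = cl f" "g \<in> Hf" "G = cl g" by (auto elim!: HE)
  have s: "(\<psi> \<cdot> f) \<in> sq m" "(\<lambda>x. cnj (\<psi> x) * g x) \<in> sq m" by (intro sq_mult psi bm_cnj Hf_sq fg)+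
  have "ip m (P (\<psi> \<cdot> f)) g = ip m (\<psi> \<cdot> f) g" by (rule P_ip[OF s(1) fg(3)])
  also have "\<dots> = ip m f (\<lambda>x. cnj (\<psi> x) * g x)" by (simp add: ip_def mult_ac)
  also have "\<dots> = ip m f (P (\<lambda>x. cnj (\<psi> x) * g x))" by (rule P_ip_right[OF s(2) fg(1), symmetric])
  finally show "l2_inner m (T (cl \<psi>) F) G = l2_inner m F (T (cl (\<lambda>x. cnj (\<psi> x))) G)"
    using fg s by (simp add: toeplitz_cl psi bm_cnj l2_inner_cl Hfm P_Hf)
qed

lemma T_add: assumes f: "f \<in> bm m" and g: "g \<in> bm m"
  shows "T (cl (f +: g)) = T (cl f) \<oplus>\<^bsub>R\<^esub> T (cl g)"
proof (rule ops_eqI[OF toeplitz_in[OF bm_add[OF f g]] R_add_closed[OF toeplitz_in[OF f] toeplitz_in[OF g]]])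
  fix h assume h: "h \<in> Hf"
  have s: "(f \<cdot> h) \<in> sq m" "(g \<cdot> h) \<in> sq m" by (intro sq_mult f g Hf_sq h)+
  have "cl (P (\<lambda>x. f x * h x + g x * h x)) = cl (\<lambda>x. P (f \<cdot> h) x + P (g \<cdot> h) x)"
    by (rule ae_class_cong[OF bop_add[OF bop_P s]])
  then show "T (cl (f +: g)) (cl h) = (T (cl f) \<oplus>\<^bsub>R\<^esub> T (cl g)) (cl h)"
    using h by (simp add: toeplitz_cl f g bm_add R_app cl_H lc_add_cl Hfm P_Hf s distrib_right)
qed

lemma T_smult: assumes f: "f \<in> bm m"
  shows "T (cl (\<lambda>x. c * f x)) = c \<odot>\<^bsub>R\<^esub> T (cl f)"
proof (rule ops_eqI[OF toeplitz_in[OF bm_scale[OF f]] R_smult_closed[OF toeplitz_in[OF f]]])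
  fix h assume h: "h \<in> Hf"
  have s: "(f \<cdot> h) \<in> sq m" by (intro sq_mult f Hf_sq h)
  have "cl (P (\<lambda>x. c * (f x * h x))) = cl (\<lambda>x. c * P (f \<cdot> h) x)"
    by (rule ae_class_cong[OF bop_scale[OF bop_P s]])
  then show "T (cl (\<lambda>x. c * f x)) (cl h) = (c \<odot>\<^bsub>R\<^esub> T (cl f)) (cl h)"
    using h by (simp add: toeplitz_cl f bm_scale R_app cl_H lc_scale_cl Hfm P_Hf s mult.assoc)
qed

lemma T_one: "T (cl (\<lambda>_. 1)) = \<one>\<^bsub>R\<^esub>"
proof (rule ops_eqI[OF toeplitz_in[OF bm_const] R_one_closed])
  fix h assume h: "h \<in> Hf"
  show "T (cl (\<lambda>_. 1)) (cl h) = \<one>\<^bsub>R\<^esub> (cl h)"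
    using h ae_class_cong[OF P_id[OF h]] by (simp add: toeplitz_cl bm_const R_app cl_H)
qed

lemma T_norm: "f \<in> bm m \<Longrightarrow> anorm R (T (cl f)) = anorm (Linf m) (cl f)"
proof (rule antisym)
  assume f: "f \<in> bm m"
  show "anorm R (T (cl f)) \<le> anorm (Linf m) (cl f)"
    by (rule R_anorm_le[OF toeplitz_in[OF f] Linf_anorm(1)[OF f] T_bop[OF f Linf_anorm(1,2)[OF f]]])
  show "anorm (Linf m) (cl f) \<le> anorm R (T (cl f))"
    by (rule sym_norm[OF toeplitz_in[OF f] sym_toeplitz[OF f]])
qed

lemma symbol_calculus_R:
  assumes B: "cstar_subalgebra (Linf m) B" and one: "\<one>\<^bsub>Linf m\<^esub> \<in> B"
  shows "symbol_calculus R (Linf m) T sym B"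
proof (unfold_locales; (unfold R_simps(1))?)
  show "cstar_subalgebra (Linf m) B" "\<one>\<^bsub>Linf m\<^esub> \<in> B" by (rule B, rule one)
  fix F c assume "F \<in> carrier (Linf m)"
  then obtain f where f: "f \<in> bm m" "F = cl f" by (rule LinfE)
  show "T F \<in> Ops" unfolding f by (rule toeplitz_in[OF f(1)])
  show "T (c \<odot>\<^bsub>Linf m\<^esub> F) = c \<odot>\<^bsub>R\<^esub> T F" using f by (simp add: Linf_simps lc_cl bm_measurable T_smult)
  show "adj R (T F) = T (adj (Linf m) F)" using f by (simp add: Linf_simps lc_cl bm_measurable T_adj)
  show "anorm R (T F) \<le> anorm (Linf m) F" using f by (simp add: T_norm)
  show "sym (T F) F" unfolding f by (rule sym_toeplitz[OF f(1)])
next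
  fix F G assume "F \<in> carrier (Linf m)" "G \<in> carrier (Linf m)"
  then obtain f g where "f \<in> bm m" "F = cl f" "g \<in> bm m" "G = cl g" by (auto elim!: LinfE)
  then show "T (F \<oplus>\<^bsub>Linf m\<^esub> G) = T F \<oplus>\<^bsub>R\<^esub> T G" by (simp add: Linf_simps lc_cl bm_measurable T_add)
next
  show "T \<one>\<^bsub>Linf m\<^esub> = \<one>\<^bsub>R\<^esub>" by (simp add: Linf_simps T_one)
next
  fix X Y F G assume *: "X \<in> Ops" "Y \<in> Ops" "sym X F" "sym Y G"
  show "sym (X \<oplus>\<^bsub>R\<^esub> Y) (F \<oplus>\<^bsub>Linf m\<^esub> G)" unfolding Linf_simps by (rule sym_add[OF *])
  show "sym (X \<otimes>\<^bsub>R\<^esub> Y) (F \<otimes>\<^bsub>Linf m\<^esub> G)" unfolding Linf_simps by (rule sym_mult[OF *])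
next
  fix X F c assume *: "X \<in> Ops" "sym X F"
  show "sym (c \<odot>\<^bsub>R\<^esub> X) (c \<odot>\<^bsub>Linf m\<^esub> F)" unfolding Linf_simps by (rule sym_smult[OF *])
  show "anorm (Linf m) F \<le> anorm R X" by (rule sym_norm[OF *])
next
  fix X assume "X \<in> Ops" "\<And>e. e > 0 \<Longrightarrow> \<exists>Y\<in>Ops. \<exists>G\<in>B. sym Y G \<and> anorm R (X \<ominus>\<^bsub>R\<^esub> Y) < e"
  then show "\<exists>F\<in>B. sym X F" by (rule sym_lim[OF B])
qed

theorem short_exact_B:
  assumes B: "cstar_subalgebra (Linf m) B" and one: "\<one>\<^bsub>Linf m\<^esub> \<in> B"
  shows "\<exists>\<pi>. short_exact (semicommutator_ideal m A B) (toeplitz_algebra m A B) ((Linf m)\<lparr>carrier := B\<rparr>) \<pi>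
     \<and> (\<forall>\<psi>\<in>B. \<pi> (T \<psi>) = \<psi>)"
proof -
  interpret symbol_calculus R "Linf m" T sym B by (rule symbol_calculus_R[OF B one])
  have ta: "toeplitz_algebra m A B = R\<lparr>carrier := TB\<rparr>" unfolding toeplitz_algebra_def by (rule cstar_generated_eq)
  have "semicommutator_ideal m A B = CB"
    unfolding semicommutator_ideal_def ta semi_def Linf_simps ..
  then show ?thesis using short_exact_symb symb_T ta by auto
qed

lemma brown_halmos_ops:
  assumes X: "X \<in> Ops"
    and inv: "\<And>\<alpha> h k. \<alpha> \<in> \<Gamma> \<Longrightarrow> h \<in> Hf \<Longrightarrow> k \<in> Hf \<Longrightarrow>
      (\<Sum>j\<in>J \<alpha>. ip m (L_of X (\<phi> \<alpha> j \<cdot> h)) (\<phi> \<alpha> j \<cdot> k)) = ip m (L_of X h) k"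
  shows "\<exists>\<psi>\<in>bm m. X = T (cl \<psi>)"
proof -
  have iv: "(\<Sum>u\<leftarrow>us. ip m (L_of X (u \<cdot> h)) (u \<cdot> k)) = ip m (L_of X h) k"
    if "us \<in> sph" "h \<in> Hf" "k \<in> Hf" for us h k
    using that
  proof (induction us arbitrary: h k rule: sph.induct)
    case (fam \<alpha> js)
    then show ?case using inv[of \<alpha> h k] by (simp add: o_def sum_list_distinct_conv_sum_set)
  next
    case (prod us vs)
    have "(\<Sum>w\<leftarrow>prodl us vs. ip m (L_of X (w \<cdot> h)) (w \<cdot> k))
      = (\<Sum>v\<leftarrow>vs. \<Sum>u\<leftarrow>us. ip m (L_of X (\<lambda>x. u x * (v x * h x))) (\<lambda>x. u x * (v x * k x)))"
      unfolding sum_prodl by (subst sum_list_swap') (simp add: mult.assoc)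
    also have "\<dots> = (\<Sum>v\<leftarrow>vs. ip m (L_of X (v \<cdot> h)) (v \<cdot> k))"
      using prod by (intro arg_cong[of _ _ sum_list] map_cong refl prod.IH(1) A_mult_Hf sph_A[OF prod.hyps(2)]) auto
    also have "\<dots> = ip m (L_of X h) k" using prod by auto
    finally show ?case .
  qed simp
  obtain \<psi> where psi: "\<psi> \<in> bm m" "\<And>h k. h \<in> Hf \<Longrightarrow> k \<in> Hf \<Longrightarrow> ip m (L_of X h) k = ip m (\<psi> \<cdot> h) k"
    by (rule brown_halmos_function[OF L_of_anorm[OF X] iv]) auto
  have "X = T (cl \<psi>)"
  proof (rule ops_eqI[OF X toeplitz_in[OF psi(1)]])
    fix h assume h: "h \<in> Hf"
    have "AE x in m. P (\<psi> \<cdot> h) x = L_of X h x"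
      by (rule P_unique[OF sq_mult[OF psi(1) Hf_sq[OF h]] L_of_Hf(1)[OF X Hf_sq[OF h]] psi(2)[OF h]])
    then have "cl (P (\<psi> \<cdot> h)) = cl (L_of X h)" by (rule ae_class_cong)
    then show "X (cl h) = T (cl \<psi>) (cl h)" using h by (simp add: toeplitz_cl psi L_of_cl[OF X])
  qed
  then show ?thesis using psi by blast
qed

text \<open>This makes every Toeplitz operator satisfy the Brown--Halmos equations.\<close>

lemma phi_ip_sum:
  assumes \<alpha>: "\<alpha> \<in> \<Gamma>" and f: "f \<in> sq m" and g: "g \<in> sq m"
  shows "(\<Sum>j\<in>J \<alpha>. ip m (\<phi> \<alpha> j \<cdot> f) (\<phi> \<alpha> j \<cdot> g)) = ip m f g"
proof -
  have s: "(\<phi> \<alpha> j \<cdot> f) \<in> sq m" "(\<phi> \<alpha> j \<cdot> g) \<in> sq m" if "j \<in> J \<alpha>" for j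
    by (intro A_mult_sq phi_A \<alpha> that f g)+
  have one: "(\<Sum>j\<in>J \<alpha>. \<phi> \<alpha> j x * cnj (\<phi> \<alpha> j x)) = 1" for x
    using arg_cong[OF phi_sum[OF \<alpha>, of x], of complex_of_real] by (simp add: complex_norm_square[symmetric])
  have "(\<Sum>j\<in>J \<alpha>. ip m (\<phi> \<alpha> j \<cdot> f) (\<phi> \<alpha> j \<cdot> g))
    = (LINT x|m. (\<Sum>j\<in>J \<alpha>. \<phi> \<alpha> j x * f x * cnj (\<phi> \<alpha> j x * g x)))"
    unfolding ip_def using ip_integrable[OF s] by (intro Bochner_Integration.integral_sum[symmetric]) auto
  also have "\<dots> = ip m f g"
    unfolding ip_def
  proof (intro Bochner_Integration.integral_cong refl)
    fix x
    have "(\<Sum>j\<in>J \<alpha>. \<phi> \<alpha> j x * f x * cnj (\<phi> \<alpha> j x * g x)) = (\<Sum>j\<in>J \<alpha>. (\<phi> \<alpha> j x * cnj (\<phi> \<alpha> j x)) * (f x * cnj (g x)))"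
      by (simp add: mult_ac)
    also have "\<dots> = f x * cnj (g x)" unfolding sum_distrib_right[symmetric] one by simp
    finally show "(\<Sum>j\<in>J \<alpha>. \<phi> \<alpha> j x * f x * cnj (\<phi> \<alpha> j x * g x)) = f x * cnj (g x)" .
  qed
  finally show ?thesis .
qed

lemma T_A_cl: "a \<in> A \<Longrightarrow> h \<in> Hf \<Longrightarrow> T (cl a) (cl h) = cl (a \<cdot> h)"
  using ae_class_cong[OF P_id[OF A_mult_Hf]] by (simp add: toeplitz_cl A_bm)

lemma finsum_inner:
  assumes "finite I" "\<And>i. i \<in> I \<Longrightarrow> Z i \<in> Ops" "F \<in> H" "G \<in> H"
  shows "l2_inner m (finsum R Z I F) G = (\<Sum>i\<in>I. l2_inner m (Z i F) G) \<and> finsum R Z I \<in> Ops"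
  using assms(1,2)
proof (induction I rule: finite_induct)
  case empty
  obtain g where "g \<in> Hf" "G = cl g" using assms(4) by (rule HE)
  then have "l2_inner m (cl (\<lambda>_. 0)) G = 0" by (simp add: l2_inner_cl Hfm)
  then show ?case using assms by (simp add: R_app R_zero_closed)
next
  case (insert i I)
  have Z: "Z \<in> I \<rightarrow> carrier R" "Z i \<in> carrier R" using insert by (auto simp: R_simps(1))
  have eq: "finsum R Z (insert i I) = Z i \<oplus>\<^bsub>R\<^esub> finsum R Z I"
    by (rule BH.finsum_insert[OF insert(1,2) Z])
  have c: "Z i \<in> Ops" "finsum R Z I \<in> Ops" using insert by auto
  show ?case unfolding eq using insert assms c
    by (simp add: R_app R_add_closed H_inner_add_l ops_in[OF c(1)] ops_in[OF c(2)])
qed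

lemma H_inner_ext_left:
  assumes "F \<in> H" "G \<in> H" "\<And>K. K \<in> H \<Longrightarrow> l2_inner m F K = l2_inner m G K"
  shows "F = G"
  by (rule H_inner_ext[OF assms(1,2)]) (metis H_inner_cnj assms)

lemma brown_halmos_eq_iff:
  assumes X: "X \<in> Ops" and \<alpha>: "\<alpha> \<in> \<Gamma>"
  shows "(\<Oplus>\<^bsub>R\<^esub>j\<in>J \<alpha>. adj R (T (cl (\<phi> \<alpha> j))) \<otimes>\<^bsub>R\<^esub> X \<otimes>\<^bsub>R\<^esub> T (cl (\<phi> \<alpha> j))) = X \<longleftrightarrow>
    (\<forall>h\<in>Hf. \<forall>k\<in>Hf. (\<Sum>j\<in>J \<alpha>. ip m (L_of X (\<phi> \<alpha> j \<cdot> h)) (\<phi> \<alpha> j \<cdot> k)) = ip m (L_of X h) k)"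
    (is "?S = X \<longleftrightarrow> _")
proof -
  define Z where "Z j = adj R (T (cl (\<phi> \<alpha> j))) \<otimes>\<^bsub>R\<^esub> X \<otimes>\<^bsub>R\<^esub> T (cl (\<phi> \<alpha> j))" for j
  have Tj: "T (cl (\<phi> \<alpha> j)) \<in> Ops" if "j \<in> J \<alpha>" for j by (intro toeplitz_in A_bm phi_A \<alpha> that)
  have Z: "Z j \<in> Ops" if "j \<in> J \<alpha>" for j
    unfolding Z_def by (intro R_mult_closed adj_props(1) Tj X that)
  have S: "?S = finsum R Z (J \<alpha>)" unfolding Z_def[abs_def] ..
  have Sc: "finsum R Z (J \<alpha>) \<in> Ops" using finsum_inner[OF finite_J[OF \<alpha>] Z H_zero H_zero] by simp
  have val: "l2_inner m (finsum R Z (J \<alpha>) (cl h)) (cl k) = (\<Sum>j\<in>J \<alpha>. ip m (L_of X (\<phi> \<alpha> j \<cdot> h)) (\<phi> \<alpha> j \<cdot> k))"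
    if h: "h \<in> Hf" and k: "k \<in> Hf" for h k
  proof -
    have "l2_inner m (Z j (cl h)) (cl k) = ip m (L_of X (\<phi> \<alpha> j \<cdot> h)) (\<phi> \<alpha> j \<cdot> k)" if j: "j \<in> J \<alpha>" for j
    proof -
      have pA: "\<phi> \<alpha> j \<in> A" by (intro phi_A \<alpha> j)
      have H1: "(\<phi> \<alpha> j \<cdot> h) \<in> Hf" "(\<phi> \<alpha> j \<cdot> k) \<in> Hf" by (intro A_mult_Hf pA h k)+
      have "Z j (cl h) = adj R (T (cl (\<phi> \<alpha> j))) (X (cl (\<phi> \<alpha> j \<cdot> h)))"
        using h cl_H[OF H1(1)] by (simp add: Z_def R_app cl_H T_A_cl pA)
      then have "l2_inner m (Z j (cl h)) (cl k) = l2_inner m (X (cl (\<phi> \<alpha> j \<cdot> h))) (T (cl (\<phi> \<alpha> j)) (cl k))"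
        using adj_props(3)[OF Tj[OF j] ops_in[OF X cl_H[OF H1(1)]] cl_H[OF k]] by simp
      also have "\<dots> = ip m (L_of X (\<phi> \<alpha> j \<cdot> h)) (\<phi> \<alpha> j \<cdot> k)"
        unfolding T_A_cl[OF pA k] L_of_cl[OF X H1(1), symmetric]
        by (intro l2_inner_cl Hfm L_of_Hf(1)[OF X] Hf_sq H1)
      finally show ?thesis .
    qed
    then show ?thesis using finsum_inner[OF finite_J[OF \<alpha>] Z cl_H[OF h] cl_H[OF k]] by simp
  qed
  have Xv: "l2_inner m (X (cl h)) (cl k) = ip m (L_of X h) k" if h: "h \<in> Hf" and k: "k \<in> Hf" for h k
    unfolding L_of_cl[OF X h, symmetric] by (intro l2_inner_cl Hfm L_of_Hf(1)[OF X] Hf_sq h k)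
  show ?thesis
  proof
    assume "?S = X"
    then show "\<forall>h\<in>Hf. \<forall>k\<in>Hf. (\<Sum>j\<in>J \<alpha>. ip m (L_of X (\<phi> \<alpha> j \<cdot> h)) (\<phi> \<alpha> j \<cdot> k)) = ip m (L_of X h) k"
      using val Xv S by simp
  next
    assume *: "\<forall>h\<in>Hf. \<forall>k\<in>Hf. (\<Sum>j\<in>J \<alpha>. ip m (L_of X (\<phi> \<alpha> j \<cdot> h)) (\<phi> \<alpha> j \<cdot> k)) = ip m (L_of X h) k"
    show "?S = X" unfolding S
    proof (rule ops_eqI[OF Sc X])
      fix h assume h: "h \<in> Hf"
      show "finsum R Z (J \<alpha>) (cl h) = X (cl h)"
      proof (rule H_inner_ext_left[OF ops_in[OF Sc cl_H[OF h]] ops_in[OF X cl_H[OF h]]])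
        fix G assume "G \<in> H"
        then obtain k where k: "k \<in> Hf" "G = cl k" by (rule HE)
        then show "l2_inner m (finsum R Z (J \<alpha>) (cl h)) G = l2_inner m (X (cl h)) G"
          using val[OF h k(1)] Xv[OF h k(1)] * h by simp
      qed
    qed
  qed
qed

theorem toeplitz_iff_brown_halmos:
  assumes X: "X \<in> Ops"
  shows "(\<exists>\<psi>\<in>carrier (Linf m). X = T \<psi>) \<longleftrightarrow>
    (\<forall>\<alpha>\<in>\<Gamma>. (\<Oplus>\<^bsub>R\<^esub>j\<in>J \<alpha>. adj R (T (cl (\<phi> \<alpha> j))) \<otimes>\<^bsub>R\<^esub> X \<otimes>\<^bsub>R\<^esub> T (cl (\<phi> \<alpha> j))) = X)"
proof
  assume "\<exists>\<psi>\<in>carrier (Linf m). X = T \<psi>"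
  then obtain \<psi> where psi: "\<psi> \<in> bm m" "X = T (cl \<psi>)" by (auto elim: LinfE)
  have L: "ip m (L_of X h) k = ip m (\<psi> \<cdot> h) k" if h: "h \<in> Hf" and k: "k \<in> Hf" for h k
  proof -
    have s: "(\<psi> \<cdot> h) \<in> sq m" by (intro sq_mult psi Hf_sq h)
    have "cl (L_of X h) = cl (P (\<psi> \<cdot> h))" using L_of_cl[OF X h] toeplitz_cl[OF psi(1) h] psi(2) by simp
    then have "AE x in m. L_of X h x = P (\<psi> \<cdot> h) x"
      using ae_class_eq_iff[OF Hfm[OF L_of_Hf(1)[OF X Hf_sq[OF h]]] Hfm[OF P_Hf[OF s]]] by blast
    then have "ip m (L_of X h) k = ip m (P (\<psi> \<cdot> h)) k"
      by (intro ip_cong_AE Hfm L_of_Hf(1)[OF X] Hf_sq h k P_Hf s) auto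
    then show ?thesis using P_ip[OF s k] by simp
  qed
  show "\<forall>\<alpha>\<in>\<Gamma>. (\<Oplus>\<^bsub>R\<^esub>j\<in>J \<alpha>. adj R (T (cl (\<phi> \<alpha> j))) \<otimes>\<^bsub>R\<^esub> X \<otimes>\<^bsub>R\<^esub> T (cl (\<phi> \<alpha> j))) = X"
  proof
    fix \<alpha> assume \<alpha>: "\<alpha> \<in> \<Gamma>"
    show "(\<Oplus>\<^bsub>R\<^esub>j\<in>J \<alpha>. adj R (T (cl (\<phi> \<alpha> j))) \<otimes>\<^bsub>R\<^esub> X \<otimes>\<^bsub>R\<^esub> T (cl (\<phi> \<alpha> j))) = X"
      unfolding brown_halmos_eq_iff[OF X \<alpha>]
    proof (intro ballI)
      fix h k assume h: "h \<in> Hf" and k: "k \<in> Hf"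
      have "(\<Sum>j\<in>J \<alpha>. ip m (L_of X (\<phi> \<alpha> j \<cdot> h)) (\<phi> \<alpha> j \<cdot> k))
        = (\<Sum>j\<in>J \<alpha>. ip m (\<lambda>x. \<phi> \<alpha> j x * (\<psi> x * h x)) (\<phi> \<alpha> j \<cdot> k))"
        using L[OF A_mult_Hf[OF phi_A[OF \<alpha>] h] A_mult_Hf[OF phi_A[OF \<alpha>] k]]
        by (intro sum.cong refl) (simp add: mult.left_commute)
      also have "\<dots> = ip m (\<psi> \<cdot> h) k"
        by (intro phi_ip_sum \<alpha> sq_mult psi Hf_sq h k)
      also have "\<dots> = ip m (L_of X h) k" using L[OF h k] by simp
      finally show "(\<Sum>j\<in>J \<alpha>. ip m (L_of X (\<phi> \<alpha> j \<cdot> h)) (\<phi> \<alpha> j \<cdot> k)) = ip m (L_of X h) k" .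
    qed
  qed
next
  assume "\<forall>\<alpha>\<in>\<Gamma>. (\<Oplus>\<^bsub>R\<^esub>j\<in>J \<alpha>. adj R (T (cl (\<phi> \<alpha> j))) \<otimes>\<^bsub>R\<^esub> X \<otimes>\<^bsub>R\<^esub> T (cl (\<phi> \<alpha> j))) = X"
  then have "\<exists>\<psi>\<in>bm m. X = T (cl \<psi>)"
    by (intro brown_halmos_ops[OF X]) (auto simp: brown_halmos_eq_iff[OF X])
  then show "\<exists>\<psi>\<in>carrier (Linf m). X = T \<psi>" using cl_Linf by blast
qed

end


section \<open>Analytic Toeplitz operators\<close>

context spherical_setting begin

abbreviation "Ha \<equiv> bm m \<inter> Hf"

lemma analytic_mult_Hf:
  assumes psi: "\<psi> \<in> Ha" and h: "h \<in> Hf"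
  shows "(\<psi> \<cdot> h) \<in> Hf"
proof (rule mult_Hf_if_A[OF _ _ h])
  show "(\<psi> \<cdot> a) \<in> Hf" if "a \<in> A" for a
    using A_mult_Hf[OF that, of \<psi>] psi by (simp add: mult.commute)
qed (use psi in auto)

lemma T_analytic_cl: "\<psi> \<in> Ha \<Longrightarrow> h \<in> Hf \<Longrightarrow> T (cl \<psi>) (cl h) = cl (\<psi> \<cdot> h)"
  using ae_class_cong[OF P_id[OF analytic_mult_Hf]] by (simp add: toeplitz_cl)

lemma T_mult_analytic:
  assumes chi: "\<eta> \<in> bm m" and psi: "\<psi> \<in> Ha"
  shows "T (cl \<eta>) \<otimes>\<^bsub>R\<^esub> T (cl \<psi>) = T (cl (\<eta> \<cdot> \<psi>))"
proof (rule ops_eqI)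
  have p: "\<psi> \<in> bm m" using psi by simp
  show "T (cl \<eta>) \<otimes>\<^bsub>R\<^esub> T (cl \<psi>) \<in> Ops" "T (cl (\<eta> \<cdot> \<psi>)) \<in> Ops"
    by (intro R_mult_closed toeplitz_in chi p bm_mult)+
  fix h assume h: "h \<in> Hf"
  then show "(T (cl \<eta>) \<otimes>\<^bsub>R\<^esub> T (cl \<psi>)) (cl h) = T (cl (\<eta> \<cdot> \<psi>)) (cl h)"
    using psi chi by (simp add: R_app cl_H T_analytic_cl toeplitz_cl analytic_mult_Hf bm_mult mult.assoc)
qed

lemma commute_A_iff:
  assumes X: "X \<in> Ops" and a: "a \<in> A"
  shows "X \<otimes>\<^bsub>R\<^esub> T (cl a) = T (cl a) \<otimes>\<^bsub>R\<^esub> X \<longleftrightarrow>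
    (\<forall>h\<in>Hf. X (cl (a \<cdot> h)) = cl (\<lambda>x. a x * L_of X h x))"
proof -
  have 1: "(X \<otimes>\<^bsub>R\<^esub> T (cl a)) (cl h) = X (cl (a \<cdot> h))" if "h \<in> Hf" for h
    using that a by (simp add: R_app cl_H T_A_cl)
  have 2: "(T (cl a) \<otimes>\<^bsub>R\<^esub> X) (cl h) = cl (\<lambda>x. a x * L_of X h x)" if h: "h \<in> Hf" for h
    using T_A_cl[OF a L_of_Hf(1)[OF X Hf_sq[OF h]]] by (simp add: R_app cl_H[OF h] L_of_cl[OF X h])
  show ?thesis
  proof
    assume "\<forall>h\<in>Hf. X (cl (a \<cdot> h)) = cl (\<lambda>x. a x * L_of X h x)"
    then show "X \<otimes>\<^bsub>R\<^esub> T (cl a) = T (cl a) \<otimes>\<^bsub>R\<^esub> X"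
      using 1 2 by (intro ops_eqI R_mult_closed X toeplitz_in A_bm a) simp
  next
    assume eq: "X \<otimes>\<^bsub>R\<^esub> T (cl a) = T (cl a) \<otimes>\<^bsub>R\<^esub> X"
    show "\<forall>h\<in>Hf. X (cl (a \<cdot> h)) = cl (\<lambda>x. a x * L_of X h x)" using 1[unfolded eq] 2 by simp
  qed
qed

lemma L_of_A_AE:
  assumes X: "X \<in> Ops" and a: "a \<in> A" and h: "h \<in> Hf"
    and eq: "X (cl (a \<cdot> h)) = cl (\<lambda>x. a x * L_of X h x)"
  shows "AE x in m. L_of X (a \<cdot> h) x = a x * L_of X h x"
proof -
  have 1: "(a \<cdot> h) \<in> Hf" by (rule A_mult_Hf[OF a h])
  have 2: "L_of X h \<in> Hf" "L_of X (a \<cdot> h) \<in> Hf" using L_of_Hf(1)[OF X] Hf_sq h 1 by auto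
  have "cl (L_of X (a \<cdot> h)) = cl (\<lambda>x. a x * L_of X h x)" using L_of_cl[OF X 1] eq by simp
  then show ?thesis using ae_class_eq_iff[OF Hfm[OF 2(2)] Hfm[OF A_mult_Hf[OF a 2(1)]]] by blast
qed

text \<open>Commutation with the \<open>T\<^bsub>\<phi>\<^esub>\<close> passes to products, hence to all members of spherical families.\<close>

lemma commute_sph:
  assumes X: "X \<in> Ops"
    and comm: "\<And>\<alpha> j h. \<alpha> \<in> \<Gamma> \<Longrightarrow> j \<in> J \<alpha> \<Longrightarrow> h \<in> Hf \<Longrightarrow> X (cl (\<phi> \<alpha> j \<cdot> h)) = cl (\<lambda>x. \<phi> \<alpha> j x * L_of X h x)"
    and us: "us \<in> sph" and u: "u \<in> set us" and h: "h \<in> Hf"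
  shows "X (cl (u \<cdot> h)) = cl (\<lambda>x. u x * L_of X h x)"
  using us u h
proof (induction us arbitrary: u h rule: sph.induct)
  case one
  then show ?case by (simp add: L_of_cl[OF X])
next
  case (fam \<alpha> js)
  then show ?case using comm by auto
next
  case (prod us vs)
  then obtain v w where vw: "v \<in> set us" "w \<in> set vs" "u = (v \<cdot> w)" by (auto simp: set_prodl)
  have vA: "v \<in> A" "w \<in> A" using sph_A prod.hyps vw by auto
  have wh: "(w \<cdot> h) \<in> Hf" by (rule A_mult_Hf[OF vA(2) prod.prems(2)])
  have "X (cl (\<lambda>x. v x * (w x * h x))) = cl (\<lambda>x. v x * L_of X (w \<cdot> h) x)"
    by (rule prod.IH(1)[OF vw(1) wh])
  also have "\<dots> = cl (\<lambda>x. v x * (w x * L_of X h x))"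
  proof (rule ae_class_cong)
    show "AE x in m. v x * L_of X (w \<cdot> h) x = v x * (w x * L_of X h x)"
      using L_of_A_AE[OF X vA(2) prod.prems(2) prod.IH(2)[OF vw(2) prod.prems(2)]] by eventually_elim simp
  qed
  finally show ?case by (simp add: vw(3) mult.assoc)
qed

text \<open>The Brown--Halmos equations provide a bounded \<open>\<psi>\<close> with \<open>X = T\<^sub>\<psi>\<close>. For \<open>u\<close> in a spherical family,
commutation gives \<open>P (u \<psi>) = u P \<psi>\<close>, so \<open>k = \<psi> - P \<psi>\<close> has \<open>P (u k) = 0\<close> and vanishes by \<open>symbol_P\<close>.\<close>

lemma commuting_op_analytic:
  assumes X: "X \<in> Ops"
    and comm: "\<And>\<alpha> j. \<alpha> \<in> \<Gamma> \<Longrightarrow> j \<in> J \<alpha> \<Longrightarrow> X \<otimes>\<^bsub>R\<^esub> T (cl (\<phi> \<alpha> j)) = T (cl (\<phi> \<alpha> j)) \<otimes>\<^bsub>R\<^esub> X"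
  obtains \<psi> where "\<psi> \<in> Ha" "X = T (cl \<psi>)"
proof -
  have cp: "X (cl (\<phi> \<alpha> j \<cdot> h)) = cl (\<lambda>x. \<phi> \<alpha> j x * L_of X h x)" if "\<alpha> \<in> \<Gamma>" "j \<in> J \<alpha>" "h \<in> Hf" for \<alpha> j h
    using commute_A_iff[OF X phi_A[OF that(1,2)]] comm[OF that(1,2)] that(3) by blast
  have "\<exists>\<psi>\<in>bm m. X = T (cl \<psi>)"
  proof (rule brown_halmos_ops[OF X])
    fix \<alpha> h k assume \<alpha>: "\<alpha> \<in> \<Gamma>" and h: "h \<in> Hf" and k: "k \<in> Hf"
    have s: "L_of X h \<in> sq m" by (rule L_of_sq[OF X Hf_sq[OF h]])
    have "(\<Sum>j\<in>J \<alpha>. ip m (L_of X (\<phi> \<alpha> j \<cdot> h)) (\<phi> \<alpha> j \<cdot> k))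
      = (\<Sum>j\<in>J \<alpha>. ip m (\<lambda>x. \<phi> \<alpha> j x * L_of X h x) (\<phi> \<alpha> j \<cdot> k))"
    proof (rule sum.cong[OF refl])
      fix j assume j: "j \<in> J \<alpha>"
      note pA = phi_A[OF \<alpha> j]
      show "ip m (L_of X (\<phi> \<alpha> j \<cdot> h)) (\<phi> \<alpha> j \<cdot> k) = ip m (\<lambda>x. \<phi> \<alpha> j x * L_of X h x) (\<phi> \<alpha> j \<cdot> k)"
        by (rule ip_cong_AE[OF _ _ _ _ L_of_A_AE[OF X pA h cp[OF \<alpha> j h]]])
          (use sqm[OF L_of_sq[OF X A_mult_sq[OF pA Hf_sq[OF h]]]] sqm[OF A_mult_sq[OF pA s]] sqm[OF A_mult_sq[OF pA Hf_sq[OF k]]] in simp_all)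
    qed
    also have "\<dots> = ip m (L_of X h) k" by (rule phi_ip_sum[OF \<alpha> s Hf_sq[OF k]])
    finally show "(\<Sum>j\<in>J \<alpha>. ip m (L_of X (\<phi> \<alpha> j \<cdot> h)) (\<phi> \<alpha> j \<cdot> k)) = ip m (L_of X h) k" .
  qed
  then obtain \<psi> where psi: "\<psi> \<in> bm m" "X = T (cl \<psi>)" by blast
  have ps: "\<psi> \<in> sq m" by (rule bm_imp_sq[OF psi(1)])
  define k where "k = (\<lambda>x. \<psi> x - P \<psi> x)"
  have ks: "k \<in> sq m" unfolding k_def by (intro sq_diff ps P_sq)
  have one: "(\<lambda>_. 1) \<in> Hf" by (rule A_Hf[OF A_const])
  have L1: "AE x in m. L_of X (\<lambda>_. 1) x = P \<psi> x"
  proof -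
    have "cl (L_of X (\<lambda>_. 1)) = cl (P \<psi>)" using L_of_cl[OF X one] toeplitz_cl[OF psi(1) one] psi(2) by simp
    then show ?thesis
      using ae_class_eq_iff[OF Hfm[OF L_of_Hf(1)[OF X Hf_sq[OF one]]] Hfm[OF P_Hf[OF ps]]] by blast
  qed
  have Puk: "n2 m (\<lambda>x. P (u \<cdot> k) x - 1 * (u x * k x)) = n2 m (u \<cdot> k)" if us: "us \<in> sph" "u \<in> set us" for us u
  proof -
    have uA: "u \<in> A" by (rule sph_A[OF us])
    note s = A_mult_sq[OF uA ps] and s' = A_mult_sq[OF uA P_sq[OF ps]] and s'' = A_mult_sq[OF uA ks]
    have "cl (P (u \<cdot> \<psi>)) = X (cl (\<lambda>x. u x * 1))"
      using toeplitz_cl[OF psi(1) A_Hf[OF uA]] psi(2) by (simp add: mult.commute)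
    also have "\<dots> = cl (\<lambda>x. u x * L_of X (\<lambda>_. 1) x)" by (rule commute_sph[OF X cp us one])
    also have "\<dots> = cl (\<lambda>x. u x * P \<psi> x)"
    proof (rule ae_class_cong)
      show "AE x in m. u x * L_of X (\<lambda>_. 1) x = u x * P \<psi> x" using L1 by eventually_elim simp
    qed
    finally have 1: "AE x in m. P (u \<cdot> \<psi>) x = u x * P \<psi> x"
      using ae_class_eq_iff[OF Hfm[OF P_Hf[OF s]] sqm[OF s']] by blast
    have 2: "AE x in m. P (\<lambda>x. u x * P \<psi> x) x = u x * P \<psi> x" by (rule P_id[OF A_mult_Hf[OF uA P_Hf[OF ps]]])
    have 3: "(u \<cdot> k) = (\<lambda>x. u x * \<psi> x - u x * P \<psi> x)" by (simp add: k_def right_diff_distrib)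
    have "AE x in m. P (u \<cdot> k) x = 0"
      using bop_diff[OF bop_P s s'] 1 2 unfolding 3 by eventually_elim simp
    then have z: "AE x in m. P (u \<cdot> k) x - 1 * (u x * k x) = (-1) * (u x * k x)" by eventually_elim simp
    have "n2 m (\<lambda>x. P (u \<cdot> k) x - 1 * (u x * k x)) = n2 m (\<lambda>x. (-1) * (u x * k x))"
      by (rule n2_cong_AE[OF _ _ z]) (use s'' sq_diff[OF P_sq[OF s''] s''] sq_scale[OF s'', of "-1"] in \<open>auto intro: sqm\<close>)
    also have "\<dots> = n2 m (u \<cdot> k)" by (subst n2_scale) simp
    finally show ?thesis .
  qed
  have "n2 m k \<le> 0 + e" if e: "e > 0" for e
  proof -
    obtain us where us: "us \<in> sph" "(\<Sum>u\<leftarrow>us. n2 m (\<lambda>x. P (u \<cdot> k) x - 1 * (u x * k x))) \<le> e"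
      by (rule symbolE[OF symbol_P ks e]) auto
    have "(\<Sum>u\<leftarrow>us. n2 m (\<lambda>x. P (u \<cdot> k) x - 1 * (u x * k x))) = (\<Sum>u\<leftarrow>us. n2 m (u \<cdot> k))"
      by (intro arg_cong[of _ _ sum_list] map_cong refl Puk[OF us(1)])
    also have "\<dots> = n2 m k" by (rule sph_n2[OF us(1) ks])
    finally show ?thesis using us(2) by simp
  qed
  then have "n2 m k \<le> 0" by (rule field_le_epsilon)
  then have "n2 m k = 0" using n2_nonneg[of m k] by linarith
  then have "AE x in m. \<psi> x = P \<psi> x" unfolding k_def by (rule n2_diff_eq_0_imp_AE[OF ps P_sq[OF ps]])
  then have "\<psi> \<in> Hf" by (rule Hf_cong_AE[OF P_Hf[OF ps] sqm[OF ps]])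
  then show thesis using that psi by blast
qed

lemma analytic_commutes_A:
  assumes "\<psi> \<in> Ha" "a \<in> A"
  shows "T (cl \<psi>) \<otimes>\<^bsub>R\<^esub> T (cl a) = T (cl a) \<otimes>\<^bsub>R\<^esub> T (cl \<psi>)"
  using assms T_mult_analytic[of \<psi> a] T_mult_analytic[of a \<psi>] A_bm[of a] A_Hf[of a] by (simp add: mult.commute)

lemma Hinf_carrier: "carrier (Hinf m A) = cl ` Ha"
  by (auto simp: Hinf_def Linf_carrier cl_H_iff bm_measurable cl_H intro: rev_image_eqI)

lemma HinfE: assumes "F \<in> carrier (Hinf m A)" obtains \<psi> where "\<psi> \<in> Ha" "F = cl \<psi>"
  using assms by (auto simp: Hinf_carrier)

lemma cl_Hinf: "\<psi> \<in> Ha \<Longrightarrow> cl \<psi> \<in> carrier (Hinf m A)" by (auto simp: Hinf_carrier)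

lemma A_Ha: "a \<in> A \<Longrightarrow> a \<in> Ha" by (simp add: A_bm A_Hf)

theorem analytic_toeplitz_iff_commutes:
  assumes X: "X \<in> Ops"
  shows "(\<exists>\<psi>\<in>carrier (Hinf m A). X = T \<psi>) \<longleftrightarrow>
         (\<forall>\<alpha>\<in>\<Gamma>. \<forall>j\<in>J \<alpha>. X \<otimes>\<^bsub>R\<^esub> T (cl (\<phi> \<alpha> j)) = T (cl (\<phi> \<alpha> j)) \<otimes>\<^bsub>R\<^esub> X)" (is "?a \<longleftrightarrow> ?b")
    and "(\<exists>\<psi>\<in>carrier (Hinf m A). X = T \<psi>) \<longleftrightarrow>
         (\<forall>a\<in>A. X \<otimes>\<^bsub>R\<^esub> T (cl a) = T (cl a) \<otimes>\<^bsub>R\<^esub> X)" (is "?a \<longleftrightarrow> ?c")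
proof -
  have ac: ?c if ?a using that analytic_commutes_A by (auto elim!: HinfE)
  have cb: ?b if ?c using that phi_A by blast
  have ba: ?a if b: ?b
  proof -
    obtain \<psi> where "\<psi> \<in> Ha" "X = T (cl \<psi>)" by (rule commuting_op_analytic[OF X]) (use b in auto)
    then show ?a using cl_Hinf by blast
  qed
  show "?a \<longleftrightarrow> ?b" "?a \<longleftrightarrow> ?c" using ac cb ba by blast+
qed

abbreviation "CA \<equiv> commutant R {T (cl a) | a. a \<in> A}"

lemma CA_eq: "CA = T ` carrier (Hinf m A)"
proof -
  have sub: "T ` carrier (Hinf m A) \<subseteq> Ops" by (auto elim!: HinfE intro: toeplitz_in)
  show ?thesis
  proof (rule Set.set_eqI)
   fix X show "X \<in> CA \<longleftrightarrow> X \<in> T ` carrier (Hinf m A)"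
  proof (cases "X \<in> Ops")
    case True
    have "X \<in> CA \<longleftrightarrow> (\<forall>a\<in>A. X \<otimes>\<^bsub>R\<^esub> T (cl a) = T (cl a) \<otimes>\<^bsub>R\<^esub> X)"
      unfolding commutant_def using True by (auto simp: R_simps(1))
    then show ?thesis unfolding analytic_toeplitz_iff_commutes(2)[OF True, symmetric] by (simp add: image_iff)
  next
    case False
    then show ?thesis using sub by (auto simp: commutant_def R_simps(1))
  qed
  qed
qed

lemma Ha_closed:
  assumes "f \<in> Ha" "g \<in> Ha"
  shows "(f +: g) \<in> Ha" "(f \<cdot> g) \<in> Ha" "(\<lambda>x. c * f x) \<in> Ha"
  using assms by (auto intro: bm_add bm_mult bm_scale Hf_add Hf_scale analytic_mult_Hf)

lemma Ha_const: "(\<lambda>_. c) \<in> Ha" by (rule A_Ha[OF A_const])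

lemma Hinf_subalgebra: "complex_subalgebra (Linf m) (carrier (Hinf m A))"
proof -
  have "F \<in> carrier (Linf m)" if "F \<in> carrier (Hinf m A)" for F using that by (simp add: Hinf_def)
  then show ?thesis
    using Ha_const unfolding complex_subalgebra_def Linf_simps
    by (auto elim!: HinfE simp: lc_cl bm_measurable intro!: cl_Hinf Ha_closed bm_add bm_mult bm_scale Hf_add Hf_scale analytic_mult_Hf)
qed

sublocale HI: unital_subalgebra "Linf m" "carrier (Hinf m A)"
  using Hinf_subalgebra cl_Hinf[OF Ha_const] by unfold_locales (auto simp: Linf_simps)

lemma Hinf_eq: "Hinf m A = (Linf m)\<lparr>carrier := carrier (Hinf m A)\<rparr>"
  by (simp add: Hinf_def)

lemma T_zero: "T (cl (\<lambda>_. 0)) = \<zero>\<^bsub>R\<^esub>"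
proof (rule ops_eqI[OF toeplitz_in[OF bm_const] R_zero_closed])
  fix h assume h: "h \<in> Hf"
  show "T (cl (\<lambda>_. 0)) (cl h) = \<zero>\<^bsub>R\<^esub> (cl h)"
    using h T_analytic_cl[OF Ha_const h] by (simp add: R_app cl_H)
qed

lemma CA_subalgebra: "complex_subalgebra R CA"
  unfolding complex_subalgebra_def CA_eq R_simps(1)
proof (intro conjI ballI allI subsetI)
  have E: "\<exists>f\<in>Ha. X = T (cl f)" if "X \<in> T ` carrier (Hinf m A)" for X using that by (auto elim!: HinfE)
  have I: "T (cl f) \<in> T ` carrier (Hinf m A)" if "f \<in> Ha" for f using cl_Hinf[OF that] by (rule imageI)
  show "X \<in> Ops" if "X \<in> T ` carrier (Hinf m A)" for X using E[OF that] toeplitz_in by auto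
  show "\<zero>\<^bsub>R\<^esub> \<in> T ` carrier (Hinf m A)" using I[OF Ha_const[of 0]] T_zero by simp
  fix X assume X: "X \<in> T ` carrier (Hinf m A)"
  then obtain f where f: "f \<in> Ha" "X = T (cl f)" using E by blast
  show "c \<odot>\<^bsub>R\<^esub> X \<in> T ` carrier (Hinf m A)" for c
    using T_smult[of f c] I[OF Ha_closed(3)[OF f(1,1)], of c] f by simp
  fix Y assume Y: "Y \<in> T ` carrier (Hinf m A)"
  then obtain g where g: "g \<in> Ha" "Y = T (cl g)" using E by blast
  show "X \<oplus>\<^bsub>R\<^esub> Y \<in> T ` carrier (Hinf m A)"
    using T_add[of f g] I[OF Ha_closed(1)[OF f(1) g(1)]] f g by simp
  show "X \<otimes>\<^bsub>R\<^esub> Y \<in> T ` carrier (Hinf m A)"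
    using T_mult_analytic[of f g] I[OF Ha_closed(2)[OF f(1) g(1)]] f g by simp
qed

lemma T_inj: "inj_on T (carrier (Linf m))"
proof -
  interpret SC: symbol_calculus R "Linf m" T sym "carrier (Linf m)"
    by (rule symbol_calculus_R[OF LI.cstar_subalgebra_carrier LI.one_closed])
  show ?thesis
  proof (rule inj_onI)
    fix F G assume F: "F \<in> carrier (Linf m)" and G: "G \<in> carrier (Linf m)" and eq: "T F = T G"
    show "F = G" using SC.sym_unique[OF SC.T_closed[OF F] F G SC.sym_T[OF F]] SC.sym_T[OF G] eq by simp
  qed
qed

theorem Hinf_isometric: "isometric_isomorphism (Hinf m A) (R\<lparr>carrier := CA\<rparr>) T"
  unfolding isometric_isomorphism_def ring_iso_def
proof (intro conjI CollectI allI ballI)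
  show "T \<in> ring_hom (Hinf m A) (R\<lparr>carrier := CA\<rparr>)"
  proof (rule ring_hom_memI)
    fix F assume F: "F \<in> carrier (Hinf m A)"
    then show "T F \<in> carrier (R\<lparr>carrier := CA\<rparr>)" by (simp add: CA_eq)
    fix G assume G: "G \<in> carrier (Hinf m A)"
    obtain f g where fg: "f \<in> Ha" "F = cl f" "g \<in> Ha" "G = cl g" using F G by (auto elim!: HinfE)
    show "T (F \<otimes>\<^bsub>Hinf m A\<^esub> G) = T F \<otimes>\<^bsub>R\<lparr>carrier := CA\<rparr>\<^esub> T G"
      using fg T_mult_analytic[of f g] by (simp add: Hinf_def Linf_simps lc_cl bm_measurable)
    show "T (F \<oplus>\<^bsub>Hinf m A\<^esub> G) = T F \<oplus>\<^bsub>R\<lparr>carrier := CA\<rparr>\<^esub> T G"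
      using fg T_add[of f g] by (simp add: Hinf_def Linf_simps lc_cl bm_measurable)
  next
    show "T \<one>\<^bsub>Hinf m A\<^esub> = \<one>\<^bsub>R\<lparr>carrier := CA\<rparr>\<^esub>" using T_one by (simp add: Hinf_def Linf_simps)
  qed
  show "bij_betw T (carrier (Hinf m A)) (carrier (R\<lparr>carrier := CA\<rparr>))"
    unfolding bij_betw_def using inj_on_subset[OF T_inj, of "carrier (Hinf m A)"] HI.S_sub by (auto simp: CA_eq)
  fix F assume F: "F \<in> carrier (Hinf m A)"
  obtain f where f: "f \<in> Ha" "F = cl f" using F by (rule HinfE)
  show "anorm (R\<lparr>carrier := CA\<rparr>) (T F) = anorm (Hinf m A) F"
    using T_norm[of f] f by (simp add: Hinf_def)
  show "T (c \<odot>\<^bsub>Hinf m A\<^esub> F) = c \<odot>\<^bsub>R\<lparr>carrier := CA\<rparr>\<^esub> T F" for c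
    using T_smult[of f c] f by (simp add: Hinf_def Linf_simps lc_cl bm_measurable)
qed

theorem CA_maximal_abelian: "maximal_abelian_subalgebra R CA"
  unfolding maximal_abelian_subalgebra_def
proof (intro conjI allI impI)
  show "abelian_subalgebra R CA"
    unfolding abelian_subalgebra_def
  proof (intro conjI ballI CA_subalgebra)
    fix X Y assume "X \<in> CA" "Y \<in> CA"
    then obtain f g where fg: "f \<in> Ha" "X = T (cl f)" "g \<in> Ha" "Y = T (cl g)" by (auto simp: CA_eq elim!: HinfE)
    then show "X \<otimes>\<^bsub>R\<^esub> Y = Y \<otimes>\<^bsub>R\<^esub> X"
      using T_mult_analytic[of f g] T_mult_analytic[of g f] by (simp add: mult.commute)
  qed
  fix S assume S: "abelian_subalgebra R S \<and> CA \<subseteq> S"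
  have "T (cl a) \<in> CA" if "a \<in> A" for a using cl_Hinf[OF A_Ha[OF that]] by (auto simp: CA_eq)
  moreover have "S \<subseteq> carrier R" using S by (auto simp: abelian_subalgebra_def complex_subalgebra_def)
  ultimately have "S \<subseteq> CA" using S unfolding commutant_def abelian_subalgebra_def by blast
  then show "S = CA" using S by blast
qed

lemma T_resolvent:
  assumes psi: "\<psi> \<in> bm m"
  shows "(c \<odot>\<^bsub>R\<^esub> \<one>\<^bsub>R\<^esub>) \<ominus>\<^bsub>R\<^esub> T (cl \<psi>) = T (cl (\<lambda>x. c - \<psi> x))"
proof -
  have "T (cl (\<lambda>x. c * 1 + (-1) * \<psi> x)) = T (cl (\<lambda>x. c * 1)) \<oplus>\<^bsub>R\<^esub> T (cl (\<lambda>x. (-1) * \<psi> x))"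
    by (rule T_add[OF bm_const bm_scale[OF psi]])
  also have "T (cl (\<lambda>x. c * 1)) = c \<odot>\<^bsub>R\<^esub> \<one>\<^bsub>R\<^esub>" using T_smult[OF bm_const, of c 1] T_one by simp
  also have "T (cl (\<lambda>x. (-1) * \<psi> x)) = \<ominus>\<^bsub>R\<^esub> T (cl \<psi>)" 
    by (simp only: T_smult[OF psi] R_smult_neg[OF toeplitz_in[OF psi]])
  finally show ?thesis by (simp add: a_minus_def)
qed

text \<open>The inverse of an operator in the commutant lies in the commutant, hence is again an analytic Toeplitz
operator.\<close>

lemma Units_analytic_iff:
  assumes chi: "\<eta> \<in> Ha"
  shows "T (cl \<eta>) \<in> Units R \<longleftrightarrow> cl \<eta> \<in> Units (Hinf m A)"
proof
  assume "cl \<eta> \<in> Units (Hinf m A)"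
  then obtain G where G: "G \<in> carrier (Hinf m A)" "cl \<eta> \<otimes>\<^bsub>Hinf m A\<^esub> G = \<one>\<^bsub>Hinf m A\<^esub>" by (auto simp: Units_def)
  obtain g where g: "g \<in> Ha" "G = cl g" using G(1) by (rule HinfE)
  have eq: "cl (\<eta> \<cdot> g) = cl (\<lambda>_. 1)" using G(2) chi g by (simp add: Hinf_def Linf_simps lc_cl bm_measurable)
  have "T (cl \<eta>) \<otimes>\<^bsub>R\<^esub> T (cl g) = \<one>\<^bsub>R\<^esub>" using T_mult_analytic[of \<eta> g] chi g eq T_one by simp
  moreover have "T (cl g) \<otimes>\<^bsub>R\<^esub> T (cl \<eta>) = \<one>\<^bsub>R\<^esub>"
    using T_mult_analytic[of g \<eta>] chi g eq T_one by (simp add: mult.commute)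
  ultimately show "T (cl \<eta>) \<in> Units R" using toeplitz_in chi g unfolding Units_def R_simps(1) by auto
next
  assume "T (cl \<eta>) \<in> Units R"
  then obtain Y where Y: "Y \<in> carrier R" "Y \<otimes>\<^bsub>R\<^esub> T (cl \<eta>) = \<one>\<^bsub>R\<^esub>" "T (cl \<eta>) \<otimes>\<^bsub>R\<^esub> Y = \<one>\<^bsub>R\<^esub>"
    by (auto simp: Units_def)
  have Tc: "T (cl \<eta>) \<in> carrier R" using toeplitz_in chi by (auto simp: R_simps(1))
  have "Y \<otimes>\<^bsub>R\<^esub> T (cl a) = T (cl a) \<otimes>\<^bsub>R\<^esub> Y" if a: "a \<in> A" for a
  proof -
    have Ta: "T (cl a) \<in> carrier R" using toeplitz_in[OF A_bm[OF a]] by (simp add: R_simps(1))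
    have "Y \<otimes>\<^bsub>R\<^esub> T (cl a) = Y \<otimes>\<^bsub>R\<^esub> (T (cl a) \<otimes>\<^bsub>R\<^esub> (T (cl \<eta>) \<otimes>\<^bsub>R\<^esub> Y))" using Y Ta by simp
    also have "\<dots> = Y \<otimes>\<^bsub>R\<^esub> (T (cl a) \<otimes>\<^bsub>R\<^esub> T (cl \<eta>)) \<otimes>\<^bsub>R\<^esub> Y" using Y(1) Ta Tc by (simp add: BH.m_assoc)
    also have "T (cl a) \<otimes>\<^bsub>R\<^esub> T (cl \<eta>) = T (cl \<eta>) \<otimes>\<^bsub>R\<^esub> T (cl a)" using analytic_commutes_A[OF chi a] by simp
    also have "Y \<otimes>\<^bsub>R\<^esub> (T (cl \<eta>) \<otimes>\<^bsub>R\<^esub> T (cl a)) \<otimes>\<^bsub>R\<^esub> Y = (Y \<otimes>\<^bsub>R\<^esub> T (cl \<eta>)) \<otimes>\<^bsub>R\<^esub> (T (cl a) \<otimes>\<^bsub>R\<^esub> Y)"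
      using Y(1) Ta Tc by (simp add: BH.m_assoc)
    also have "\<dots> = T (cl a) \<otimes>\<^bsub>R\<^esub> Y" using Y Ta by simp
    finally show ?thesis .
  qed
  then obtain G where G: "G \<in> carrier (Hinf m A)" "Y = T G"
    using analytic_toeplitz_iff_commutes(2)[of Y] Y(1) unfolding R_simps(1) by blast
  obtain g where g: "g \<in> Ha" "G = cl g" using G(1) by (rule HinfE)
  have "T (cl (g \<cdot> \<eta>)) = T (cl (\<lambda>_. 1))" using Y(2) G(2) g(2) T_mult_analytic[of g \<eta>] chi g(1) T_one by simp
  then have eq: "cl (g \<cdot> \<eta>) = cl (\<lambda>_. 1)"
    using chi g(1) by (intro inj_onD[OF T_inj]) (auto intro: cl_Linf bm_mult bm_const)
  have "G \<otimes>\<^bsub>Hinf m A\<^esub> cl \<eta> = \<one>\<^bsub>Hinf m A\<^esub>" "cl \<eta> \<otimes>\<^bsub>Hinf m A\<^esub> G = \<one>\<^bsub>Hinf m A\<^esub>"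
    using eq chi g by (auto simp: Hinf_def Linf_simps lc_cl bm_measurable mult.commute)
  then show "cl \<eta> \<in> Units (Hinf m A)" using G(1) cl_Hinf[OF chi] unfolding Units_def by blast
qed

theorem spectrum_analytic:
  assumes "\<psi> \<in> carrier (Hinf m A)"
  shows "alg_spectrum R (T \<psi>) = alg_spectrum (Hinf m A) \<psi>"
proof -
  obtain f where f: "f \<in> Ha" "\<psi> = cl f" using assms by (rule HinfE)
  have d: "(\<lambda>x. c - f x) \<in> Ha" for c using f(1) Ha_const[of c] by (auto intro: bm_diff Hf_diff)
  have "(c \<odot>\<^bsub>Hinf m A\<^esub> \<one>\<^bsub>Hinf m A\<^esub>) \<ominus>\<^bsub>Hinf m A\<^esub> cl f = cl (\<lambda>x. c - f x)" for c
  proof -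
    have 1: "c \<odot>\<^bsub>Hinf m A\<^esub> \<one>\<^bsub>Hinf m A\<^esub> = cl (\<lambda>_. c)" by (simp add: Hinf_def Linf_simps lc_cl)
    have "cl (\<lambda>_. c) \<ominus>\<^bsub>Hinf m A\<^esub> cl f = cl (\<lambda>_. c) \<ominus>\<^bsub>Linf m\<^esub> cl f"
      by (subst Hinf_eq, rule HI.RS_minus) (intro cl_Hinf Ha_const f(1))+
    then show ?thesis unfolding 1 using Linf_minus[OF bm_const, of f m c] f(1) by simp
  qed
  then show ?thesis unfolding alg_spectrum_def f(2)
    using T_resolvent[of f] f(1) Units_analytic_iff[OF d] by simp
qed

end


section \<open>Essential range and spectrum\<close>

context prob_space begin

lemma coercive_lower_bound:
  assumes "h \<in> sq M" "g \<in> sq M" "0 < \<delta>" and co: "\<delta> * n2 M h \<le> cmod (ip M g h)"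
  shows "\<delta>\<^sup>2 * n2 M h \<le> n2 M g"
proof (cases "n2 M h = 0")
  case False
  then have p: "0 < sqrt (n2 M h)" using n2_nonneg[of M h] by (simp add: less_le)
  have "\<delta> * sqrt (n2 M h) * sqrt (n2 M h) \<le> sqrt (n2 M g) * sqrt (n2 M h)"
    using co ip_Cauchy_Schwarz[OF assms(2,1)] by (simp add: mult.assoc)
  then have "\<delta> * sqrt (n2 M h) \<le> sqrt (n2 M g)" using p by (rule mult_right_le_imp_le)
  then have "(\<delta> * sqrt (n2 M h))\<^sup>2 \<le> (sqrt (n2 M g))\<^sup>2" using assms(3) by (intro power_mono) auto
  then show ?thesis by (simp add: power_mult_distrib)
qed simp

text \<open>The range is closed because \<open>L\<close> is bounded below, and dense because a vector orthogonal to it is orthogonal to its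
own image.\<close>

theorem lax_milgram:
  assumes V: "csub V" and L: "bop M L C" and LV: "\<And>h. h \<in> V \<Longrightarrow> L h \<in> V"
    and d: "0 < \<delta>" and co: "\<And>h. h \<in> V \<Longrightarrow> \<delta> * n2 M h \<le> cmod (ip M (L h) h)" and f: "f \<in> V"
  shows "\<exists>h\<in>V. AE x in M. L h x = f x"
proof -
  have Vl: "lsub V" and Vc: "\<And>f. f \<in> sq M \<Longrightarrow> \<forall>e>0. \<exists>h\<in>V. n2 M (f -: h) \<le> e \<Longrightarrow> f \<in> V"
    using V by (auto simp: csub_def)
  have Vs: "h \<in> sq M" if "h \<in> V" for h using Vl that by (auto simp: lsub_def)
  have Ls: "L h \<in> sq M" if "h \<in> V" for h by (rule Vs[OF LV[OF that]])
  have low: "\<delta>\<^sup>2 * n2 M (h -: k) \<le> n2 M (\<lambda>x. L h x - L k x)" if h: "h \<in> V" and k: "k \<in> V" for h k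
  proof -
    have D: "(h -: k) \<in> V" by (rule lsub_diff[OF Vl h k])
    have "\<delta>\<^sup>2 * n2 M (h -: k) \<le> n2 M (L (h -: k))"
      by (rule coercive_lower_bound[OF Vs[OF D] Ls[OF D] d co[OF D]])
    also have "\<dots> = n2 M (\<lambda>x. L h x - L k x)"
      using bop_diff[OF L Vs[OF h] Vs[OF k]] Ls[OF D] Ls[OF h] Ls[OF k]
      by (intro n2_cong_AE sq_measurable sq_diff) auto
    finally show ?thesis .
  qed
  have tri: "n2 M (a -: c) \<le> 2 * n2 M (a -: b) + 2 * n2 M (b -: c)"
    if "a \<in> sq M" "b \<in> sq M" "c \<in> sq M" for a b c
    using n2_add_le2[OF sq_diff[OF that(1,2)] sq_diff[OF that(2,3)]] by simp
  define W where "W = {g \<in> sq M. \<exists>h\<in>V. AE x in M. L h x = g x}"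
  have LW: "L h \<in> W" if "h \<in> V" for h using that Ls by (auto simp: W_def)
  have W: "csub W"
    unfolding csub_def lsub_def
  proof (intro conjI ballI allI impI)
    show "W \<subseteq> sq M" by (auto simp: W_def)
    have V0: "(\<lambda>x. 0) \<in> V" using Vl by (simp add: lsub_def)
    have "AE x in M. L (\<lambda>x. 0 * 0) x = 0 * L (\<lambda>x. 0) x" by (rule bop_scale[OF L Vs[OF V0]])
    then show "(\<lambda>x. 0) \<in> W" using V0 by (auto simp: W_def sq_zero intro!: bexI[of _ "\<lambda>x. 0"])
  next
    fix f g assume "f \<in> W" "g \<in> W"
    then obtain h k where hk: "f \<in> sq M" "g \<in> sq M" "h \<in> V" "k \<in> V" "AE x in M. L h x = f x" "AE x in M. L k x = g x"
      by (auto simp: W_def)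
    have "AE x in M. L (h +: k) x = f x + g x"
      using bop_add[OF L Vs[OF hk(3)] Vs[OF hk(4)]] hk(5,6) by eventually_elim simp
    moreover have "(h +: k) \<in> V" using Vl hk by (simp add: lsub_def)
    ultimately show "(f +: g) \<in> W" using sq_add[OF hk(1,2)] by (auto simp: W_def)
  next
    fix c f assume "f \<in> W"
    then obtain h where h: "f \<in> sq M" "h \<in> V" "AE x in M. L h x = f x" by (auto simp: W_def)
    have "AE x in M. L (\<lambda>x. c * h x) x = c * f x" using bop_scale[OF L Vs[OF h(2)], of c] h(3) by eventually_elim simp
    moreover have "(\<lambda>x. c * h x) \<in> V" using Vl h by (simp add: lsub_def)
    ultimately show "(\<lambda>x. c * f x) \<in> W" using sq_scale[OF h(1), of c] by (auto simp: W_def)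
  next
    fix f assume f: "f \<in> sq M" and ap: "\<forall>e>0. \<exists>h\<in>W. n2 M (f -: h) \<le> e"
    have "\<exists>h\<in>V. n2 M (\<lambda>x. f x - L h x) \<le> inverse (real (Suc n))" for n
    proof -
      have "inverse (real (Suc n)) > 0" by simp
      then obtain g where g: "g \<in> W" "n2 M (f -: g) \<le> inverse (real (Suc n))" using ap by blast
      then obtain h where h: "h \<in> V" "AE x in M. L h x = g x" "g \<in> sq M" by (auto simp: W_def)
      have "n2 M (\<lambda>x. f x - L h x) = n2 M (f -: g)"
        using h(2) by (intro n2_cong_AE sq_measurable sq_diff f h(3) Ls[OF h(1)]) auto
      then have "n2 M (\<lambda>x. f x - L h x) \<le> inverse (real (Suc n))" using g(2) by simp
      then show ?thesis using h(1) by blast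
    qed
    then obtain h where h: "\<And>n. h n \<in> V" "\<And>n. n2 M (\<lambda>x. f x - L (h n) x) \<le> inverse (real (Suc n))" by metis
    have small: "\<exists>N. \<forall>n\<ge>N. inverse (real (Suc n)) \<le> e" if "e > 0" for e :: real
    proof -
      obtain N where N: "inverse (real (Suc N)) < e" using reals_Archimedean[OF \<open>e > 0\<close>] by blast
      have "inverse (real (Suc n)) \<le> e" if "n \<ge> N" for n
      proof -
        have "inverse (real (Suc n)) \<le> inverse (real (Suc N))" using that by (intro le_imp_inverse_le) auto
        then show ?thesis using N by linarith
      qed
      then show ?thesis by blast
    qed
    have "\<exists>g\<in>sq M. \<forall>e>0. \<exists>N. \<forall>i\<ge>N. n2 M (\<lambda>x. h i x - g x) \<le> e"
    proof (rule sq_complete[OF Vs[OF h(1)]])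
      fix e :: real assume "e > 0"
      then have "\<delta>\<^sup>2 * e / 4 > 0" using d by simp
      then obtain N where N: "\<And>n. n \<ge> N \<Longrightarrow> inverse (real (Suc n)) \<le> \<delta>\<^sup>2 * e / 4" using small by blast
      have "n2 M (\<lambda>x. h i x - h j x) \<le> e" if ij: "i \<ge> N" "j \<ge> N" for i j
      proof -
        have "\<delta>\<^sup>2 * n2 M (\<lambda>x. h i x - h j x) \<le> n2 M (\<lambda>x. L (h i) x - L (h j) x)" by (rule low[OF h(1) h(1)])
        also have "\<dots> \<le> 2 * n2 M (\<lambda>x. L (h i) x - f x) + 2 * n2 M (\<lambda>x. f x - L (h j) x)"
          by (rule tri[OF Ls[OF h(1)] f Ls[OF h(1)]])
        also have "\<dots> \<le> \<delta>\<^sup>2 * e"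
          using h(2)[of i] h(2)[of j] N[OF ij(1)] N[OF ij(2)] n2_diff_commute[of M f "L (h i)"] by linarith
        finally show ?thesis using d by simp
      qed
      then show "\<exists>N. \<forall>i\<ge>N. \<forall>j\<ge>N. n2 M (\<lambda>x. h i x - h j x) \<le> e" by blast
    qed
    then obtain g where g: "g \<in> sq M" "\<And>e. e > 0 \<Longrightarrow> \<exists>N. \<forall>i\<ge>N. n2 M (\<lambda>x. h i x - g x) \<le> e" by blast
    have gV: "g \<in> V"
    proof (rule Vc[OF g(1)], intro allI impI)
      fix e :: real assume "e > 0"
      then obtain N where "\<forall>i\<ge>N. n2 M (\<lambda>x. h i x - g x) \<le> e" using g(2) by blast
      then have "n2 M (\<lambda>x. g x - h N x) \<le> e" using n2_diff_commute[of M g "h N"] by simp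
      then show "\<exists>h\<in>V. n2 M (g -: h) \<le> e" using h(1) by blast
    qed
    have "n2 M (\<lambda>x. f x - L g x) \<le> 0 + e" if e: "e > 0" for e
    proof -
      have C: "0 \<le> C" by (rule bop_nonneg[OF L])
      have "e / (4 * (C + 1)) > 0" using C e by simp
      then obtain N where N: "\<And>i. i \<ge> N \<Longrightarrow> n2 M (\<lambda>x. h i x - g x) \<le> e / (4 * (C + 1))" using g(2) by blast
      have "e / 4 > 0" using e by simp
      then obtain N' where N': "\<And>i. i \<ge> N' \<Longrightarrow> inverse (real (Suc i)) \<le> e / 4" using small by blast
      define i where "i = max N N'"
      have "n2 M (\<lambda>x. L (h i) x - L g x) \<le> C * n2 M (\<lambda>x. h i x - g x)"
        by (rule bop_diff_n2[OF L Vs[OF h(1)] g(1)])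
      also have "\<dots> \<le> (C + 1) * (e / (4 * (C + 1)))" using C N[of i] by (intro mult_mono) (auto simp: i_def)
      also have "\<dots> = e / 4" using C by (simp add: field_simps)
      finally have 1: "n2 M (\<lambda>x. L (h i) x - L g x) \<le> e / 4" .
      have "n2 M (\<lambda>x. f x - L (h i) x) \<le> e / 4" using h(2)[of i] N'[of i] by (simp add: i_def)
      then show ?thesis using 1 tri[OF f Ls[OF h(1)] Ls[OF gV], of i] by linarith
    qed
    then have "n2 M (\<lambda>x. f x - L g x) \<le> 0" by (rule field_le_epsilon)
    then have "n2 M (\<lambda>x. f x - L g x) = 0" using n2_nonneg[of M "\<lambda>x. f x - L g x"] by linarith
    then have "AE x in M. f x = L g x" by (rule n2_diff_eq_0_imp_AE[OF f Ls[OF gV]])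
    then have "AE x in M. L g x = f x" by eventually_elim simp
    then show "f \<in> W" using f gV by (auto simp: W_def)
  qed
  have fs: "f \<in> sq M" by (rule Vs[OF f])
  obtain g where g: "g \<in> W" "\<And>k. k \<in> W \<Longrightarrow> ip M (f -: g) k = 0" using projection_exists[OF W fs] by blast
  then obtain h where h: "h \<in> V" "AE x in M. L h x = g x" "g \<in> sq M" by (auto simp: W_def)
  define r where "r = (\<lambda>x. f x - L h x)"
  have rV: "r \<in> V" unfolding r_def by (rule lsub_diff[OF Vl f LV[OF h(1)]])
  have "ip M r (L r) = ip M (f -: g) (L r)"
    using h(2) unfolding r_def
    by (intro ip_cong_AE sq_measurable sq_diff fs h(3) Ls h(1) rV[unfolded r_def]) auto
  then have "ip M (L r) r = 0" using g(2)[OF LW[OF rV]] ip_cnj[of M r "L r"] by simp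
  then have "\<delta> * n2 M r \<le> 0" using co[OF rV] by simp
  then have "n2 M r = 0" using d n2_nonneg[of M r] by (simp add: mult_le_0_iff)
  then have "AE x in M. f x = L h x" unfolding r_def by (rule n2_diff_eq_0_imp_AE[OF fs Ls[OF h(1)]])
  then have "AE x in M. L h x = f x" by eventually_elim simp
  then show ?thesis using h(1) by blast
qed

lemma essran_props:
  assumes f: "f \<in> bm M"
  shows AE_essran: "AE x in M. f x \<in> essran M (ae_class M f)"
    and compact_essran: "compact (essran M (ae_class M f))"
proof -
  let ?E = "essran M (ae_class M f)"
  have cE: "\<exists>e>0. AE x in M. e \<le> cmod (f x - c)" if "c \<notin> ?E" for c using that essran_iff[OF f] by blast
  define F where "F = {ball c e | c e. AE x in M. e \<le> cmod (f x - c)}"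
  obtain F' where F': "F' \<subseteq> F" "countable F'" "\<Union>F' = \<Union>F"
    by (rule Lindelof[of F]) (auto simp: F_def)
  have avoid: "AE x in M. f x \<notin> S" if "S \<in> F" for S
    using that by (auto simp: F_def dist_norm norm_minus_commute elim!: eventually_mono)
  have "AE x in M. \<forall>S\<in>F'. f x \<notin> S" using F' avoid by (subst AE_ball_countable) auto
  then show "AE x in M. f x \<in> ?E"
  proof eventually_elim
    fix x assume x: "\<forall>S\<in>F'. f x \<notin> S"
    show "f x \<in> ?E"
    proof (rule ccontr)
      assume "f x \<notin> ?E"
      then obtain e where "e > 0" "AE y in M. e \<le> cmod (f y - f x)" using cE by blast
      then have "f x \<in> \<Union>F" by (auto simp: F_def intro!: exI[of _ "ball (f x) e"])
      then show False using x F'(3) by blast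
    qed
  qed
  have "open (- ?E)" unfolding open_contains_ball
  proof
    fix c assume "c \<in> - ?E"
    then obtain e where e: "e > 0" "AE x in M. e \<le> cmod (f x - c)" using cE by blast
    have "c' \<notin> ?E" if c': "c' \<in> ball c (e/2)" for c'
    proof -
      have "AE x in M. e/2 \<le> cmod (f x - c')" using e(2)
      proof eventually_elim
        fix x assume "e \<le> cmod (f x - c)"
        then show "e/2 \<le> cmod (f x - c')"
          using c' norm_triangle_ineq[of "f x - c'" "c' - c"] by (simp add: dist_norm norm_minus_commute)
      qed
      moreover have "e/2 > 0" using e by simp
      ultimately show ?thesis using essran_iff[OF f] by blast
    qed
    moreover have "e/2 > 0" using e by simp
    ultimately show "\<exists>d>0. ball c d \<subseteq> - ?E" by blast
  qed
  then have cl: "closed ?E" by (simp add: closed_def)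
  obtain N where N: "AE x in M. cmod (f x) \<le> N" using f by (auto simp: bm_def)
  have "cmod c \<le> N" if c: "c \<in> ?E" for c
  proof (rule ccontr)
    assume "\<not> cmod c \<le> N"
    then have p: "cmod c - N > 0" by simp
    have "AE x in M. cmod c - N \<le> cmod (f x - c)" using N
    proof eventually_elim
      fix x assume "cmod (f x) \<le> N"
      then show "cmod c - N \<le> cmod (f x - c)" using norm_triangle_ineq2[of c "f x"] by (simp add: norm_minus_commute)
    qed
    then show False using c p essran_iff[OF f] by blast
  qed
  then have "bounded ?E" by (auto simp: bounded_iff)
  then show "compact ?E" using cl by (simp add: compact_eq_bounded_closed)
qed

end

context spherical_setting begin

lemma Units_if_bounded_below:
  assumes Z: "Z \<in> Ops" and low: "\<And>K. K \<in> H \<Longrightarrow> l2_norm m K \<le> c * l2_norm m (Z K)"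
    and onto: "\<And>G. G \<in> H \<Longrightarrow> \<exists>K\<in>H. Z K = G"
  shows "Z \<in> Units R"
proof -
  have inj: "K = K'" if K: "K \<in> H" and K': "K' \<in> H" and eq: "Z K = Z K'" for K K'
  proof -
    let ?D = "lc_add m (lc_scale m (-1) K') K"
    have D: "?D \<in> H" by (intro H_add H_scale K K')
    have "Z ?D = lc_add m (lc_scale m (-1) (Z K)) (Z K)"
      using K K' eq by (simp add: ops_add[OF Z] ops_scale[OF Z] H_scale)
    also have "\<dots> = cl (\<lambda>_. 0)" by (rule H_neg[OF ops_in[OF Z K]])
    finally have "l2_norm m ?D \<le> 0" using low[OF D] H_norm_zero by simp
    then have "?D = cl (\<lambda>_. 0)" using H_norm_0[OF D] l2_norm_nonneg[of ?D] by simp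
    then have "lc_add m K' ?D = lc_add m K' (cl (\<lambda>_. 0))" by simp
    moreover obtain k k' where "k \<in> Hf" "K = cl k" "k' \<in> Hf" "K' = cl k'" using K K' by (auto elim!: HE)
    ultimately show "K = K'" by (simp add: lc_cl Hfm Hf_scale Hf_add Hf_diff Hf_zero)
  qed
  define Y where "Y = (\<lambda>G\<in>H. SOME K. K \<in> H \<and> Z K = G)"
  have Y: "Y G \<in> H" "Z (Y G) = G" if "G \<in> H" for G
  proof -
    have "\<exists>K. K \<in> H \<and> Z K = G" using onto[OF that] by blast
    from someI_ex[OF this] show "Y G \<in> H" "Z (Y G) = G" using that by (auto simp: Y_def)
  qed
  have Yeq: "Y G = K" if "K \<in> H" "Z K = G" for G K
    using inj[OF Y(1) that(1)] Y(2)[of G] ops_in[OF Z that(1)] that(2) by simp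
  have Yb: "Y \<in> Ops"
    unfolding bounded_ops_def
  proof (intro CollectI conjI ballI allI)
    show "Y \<in> H \<rightarrow>\<^sub>E H" using Y(1) by (intro PiE_I) (auto simp: Y_def)
    show "Y (lc_add m F G) = lc_add m (Y F) (Y G)" if "F \<in> H" "G \<in> H" for F G
      using that Y by (intro Yeq) (auto simp: ops_add[OF Z] intro: H_add)
    show "Y (lc_scale m d F) = lc_scale m d (Y F)" if "F \<in> H" for d F
      using that Y by (intro Yeq) (auto simp: ops_scale[OF Z] intro: H_scale)
    have "l2_norm m (Y F) \<le> c * l2_norm m F" if "F \<in> H" for F using low[OF Y(1)[OF that]] Y(2)[OF that] by simp
    then show "\<exists>C. \<forall>F\<in>H. l2_norm m (Y F) \<le> C * l2_norm m F" by blast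
  qed
  have "Y \<otimes>\<^bsub>R\<^esub> Z = \<one>\<^bsub>R\<^esub>"
    by (rule R_eqI[OF R_mult_closed[OF Yb Z] R_one_closed]) (simp add: R_app Yeq)
  moreover have "Z \<otimes>\<^bsub>R\<^esub> Y = \<one>\<^bsub>R\<^esub>"
    by (rule R_eqI[OF R_mult_closed[OF Z Yb] R_one_closed]) (simp add: R_app Y)
  ultimately show ?thesis using Z Yb unfolding Units_def R_simps(1) by blast
qed

text \<open>\<open>\<parallel>h\<parallel> \<le> \<parallel>T\<^sup>-\<^sup>1\<parallel> \<parallel>T h\<parallel>\<close> carries over to the symbol by \<open>symbol_lower\<close>.\<close>

lemma T_unit_bounded_below:
  assumes eta: "\<eta> \<in> bm m" and U: "T (cl \<eta>) \<in> Units R"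
  obtains a where "a > 0" "AE x in m. a \<le> cmod (\<eta> x)"
proof -
  define Z where "Z = T (cl \<eta>)"
  have Z: "Z \<in> Ops" unfolding Z_def by (rule toeplitz_in[OF eta])
  obtain Y where Y: "Y \<in> Ops" "Y \<otimes>\<^bsub>R\<^esub> Z = \<one>\<^bsub>R\<^esub>"
    using U unfolding Units_def R_simps(1) Z_def by blast
  have N: "0 \<le> anorm R Y" by (rule R_anorm_nonneg[OF Y(1)])
  have low: "n2 m (P g) \<le> (anorm R Y)\<^sup>2 * n2 m (L_of Z g)" if g: "g \<in> sq m" for g
  proof -
    have Hg: "cl (P g) \<in> H" by (rule cl_H[OF P_Hf[OF g]])
    have "Y (Z (cl (P g))) = cl (P g)" using arg_cong[OF Y(2), of "\<lambda>X. X (cl (P g))"] Hg by (simp add: R_app)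
    then have "l2_norm m (cl (P g)) \<le> anorm R Y * l2_norm m (Z (cl (P g)))"
      using R_anorm_bound[OF Y(1) ops_in[OF Z Hg]] by simp
    then have "sqrt (n2 m (P g)) \<le> anorm R Y * sqrt (n2 m (L_of Z g))"
      using l2_norm_H[OF P_Hf[OF g]] l2_norm_H[OF L_of_Hf(1)[OF Z g]] L_of_Hf(2)[OF Z g] by simp
    then have "(sqrt (n2 m (P g)))\<^sup>2 \<le> (anorm R Y * sqrt (n2 m (L_of Z g)))\<^sup>2" by (intro power_mono) auto
    then show ?thesis by (simp add: power_mult_distrib)
  qed
  obtain \<theta> where th: "\<theta> \<in> bm m" "cl \<eta> = cl \<theta>" "symbol (L_of Z) \<theta>"
    using sym_toeplitz[OF eta] by (auto simp: sym_def Z_def)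
  let ?C = "4 * (anorm R Y)\<^sup>2"
  have "n2 m g \<le> ?C * n2 m (\<theta> \<cdot> g)" if g: "g \<in> sq m" for g
    by (rule symbol_lower[OF L_of_sq[OF Z] th(3) th(1) g low]) auto
  then have "AE x in m. 1 \<le> ?C * (cmod (\<theta> x))\<^sup>2"
    using mult_le_AE[OF sq_one bm_imp_sq[OF th(1)], of ?C] by (simp add: bm_imp_sq)
  moreover have "AE x in m. \<eta> x = \<theta> x" using th(2) ae_class_eq_iff[OF bm_measurable[OF eta] bm_measurable[OF th(1)]] by blast
  ultimately have "AE x in m. 1 / (2 * anorm R Y + 1) \<le> cmod (\<eta> x)"
  proof eventually_elim
    fix x assume "1 \<le> ?C * (cmod (\<theta> x))\<^sup>2" "\<eta> x = \<theta> x"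
    then have "1\<^sup>2 \<le> (2 * anorm R Y * cmod (\<eta> x))\<^sup>2" by (simp add: power_mult_distrib)
    then have "1 \<le> 2 * anorm R Y * cmod (\<eta> x)" by (rule power2_le_imp_le) (use N in simp)
    also have "\<dots> \<le> (2 * anorm R Y + 1) * cmod (\<eta> x)" by (intro mult_right_mono) auto
    finally show "1 / (2 * anorm R Y + 1) \<le> cmod (\<eta> x)" using N by (simp add: field_simps)
  qed
  moreover have "1 / (2 * anorm R Y + 1) > 0" using N by simp
  ultimately show thesis by (rule that[rotated])
qed

text \<open>Multiplication by \<open>k\<close> turns the half-plane condition into coercivity of the compressed form.\<close>

lemma T_unit_if_halfplane:
  assumes eta: "\<eta> \<in> bm m" and d: "\<delta> > 0" and half: "AE x in m. \<delta> \<le> Re (k * \<eta> x)"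
  shows "T (cl \<eta>) \<in> Units R"
proof -
  have s: "(\<eta> \<cdot> h) \<in> sq m" if "h \<in> Hf" for h by (intro sq_mult eta Hf_sq that)
  have Re_times_real: "Re (z * of_real r) = Re z * r" for z r by simp
  have co: "\<delta> * n2 m h \<le> cmod k * cmod (ip m (P (\<eta> \<cdot> h)) h)" if h: "h \<in> Hf" for h
  proof -
    note hs = Hf_sq[OF h]
    have int: "integrable m (\<lambda>x. k * (\<eta> x * h x * cnj (h x)))" using ip_integrable[OF s[OF h] hs] by simp
    have "\<delta> * n2 m h = (LINT x|m. \<delta> * (cmod (h x))\<^sup>2)" by (simp add: n2_def)
    also have "\<dots> \<le> (LINT x|m. Re (k * (\<eta> x * h x * cnj (h x))))"
    proof (rule integral_mono_AE)
      show "integrable m (\<lambda>x. \<delta> * (cmod (h x))\<^sup>2)" using sq_integrable[OF hs] by simp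
      show "integrable m (\<lambda>x. Re (k * (\<eta> x * h x * cnj (h x))))" using int by (rule integrable_Re)
      show "AE x in m. \<delta> * (cmod (h x))\<^sup>2 \<le> Re (k * (\<eta> x * h x * cnj (h x)))" using half
      proof eventually_elim
        fix x assume x: "\<delta> \<le> Re (k * \<eta> x)"
        have "k * (\<eta> x * h x * cnj (h x)) = (k * \<eta> x) * of_real ((cmod (h x))\<^sup>2)"
          unfolding complex_norm_square by simp
        then have "Re (k * (\<eta> x * h x * cnj (h x))) = Re (k * \<eta> x) * (cmod (h x))\<^sup>2"
          by (simp only: Re_times_real)
        then show "\<delta> * (cmod (h x))\<^sup>2 \<le> Re (k * (\<eta> x * h x * cnj (h x)))" using mult_right_mono[OF x] by simp
      qed
    qed
    also have "\<dots> = Re (k * ip m (\<eta> \<cdot> h) h)" using integral_Re[OF int] by (simp add: ip_def)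
    also have "\<dots> \<le> cmod (k * ip m (\<eta> \<cdot> h) h)" by (rule complex_Re_le_cmod)
    also have "\<dots> = cmod k * cmod (ip m (P (\<eta> \<cdot> h)) h)" by (simp add: norm_mult P_ip[OF s[OF h] h])
    finally show ?thesis .
  qed
  have "k \<noteq> 0"
  proof
    assume "k = 0"
    then have "AE x in m. False" using half d by simp
    then show False by simp
  qed
  then have k: "cmod k > 0" by simp
  define \<epsilon> where "\<epsilon> = \<delta> / cmod k"
  have e: "\<epsilon> > 0" using d k by (simp add: \<epsilon>_def)
  have co': "\<epsilon> * n2 m h \<le> cmod (ip m (P (\<eta> \<cdot> h)) h)" if "h \<in> Hf" for h
    using co[OF that] k by (simp add: \<epsilon>_def field_simps)
  obtain C where C: "bop m (\<lambda>f x. \<eta> x * f x) C" by (rule bop_mult[OF eta])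
  have L: "bop m (\<lambda>f. P (\<eta> \<cdot> f)) (1 * C)" by (rule bop_comp[OF bop_P C])
  show ?thesis
  proof (rule Units_if_bounded_below[OF toeplitz_in[OF eta]])
    fix K assume "K \<in> H"
    then obtain h where h: "h \<in> Hf" "K = cl h" by (rule HE)
    have "\<epsilon>\<^sup>2 * n2 m h \<le> n2 m (P (\<eta> \<cdot> h))"
      by (rule coercive_lower_bound[OF Hf_sq[OF h(1)] P_sq[OF s[OF h(1)]] e co'[OF h(1)]])
    then have "sqrt (\<epsilon>\<^sup>2 * n2 m h) \<le> sqrt (n2 m (P (\<eta> \<cdot> h)))" by (rule real_sqrt_le_mono)
    then have "\<epsilon> * l2_norm m K \<le> l2_norm m (T (cl \<eta>) K)"
      using h e by (simp add: toeplitz_cl[OF eta] l2_norm_H P_Hf s real_sqrt_mult)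
    then show "l2_norm m K \<le> inverse \<epsilon> * l2_norm m (T (cl \<eta>) K)" using e by (simp add: field_simps)
  next
    fix G assume "G \<in> H"
    then obtain g where g: "g \<in> Hf" "G = cl g" by (rule HE)
    have "\<exists>h\<in>Hf. AE x in m. P (\<eta> \<cdot> h) x = g x"
      by (rule lax_milgram[OF csub_Hf L P_Hf[OF s] e co' g(1)])
    then obtain h where h: "h \<in> Hf" "AE x in m. P (\<eta> \<cdot> h) x = g x" by blast
    have "T (cl \<eta>) (cl h) = G" using ae_class_cong[OF h(2)] by (simp add: toeplitz_cl[OF eta h(1)] g(2))
    then show "\<exists>K\<in>H. T (cl \<eta>) K = G" using cl_H[OF h(1)] by blast
  qed
qed

text \<open>A point outside the convex hull of the compact essential range is strictly separated from it by a line, which gives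
the half-plane condition.\<close>

theorem spectrum_bounds:
  assumes "\<psi> \<in> carrier (Linf m)"
  shows "essran m \<psi> \<subseteq> alg_spectrum R (T \<psi>)" and "alg_spectrum R (T \<psi>) \<subseteq> convex hull (essran m \<psi>)"
proof -
  obtain f where f: "f \<in> bm m" "\<psi> = cl f" using assms by (rule LinfE)
  have d: "(\<lambda>x. c - f x) \<in> bm m" for c by (rule bm_diff[OF bm_const f(1)])
  have spec: "c \<in> alg_spectrum R (T \<psi>) \<longleftrightarrow> T (cl (\<lambda>x. c - f x)) \<notin> Units R" for c
    unfolding alg_spectrum_def f(2) by (simp add: T_resolvent[OF f(1)])
  show "essran m \<psi> \<subseteq> alg_spectrum R (T \<psi>)"
  proof
    fix c assume c: "c \<in> essran m \<psi>"
    show "c \<in> alg_spectrum R (T \<psi>)" unfolding spec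
    proof
      assume "T (cl (\<lambda>x. c - f x)) \<in> Units R"
      then obtain a where "a > 0" "AE x in m. a \<le> cmod (c - f x)" by (rule T_unit_bounded_below[OF d])
      then show False using c essran_iff[OF f(1)] f(2) by (auto simp: norm_minus_commute)
    qed
  qed
  show "alg_spectrum R (T \<psi>) \<subseteq> convex hull (essran m \<psi>)"
  proof
    fix c assume "c \<in> alg_spectrum R (T \<psi>)"
    then have nu: "T (cl (\<lambda>x. c - f x)) \<notin> Units R" by (simp add: spec)
    show "c \<in> convex hull (essran m \<psi>)"
    proof (rule ccontr)
      assume nc: "c \<notin> convex hull (essran m \<psi>)"
      have "closed (convex hull (essran m \<psi>))"
        unfolding f(2) by (intro compact_imp_closed compact_convex_hull compact_essran f(1))
      then obtain a b where ab: "inner a c < b" "\<And>z. z \<in> convex hull (essran m \<psi>) \<Longrightarrow> inner a z > b"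
        using separating_hyperplane_closed_point[OF convex_convex_hull _ nc] by blast
      have "AE x in m. b - inner a c \<le> Re ((- cnj a) * (c - f x))" using AE_essran[OF f(1)]
      proof eventually_elim
        fix x assume "f x \<in> essran m (cl f)"
        then have "f x \<in> convex hull (essran m \<psi>)" unfolding f(2) by (rule hull_inc)
        then have "inner a (f x) > b" by (rule ab(2))
        then show "b - inner a c \<le> Re ((- cnj a) * (c - f x))" by (simp add: inner_complex_def algebra_simps)
      qed
      then have "T (cl (\<lambda>x. c - f x)) \<in> Units R" by (rule T_unit_if_halfplane[OF d, rotated]) (use ab(1) in simp)
      then show False using nu by simp
    qed
  qed
qed

end


section \<open>Continuous symbols\<close>

lemma short_exact_comp:
  assumes ex: "short_exact I R S h" and r: "star_homomorphism S Q r" and bij: "bij_betw r (carrier S) (carrier Q)"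
    and z: "\<zero>\<^bsub>S\<^esub> \<in> carrier S" "r \<zero>\<^bsub>S\<^esub> = \<zero>\<^bsub>Q\<^esub>"
  shows "short_exact I R Q (\<lambda>x. r (h x))"
proof -
  have im: "h ` carrier R = carrier S" using ex by (simp add: short_exact_def)
  then have hc: "h x \<in> carrier S" if "x \<in> carrier R" for x using that by blast
  have hh: "star_homomorphism R S h" using ex by (simp add: short_exact_def)
  have "(\<lambda>x. r (h x)) \<in> ring_hom R Q"
    using ring_hom_trans[of h R S r Q] hh r by (simp add: star_homomorphism_def o_def)
  then have "star_homomorphism R Q (\<lambda>x. r (h x))"
    using hh r hc by (simp add: star_homomorphism_def)
  moreover have "a_kernel R Q (\<lambda>x. r (h x)) = a_kernel R S h"
    unfolding a_kernel_def'
  proof (intro Collect_cong conj_cong refl)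
    fix x assume "x \<in> carrier R"
    then have "r (h x) = r \<zero>\<^bsub>S\<^esub> \<longleftrightarrow> h x = \<zero>\<^bsub>S\<^esub>" using hc z(1) bij by (intro inj_on_eq_iff[of r "carrier S"]) (auto simp: bij_betw_def)
    then show "r (h x) = \<zero>\<^bsub>Q\<^esub> \<longleftrightarrow> h x = \<zero>\<^bsub>S\<^esub>" using z(2) by simp
  qed
  moreover have "(\<lambda>x. r (h x)) ` carrier R = carrier Q"
    using im bij by (auto simp: bij_betw_def image_image[symmetric])
  ultimately show ?thesis using ex by (simp add: short_exact_def)
qed

context spherical_setting begin

lemma Cont_UNIV: "carrier (Cont UNIV) = {f :: 'k \<Rightarrow> complex. cts f}"
  by (auto simp: Cont_def)

lemma CK_eq: "CK_classes m = cl ` {f. cts f}"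
  by (simp add: CK_classes_def Cont_UNIV)

lemma not_msupp_eq: "- msupp m = \<Union>{U. open U \<and> emeasure m U = 0}"
  unfolding msupp_def by (auto simp: zero_less_iff_neq_zero)

lemma closed_msupp: "closed (msupp m)"
  unfolding closed_def not_msupp_eq by (rule open_Union) blast

lemma AE_msupp: "AE x in m. x \<in> msupp m"
proof -
  have o: "open (- msupp m)" using closed_msupp by (simp add: open_Compl)
  have C0: "emeasure m C = 0" if C: "C \<subseteq> - msupp m" "compact C" for C
  proof -
    let ?D = "{U. open U \<and> emeasure m U = 0}"
    have "C \<subseteq> \<Union>?D" using C(1) unfolding not_msupp_eq .
    then obtain D' where D': "D' \<subseteq> ?D" "finite D'" "C \<subseteq> \<Union>D'"
      using compactE[OF C(2), of ?D] by blast
    have "(\<Union>U\<in>D'. U) \<in> null_sets m" using D' by (intro null_sets_UN') (auto simp: null_sets_def countable_finite)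
    then have "emeasure m (\<Union>D') = 0" "\<Union>D' \<in> sets m" by (auto simp: null_sets_def)
    then show ?thesis using emeasure_mono[OF D'(3), of m] by simp
  qed
  have "- msupp m \<in> sets borel" using o by simp
  then have "emeasure m (- msupp m) = (SUP C\<in>{C. C \<subseteq> - msupp m \<and> compact C}. emeasure m C)"
    using regular unfolding regular_borel_prob_def by blast
  also have "\<dots> = (SUP C\<in>{C. C \<subseteq> - msupp m \<and> compact C}. 0)" using C0 by (intro SUP_cong) auto
  also have "\<dots> = 0" by (simp add: SUP_constant bot_ennreal)
  finally have "- msupp m \<in> null_sets m" using o by (simp add: null_sets_def)
  then show ?thesis by (rule AE_I') auto
qed

lemma AE_iff_msupp:
  assumes "closed {x :: 'k. Q x}" shows "(AE x in m. Q x) \<longleftrightarrow> (\<forall>x\<in>msupp m. Q x)"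
proof
  assume ae: "AE x in m. Q x"
  have o: "open (- {x. Q x})" using assms by (simp add: open_Compl)
  then have "emeasure m (- {x. Q x}) = 0"
    using ae by (subst (asm) AE_iff_measurable[OF _ refl]) (auto simp: Compl_eq)
  then have "- {x. Q x} \<subseteq> - msupp m" unfolding not_msupp_eq using o by blast
  then show "\<forall>x\<in>msupp m. Q x" by blast
next
  assume "\<forall>x\<in>msupp m. Q x"
  then show "AE x in m. Q x" using AE_msupp by (auto elim: eventually_mono)
qed

lemma cont_eq_msupp:
  assumes f: "cts f" and g: "cts (g :: 'k \<Rightarrow> complex)"
  shows "cl f = cl g \<longleftrightarrow> (\<forall>x\<in>msupp m. f x = g x)"
  unfolding ae_class_eq_iff[OF cont_measurable[OF f] cont_measurable[OF g]]
  by (rule AE_iff_msupp) (rule closed_Collect_eq[OF f g])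

lemma Tietze_complex:
  fixes h :: "'k \<Rightarrow> complex"
  assumes S: "closed S" and h: "continuous_on S h"
  obtains g where "cts g" "\<And>x. x \<in> S \<Longrightarrow> g x = h x"
proof -
  have ext: "\<exists>g. cts g \<and> (\<forall>x\<in>S. g x = u x)" if u: "continuous_on S u" for u :: "'k \<Rightarrow> real"
  proof -
    obtain g where "continuous_map (euclidean :: 'k topology) euclideanreal g" "\<And>x. x \<in> S \<Longrightarrow> g x = u x"
      by (rule Tietze_extension_realinterval[OF normal_K, of S UNIV u]) (use S u in auto)
    then show ?thesis by (intro exI[of _ g]) auto
  qed
  obtain u where u: "cts u" "\<And>x. x \<in> S \<Longrightarrow> u x = Re (h x)"
    using ext[OF continuous_on_Re[OF h]] by blast
  obtain v where v: "cts v" "\<And>x. x \<in> S \<Longrightarrow> v x = Im (h x)"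
    using ext[OF continuous_on_Im[OF h]] by blast
  show thesis
  proof (rule that[of "\<lambda>x. Complex (u x) (v x)"])
    show "cts (\<lambda>x. Complex (u x) (v x))"
      unfolding Complex_eq by (intro continuous_intros u v)
    show "Complex (u x) (v x) = h x" if "x \<in> S" for x using u v that by simp
  qed
qed

lemma CKE: assumes "F \<in> CK_classes m" obtains f where "cts f" "F = cl f"
  using assms by (auto simp: CK_eq)

lemma cl_CK: "cts f \<Longrightarrow> cl f \<in> CK_classes m" by (auto simp: CK_eq)

text \<open>Essential uniform convergence of continuous functions is uniform convergence on the support; the limit there is
extended to the whole space by Tietze.\<close>

lemma CK_norm_closed: "norm_closed (Linf m) (CK_classes m)"
  unfolding norm_closed_def
proof (intro ballI impI)
  fix F assume F: "F \<in> carrier (Linf m)" and ap: "\<forall>e>0. \<exists>G\<in>CK_classes m. anorm (Linf m) (F \<ominus>\<^bsub>Linf m\<^esub> G) < e"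
  obtain f where f: "f \<in> bm m" "F = cl f" using F by (rule LinfE)
  define e where "e n = inverse (real (Suc n))" for n
  have "\<exists>g. cts g \<and> (AE x in m. cmod (f x - g x) \<le> e n)" for n
  proof -
    have "e n > 0" by (simp add: e_def)
    then obtain G where G: "G \<in> CK_classes m" "anorm (Linf m) (F \<ominus>\<^bsub>Linf m\<^esub> G) < e n" using ap by blast
    obtain g where g: "cts g" "G = cl g" using G(1) by (rule CKE)
    have "AE x in m. cmod (f x - g x) \<le> anorm (Linf m) (cl (f -: g))"
      by (rule Linf_anorm(2)[OF bm_diff[OF f(1) cont_bm[OF g(1)]]])
    then have "AE x in m. cmod (f x - g x) \<le> e n"
      using G(2) unfolding f(2) g(2) Linf_minus[OF f(1) cont_bm[OF g(1)]] by (auto elim: eventually_mono)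
    then show ?thesis using g(1) by blast
  qed
  then obtain g where g: "\<And>n. cts (g n)" "\<And>n. AE x in m. cmod (f x - g n x) \<le> e n" by metis
  have e0: "e \<longlonglongrightarrow> 0" unfolding e_def by (rule LIMSEQ_inverse_real_of_nat)
  have gg: "cmod (g i x - g j x) \<le> e i + e j" if x: "x \<in> msupp m" for i j x
  proof -
    have "AE x in m. cmod (g i x - g j x) \<le> e i + e j" using g(2)[of i] g(2)[of j]
    proof eventually_elim
      fix x assume "cmod (f x - g i x) \<le> e i" "cmod (f x - g j x) \<le> e j"
      then show "cmod (g i x - g j x) \<le> e i + e j"
        using norm_triangle_ineq4[of "f x - g j x" "f x - g i x"] by simp
    qed
    moreover have "closed {x. cmod (g i x - g j x) \<le> e i + e j}"
      by (intro closed_Collect_le continuous_intros g(1))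
    ultimately show ?thesis using AE_iff_msupp[of "\<lambda>x. cmod (g i x - g j x) \<le> e i + e j"] x by blast
  qed
  define u where "u x = lim (\<lambda>n. g n x)" for x
  have gu: "(\<lambda>n. g n x) \<longlonglongrightarrow> u x" and gu': "cmod (g i x - u x) \<le> e i" if x: "x \<in> msupp m" for x i
    unfolding u_def using almost_Cauchy_limit[OF gg[OF x] e0] by auto
  have "uniform_limit (msupp m) g u sequentially"
  proof (rule uniform_limitI)
    fix d :: real assume "d > 0"
    then have "eventually (\<lambda>n. e n < d) sequentially" using e0 by (intro order_tendstoD(2)) auto
    then show "\<forall>\<^sub>F n in sequentially. \<forall>x\<in>msupp m. dist (g n x) (u x) < d"
      by eventually_elim (auto simp: dist_norm intro: le_less_trans[OF gu'])
  qed
  then have "continuous_on (msupp m) u"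
    by (rule uniform_limit_theorem[rotated]) (simp_all add: continuous_on_subset[OF g(1)])
  then obtain h where h: "cts h" "\<And>x. x \<in> msupp m \<Longrightarrow> h x = u x"
    by (rule Tietze_complex[OF closed_msupp]) auto
  have "AE x in m. \<forall>n. cmod (f x - g n x) \<le> e n" using g(2) by (simp add: AE_all_countable)
  then have "AE x in m. f x = h x" using AE_msupp
  proof eventually_elim
    fix x assume b: "\<forall>n. cmod (f x - g n x) \<le> e n" and x: "x \<in> msupp m"
    have "(\<lambda>n. f x - g n x) \<longlonglongrightarrow> 0"
      by (rule Lim_null_comparison[OF _ e0]) (use b in auto)
    moreover have "(\<lambda>n. f x - g n x) \<longlonglongrightarrow> f x - u x" by (intro tendsto_intros gu x)
    ultimately have "0 = f x - u x" by (rule LIMSEQ_unique)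
    then show "f x = h x" using h(2)[OF x] by simp
  qed
  then have "F = cl h" unfolding f(2) by (rule ae_class_cong)
  then show "F \<in> CK_classes m" using cl_CK[OF h(1)] by simp
qed

lemma CK_cstar: "cstar_subalgebra (Linf m) (CK_classes m)"
  unfolding cstar_subalgebra_def complex_subalgebra_def Linf_simps
proof (intro conjI ballI allI CK_norm_closed subsetI)
  show "F \<in> carrier (Linf m)" if "F \<in> CK_classes m" for F using that by (auto elim!: CKE intro: cl_Linf cont_bm)
  show "cl (\<lambda>_. 0) \<in> CK_classes m" by (intro cl_CK continuous_intros)
  fix F assume "F \<in> CK_classes m"
  then obtain f where f: "cts f" "F = cl f" by (rule CKE)
  show "lc_scale m c F \<in> CK_classes m" for c
    using f by (simp add: lc_cl cont_measurable) (intro cl_CK continuous_intros f)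
  show "lc_cnj m F \<in> CK_classes m"
    using f by (simp add: lc_cl cont_measurable) (intro cl_CK continuous_intros f)
  fix G assume "G \<in> CK_classes m"
  then obtain g where g: "cts g" "G = cl g" by (rule CKE)
  show "lc_add m F G \<in> CK_classes m"
    using f g by (simp add: lc_cl cont_measurable) (intro cl_CK continuous_intros f g)
  show "lc_mult m F G \<in> CK_classes m"
    using f g by (simp add: lc_cl cont_measurable) (intro cl_CK continuous_intros f g)
qed

lemma CK_one: "\<one>\<^bsub>Linf m\<^esub> \<in> CK_classes m"
  unfolding Linf_simps by (intro cl_CK continuous_intros)

text \<open>The restriction of a continuous representative to the support; it depends only on the class.\<close>

definition restr :: "'k lclass \<Rightarrow> 'k \<Rightarrow> complex" where
  "restr F = restrict (SOME f. cts f \<and> F = cl f) (msupp m)"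

lemma restr_cl: "cts f \<Longrightarrow> restr (cl f) = restrict f (msupp m)"
proof -
  assume f: "cts f"
  define g where "g = (SOME g. cts g \<and> cl f = cl g)"
  have "cts g \<and> cl f = cl g" unfolding g_def by (rule someI[of _ f]) (use f in simp)
  then have "\<forall>x\<in>msupp m. f x = g x" using cont_eq_msupp[OF f] by blast
  then show ?thesis by (auto simp: restr_def g_def[symmetric] restrict_def)
qed

lemma restr_iso:
  "star_homomorphism ((Linf m)\<lparr>carrier := CK_classes m\<rparr>) (Cont (msupp m)) restr"
  "bij_betw restr (CK_classes m) (carrier (Cont (msupp m)))"
proof -
  show "star_homomorphism ((Linf m)\<lparr>carrier := CK_classes m\<rparr>) (Cont (msupp m)) restr"
    unfolding star_homomorphism_def
  proof (intro conjI allI ballI ring_hom_memI)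
    fix F assume "F \<in> carrier ((Linf m)\<lparr>carrier := CK_classes m\<rparr>)"
    then have "F \<in> CK_classes m" by simp
    then obtain f where f: "cts f" "F = cl f" by (rule CKE)
    show "restr F \<in> carrier (Cont (msupp m))"
      using f continuous_on_subset[OF f(1), of "msupp m"] by (simp add: restr_cl Cont_def)
    have c: "cts (\<lambda>x. c * f x)" "cts (\<lambda>x. cnj (f x))" for c by (intro continuous_intros f)+
    show "restr (c \<odot>\<^bsub>(Linf m)\<lparr>carrier := CK_classes m\<rparr>\<^esub> F) = c \<odot>\<^bsub>Cont (msupp m)\<^esub> restr F" for c
      using f by (simp add: Linf_simps lc_cl cont_measurable restr_cl c) (auto simp: Cont_def)
    show "restr (adj ((Linf m)\<lparr>carrier := CK_classes m\<rparr>) F) = adj (Cont (msupp m)) (restr F)"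
      using f by (simp add: Linf_simps lc_cl cont_measurable restr_cl c) (auto simp: Cont_def)
    fix G assume "G \<in> carrier ((Linf m)\<lparr>carrier := CK_classes m\<rparr>)"
    then have "G \<in> CK_classes m" by simp
    then obtain g where g: "cts g" "G = cl g" by (rule CKE)
    have d: "cts (f \<cdot> g)" "cts (f +: g)" by (intro continuous_intros f g)+
    show "restr (F \<otimes>\<^bsub>(Linf m)\<lparr>carrier := CK_classes m\<rparr>\<^esub> G) = restr F \<otimes>\<^bsub>Cont (msupp m)\<^esub> restr G"
      using f g by (simp add: Linf_simps lc_cl cont_measurable restr_cl d) (auto simp: Cont_def)
    show "restr (F \<oplus>\<^bsub>(Linf m)\<lparr>carrier := CK_classes m\<rparr>\<^esub> G) = restr F \<oplus>\<^bsub>Cont (msupp m)\<^esub> restr G"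
      using f g by (simp add: Linf_simps lc_cl cont_measurable restr_cl d) (auto simp: Cont_def)
  next
    show "restr \<one>\<^bsub>(Linf m)\<lparr>carrier := CK_classes m\<rparr>\<^esub> = \<one>\<^bsub>Cont (msupp m)\<^esub>"
      by (simp add: Linf_simps restr_cl) (simp add: Cont_def)
  qed
  show "bij_betw restr (CK_classes m) (carrier (Cont (msupp m)))"
    unfolding bij_betw_def
  proof (rule conjI, rule inj_onI, goal_cases _ surj)
    fix F G assume FG: "F \<in> CK_classes m" "G \<in> CK_classes m" and eq: "restr F = restr G"
    then obtain f g where fg: "cts f" "F = cl f" "cts g" "G = cl g" by (auto elim!: CKE)
    have "f x = g x" if "x \<in> msupp m" for x
      using fun_cong[OF eq, of x] that fg by (simp add: restr_cl)
    then show "F = G" using cont_eq_msupp[OF fg(1,3)] fg by simp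
  next
    case surj
    show ?case
    proof (intro equalityI subsetI)
    fix u assume "u \<in> restr ` CK_classes m"
    then obtain f where f: "cts f" "u = restrict f (msupp m)" by (auto elim!: CKE simp: restr_cl)
    then show "u \<in> carrier (Cont (msupp m))"
      using continuous_on_subset[OF f(1), of "msupp m"] by (simp add: Cont_def)
  next
    fix u assume "u \<in> carrier (Cont (msupp m))"
    then have u: "u \<in> extensional (msupp m)" "continuous_on (msupp m) u" by (auto simp: Cont_def)
    obtain f where f: "cts f" "\<And>x. x \<in> msupp m \<Longrightarrow> f x = u x"
      by (rule Tietze_complex[OF closed_msupp u(2)]) auto
    have "restr (cl f) = u" unfolding restr_cl[OF f(1)]
      by (rule extensionalityI[OF _ u(1)]) (auto simp: f(2))
    then show "u \<in> restr ` CK_classes m" using cl_CK[OF f(1)] by blast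
    qed
  qed
qed

theorem short_exact_CK:
  "\<exists>\<pi>. short_exact (semicommutator_ideal m A (CK_classes m)) (toeplitz_algebra m A (CK_classes m)) (Cont (msupp m)) \<pi> \<and>
       (\<forall>f\<in>carrier (Cont UNIV). \<pi> (T (cl f)) = restrict f (msupp m))"
proof -
  obtain \<pi> where p: "short_exact (semicommutator_ideal m A (CK_classes m)) (toeplitz_algebra m A (CK_classes m)) ((Linf m)\<lparr>carrier := CK_classes m\<rparr>) \<pi>"
    "\<And>\<psi>. \<psi> \<in> CK_classes m \<Longrightarrow> \<pi> (T \<psi>) = \<psi>"
    using short_exact_B[OF CK_cstar CK_one] by blast
  have z: "cl (\<lambda>_. 0) \<in> CK_classes m" "restr (cl (\<lambda>_. 0)) = (\<lambda>x\<in>msupp m. 0)"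
    by (auto intro!: cl_CK continuous_intros simp: restr_cl)
  have "short_exact (semicommutator_ideal m A (CK_classes m)) (toeplitz_algebra m A (CK_classes m)) (Cont (msupp m)) (\<lambda>x. restr (\<pi> x))"
    by (rule short_exact_comp[OF p(1) restr_iso(1)]) (use restr_iso(2) z in \<open>simp_all add: Linf_simps, simp_all add: Cont_def\<close>)
  moreover have "restr (\<pi> (T (cl f))) = restrict f (msupp m)" if "f \<in> carrier (Cont UNIV)" for f
    using that p(2)[OF cl_CK[of f]] by (simp add: Cont_UNIV restr_cl)
  ultimately show ?thesis by (intro exI[of _ "\<lambda>x. restr (\<pi> x)"] conjI) auto
qed

lemma T_mult_coanalytic:
  assumes eta: "\<eta> \<in> Ha" and psi: "\<psi> \<in> bm m"
  shows "T (cl (\<lambda>x. cnj (\<eta> x))) \<otimes>\<^bsub>R\<^esub> T (cl \<psi>) = T (cl (\<lambda>x. cnj (\<eta> x) * \<psi> x))"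
proof -
  have e: "\<eta> \<in> bm m" using eta by simp
  note c = bm_cnj[OF psi]
  have car: "T (cl \<theta>) \<in> carrier R" if "\<theta> \<in> bm m" for \<theta> using toeplitz_in[OF that] by (simp add: R_simps(1))
  have "T (cl (\<lambda>x. cnj (\<eta> x))) \<otimes>\<^bsub>R\<^esub> T (cl \<psi>) = adj R (T (cl (\<lambda>x. cnj (\<psi> x))) \<otimes>\<^bsub>R\<^esub> T (cl \<eta>))"
    using car[OF c] car[OF e] T_adj[OF c] T_adj[OF e] by (simp add: BH.adj_mult)
  also have "\<dots> = adj R (T (cl (\<lambda>x. cnj (\<psi> x) * \<eta> x)))" by (simp only: T_mult_analytic[OF c eta])
  also have "\<dots> = T (cl (\<lambda>x. cnj (\<eta> x) * \<psi> x))" using T_adj[OF bm_mult[OF c e]] by (simp add: mult.commute)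
  finally show ?thesis .
qed

text \<open>The \<open>\<phi>\<close> with \<open>T\<^sub>\<phi> T\<^sub>\<psi> - T\<^bsub>\<phi>\<psi>\<^esub>\<close> in the commutator ideal for all \<open>\<psi>\<close> form a closed algebra. It contains the
conjugates of \<open>A\<close>, where the difference is zero, and \<open>A\<close>, where \<open>T\<^bsub>\<phi>\<psi>\<^esub> = T\<^sub>\<psi> T\<^sub>\<phi>\<close> makes it a commutator;
by Stone--Weierstrass it is everything.\<close>

theorem semicommutator_eq_commutator:
  "semicommutator_ideal m A (CK_classes m) = commutator_ideal m A (CK_classes m)"
proof -
  let ?CK = "CK_classes m"
  interpret SC: symbol_calculus R "Linf m" T sym ?CK by (rule symbol_calculus_R[OF CK_cstar CK_one])
  define comm where "comm = {(T f \<otimes>\<^bsub>R\<^esub> T g) \<ominus>\<^bsub>R\<^esub> (T g \<otimes>\<^bsub>R\<^esub> T f) | f g. f \<in> ?CK \<and> g \<in> ?CK}"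
  define I where "I = closed_ideal_generated (R\<lparr>carrier := SC.TB\<rparr>) comm"
  have ta: "toeplitz_algebra m A ?CK = R\<lparr>carrier := SC.TB\<rparr>" unfolding toeplitz_algebra_def by (rule SC.cstar_generated_eq)
  have semi: "semicommutator_ideal m A ?CK = SC.CB"
    unfolding semicommutator_ideal_def ta SC.semi_def Linf_simps ..
  have comm: "commutator_ideal m A ?CK = I" unfolding commutator_ideal_def ta I_def comm_def ..
  have TT: "T f \<otimes>\<^bsub>R\<^esub> T g \<in> SC.TB" if "f \<in> ?CK" "g \<in> ?CK" for f g by (intro SC.TB.S_mult SC.T_TB that)
  have comm_TB: "comm \<subseteq> SC.TB" by (auto simp: comm_def intro!: SC.TB.S_minus TT)
  note CBi = SC.CB_closed_ideal
  have Ii: "closed_ideal (R\<lparr>carrier := SC.TB\<rparr>) I" and cI: "comm \<subseteq> I"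
    using SC.TB.closed_ideal_generated_closed[OF comm_TB] by (auto simp: I_def)
  have cont: "cl f \<in> ?CK" "f \<in> bm m" "T (cl f) \<in> SC.TB" if "cts f" for f
    using cl_CK[OF that] cont_bm[OF that] SC.T_TB by auto
  have "I \<subseteq> SC.CB"
    unfolding I_def
  proof (rule SC.TB.closed_ideal_generated_least[OF CBi], rule subsetI)
    fix x assume "x \<in> comm"
    then obtain F G where FG: "F \<in> ?CK" "G \<in> ?CK" "x = (T F \<otimes>\<^bsub>R\<^esub> T G) \<ominus>\<^bsub>R\<^esub> (T G \<otimes>\<^bsub>R\<^esub> T F)"
      unfolding comm_def by blast
    have "F \<otimes>\<^bsub>Linf m\<^esub> G = G \<otimes>\<^bsub>Linf m\<^esub> F"
      by (rule comm_monoid.m_comm[OF cring.axioms(2)[OF Linf_cring]]) (use FG SC.B_sub in auto)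
    then have "SC.TB.cong_mod SC.CB (T F \<otimes>\<^bsub>R\<^esub> T G) (T G \<otimes>\<^bsub>R\<^esub> T F)"
      using SC.TB.cong_trans[OF CBi SC.semi_cong[OF FG(1,2)] SC.TB.cong_sym[OF CBi]] SC.semi_cong[OF FG(2,1)] by simp
    then show "x \<in> SC.CB" unfolding FG(3) by (simp add: SC.TB.cong_mod_def)
  qed
  moreover have "SC.CB \<subseteq> I"
  proof (rule SC.TB.closed_ideal_generated_least[OF Ii], rule subsetI)
    define Q where "Q f \<longleftrightarrow> cts f \<and> (\<forall>g. cts g \<longrightarrow>
      SC.TB.cong_mod I (T (cl f) \<otimes>\<^bsub>R\<^esub> T (cl g)) (T (cl (f \<cdot> g))))" for f
    note trans = SC.TB.cong_trans[OF Ii] and sym' = SC.TB.cong_sym[OF Ii] and refl' = SC.TB.cong_refl[OF Ii]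
    have TTc: "T (cl f) \<otimes>\<^bsub>R\<^esub> T (cl g) \<in> SC.TB" if "cts f" "cts g" for f g
      using TT cont that by blast
    have coan: "Q (\<lambda>x. cnj (a x))" if a: "a \<in> A" for a
      unfolding Q_def
    proof (intro conjI allI impI)
      show ca: "cts (\<lambda>x. cnj (a x))" by (intro continuous_intros A_cont a)
      fix g :: "'k \<Rightarrow> complex" assume g: "cts g"
      have "cts (\<lambda>x. cnj (a x) * g x)" by (intro continuous_intros ca g)
      then show "SC.TB.cong_mod I (T (cl (\<lambda>x. cnj (a x))) \<otimes>\<^bsub>R\<^esub> T (cl g)) (T (cl (\<lambda>x. cnj (a x) * g x)))"
        unfolding T_mult_coanalytic[OF A_Ha[OF a] cont_bm[OF g]] by (intro refl' cont)
    qed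
    have an: "Q a" if a: "a \<in> A" for a
      unfolding Q_def
    proof (intro conjI allI impI A_cont a)
      fix g :: "'k \<Rightarrow> complex" assume g: "cts g"
      note ac = A_cont[OF a]
      have eq: "T (cl g) \<otimes>\<^bsub>R\<^esub> T (cl a) = T (cl (a \<cdot> g))"
        using T_mult_analytic[OF cont_bm[OF g] A_Ha[OF a]] by (simp add: mult.commute)
      have "(T (cl a) \<otimes>\<^bsub>R\<^esub> T (cl g)) \<ominus>\<^bsub>R\<^esub> (T (cl g) \<otimes>\<^bsub>R\<^esub> T (cl a)) \<in> comm"
        unfolding comm_def using cont(1)[OF ac] cont(1)[OF g] by blast
      then show "SC.TB.cong_mod I (T (cl a) \<otimes>\<^bsub>R\<^esub> T (cl g)) (T (cl (a \<cdot> g)))"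
        using cI TTc[OF ac g] TTc[OF g ac] unfolding SC.TB.cong_mod_def eq by blast
    qed
    have Qall: "Q f" if f: "cts f" for f
    proof (rule SW[where P=Q, OF _ _ _ _ _ _ _ f])
      show "cts f" if "Q f" for f using that by (simp add: Q_def)
      show "Q (\<lambda>_. c)" for c by (rule an[OF A_const])
      show "Q (\<phi> \<alpha> j)" "Q (\<lambda>x. cnj (\<phi> \<alpha> j x))" if "\<alpha> \<in> \<Gamma>" "j \<in> J \<alpha>" for \<alpha> j
        using an coan phi_A[OF that] by auto
    next
      fix f g assume Qf: "Q f" and Qg: "Q g"
      then have fg: "cts f" "cts g" by (auto simp: Q_def)
      have s: "cts (f +: g)" "cts (f \<cdot> g)" by (intro continuous_intros fg)+
      show "Q (f +: g)"
        unfolding Q_def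
      proof (intro conjI allI impI s)
        fix h :: "'k \<Rightarrow> complex" assume h: "cts h"
        have p: "cts (f \<cdot> h)" "cts (g \<cdot> h)" by (intro continuous_intros fg h)+
        have 1: "T (cl (f +: g)) \<otimes>\<^bsub>R\<^esub> T (cl h) = T (cl f) \<otimes>\<^bsub>R\<^esub> T (cl h) \<oplus>\<^bsub>R\<^esub> T (cl g) \<otimes>\<^bsub>R\<^esub> T (cl h)"
          unfolding T_add[OF cont(2)[OF fg(1)] cont(2)[OF fg(2)]]
          by (intro BH.l_distr SC.TB.S_sub cont fg h)
        have 2: "T (cl (\<lambda>x. (f x + g x) * h x)) = T (cl (f \<cdot> h)) \<oplus>\<^bsub>R\<^esub> T (cl (g \<cdot> h))"
          using T_add[OF cont(2)[OF p(1)] cont(2)[OF p(2)]] by (simp add: distrib_right)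
        show "SC.TB.cong_mod I (T (cl (f +: g)) \<otimes>\<^bsub>R\<^esub> T (cl h)) (T (cl (\<lambda>x. (f x + g x) * h x)))"
          unfolding 1 2 using Qf Qg h by (intro SC.TB.cong_add[OF Ii]) (auto simp: Q_def)
      qed
      show "Q (f \<cdot> g)"
        unfolding Q_def
      proof (intro conjI allI impI s)
        fix h :: "'k \<Rightarrow> complex" assume h: "cts h"
        have gh: "cts (g \<cdot> h)" by (intro continuous_intros fg h)
        have 1: "SC.TB.cong_mod I (T (cl (f \<cdot> g)) \<otimes>\<^bsub>R\<^esub> T (cl h)) ((T (cl f) \<otimes>\<^bsub>R\<^esub> T (cl g)) \<otimes>\<^bsub>R\<^esub> T (cl h))"
        proof (rule SC.TB.cong_mult_r[OF Ii sym' cont(3)[OF h]])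
          show "SC.TB.cong_mod I (T (cl f) \<otimes>\<^bsub>R\<^esub> T (cl g)) (T (cl (f \<cdot> g)))"
            using Qf fg(2) by (simp add: Q_def)
        qed
        have 2: "(T (cl f) \<otimes>\<^bsub>R\<^esub> T (cl g)) \<otimes>\<^bsub>R\<^esub> T (cl h) = T (cl f) \<otimes>\<^bsub>R\<^esub> (T (cl g) \<otimes>\<^bsub>R\<^esub> T (cl h))"
          by (intro BH.m_assoc SC.TB.S_sub cont fg h)
        have 3: "SC.TB.cong_mod I (T (cl f) \<otimes>\<^bsub>R\<^esub> (T (cl g) \<otimes>\<^bsub>R\<^esub> T (cl h))) (T (cl f) \<otimes>\<^bsub>R\<^esub> T (cl (g \<cdot> h)))"
          using Qg h by (intro SC.TB.cong_mult_l[OF Ii] cont fg) (simp add: Q_def)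
        have 4: "SC.TB.cong_mod I (T (cl f) \<otimes>\<^bsub>R\<^esub> T (cl (g \<cdot> h))) (T (cl (\<lambda>x. f x * (g x * h x))))"
          using Qf gh by (simp add: Q_def)
        show "SC.TB.cong_mod I (T (cl (f \<cdot> g)) \<otimes>\<^bsub>R\<^esub> T (cl h)) (T (cl (\<lambda>x. f x * g x * h x)))"
          using trans[OF 1[unfolded 2] trans[OF 3 4]] by (simp only: mult.assoc)
      qed
    next
      fix f :: "'k \<Rightarrow> complex" assume f: "cts f" and ap: "\<And>e. e > 0 \<Longrightarrow> \<exists>g. Q g \<and> (\<forall>x. cmod (f x - g x) \<le> e)"
      show "Q f"
        unfolding Q_def
      proof (intro conjI allI impI f)
        fix h :: "'k \<Rightarrow> complex" assume h: "cts h"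
        have fh: "cts (f \<cdot> h)" by (intro continuous_intros f h)
        obtain N where N: "N > 0" "\<And>x. cmod (h x) \<le> N" using cont_bounded[OF h] by blast
        show "SC.TB.cong_mod I (T (cl f) \<otimes>\<^bsub>R\<^esub> T (cl h)) (T (cl (f \<cdot> h)))"
        proof (rule SC.TB.cong_limit[OF Ii TTc[OF f h] cont(3)[OF fh]])
          fix e :: real assume "e > 0"
          define d where "d = e / (2 * N)"
          have d: "d > 0" "d * N < e" using \<open>e > 0\<close> N by (auto simp: d_def)
          obtain g where g: "Q g" "\<And>x. cmod (f x - g x) \<le> d" using ap[OF d(1)] by blast
          then have gc: "cts g" by (simp add: Q_def)
          have gh: "cts (g \<cdot> h)" by (intro continuous_intros gc h)
          have Tm: "T (cl u) \<ominus>\<^bsub>R\<^esub> T (cl v) = T (cl (u -: v))" if "cts u" "cts v" for u v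
            using SC.T_minus[of "cl u" "cl v"] cont(2)[OF that(1)] cont(2)[OF that(2)] by (simp add: cl_Linf Linf_minus)
          have nT: "anorm R (T (cl u)) \<le> c" if "u \<in> bm m" "\<And>x. cmod (u x) \<le> c" for u c
            using T_norm[OF that(1)] Linf_anorm(3)[OF that(1), of c] that(2) by simp
          have car: "T (cl u) \<in> carrier R" if "cts u" for u by (intro SC.TB.S_sub cont that)
          have fgc: "cts (f -: g)" by (intro continuous_intros f gc)
          have dist: "(T (cl f) \<otimes>\<^bsub>R\<^esub> T (cl h)) \<ominus>\<^bsub>R\<^esub> (T (cl g) \<otimes>\<^bsub>R\<^esub> T (cl h)) = (T (cl f) \<ominus>\<^bsub>R\<^esub> T (cl g)) \<otimes>\<^bsub>R\<^esub> T (cl h)"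
            using car[OF f] car[OF gc] car[OF h] by (simp add: a_minus_def BH.l_distr BH.l_minus)
          have "anorm R ((T (cl f) \<otimes>\<^bsub>R\<^esub> T (cl h)) \<ominus>\<^bsub>R\<^esub> (T (cl g) \<otimes>\<^bsub>R\<^esub> T (cl h)))
              \<le> anorm R (T (cl (f -: g))) * anorm R (T (cl h))"
            unfolding dist Tm[OF f gc] by (rule BH.norm_mult[OF car[OF fgc] car[OF h]])
          also have "\<dots> \<le> d * N"
            using nT[OF cont(2)[OF fgc] g(2)] nT[OF cont(2)[OF h] N(2)] BH.norm_ge0[OF car[OF h]] d(1)
            by (intro mult_mono) simp_all
          finally have 1: "anorm R ((T (cl f) \<otimes>\<^bsub>R\<^esub> T (cl h)) \<ominus>\<^bsub>R\<^esub> (T (cl g) \<otimes>\<^bsub>R\<^esub> T (cl h))) < e" using d(2) by simp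
          have "cmod (f x * h x - g x * h x) \<le> d * N" for x
          proof -
            have "cmod (f x * h x - g x * h x) = cmod (f x - g x) * cmod (h x)" by (simp add: norm_mult[symmetric] left_diff_distrib)
            also have "\<dots> \<le> d * N" using g(2) N d by (intro mult_mono) auto
            finally show ?thesis .
          qed
          then have "anorm R (T (cl (f \<cdot> h)) \<ominus>\<^bsub>R\<^esub> T (cl (g \<cdot> h))) \<le> d * N"
            unfolding Tm[OF fh gh] by (rule nT[OF bm_diff[OF cont(2)[OF fh] cont(2)[OF gh]]])
          then have 2: "anorm R (T (cl (f \<cdot> h)) \<ominus>\<^bsub>R\<^esub> T (cl (g \<cdot> h))) < e" using d(2) by simp
          show "\<exists>x' y'. SC.TB.cong_mod I x' y' \<and> anorm R ((T (cl f) \<otimes>\<^bsub>R\<^esub> T (cl h)) \<ominus>\<^bsub>R\<^esub> x') < e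
              \<and> anorm R (T (cl (f \<cdot> h)) \<ominus>\<^bsub>R\<^esub> y') < e"
            using 1 2 g(1) h unfolding Q_def by blast
        qed
      qed
    qed
    fix x assume "x \<in> SC.semi"
    then obtain F G where FG: "F \<in> ?CK" "G \<in> ?CK" "x = (T F \<otimes>\<^bsub>R\<^esub> T G) \<ominus>\<^bsub>R\<^esub> T (F \<otimes>\<^bsub>Linf m\<^esub> G)"
      unfolding SC.semi_def by blast
    obtain f g where fg: "cts f" "F = cl f" "cts g" "G = cl g" using FG by (auto elim!: CKE)
    have "F \<otimes>\<^bsub>Linf m\<^esub> G = cl (f \<cdot> g)" using fg by (simp add: Linf_simps lc_cl cont_measurable)
    then show "x \<in> I" using Qall[OF fg(1)] fg FG(3) by (simp add: Q_def SC.TB.cong_mod_def)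
  qed
  ultimately show ?thesis unfolding semi comm by blast
qed

end

section \<open>The theorem\<close>

theorem theorem3p1:
  fixes A :: "('k::t2_space \<Rightarrow> complex) set"
    and \<Gamma> :: "'i set" and J :: "'i \<Rightarrow> 'j set" and \<phi> :: "'i \<Rightarrow> 'j \<Rightarrow> 'k \<Rightarrow> complex"
    and m :: "'k measure"
  assumes "compact (UNIV :: 'k set)"
    and "complex_subalgebra (Cont UNIV) A" and "norm_closed (Cont UNIV) A"
    and "\<And>c. (\<lambda>_. c) \<in> A"
    and "\<And>\<alpha>. \<alpha> \<in> \<Gamma> \<Longrightarrow> spherical_multifunction (J \<alpha>) (\<phi> \<alpha>)"
    and "\<And>\<alpha> j. \<alpha> \<in> \<Gamma> \<Longrightarrow> j \<in> J \<alpha> \<Longrightarrow> \<phi> \<alpha> j \<in> A"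
    and "\<And>x y. x \<noteq> y \<Longrightarrow> \<exists>\<alpha>\<in>\<Gamma>. \<exists>j\<in>J \<alpha>. \<phi> \<alpha> j x \<noteq> \<phi> \<alpha> j y"
    and "regular_borel_prob m"
  shows
    "(\<forall>X\<in>carrier (BH2 m A).
        (\<exists>\<psi>\<in>carrier (Linf m). X = toeplitz m A \<psi>) \<longleftrightarrow>
        (\<forall>\<alpha>\<in>\<Gamma>.
           (\<Oplus>\<^bsub>BH2 m A\<^esub>j\<in>J \<alpha>.
              adj (BH2 m A) (toeplitz m A (ae_class m (\<phi> \<alpha> j))) \<otimes>\<^bsub>BH2 m A\<^esub> X
                \<otimes>\<^bsub>BH2 m A\<^esub> toeplitz m A (ae_class m (\<phi> \<alpha> j))) = X)) \<and>
     (\<forall>X\<in>carrier (BH2 m A).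
        ((\<exists>\<psi>\<in>carrier (Hinf m A). X = toeplitz m A \<psi>) \<longleftrightarrow>
         (\<forall>\<alpha>\<in>\<Gamma>. \<forall>j\<in>J \<alpha>.
            X \<otimes>\<^bsub>BH2 m A\<^esub> toeplitz m A (ae_class m (\<phi> \<alpha> j)) =
            toeplitz m A (ae_class m (\<phi> \<alpha> j)) \<otimes>\<^bsub>BH2 m A\<^esub> X)) \<and>
        ((\<exists>\<psi>\<in>carrier (Hinf m A). X = toeplitz m A \<psi>) \<longleftrightarrow>
         (\<forall>a\<in>A.
            X \<otimes>\<^bsub>BH2 m A\<^esub> toeplitz m A (ae_class m a) =
            toeplitz m A (ae_class m a) \<otimes>\<^bsub>BH2 m A\<^esub> X))) \<and>
     isometric_isomorphism (Hinf m A)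
       ((BH2 m A)\<lparr>carrier := commutant (BH2 m A) {toeplitz m A (ae_class m a) | a. a \<in> A}\<rparr>)
       (toeplitz m A) \<and>
     maximal_abelian_subalgebra (BH2 m A)
       (commutant (BH2 m A) {toeplitz m A (ae_class m a) | a. a \<in> A}) \<and>
     (\<forall>\<psi>\<in>carrier (Hinf m A).
        alg_spectrum (BH2 m A) (toeplitz m A \<psi>) = alg_spectrum (Hinf m A) \<psi>) \<and>
     (\<exists>\<pi>. short_exact (semicommutator_ideal m A (carrier (Linf m)))
            (toeplitz_algebra m A (carrier (Linf m))) (Linf m) \<pi> \<and>
          (\<forall>\<psi>\<in>carrier (Linf m). \<pi> (toeplitz m A \<psi>) = \<psi>)) \<and>
     (\<forall>\<psi>\<in>carrier (Linf m).
        essran m \<psi> \<subseteq> alg_spectrum (BH2 m A) (toeplitz m A \<psi>) \<and>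
        alg_spectrum (BH2 m A) (toeplitz m A \<psi>) \<subseteq> convex hull (essran m \<psi>)) \<and>
     (\<exists>\<pi>. short_exact (semicommutator_ideal m A (CK_classes m))
            (toeplitz_algebra m A (CK_classes m)) (Cont (msupp m)) \<pi> \<and>
          (\<forall>f\<in>carrier (Cont UNIV).
             \<pi> (toeplitz m A (ae_class m f)) = restrict f (msupp m))) \<and>
     semicommutator_ideal m A (CK_classes m) = commutator_ideal m A (CK_classes m)"
proof -
  interpret spherical_setting A \<Gamma> J \<phi> m
    using assms by unfold_locales
  show ?thesis
  proof (intro conjI ballI)
    fix X assume "X \<in> carrier (BH2 m A)"
    then have X: "X \<in> bounded_ops m (H2 m A)" by (simp add: R_simps(1))
    show "(\<exists>\<psi>\<in>carrier (Linf m). X = toeplitz m A \<psi>) \<longleftrightarrow>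
        (\<forall>\<alpha>\<in>\<Gamma>.
           (\<Oplus>\<^bsub>BH2 m A\<^esub>j\<in>J \<alpha>.
              adj (BH2 m A) (toeplitz m A (ae_class m (\<phi> \<alpha> j))) \<otimes>\<^bsub>BH2 m A\<^esub> X
                \<otimes>\<^bsub>BH2 m A\<^esub> toeplitz m A (ae_class m (\<phi> \<alpha> j))) = X)" by (rule toeplitz_iff_brown_halmos[OF X])
    show "(\<exists>\<psi>\<in>carrier (Hinf m A). X = toeplitz m A \<psi>) \<longleftrightarrow>
         (\<forall>\<alpha>\<in>\<Gamma>. \<forall>j\<in>J \<alpha>.
            X \<otimes>\<^bsub>BH2 m A\<^esub> toeplitz m A (ae_class m (\<phi> \<alpha> j)) =
            toeplitz m A (ae_class m (\<phi> \<alpha> j)) \<otimes>\<^bsub>BH2 m A\<^esub> X)" by (rule analytic_toeplitz_iff_commutes(1)[OF X])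
    show "(\<exists>\<psi>\<in>carrier (Hinf m A). X = toeplitz m A \<psi>) \<longleftrightarrow>
         (\<forall>a\<in>A.
            X \<otimes>\<^bsub>BH2 m A\<^esub> toeplitz m A (ae_class m a) =
            toeplitz m A (ae_class m a) \<otimes>\<^bsub>BH2 m A\<^esub> X)" by (rule analytic_toeplitz_iff_commutes(2)[OF X])
  next
    have "(Linf m)\<lparr>carrier := carrier (Linf m)\<rparr> = Linf m" by simp
    then show "\<exists>\<pi>. short_exact (semicommutator_ideal m A (carrier (Linf m)))
            (toeplitz_algebra m A (carrier (Linf m))) (Linf m) \<pi> \<and>
          (\<forall>\<psi>\<in>carrier (Linf m). \<pi> (toeplitz m A \<psi>) = \<psi>)"
      using short_exact_B[OF LI.cstar_subalgebra_carrier LI.one_closed] by simp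
  qed (intro Hinf_isometric CA_maximal_abelian spectrum_analytic spectrum_bounds short_exact_CK semicommutator_eq_commutator | assumption)+
qed

end
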